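(* Let $d\ge 3$ and let $V:\mathbb Z^d\to\mathbb C$ be a potential with $V\in\ell^p(\mathbb Z^d)$, where $1\le p<\frac65$ if $d=3$ and $1\le p<\frac43$ if $d\ge4$. Then the following estimates hold: $$\sum_{j=1}^N(1-|z_j|)\le-B_0\le\frac{C_*^2}2\|V\|_p^2-\frac{\sigma(\mathbb T)}{2\pi},$$ $$\Big|\sum_{j=1}^N\big(\operatorname{Re}\varkappa_j+i\operatorname{Im}\lambda_j\big)\Big|\le d\,C_*^2\|V\|_p^2,$$ $$\frac1{2\pi}\Big|\int_{\mathbb T}e^{-int}d\mu(t)\Big|\le C_*^2\|V\|_p^2\qquad\text{for all }n\in\mathbb Z,$$ and in particular, $$\sum_{j=1}^N\operatorname{Im}\lambda_j\le d\,C_*^2\|V\|_p^2\quad\text{if }\operatorname{Im}V\ge0,\qquad \sum_{j=1}^N\operatorname{Re}\varkappa_j\le d\,C_*^2\|V\|_p^2\quad\text{if }\operatorname{Re}V\ge0.$$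
   Context: The discrete Laplacian on $\ell^2(\mathbb Z^d)$ is $(\Delta f)(n)=\frac12\sum_{|n-m|=1}f_m$; its spectrum is $[-d,d]$. $V$ acts as multiplication, $(Vf)(n)=V_nf_n$, and $H=\Delta+V$. $\|V\|_p$ is the $\ell^p(\mathbb Z^d)$ norm. Let $\Lambda=\mathbb C\setminus[-d,d]$, $\mathbb D=\{|z|<1\}$, $\mathbb T=\mathbb R/2\pi\mathbb Z$. The map $\lambda(z)=\frac d2\left(z+\frac1z\right)$ is a conformal bijection $\mathbb D\to\Lambda$ (with $0\mapsto\infty$). The branch of $\varkappa(\lambda)=\sqrt{\lambda^2-d^2}$ on $\Lambda$ is fixed by $\varkappa=\lambda-\frac{d^2}{2\lambda}+O(\lambda^{-3})$ as $|\lambda|\to\infty$. With $R_0(\lambda)=(\Delta-\lambda)^{-1}$, set $\mathcal D(\lambda)=\det\big[(I+VR_0(\lambda))e^{-VR_0(\lambda)}\big]$ for $\lambda\in\Lambda$ (regularized determinant; $VR_0(\lambda)$ is Hilbert–Schmidt), and $D(z)=\mathcal D(\lambda(z))$, $z\in\mathbb D$, with $D(0)=1$. $D$ is bounded and analytic in $\mathbb D$ and extends continuously to $\overline{\mathbb D}$. Let $\{z_j\}_{j=1}^N$, $N\le\infty$, be its zeros in $\mathbb D$ counted with multiplicity; $\lambda_j=\lambda(z_j)$ (the eigenvalues of $H$ in $\Lambda$), $\varkappa_j=\varkappa(\lambda_j)$. The Blaschke product is $B=1$ if $N=0$, and $B(z)=\prod_{j=1}^N\frac{|z_j|}{z_j}\frac{z_j-z}{1-\overline{z_j}z}$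 if $N\ge1$; $B_0=\log B(0)=\log\prod_j|z_j|$. The measure $\sigma\ge0$ is the singular measure on $[-\pi,\pi]$ (viewed on $\mathbb T$) in the canonical factorization $$D(z)=B(z)\exp\Big(-\frac1{2\pi}\int_{-\pi}^\pi\frac{e^{it}+z}{e^{it}-z}d\sigma(t)\Big)\exp\Big(\frac1{2\pi}\int_{-\pi}^\pi\frac{e^{it}+z}{e^{it}-z}\log|D(e^{it})|dt\Big),\quad |z|<1,$$ with $\log|D(e^{it})|\in L^1(-\pi,\pi)$, and $d\mu(t)=\log|D(e^{it})|\,dt-d\sigma(t)$. The constant $C_*$ is $C_*=C_{p,d}+C_d^0\,\Gamma(p,d)$, where $C_{1,d}=1$, $C_{p,d}=p^{\frac{d(p-1)}{2p}}$, $\Gamma(p,d)=(3+2\kappa)^{\frac{d(p-1)}{p}}$; $C_d^0=16$ if $d=3$, $C_d^0=4$ if $d=4$, $C_d^0=\frac{14\cdot2^{d/4}}{d-4}$ if $d\ge5$; and $\kappa=\frac{6(p-1)}{6-5p}$ if $d=3$, $\kappa=\left(\frac{5p-1}{4-3p}\right)^{\frac{5p-4}{4(p-1)}}$ if $d=4$, $\kappa=\frac{3d(p-1)}{3d-(2d+1)p}$ if $d\ge5$. (For $d=4$, $p=1$, where $\kappa$ is undefined, $\Gamma(1,4)$ is understood as the limit of $\Gamma(p,4)$ as $p\to1^+$.) *)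

theory Defs
  imports "HOL-Complex_Analysis.Complex_Analysis"
begin

section \<open>The Hilbert space of square-summable functions\<close>

typedef 'i ell2 = "{f :: 'i \<Rightarrow> complex. (\<lambda>x. (cmod (f x))\<^sup>2) summable_on UNIV}"
  morphisms ell2_fun Abs_ell2
  by (rule exI[of _ "\<lambda>_. 0"]) simp

setup_lifting type_definition_ell2

lemma ell2_summable: "(\<lambda>x. (cmod (ell2_fun f x))\<^sup>2) summable_on UNIV"
  using ell2_fun[of f] by simp

lemma ell2_add_summable:
  fixes f g :: "'i \<Rightarrow> complex"
  assumes "(\<lambda>x. (cmod (f x))\<^sup>2) summable_on UNIV" "(\<lambda>x. (cmod (g x))\<^sup>2) summable_on UNIV"
  shows "(\<lambda>x. (cmod (f x + g x))\<^sup>2) summable_on UNIV"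
proof (rule summable_on_comparison_test)
  show "(\<lambda>x. 2 * (cmod (f x))\<^sup>2 + 2 * (cmod (g x))\<^sup>2) summable_on UNIV"
    by (intro summable_on_add summable_on_cmult_right assms)
  fix x
  have "(cmod (f x + g x))\<^sup>2 \<le> (cmod (f x) + cmod (g x))\<^sup>2"
    by (intro power_mono norm_triangle_ineq) auto
  also have "\<dots> \<le> 2 * (cmod (f x))\<^sup>2 + 2 * (cmod (g x))\<^sup>2"
    using zero_le_power2[of "cmod (f x) - cmod (g x)"] by (simp add: power2_eq_square algebra_simps)
  finally show "(cmod (f x + g x))\<^sup>2 \<le> 2 * (cmod (f x))\<^sup>2 + 2 * (cmod (g x))\<^sup>2" .
qed auto

lemma ell2_mult_summable:
  fixes f v :: "'i \<Rightarrow> complex"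
  assumes "(\<lambda>x. (cmod (f x))\<^sup>2) summable_on UNIV" "\<And>x. cmod (v x) \<le> C"
  shows "(\<lambda>x. (cmod (v x * f x))\<^sup>2) summable_on UNIV"
proof (rule summable_on_comparison_test)
  show "(\<lambda>x. C\<^sup>2 * (cmod (f x))\<^sup>2) summable_on UNIV"
    by (intro summable_on_cmult_right assms)
  fix x
  have "(cmod (v x))\<^sup>2 \<le> C\<^sup>2" by (intro power_mono assms) auto
  then show "(cmod (v x * f x))\<^sup>2 \<le> C\<^sup>2 * (cmod (f x))\<^sup>2"
    by (simp add: norm_mult power_mult_distrib mult_right_mono)
qed auto

instantiation ell2 :: (type) real_vector
begin
lift_definition zero_ell2 :: "'a ell2" is "\<lambda>_. 0" by simp
lift_definition plus_ell2 :: "'a ell2 \<Rightarrow> 'a ell2 \<Rightarrow> 'a ell2" is "\<lambda>f g x. f x + g x"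
  by (rule ell2_add_summable)
lift_definition uminus_ell2 :: "'a ell2 \<Rightarrow> 'a ell2" is "\<lambda>f x. - f x" by simp
lift_definition minus_ell2 :: "'a ell2 \<Rightarrow> 'a ell2 \<Rightarrow> 'a ell2" is "\<lambda>f g x. f x - g x"
  by (drule ell2_add_summable[where g = "\<lambda>x. - g x" for g]) simp_all
lift_definition scaleR_ell2 :: "real \<Rightarrow> 'a ell2 \<Rightarrow> 'a ell2" is "\<lambda>c f x. c *\<^sub>R f x"
  by (simp add: power_mult_distrib summable_on_cmult_right)
instance
  by standard (transfer; simp add: algebra_simps fun_eq_iff)+
end

lemma ell2_inner_summable:
  "(\<lambda>x. ell2_fun f x \<bullet> ell2_fun g x) summable_on UNIV"
proof -
  have "(\<lambda>x. norm (ell2_fun f x \<bullet> ell2_fun g x)) summable_on UNIV"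
  proof (rule summable_on_comparison_test)
    show "(\<lambda>x. (cmod (ell2_fun f x))\<^sup>2 + (cmod (ell2_fun g x))\<^sup>2) summable_on UNIV"
      by (intro summable_on_add ell2_summable)
    fix x
    let ?a = "cmod (ell2_fun f x)" and ?b = "cmod (ell2_fun g x)"
    have "\<bar>ell2_fun f x \<bullet> ell2_fun g x\<bar> \<le> ?a * ?b" by (rule Cauchy_Schwarz_ineq2)
    also have "\<dots> \<le> ?a\<^sup>2 + ?b\<^sup>2"
    proof -
      have "0 \<le> ?a * ?b" by simp
      then show ?thesis using sum_squares_bound[of ?a ?b] by linarith
    qed
    finally show "norm (ell2_fun f x \<bullet> ell2_fun g x) \<le> ?a\<^sup>2 + ?b\<^sup>2" by simp
  qed simp
  then show ?thesis by (rule abs_summable_summable)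
qed

instantiation ell2 :: (type) real_inner
begin
definition inner_ell2 :: "'a ell2 \<Rightarrow> 'a ell2 \<Rightarrow> real"
  where "inner_ell2 f g = (\<Sum>\<^sub>\<infinity>x. ell2_fun f x \<bullet> ell2_fun g x)"
definition norm_ell2 :: "'a ell2 \<Rightarrow> real"
  where "norm_ell2 f = sqrt (\<Sum>\<^sub>\<infinity>x. (cmod (ell2_fun f x))\<^sup>2)"
definition sgn_ell2 :: "'a ell2 \<Rightarrow> 'a ell2"
  where "sgn_ell2 f = f /\<^sub>R norm f"
definition dist_ell2 :: "'a ell2 \<Rightarrow> 'a ell2 \<Rightarrow> real"
  where "dist_ell2 f g = norm (f - g)"
definition uniformity_ell2 :: "('a ell2 \<times> 'a ell2) filter"
  where "uniformity_ell2 = (INF e\<in>{0<..}. principal {(f, g). dist f g < e})"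
definition open_ell2 :: "'a ell2 set \<Rightarrow> bool"
  where "open_ell2 U = (\<forall>x\<in>U. eventually (\<lambda>(x', y). x' = x \<longrightarrow> y \<in> U) uniformity)"
instance
proof
  fix f g h :: "'a ell2" and r :: real
  show "f \<bullet> g = g \<bullet> f" by (simp add: inner_ell2_def inner_commute)
  show "(f + g) \<bullet> h = f \<bullet> h + g \<bullet> h"
    unfolding inner_ell2_def
    by (simp add: plus_ell2.rep_eq inner_add_left infsum_add ell2_inner_summable)
  show "(r *\<^sub>R f) \<bullet> g = r * (f \<bullet> g)"
    unfolding inner_ell2_def by (simp add: scaleR_ell2.rep_eq infsum_cmult_right')
  show "0 \<le> f \<bullet> f" unfolding inner_ell2_def by (intro infsum_nonneg) simp
  show "(f \<bullet> f = 0) = (f = 0)"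
  proof
    assume "f \<bullet> f = 0"
    then have "ell2_fun f x \<bullet> ell2_fun f x = 0" for x
      unfolding inner_ell2_def
      by (intro nonneg_infsum_le_0D[where A = UNIV, OF _ ell2_inner_summable]) auto
    then have "ell2_fun f = (\<lambda>_. 0)" by auto
    then show "f = 0" by (metis ell2_fun_inverse zero_ell2_def)
  next
    assume "f = 0"
    then show "f \<bullet> f = 0" by (simp add: inner_ell2_def zero_ell2.rep_eq)
  qed
  show "norm f = sqrt (f \<bullet> f)"
    by (simp add: norm_ell2_def inner_ell2_def power2_norm_eq_inner)
qed (auto simp: sgn_ell2_def dist_ell2_def uniformity_ell2_def open_ell2_def)
end

lemma ell2_sum_le_norm:
  assumes "finite F"
  shows "(\<Sum>x\<in>F. (cmod (ell2_fun f x))\<^sup>2) \<le> (norm f)\<^sup>2"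
proof -
  have "(norm f)\<^sup>2 = (\<Sum>\<^sub>\<infinity>x. (cmod (ell2_fun f x))\<^sup>2)"
    by (simp add: norm_ell2_def infsum_nonneg)
  moreover have "(\<Sum>x\<in>F. (cmod (ell2_fun f x))\<^sup>2) \<le> (\<Sum>\<^sub>\<infinity>x. (cmod (ell2_fun f x))\<^sup>2)"
    by (rule finite_sum_le_infsum[OF ell2_summable assms]) auto
  ultimately show ?thesis by simp
qed

lemma ell2_bdd_sums:
  fixes f :: "'i \<Rightarrow> complex"
  assumes "\<And>F. finite F \<Longrightarrow> (\<Sum>x\<in>F. (cmod (f x))\<^sup>2) \<le> C\<^sup>2" "C \<ge> 0"
  shows "(\<lambda>x. (cmod (f x))\<^sup>2) summable_on UNIV" "norm (Abs_ell2 f) \<le> C"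
proof -
  show s: "(\<lambda>x. (cmod (f x))\<^sup>2) summable_on UNIV"
    by (rule nonneg_bdd_above_summable_on) (use assms in \<open>auto intro!: bdd_aboveI\<close>)
  have "(\<Sum>\<^sub>\<infinity>x. (cmod (f x))\<^sup>2) \<le> C\<^sup>2"
    by (rule infsum_le_finite_sums[OF s]) (use assms in auto)
  then show "norm (Abs_ell2 f) \<le> C"
    using assms(2) s by (simp add: norm_ell2_def Abs_ell2_inverse real_le_lsqrt infsum_nonneg)
qed

lemma ell2_coord_le: "cmod (ell2_fun f x) \<le> norm f"
  using ell2_sum_le_norm[of "{x}" f] by (intro power2_le_imp_le[OF _ norm_ge_zero]) simp

instance ell2 :: (type) banach
proof
  fix X :: "nat \<Rightarrow> 'a ell2"
  assume X: "Cauchy X"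
  have "Cauchy (\<lambda>n. ell2_fun (X n) x)" for x
  proof (rule CauchyI)
    fix e :: real assume "e > 0"
    then obtain M where M: "\<forall>m\<ge>M. \<forall>n\<ge>M. norm (X m - X n) < e"
      using CauchyD[OF X] by blast
    have "norm (ell2_fun (X m) x - ell2_fun (X n) x) < e" if "m \<ge> M" "n \<ge> M" for m n
      using ell2_coord_le[of "X m - X n" x] M that
      by (metis le_less_trans minus_ell2.rep_eq)
    then show "\<exists>M. \<forall>m\<ge>M. \<forall>n\<ge>M. norm (ell2_fun (X m) x - ell2_fun (X n) x) < e" by blast
  qed
  then have "\<forall>x. \<exists>l. (\<lambda>n. ell2_fun (X n) x) \<longlonglongrightarrow> l"
    by (simp add: Cauchy_convergent_iff convergent_def)
  then obtain g where g: "\<And>x. (\<lambda>n. ell2_fun (X n) x) \<longlonglongrightarrow> g x" by metis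
  have bound: "(\<Sum>x\<in>F. (cmod (ell2_fun (X m) x - g x))\<^sup>2) \<le> e\<^sup>2"
    if "finite F" "e > 0" "\<forall>n\<ge>m. norm (X m - X n) < e" for F m e
  proof (rule LIMSEQ_le_const2)
    show "(\<lambda>n. \<Sum>x\<in>F. (cmod (ell2_fun (X m) x - ell2_fun (X n) x))\<^sup>2)
            \<longlonglongrightarrow> (\<Sum>x\<in>F. (cmod (ell2_fun (X m) x - g x))\<^sup>2)"
      by (intro tendsto_intros g)
    have "(\<Sum>x\<in>F. (cmod (ell2_fun (X m) x - ell2_fun (X n) x))\<^sup>2) \<le> e\<^sup>2" if "n \<ge> m" for n
    proof -
      have "(\<Sum>x\<in>F. (cmod (ell2_fun (X m) x - ell2_fun (X n) x))\<^sup>2) \<le> (norm (X m - X n))\<^sup>2"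
        using ell2_sum_le_norm[OF \<open>finite F\<close>, of "X m - X n"] by (simp add: minus_ell2.rep_eq)
      also have "\<dots> \<le> e\<^sup>2"
        using \<open>\<forall>n\<ge>m. norm (X m - X n) < e\<close> that by (intro power_mono) (auto intro: less_imp_le)
      finally show ?thesis .
    qed
    then show "\<exists>N. \<forall>n\<ge>N. (\<Sum>x\<in>F. (cmod (ell2_fun (X m) x - ell2_fun (X n) x))\<^sup>2) \<le> e\<^sup>2" by blast
  qed
  obtain M where M: "\<forall>m\<ge>M. \<forall>n\<ge>M. norm (X m - X n) < 1"
    using CauchyD[OF X, of 1] by auto
  have "(\<lambda>x. (cmod (ell2_fun (X M) x - g x))\<^sup>2) summable_on UNIV"
    by (rule ell2_bdd_sums(1)[where C = 1]) (use bound[of _ 1 M] M in auto)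
  from ell2_add_summable[OF this, where g = "\<lambda>x. - ell2_fun (X M) x"] ell2_summable[of "X M"]
  have gs: "(\<lambda>x. (cmod (g x))\<^sup>2) summable_on UNIV" by simp
  have "X \<longlonglongrightarrow> Abs_ell2 g"
  proof (rule LIMSEQ_I)
    fix e :: real assume e: "e > 0"
    then obtain N where N: "\<forall>m\<ge>N. \<forall>n\<ge>N. norm (X m - X n) < e / 2"
      using CauchyD[OF X, of "e / 2"] by auto
    have "norm (X m - Abs_ell2 g) < e" if "m \<ge> N" for m
    proof -
      have "X m - Abs_ell2 g = Abs_ell2 (\<lambda>x. ell2_fun (X m) x - g x)"
        using gs by (simp add: minus_ell2_def Abs_ell2_inverse)
      moreover have "norm (Abs_ell2 (\<lambda>x. ell2_fun (X m) x - g x)) \<le> e / 2"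
        by (rule ell2_bdd_sums(2)) (use bound[of _ "e / 2" m] N e that in auto)
      ultimately show ?thesis using e by simp
    qed
    then show "\<exists>N. \<forall>n\<ge>N. norm (X n - Abs_ell2 g) < e" by blast
  qed
  then show "convergent X" by (auto simp: convergent_def)
qed

lift_definition ell2_delta :: "'i \<Rightarrow> 'i ell2" is "\<lambda>n m. if m = n then 1 else 0"
proof -
  fix n :: 'i
  have "(\<lambda>m. (cmod (if m = n then 1 else 0))\<^sup>2) summable_on {n}" by simp
  then show "(\<lambda>m. (cmod (if m = n then 1 else 0))\<^sup>2) summable_on UNIV"
    by (subst summable_on_cong_neutral[where T = "{n}"]) auto
qed


section \<open>The discrete Laplacian and multiplication operators\<close>

text \<open>\<open>\<int>\<^sup>d\<close> is rendered as \<open>int ^ 'd\<close> with \<open>d = CARD('d)\<close>.\<close>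

definition neighbours :: "int ^ 'd::finite \<Rightarrow> (int ^ 'd) set"
  where "neighbours n = {m. sqrt (\<Sum>i\<in>UNIV. (real_of_int (n $ i - m $ i))\<^sup>2) = 1}"

definition laplacian_fun :: "((int ^ 'd::finite) \<Rightarrow> complex) \<Rightarrow> int ^ 'd \<Rightarrow> complex"
  where "laplacian_fun f n = (1/2) * (\<Sum>m\<in>neighbours n. f m)"

text \<open>Operators are bounded \<open>\<real>\<close>-linear maps; all those occurring below are in fact
  \<open>\<complex>\<close>-linear, so that inverses and exponentials agree with the complex ones.\<close>

type_synonym 'i ell2_op = "'i ell2 \<Rightarrow>\<^sub>L 'i ell2"

lemma neighbours_eq_image: "neighbours n = (\<lambda>e. n + e) ` neighbours 0"
proof (intro equalityI subsetI)
  fix m assume "m \<in> neighbours n"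
  then have "m - n \<in> neighbours 0"
    by (simp add: neighbours_def power2_commute)
  moreover have "m = n + (m - n)" by simp
  ultimately show "m \<in> (\<lambda>e. n + e) ` neighbours 0" by blast
qed (auto simp: neighbours_def)

lemma finite_neighbours: "finite (neighbours (n :: int ^ 'd::finite))"
proof -
  have "neighbours (0 :: int ^ 'd) \<subseteq> (\<lambda>f. \<chi> i. f i) ` (UNIV \<rightarrow>\<^sub>E {-1..1})"
  proof
    fix e :: "int ^ 'd" assume "e \<in> neighbours 0"
    then have s: "(\<Sum>i\<in>UNIV. (real_of_int (e $ i))\<^sup>2) = 1" by (simp add: neighbours_def)
    have "e $ i \<in> {-1..1}" for i
    proof -
      have "(real_of_int (e $ i))\<^sup>2 \<le> 1"
        unfolding s[symmetric] by (rule member_le_sum) auto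
      then have "\<bar>real_of_int (e $ i)\<bar> \<le> 1" by (simp add: abs_square_le_1)
      then show ?thesis by auto
    qed
    then show "e \<in> (\<lambda>f. \<chi> i. f i) ` (UNIV \<rightarrow>\<^sub>E {-1..1})"
      by (intro image_eqI[where x = "\<lambda>i. e $ i"]) auto
  qed
  then have "finite (neighbours (0 :: int ^ 'd))"
    by (rule finite_subset) (intro finite_imageI finite_PiE, auto)
  then show ?thesis by (subst neighbours_eq_image) simp
qed

lemma ell2_shift:
  fixes f :: "('i::ab_group_add) ell2"
  shows "(\<lambda>n. (cmod (ell2_fun f (n + e)))\<^sup>2) summable_on UNIV"
    and "norm (Abs_ell2 (\<lambda>n. ell2_fun f (n + e))) = norm f"
proof -
  have b: "bij_betw (\<lambda>n. n + e) UNIV UNIV"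
    by (rule bij_betw_byWitness[where f' = "\<lambda>n. n - e"]) auto
  show s: "(\<lambda>n. (cmod (ell2_fun f (n + e)))\<^sup>2) summable_on UNIV"
    using summable_on_reindex_bij_betw[OF b, of "\<lambda>n. (cmod (ell2_fun f n))\<^sup>2"] ell2_summable by blast
  show "norm (Abs_ell2 (\<lambda>n. ell2_fun f (n + e))) = norm f"
    using s infsum_reindex_bij_betw[OF b, of "\<lambda>n. (cmod (ell2_fun f n))\<^sup>2"]
    by (simp add: norm_ell2_def Abs_ell2_inverse)
qed

lift_definition ell2_translate :: "('i::ab_group_add) \<Rightarrow> 'i ell2 \<Rightarrow> 'i ell2"
  is "\<lambda>e f n. f (n + e)"
  subgoal for e f using ell2_shift(1)[of "Abs_ell2 f" e] by (simp add: Abs_ell2_inverse)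
  done

lemma bounded_linear_ell2_translate: "bounded_linear (ell2_translate e)"
proof (rule bounded_linear_intro[where K = 1])
  show "norm (ell2_translate e f) \<le> norm f * 1" for f
    using ell2_shift(2)[of f e] by (simp add: ell2_translate_def)
qed (simp_all add: fun_eq_iff ell2_translate.rep_eq plus_ell2.rep_eq scaleR_ell2.rep_eq
      flip: ell2_fun_inject)

lemma ell2_fun_sum: "ell2_fun (\<Sum>i\<in>A. F i) x = (\<Sum>i\<in>A. ell2_fun (F i) x)"
  by (induction A rule: infinite_finite_induct) (auto simp: zero_ell2.rep_eq plus_ell2.rep_eq)

lemma laplacian_fun_eq:
  "laplacian_fun (ell2_fun f) = ell2_fun ((1/2) *\<^sub>R (\<Sum>e\<in>neighbours 0. ell2_translate e f))"
proof
  fix n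
  have "(\<Sum>m\<in>neighbours n. ell2_fun f m) = (\<Sum>e\<in>neighbours 0. ell2_fun f (n + e))"
    by (subst neighbours_eq_image, subst sum.reindex) auto
  then show "laplacian_fun (ell2_fun f) n
      = ell2_fun ((1/2) *\<^sub>R (\<Sum>e\<in>neighbours 0. ell2_translate e f)) n"
    by (simp add: laplacian_fun_def scaleR_ell2.rep_eq ell2_fun_sum ell2_translate.rep_eq
        scaleR_conv_of_real)
qed

lift_definition laplacian :: "(int ^ 'd::finite) ell2_op"
  is "\<lambda>f. Abs_ell2 (laplacian_fun (ell2_fun f))"
  unfolding laplacian_fun_eq ell2_fun_inverse
  by (intro bounded_linear_scaleR_right[THEN bounded_linear_compose]
      bounded_linear_sum bounded_linear_ell2_translate)

lemma laplacian_apply: "ell2_fun (laplacian f) n = (1/2) * (\<Sum>m\<in>neighbours n. ell2_fun f m)"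
  by (simp only: laplacian.rep_eq laplacian_fun_eq ell2_fun_inverse)
    (simp only: laplacian_fun_eq[symmetric] laplacian_fun_def)

text \<open>Meaningful for bounded \<open>V\<close> only, which covers every \<open>V \<in> \<ell>\<^sup>p\<close> and the constant functions
  (the scalar operators).\<close>

definition mult_op :: "('i \<Rightarrow> complex) \<Rightarrow> 'i ell2_op"
  where "mult_op V = Blinfun (\<lambda>f. Abs_ell2 (\<lambda>n. V n * ell2_fun f n))"

lemma mult_op_apply:
  assumes "bounded (range V)"
  shows "ell2_fun (mult_op V f) n = V n * ell2_fun f n"
proof -
  obtain C where C: "\<And>x. cmod (V x) \<le> C" using assms by (auto simp: bounded_iff)
  have C0: "C \<ge> 0" using C[of undefined] norm_ge_zero order_trans by blast
  have s: "(\<lambda>n. (cmod (V n * ell2_fun f n))\<^sup>2) summable_on UNIV" for f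
    by (rule ell2_mult_summable[OF ell2_summable C])
  have eq: "ell2_fun (Abs_ell2 (\<lambda>n. V n * ell2_fun f n)) = (\<lambda>n. V n * ell2_fun f n)" for f
    using s by (simp add: Abs_ell2_inverse)
  have "bounded_linear (\<lambda>f. Abs_ell2 (\<lambda>n. V n * ell2_fun f n))"
  proof (rule bounded_linear_intro[where K = C])
    fix f g :: "'a ell2" and r :: real
    show "Abs_ell2 (\<lambda>n. V n * ell2_fun (f + g) n)
        = Abs_ell2 (\<lambda>n. V n * ell2_fun f n) + Abs_ell2 (\<lambda>n. V n * ell2_fun g n)"
      by (rule ell2_fun_inject[THEN iffD1], rule ext, simp only: eq)
        (simp only: eq plus_ell2.rep_eq distrib_left)
    show "Abs_ell2 (\<lambda>n. V n * ell2_fun (r *\<^sub>R f) n) = r *\<^sub>R Abs_ell2 (\<lambda>n. V n * ell2_fun f n)"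
      by (rule ell2_fun_inject[THEN iffD1], rule ext, simp only: eq)
        (simp only: eq scaleR_ell2.rep_eq mult_scaleR_right)
    show "norm (Abs_ell2 (\<lambda>n. V n * ell2_fun f n)) \<le> norm f * C"
    proof (rule ell2_bdd_sums(2))
      fix F :: "'a set" assume F: "finite F"
      have "(\<Sum>x\<in>F. (cmod (V x * ell2_fun f x))\<^sup>2) \<le> (\<Sum>x\<in>F. C\<^sup>2 * (cmod (ell2_fun f x))\<^sup>2)"
        by (intro sum_mono) (simp add: norm_mult power_mult_distrib mult_right_mono power_mono C)
      also have "\<dots> \<le> C\<^sup>2 * (norm f)\<^sup>2"
        using ell2_sum_le_norm[OF F, of f] by (simp add: mult_left_mono flip: sum_distrib_left)
      finally show "(\<Sum>x\<in>F. (cmod (V x * ell2_fun f x))\<^sup>2) \<le> (norm f * C)\<^sup>2"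
        by (simp add: power_mult_distrib mult.commute)
    qed (simp add: C0)
  qed
  then show ?thesis
    by (simp add: mult_op_def bounded_linear_Blinfun_apply eq)
qed


section \<open>The regularized determinant\<close>

definition op_inverse :: "'i ell2_op \<Rightarrow> 'i ell2_op"
  where "op_inverse A = (THE B. A o\<^sub>L B = id_blinfun \<and> B o\<^sub>L A = id_blinfun)"

definition op_exp :: "'i ell2_op \<Rightarrow> 'i ell2_op"
  where "op_exp A = (\<Sum>k. (1 / fact k) *\<^sub>R (((\<lambda>B. A o\<^sub>L B) ^^ k) id_blinfun))"

definition matrix_entry :: "'i ell2_op \<Rightarrow> 'i \<Rightarrow> 'i \<Rightarrow> complex"
  where "matrix_entry T m n = ell2_fun (T (ell2_delta n)) m"

definition principal_minor :: "('i \<Rightarrow> 'i \<Rightarrow> complex) \<Rightarrow> 'i set \<Rightarrow> complex"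
  where "principal_minor K S = (\<Sum>\<pi> | \<pi> permutes S. of_int (sign \<pi>) * (\<Prod>i\<in>S. K i (\<pi> i)))"

text \<open>For \<open>X = I + T\<close> with \<open>T\<close> of trace class this is \<open>det (I + T) = \<Sum>\<^sub>k tr (\<Lambda>\<^sup>k T)\<close>, where the
  trace of \<open>\<Lambda>\<^sup>k T\<close> is computed in the orthonormal basis \<open>\<delta>\<^bsub>n\<^sub>1\<^esub> \<and> \<dots> \<and> \<delta>\<^bsub>n\<^sub>k\<^esub>\<close>, whose members
  correspond to the sets \<open>{n\<^sub>1,\<dots>,n\<^sub>k}\<close>; the sum converges absolutely.\<close>

definition fredholm_det :: "'i ell2_op \<Rightarrow> complex"
  where "fredholm_det X = (\<Sum>\<^sub>\<infinity>S\<in>{S. finite S}. principal_minor (matrix_entry (X - id_blinfun)) S)"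

definition free_resolvent :: "complex \<Rightarrow> (int ^ 'd::finite) ell2_op"
  where "free_resolvent l = op_inverse (laplacian - mult_op (\<lambda>_. l))"

definition perturbation_det :: "((int ^ 'd::finite) \<Rightarrow> complex) \<Rightarrow> complex \<Rightarrow> complex"
  where "perturbation_det V l =
    (let A = mult_op V o\<^sub>L free_resolvent l
     in fredholm_det ((id_blinfun + A) o\<^sub>L op_exp (- A)))"


section \<open>The uniformization of the resolvent set\<close>

definition joukowski :: "nat \<Rightarrow> complex \<Rightarrow> complex"
  where "joukowski d z = of_nat d / 2 * (z + 1 / z)"

text \<open>The branch of \<open>\<surd>(\<lambda>\<^sup>2 - d\<^sup>2)\<close> on \<open>\<complex> - [-d,d]\<close> asymptotic to \<open>\<lambda>\<close> at infinity; that it is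
  that branch is shown in \<open>varkappa_branch\<close>.\<close>

definition varkappa :: "nat \<Rightarrow> complex \<Rightarrow> complex"
  where "varkappa d l = l * csqrt (1 - (of_nat d / l)\<^sup>2)"

definition Lambda_dom :: "nat \<Rightarrow> complex set"
  where "Lambda_dom d = - (complex_of_real ` {- real d .. real d})"

lemma Lambda_dom_csqrt_arg:
  assumes "l \<in> Lambda_dom d"
  shows "l \<noteq> 0" "1 - (of_nat d / l)\<^sup>2 \<notin> \<real>\<^sub>\<le>\<^sub>0"
proof -
  have "(0::complex) \<in> complex_of_real ` {- real d .. real d}"
    by (rule image_eqI[where x = 0]) auto
  then show l0: "l \<noteq> 0" using assms by (auto simp: Lambda_dom_def)
  show "1 - (of_nat d / l)\<^sup>2 \<notin> \<real>\<^sub>\<le>\<^sub>0"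
  proof
    assume "1 - (of_nat d / l)\<^sup>2 \<in> \<real>\<^sub>\<le>\<^sub>0"
    then obtain r where r: "1 - (of_nat d / l)\<^sup>2 = complex_of_real r" "r \<le> 0"
      by (auto simp: nonpos_Reals_def)
    define q where "q = sqrt (1 - r)"
    have q: "q \<ge> 1" "q\<^sup>2 = 1 - r" using r by (auto simp: q_def)
    have "(of_nat d / l)\<^sup>2 = complex_of_real (1 - r)"
      using r(1) by (simp add: algebra_simps)
    also have "\<dots> = (complex_of_real q)\<^sup>2" by (simp flip: q(2))
    finally have "of_nat d / l = complex_of_real q \<or> of_nat d / l = - complex_of_real q"
      by (simp add: power2_eq_iff)
    then have *: "l = complex_of_real (real d / q) \<or> l = complex_of_real (- (real d / q))"
      using l0 q(1) by (auto simp: field_simps)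
    have "real d / q \<le> real d" "real d / q \<ge> 0"
      using q(1) by (auto simp: divide_le_eq intro!: mult_le_cancel_left1[THEN iffD2])
    then have "real d / q \<in> {- real d .. real d}" "- (real d / q) \<in> {- real d .. real d}" by auto
    then have "l \<in> complex_of_real ` {- real d .. real d}" using * by (blast intro: image_eqI)
    then show False using assms by (simp add: Lambda_dom_def)
  qed
qed

lemma varkappa_branch:
  "varkappa d holomorphic_on Lambda_dom d"
  "\<And>l. l \<in> Lambda_dom d \<Longrightarrow> (varkappa d l)\<^sup>2 = l\<^sup>2 - (of_nat d)\<^sup>2"
  "(\<lambda>l. varkappa d l - (l - (of_nat d)\<^sup>2 / (2 * l))) \<in> O[at_infinity](\<lambda>l. 1 / l ^ 3)"
proof -
  show "varkappa d holomorphic_on Lambda_dom d"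
    unfolding varkappa_def by (intro holomorphic_intros) (use Lambda_dom_csqrt_arg in auto)
  show "(varkappa d l)\<^sup>2 = l\<^sup>2 - (of_nat d)\<^sup>2" if "l \<in> Lambda_dom d" for l
    using Lambda_dom_csqrt_arg(1)[OF that]
    by (simp add: varkappa_def power_mult_distrib power_divide field_simps)
  show "(\<lambda>l. varkappa d l - (l - (of_nat d)\<^sup>2 / (2 * l))) \<in> O[at_infinity](\<lambda>l. 1 / l ^ 3)"
  proof (rule bigoI[where c = "real d ^ 4"])
    show "eventually (\<lambda>l. norm (varkappa d l - (l - (of_nat d)\<^sup>2 / (2 * l)))
            \<le> real d ^ 4 * norm (1 / l ^ 3)) at_infinity"
      unfolding eventually_at_infinity
    proof (intro exI[of _ 1] allI impI)
      fix l :: complex assume "1 \<le> norm l"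
      then have l: "l \<noteq> 0" by auto
      define u where "u = (of_nat d / l)\<^sup>2"
      define s where "s = csqrt (1 - u)"
      have s2: "s\<^sup>2 = 1 - u" by (simp add: s_def)
      have "Re (s + 1) \<ge> 1" using Re_csqrt[of "1 - u"] by (simp add: s_def)
      then have s1: "norm (s + 1) \<ge> 1" using complex_Re_le_cmod order_trans by blast
      then have s0: "s + 1 \<noteq> 0" by auto
      have u: "u = (1 - s) * (s + 1)" using s2 by (simp add: power2_eq_square algebra_simps)
      have "s - 1 + u / 2 = - u\<^sup>2 / (2 * (s + 1)\<^sup>2)"
      proof -
        have "- u\<^sup>2 / (2 * (s + 1)\<^sup>2) = - (1 - s)\<^sup>2 / 2"
          using s0 unfolding u by (simp add: power_mult_distrib)
        also have "\<dots> = s - 1 + u / 2"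
          unfolding u by (simp add: field_simps power2_eq_square)
        finally show ?thesis by simp
      qed
      moreover have "(of_nat d)\<^sup>2 / (2 * l) = l * (u / 2)"
        using l by (simp add: u_def field_simps power2_eq_square)
      moreover have "varkappa d l = l * s" by (simp add: varkappa_def u_def s_def)
      ultimately have "varkappa d l - (l - (of_nat d)\<^sup>2 / (2 * l)) = l * (- u\<^sup>2 / (2 * (s + 1)\<^sup>2))"
        by (metis diff_diff_eq2 add_diff_eq diff_add_eq distrib_left mult.right_neutral right_diff_distrib)
      then have "norm (varkappa d l - (l - (of_nat d)\<^sup>2 / (2 * l)))
          = norm l * (norm u)\<^sup>2 / (2 * (norm (s + 1))\<^sup>2)"
        by (simp add: norm_mult norm_divide norm_power)
      also have "\<dots> \<le> norm l * (norm u)\<^sup>2 / 1"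
      proof (rule divide_left_mono)
        show "1 \<le> 2 * (norm (s + 1))\<^sup>2" using one_le_power[OF s1, of 2] by linarith
      qed (use s0 in auto)
      also have "\<dots> = real d ^ 4 * norm (1 / l ^ 3)"
        using l by (simp add: u_def norm_mult norm_power norm_divide field_simps eval_nat_numeral)
      finally show "norm (varkappa d l - (l - (of_nat d)\<^sup>2 / (2 * l)))
          \<le> real d ^ 4 * norm (1 / l ^ 3)" .
    qed
  qed
qed


section \<open>The function D, its zeros and its canonical factorization\<close>

definition D_fun :: "((int ^ 'd::finite) \<Rightarrow> complex) \<Rightarrow> complex \<Rightarrow> complex"
  where "D_fun V z = (if z = 0 then 1 else perturbation_det V (joukowski CARD('d) z))"

definition boundary_value :: "(complex \<Rightarrow> complex) \<Rightarrow> complex \<Rightarrow> complex"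
  where "boundary_value f w = Lim (at w within ball 0 1) f"

text \<open>The zeros are listed as \<open>z 0, z 1, \<dots>\<close>, so the indices are the \<open>j\<close> with \<open>enat j < N\<close>.\<close>

definition zero_enumeration :: "(complex \<Rightarrow> complex) \<Rightarrow> enat \<Rightarrow> (nat \<Rightarrow> complex) \<Rightarrow> bool"
  where "zero_enumeration f N z \<longleftrightarrow>
    (\<forall>j. enat j < N \<longrightarrow> z j \<in> ball 0 1 \<and> f (z j) = 0) \<and>
    (\<forall>w\<in>ball 0 1. f w = 0 \<longrightarrow>
      finite {j. enat j < N \<and> z j = w} \<and> int (card {j. enat j < N \<and> z j = w}) = zorder f w)"

definition blaschke :: "enat \<Rightarrow> (nat \<Rightarrow> complex) \<Rightarrow> complex \<Rightarrow> complex"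
  where "blaschke N z w = (\<Prod>j. if enat j < N
    then of_real (cmod (z j)) / z j * ((z j - w) / (1 - cnj (z j) * w)) else 1)"

definition B_zero :: "enat \<Rightarrow> (nat \<Rightarrow> complex) \<Rightarrow> real"
  where "B_zero N z = ln (\<Prod>j. if enat j < N then cmod (z j) else 1)"

text \<open>The circle is represented by \<open>[-\<pi>,\<pi>]\<close>; how a mass at the identified endpoints is
  distributed between them is irrelevant, as only integrals of \<open>2\<pi>\<close>-periodic functions occur.
  Since \<open>ln 0 = 0\<close> in HOL, that \<open>log \<bar>D\<bar>\<close> is finite almost everywhere, which is part of its being
  in \<open>L\<^sup>1\<close>, has to be stated separately.\<close>

definition canonical_singular_measure ::
    "(complex \<Rightarrow> complex) \<Rightarrow> enat \<Rightarrow> (nat \<Rightarrow> complex) \<Rightarrow> real measure \<Rightarrow> bool"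
  where "canonical_singular_measure f N z \<sigma> \<longleftrightarrow>
    space \<sigma> = {-pi..pi} \<and> sets \<sigma> = sets (restrict_space borel {-pi..pi}) \<and> finite_measure \<sigma> \<and>
    (\<exists>S\<in>sets \<sigma>. emeasure lborel S = 0 \<and> emeasure \<sigma> (space \<sigma> - S) = 0) \<and>
    set_integrable lborel {-pi..pi} (\<lambda>t. ln (cmod (boundary_value f (cis t)))) \<and>
    (AE t in lborel. t \<in> {-pi..pi} \<longrightarrow> boundary_value f (cis t) \<noteq> 0) \<and>
    (\<forall>w\<in>ball 0 1. f w = blaschke N z w *
      exp (- 1 / (2 * of_real pi) * (LINT t|\<sigma>. (cis t + w) / (cis t - w))) *
      exp (1 / (2 * of_real pi) *
        (LINT t:{-pi..pi}|lborel.
          (cis t + w) / (cis t - w) * of_real (ln (cmod (boundary_value f (cis t)))))))"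

text \<open>Integration against the signed measure \<open>d\<mu>(t) = log \<bar>f(e\<^bsup>it\<^esup>)\<bar> dt - d\<sigma>(t)\<close>.\<close>

definition mu_integral ::
    "(complex \<Rightarrow> complex) \<Rightarrow> real measure \<Rightarrow> (real \<Rightarrow> complex) \<Rightarrow> complex"
  where "mu_integral f \<sigma> g =
    (LINT t:{-pi..pi}|lborel. g t * of_real (ln (cmod (boundary_value f (cis t)))))
    - (LINT t|\<sigma>. g t)"


section \<open>Norms and constants\<close>

definition in_lp :: "real \<Rightarrow> ('i \<Rightarrow> complex) \<Rightarrow> bool"
  where "in_lp p V \<longleftrightarrow> (\<lambda>n. cmod (V n) powr p) summable_on UNIV"

definition lp_norm :: "real \<Rightarrow> ('i \<Rightarrow> complex) \<Rightarrow> real"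
  where "lp_norm p V = (\<Sum>\<^sub>\<infinity>n. cmod (V n) powr p) powr (1 / p)"

definition const_C :: "real \<Rightarrow> nat \<Rightarrow> real"
  where "const_C p d = (if p = 1 then 1 else p powr (real d * (p - 1) / (2 * p)))"

definition const_C0 :: "nat \<Rightarrow> real"
  where "const_C0 d = (if d = 3 then 16 else if d = 4 then 4
    else 14 * 2 powr (real d / 4) / (real d - 4))"

definition const_kappa :: "real \<Rightarrow> nat \<Rightarrow> real"
  where "const_kappa p d =
    (if d = 3 then 6 * (p - 1) / (6 - 5 * p)
     else if d = 4 then ((5 * p - 1) / (4 - 3 * p)) powr ((5 * p - 4) / (4 * (p - 1)))
     else 3 * real d * (p - 1) / (3 * real d - (2 * real d + 1) * p))"

definition const_Gamma :: "real \<Rightarrow> nat \<Rightarrow> real"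
  where "const_Gamma p d =
    (let G = (\<lambda>q. (3 + 2 * const_kappa q d) powr (real d * (q - 1) / q))
     in if d = 4 \<and> p = 1 then Lim (at_right 1) G else G p)"

definition C_star :: "real \<Rightarrow> nat \<Rightarrow> real"
  where "C_star p d = const_C p d + const_C0 d * const_Gamma p d"

end

theory Submission
  imports Defs "HOL-Real_Asymp.Real_Asymp"
begin

text \<open>
  The entries of the free resolvent are Laplace transforms of products of Bessel functions, so
  uniform decay estimates for Bessel functions give \<open>\<bar>R\<^sub>0(\<lambda>)(m,n)\<bar> \<le> G(m - n)\<close> with
  \<open>\<parallel>G\<parallel>\<^bsub>p/(p-1)\<^esub> \<le> C\<^sub>*\<close>, uniformly in \<open>\<lambda>\<close> up to the spectrum. By Young's inequality
  \<open>\<surd>V R\<^sub>0(\<lambda>) \<surd>V\<close> has Hilbert--Schmidt norm at most \<open>C\<^sub>* \<parallel>V\<parallel>\<^sub>p\<close>, and Hadamard's inequality turns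
  this into \<open>\<bar>D\<bar> \<le> exp m\<close> with \<open>m = C\<^sub>*\<^sup>2 \<parallel>V\<parallel>\<^sub>p\<^sup>2 / 2\<close>, in the disk and almost everywhere on the
  circle. Moreover \<open>D(0) = 1\<close> and \<open>D'(0) = 0\<close>, because the determinant is regularized.

  The measure \<open>m dt - d\<mu>\<close> is therefore positive. At the origin the canonical factorization says
  \<open>-B\<^sub>0 = \<mu>(\<T>) / 2\<pi>\<close>, hence \<open>-B\<^sub>0 \<le> m - \<sigma>(\<T>) / 2\<pi>\<close>, and every Fourier coefficient of \<open>\<mu>\<close> is bounded
  by \<open>2\<pi>m\<close>. Its logarithmic derivative at the origin gives \<open>\<Sum>\<^sub>j (1/z\<^sub>j - cnj z\<^sub>j) = \<mu>\<^sub>1 / \<pi>\<close> with \<open>\<mu>\<^sub>1\<close> the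
  first Fourier coefficient, and \<open>Re \<kappa>\<^sub>j + \<i> Im \<lambda>\<^sub>j = (d/2) (1/z\<^sub>j - cnj z\<^sub>j)\<close>.
\<close>

section \<open>Bessel functions of integer order\<close>

text \<open>The exponents come from the decay of Bessel integrals in the order. Put q = p/(p-1). For
  d = 3 the integral of |J_m|^3 is O(m^(-1/2)), and its power q/3 is summable over m if q > 6, that
  is p < 6/5. For d = 4 the integral of J_m^4 is O(log m / m), and its power q/4 is summable if q >
  4, that is p < 4/3. For d >= 5 the fourth powers are summed over the lattice under the time
  integral, which puts G in l^4, so q > 4 suffices again. The determinant is an infinite object
  defined through V R_0, while a bound that is uniform up to the spectrum is available only for the
  symmetrized operator. Finite sections connect the two: for them conjugation by a square root of V
  does not change the determinant. They converge uniformly on the whole open disk, so that the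
  value, the derivative at the origin and the boundary limits all pass to D. The boundary points 1
  and -1, which correspond to the edges of the spectrum and where both half planes meet, are left
  out; they form a null set.\<close>

definition bessel_j :: "int \<Rightarrow> real \<Rightarrow> real"
  where "bessel_j n t = integral {0..pi} (\<lambda>x. cos (of_int n * x - t * sin x)) / pi"

lemma bessel_j_has_integral:
  "((\<lambda>x. cos (of_int n * x - t * sin x)) has_integral (pi * bessel_j n t)) {0..pi}"
proof -
  have "(\<lambda>x. cos (of_int n * x - t * sin x)) integrable_on {0..pi}"
    by (intro integrable_continuous_interval continuous_intros)
  then show ?thesis by (simp add: bessel_j_def has_integral_integral)
qed

lemma bessel_j_eqI:
  assumes "((\<lambda>x. cos (of_int n * x - t * sin x)) has_integral y) {0..pi}"
  shows "bessel_j n t = y / pi"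
  using has_integral_unique[OF bessel_j_has_integral assms] by (simp add: field_simps)

lemma bessel_j_abs_le_1: "\<bar>bessel_j n t\<bar> \<le> 1"
proof -
  have "norm (pi * bessel_j n t) \<le> 1 * measure lborel (cbox 0 pi)"
    by (rule has_integral_bound) (use bessel_j_has_integral[of n t] in \<open>auto simp: cbox_interval\<close>)
  then show ?thesis by (simp add: abs_mult)
qed

lemma sin_of_int_times_pi [simp]: "sin (of_int n * pi) = 0"
  by (simp add: sin_zero_iff_int2)

lemma has_integral_cos_int:
  assumes "n \<noteq> 0"
  shows "((\<lambda>x. cos (of_int n * x)) has_integral 0) {0..pi}"
proof -
  have "((\<lambda>x. cos (of_int n * x)) has_integral
     (sin (of_int n * pi) / of_int n - sin (of_int n * 0) / of_int n)) {0..pi}"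
    by (rule fundamental_theorem_of_calculus)
      (use assms in \<open>auto intro!: derivative_eq_intros simp: has_real_derivative_iff_has_vector_derivative[symmetric]\<close>)
  then show ?thesis by (simp)
qed

lemma bessel_j_0: "bessel_j n 0 = (if n = 0 then 1 else 0)"
proof (cases "n = 0")
  case True
  then show ?thesis using bessel_j_eqI[of 0 0 pi] has_integral_const_real[of "1::real" 0 pi] by simp
next
  case False
  then show ?thesis using bessel_j_eqI[of n 0 0] has_integral_cos_int[OF False] by simp
qed

lemma bessel_j_deriv:
  "((\<lambda>t. bessel_j n t) has_real_derivative (bessel_j (n - 1) t - bessel_j (n + 1) t) / 2) (at t)"
proof -
  let ?g = "\<lambda>t x. sin (of_int n * x - t * sin x) * sin x"
  have "((\<lambda>t. integral (cbox 0 pi) (\<lambda>x. cos (of_int n * x - t * sin x)))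
      has_field_derivative integral (cbox 0 pi) (?g t)) (at t within UNIV)"
    by (rule leibniz_rule_field_derivative)
      (auto intro!: derivative_eq_intros continuous_intros integrable_continuous_interval
        simp: case_prod_unfold cbox_interval)
  moreover have "integral (cbox 0 pi) (?g t) = pi * (bessel_j (n - 1) t - bessel_j (n + 1) t) / 2"
  proof -
    have "((\<lambda>x. (cos (of_int (n-1) * x - t * sin x) - cos (of_int (n+1) * x - t * sin x)) / 2)
       has_integral ((pi * bessel_j (n - 1) t - pi * bessel_j (n + 1) t) / 2)) {0..pi}"
      by (intro has_integral_divide has_integral_diff bessel_j_has_integral)
    moreover have "(cos (of_int (n-1) * x - t * sin x) - cos (of_int (n+1) * x - t * sin x)) / 2 = ?g t x" for x
    proof -
      have "of_int (n-1) * x - t * sin x = (of_int n * x - t * sin x) - x"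
        "of_int (n+1) * x - t * sin x = (of_int n * x - t * sin x) + x" by (simp_all add: algebra_simps)
      then show ?thesis by (simp only: cos_diff cos_add) (simp add: field_simps)
    qed
    ultimately show ?thesis by (simp add: cbox_interval integral_unique algebra_simps)
  qed
  ultimately have "((\<lambda>t. integral {0..pi} (\<lambda>x. cos (of_int n * x - t * sin x)) / pi)
      has_field_derivative (pi * (bessel_j (n - 1) t - bessel_j (n + 1) t) / 2) / pi) (at t)"
    by (intro DERIV_cdivide) (simp only: cbox_interval)
  then show ?thesis by (simp add: bessel_j_def[abs_def])
qed

text \<open>The cosine of the phase n x - t sin x times the derivative of the phase is exact, and
  the sine of the phase vanishes at both ends because n is an integer. The product of cos x with the
  cosine of the phase yields the two neighbouring orders.\<close>

lemma bessel_j_rec: "2 * of_int n * bessel_j n t = t * (bessel_j (n - 1) t + bessel_j (n + 1) t)"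
proof -
  let ?f = "\<lambda>x. cos (of_int n * x - t * sin x) * (of_int n - t * cos x)"
  have "(?f has_integral (sin (of_int n * pi - t * sin pi) - sin (of_int n * 0 - t * sin 0))) {0..pi}"
    by (rule fundamental_theorem_of_calculus)
      (auto intro!: derivative_eq_intros simp: has_real_derivative_iff_has_vector_derivative[symmetric])
  then have 1: "(?f has_integral 0) {0..pi}" by (simp)
  have 2: "((\<lambda>x. of_int n * cos (of_int n * x - t * sin x) -
      t * ((cos (of_int (n-1) * x - t * sin x) + cos (of_int (n+1) * x - t * sin x)) / 2))
       has_integral (of_int n * (pi * bessel_j n t) - t * ((pi * bessel_j (n - 1) t + pi * bessel_j (n + 1) t) / 2))) {0..pi}"
    by (intro has_integral_divide has_integral_diff has_integral_add has_integral_mult_right bessel_j_has_integral)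
  have "of_int n * cos (of_int n * x - t * sin x) -
      t * ((cos (of_int (n-1) * x - t * sin x) + cos (of_int (n+1) * x - t * sin x)) / 2) = ?f x" for x
  proof -
    have "of_int (n-1) * x - t * sin x = (of_int n * x - t * sin x) - x"
      "of_int (n+1) * x - t * sin x = (of_int n * x - t * sin x) + x" by (simp_all add: algebra_simps)
    then show ?thesis by (simp only: cos_diff cos_add) (simp add: field_simps)
  qed
  with 2 have "(?f has_integral (of_int n * (pi * bessel_j n t) - t * ((pi * bessel_j (n - 1) t + pi * bessel_j (n + 1) t) / 2))) {0..pi}"
    by simp
  from has_integral_unique[OF this 1] have "pi * (2 * of_int n * bessel_j n t - t * (bessel_j (n - 1) t + bessel_j (n + 1) t)) = 0"
    by (simp add: algebra_simps)
  then show ?thesis by simp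
qed

lemma cos_diff_int_pi: "cos (x - of_int n * pi) = cos (of_int n * pi) * cos x"
  by (simp add: cos_diff)

text \<open>The reflection of x to pi - x turns the phase of order n into that of order -n up to a
  multiple of pi, which costs only the sign cos (n pi). Only absolute values enter the kernel
  bound.\<close>

lemma bessel_j_minus: "\<bar>bessel_j (- n) t\<bar> = \<bar>bessel_j n t\<bar>"
proof -
  have "((\<lambda>x. cos (of_int n * pi) * cos (of_int n * x - t * sin x)) has_integral (cos (of_int n * pi) * (pi * bessel_j n t))) {0..pi}"
    by (intro has_integral_mult_right bessel_j_has_integral)
  from has_integral_affinity[OF this[folded cbox_interval], of "-1" pi]
  have *: "((\<lambda>x. cos (of_int n * pi) * cos (of_int n * (pi - x) - t * sin (pi - x))) has_integral (cos (of_int n * pi) * (pi * bessel_j n t))) {0..pi}"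
    by (simp add: cbox_interval algebra_simps)
  have c2: "cos (of_int n * pi) * cos (of_int n * pi) = (1::real)"
    using sin_cos_squared_add3[of "of_int n * pi"] by (simp)
  have "cos (of_int n * pi) * cos (of_int n * (pi - x) - t * sin (pi - x)) = cos (of_int (-n) * x - t * sin x)" for x
  proof -
    have "of_int n * (pi - x) - t * sin (pi - x) = (of_int (-n) * x - t * sin x) - of_int (- n) * pi"
      by (simp add: algebra_simps)
    then have "cos (of_int n * pi) * cos (of_int n * (pi - x) - t * sin (pi - x))
       = cos (of_int n * pi) * (cos (of_int (-n) * pi) * cos (of_int (-n) * x - t * sin x))"
      by (simp only: cos_diff_int_pi)
    also have "\<dots> = (cos (of_int n * pi) * cos (of_int n * pi)) * cos (of_int (-n) * x - t * sin x)"
      by simp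
    finally show ?thesis using c2 by simp
  qed
  with * have "((\<lambda>x. cos (of_int (-n) * x - t * sin x)) has_integral (cos (of_int n * pi) * (pi * bessel_j n t))) {0..pi}"
    by simp
  from bessel_j_eqI[OF this] have "bessel_j (- n) t = cos (of_int n * pi) * bessel_j n t" by simp
  moreover have "\<bar>cos (of_int n * pi)\<bar> = (1::real)" using c2 by (metis abs_mult_self_eq abs_one real_sqrt_abs2 real_sqrt_one)
  ultimately show ?thesis by (simp add: abs_mult)
qed

lemma bessel_j_abs: "\<bar>bessel_j \<bar>n\<bar> t\<bar> = \<bar>bessel_j n t\<bar>"
  using bessel_j_minus[of n t] by (cases "n \<ge> 0") simp_all

lemma continuous_on_bessel_j [continuous_intros]:
  assumes "continuous_on S f" shows "continuous_on S (\<lambda>x. bessel_j n (f x))"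
proof -
  have "continuous_on UNIV (bessel_j n)"
    by (meson DERIV_continuous_on UNIV_I bessel_j_deriv has_field_derivative_at_within)
  then show ?thesis using assms by (metis continuous_on_compose2 subset_UNIV)
qed

text \<open>Bessel's inequality for rho e^(i psi) against the exponentials e^(i n x), in real form
  on the half period, where cos ((n - k) x) already integrates to 0. The phase psi = t sin x yields
  the sum of squares of Bessel functions, the phase 0 the sum of fourth powers.\<close>

lemma bessel_inequality:
  fixes \<rho> \<psi> :: "real \<Rightarrow> real" and c :: "int \<Rightarrow> real"
  assumes c: "\<And>n. n \<in> S \<Longrightarrow> ((\<lambda>x. \<rho> x * cos (of_int n * x - \<psi> x)) has_integral (pi * c n)) {0..pi}"
    and r: "((\<lambda>x. (\<rho> x)\<^sup>2) has_integral R) {0..pi}" and S: "finite S"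
  shows "pi * (\<Sum>n\<in>S. (c n)\<^sup>2) \<le> R"
proof -
  let ?X = "\<Sum>n\<in>S. (c n)\<^sup>2"
  let ?C = "\<lambda>x. \<Sum>n\<in>S. c n * cos (of_int n * x - \<psi> x)"
  let ?D = "\<lambda>x. \<Sum>n\<in>S. c n * sin (of_int n * x - \<psi> x)"
  have 1: "((\<lambda>x. \<Sum>n\<in>S. c n * (\<rho> x * cos (of_int n * x - \<psi> x))) has_integral (\<Sum>n\<in>S. c n * (pi * c n))) {0..pi}"
    by (intro has_integral_sum S has_integral_mult_right c)
  have 2: "((\<lambda>x. \<Sum>n\<in>S. \<Sum>k\<in>S. c n * c k * cos (of_int (n - k) * x)) has_integral
     (\<Sum>n\<in>S. \<Sum>k\<in>S. c n * c k * (if n = k then pi else 0))) {0..pi}"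
  proof (intro has_integral_sum S has_integral_mult_right)
    fix n k :: int
    show "((\<lambda>x. cos (of_int (n - k) * x)) has_integral (if n = k then pi else 0)) {0..pi}"
      using has_integral_cos_int[of "n - k"] has_integral_const_real[of "1::real" 0 pi] by auto
  qed
  have "(\<Sum>n\<in>S. \<Sum>k\<in>S. c n * c k * (if n = k then pi else 0)) = pi * ?X"
    using S by (simp add: if_distrib sum.delta sum.delta' sum_distrib_left power2_eq_square mult_ac cong: if_cong)
  moreover have "(\<Sum>n\<in>S. \<Sum>k\<in>S. c n * c k * cos (of_int (n - k) * x)) = (?C x)\<^sup>2 + (?D x)\<^sup>2" for x
  proof -
    have "cos (of_int (n - k) * x) = cos (of_int n * x - \<psi> x) * cos (of_int k * x - \<psi> x)
       + sin (of_int n * x - \<psi> x) * sin (of_int k * x - \<psi> x)" for n k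
      unfolding cos_diff[symmetric] by (simp add: algebra_simps)
    then show ?thesis
      by (simp only: power2_eq_square sum_product sum.distrib[symmetric]) (simp add: algebra_simps)
  qed
  ultimately have 3: "((\<lambda>x. (?C x)\<^sup>2 + (?D x)\<^sup>2) has_integral (pi * ?X)) {0..pi}" using 2 by simp
  \<comment> \<open>With \<open>?C\<close> and \<open>?D\<close> the real and imaginary parts of the
    trigonometric sum, this integrand is the squared modulus of rho minus that sum.\<close>
  have "((\<lambda>x. (\<rho> x)\<^sup>2 - 2 * (\<Sum>n\<in>S. c n * (\<rho> x * cos (of_int n * x - \<psi> x))) + ((?C x)\<^sup>2 + (?D x)\<^sup>2))
     has_integral (R - 2 * (\<Sum>n\<in>S. c n * (pi * c n)) + pi * ?X)) {0..pi}"
    by (intro has_integral_add has_integral_diff has_integral_mult_right r 1 3)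
  moreover have "(\<rho> x)\<^sup>2 - 2 * (\<Sum>n\<in>S. c n * (\<rho> x * cos (of_int n * x - \<psi> x))) + ((?C x)\<^sup>2 + (?D x)\<^sup>2) \<ge> 0" for x
  proof -
    have "(\<Sum>n\<in>S. c n * (\<rho> x * cos (of_int n * x - \<psi> x))) = \<rho> x * ?C x"
      by (simp add: sum_distrib_left mult_ac)
    then have "(\<rho> x)\<^sup>2 - 2 * (\<Sum>n\<in>S. c n * (\<rho> x * cos (of_int n * x - \<psi> x))) + ((?C x)\<^sup>2 + (?D x)\<^sup>2)
       = (\<rho> x - ?C x)\<^sup>2 + (?D x)\<^sup>2" by (simp add: power2_diff)
    then show ?thesis by (simp only: sum_power2_ge_zero)
  qed
  ultimately have "0 \<le> R - 2 * (\<Sum>n\<in>S. c n * (pi * c n)) + pi * ?X"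
    using has_integral_nonneg by blast
  moreover have "(\<Sum>n\<in>S. c n * (pi * c n)) = pi * ?X"
    by (simp add: sum_distrib_left power2_eq_square mult_ac)
  ultimately show ?thesis by simp
qed

lemma sum_bessel_j_sq_le_1:
  assumes "finite S" shows "(\<Sum>n\<in>S. (bessel_j n t)\<^sup>2) \<le> 1"
proof -
  have "pi * (\<Sum>n\<in>S. (bessel_j n t)\<^sup>2) \<le> pi"
    by (rule bessel_inequality[where \<rho> = "\<lambda>_. 1" and \<psi> = "\<lambda>x. t * sin x"])
      (use assms bessel_j_has_integral has_integral_const_real[of "1::real" 0 pi] in auto)
  then show ?thesis by simp
qed

text \<open>Integration by parts against the phase derivative m - t cos x, which is positive and
  increasing on [a, pi]. Its reciprocal is therefore monotone, and what remains is at most the total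
  variation of the reciprocal.\<close>

lemma bessel_j_decay:
  assumes "0 \<le> a" "a < pi" "0 \<le> t" and pos: "of_int m > t * cos a"
  shows "\<bar>integral {a..pi} (\<lambda>x. cos (of_int m * x - t * sin x))\<bar>
    \<le> (1 + \<bar>sin (of_int m * a - t * sin a)\<bar>) / (of_int m - t * cos a)"
proof -
  let ?p = "\<lambda>x. of_int m * x - t * sin x" and ?q = "\<lambda>x. of_int m - t * cos x"
  have q: "?q x > 0" and q': "?q a \<le> ?q x" if "x \<in> {a..pi}" for x
  proof -
    have "cos x \<le> cos a" using that assms by (intro cos_monotone_0_pi_le) auto
    then have "t * cos x \<le> t * cos a" using assms by (intro mult_left_mono)
    then show "?q a \<le> ?q x" "?q x > 0" using pos by auto
  qed
  let ?f = "\<lambda>x. cos (?p x)" and ?g = "\<lambda>x. sin (?p x) * (t * sin x) / (?q x)\<^sup>2" and ?h = "\<lambda>x. (t * sin x) / (?q x)\<^sup>2"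
  have 1: "((\<lambda>x. ?f x - ?g x) has_integral (sin (?p pi) / ?q pi - sin (?p a) / ?q a)) {a..pi}"
  proof (rule fundamental_theorem_of_calculus)
    fix x assume x: "x \<in> {a..pi}"
    have "((\<lambda>x. sin (?p x) / ?q x) has_real_derivative
        (cos (?p x) * ?q x * ?q x - sin (?p x) * (t * sin x)) / (?q x * ?q x)) (at x within {a..pi})"
      using q[OF x] by (auto intro!: derivative_eq_intros)
    moreover have "(cos (?p x) * ?q x * ?q x - sin (?p x) * (t * sin x)) / (?q x * ?q x) = ?f x - ?g x"
      using q[OF x] by (simp add: diff_divide_distrib power2_eq_square)
    ultimately show "((\<lambda>x. sin (?p x) / ?q x) has_vector_derivative ?f x - ?g x) (at x within {a..pi})"
      by (simp only: has_real_derivative_iff_has_vector_derivative[symmetric])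
  qed (use assms in auto)
  \<comment> \<open>\<open>?h\<close> is the derivative of -1 / \<open>?q\<close>, so this is the
    total variation of the reciprocal.\<close>
  have 2: "(?h has_integral (- 1 / ?q pi - (- 1 / ?q a))) {a..pi}"
  proof (rule fundamental_theorem_of_calculus)
    fix x assume x: "x \<in> {a..pi}"
    show "((\<lambda>x. - 1 / ?q x) has_vector_derivative ?h x) (at x within {a..pi})"
      unfolding has_real_derivative_iff_has_vector_derivative[symmetric]
      using q[OF x] by (auto intro!: derivative_eq_intros simp: field_simps power2_eq_square)
  qed (use assms in auto)
  have gi: "?g integrable_on {a..pi}"
    by (intro integrable_continuous_interval continuous_intros) (use q in force)
  have "\<bar>integral {a..pi} ?g\<bar> \<le> integral {a..pi} ?h"
  proof -
    have "norm (integral {a..pi} ?g) \<le> integral {a..pi} ?h"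
    proof (rule integral_norm_bound_integral[OF gi])
      show "?h integrable_on {a..pi}" using 2 by blast
      fix x assume x: "x \<in> {a..pi}"
      have "sin x \<ge> 0" using x assms by (intro sin_ge_zero) auto
      then have h: "?h x \<ge> 0" using assms by auto
      have "norm (?g x) = \<bar>sin (?p x)\<bar> * \<bar>?h x\<bar>" unfolding real_norm_def abs_mult[symmetric] by simp
      also have "\<dots> \<le> 1 * \<bar>?h x\<bar>" by (intro mult_right_mono) auto
      also have "\<dots> = ?h x" using h by (simp only: abs_of_nonneg mult_1_left)
      finally show "norm (?g x) \<le> ?h x" .
    qed
    then show ?thesis by simp
  qed
  also have "integral {a..pi} ?h = 1 / ?q a - 1 / ?q pi" using 2 by (simp add: integral_unique)
  finally have g: "\<bar>integral {a..pi} ?g\<bar> \<le> 1 / ?q a - 1 / ?q pi" .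
  have "?f integrable_on {a..pi}" by (intro integrable_continuous_interval continuous_intros)
  then have "integral {a..pi} ?f = integral {a..pi} (\<lambda>x. ?f x - ?g x) + integral {a..pi} ?g"
    using gi by (simp add: integral_diff)
  also have "integral {a..pi} (\<lambda>x. ?f x - ?g x) = - sin (?p a) / ?q a"
    using 1 by (simp add: integral_unique)
  finally have "\<bar>integral {a..pi} ?f\<bar> \<le> \<bar>sin (?p a) / ?q a\<bar> + (1 / ?q a - 1 / ?q pi)" using g by linarith
  moreover have "1 / ?q pi \<ge> 0" using q[of pi] assms by auto
  moreover have "\<bar>sin (?p a) / ?q a\<bar> + 1 / ?q a = (1 + \<bar>sin (?p a)\<bar>) / ?q a" using q[of a] assms
    by (simp add: add_divide_distrib)
  ultimately show ?thesis by linarith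
qed

text \<open>For a = 0 the boundary sine in \<open>bessel_j_decay\<close> is 0, so the numerator is
  1.\<close>

lemma bessel_j_below_turning:
  assumes "0 \<le> t" "t < of_int m"
  shows "\<bar>bessel_j m t\<bar> \<le> 1 / (pi * (of_int m - t))"
  using divide_right_mono[OF bessel_j_decay[of 0 t m], of pi] assms by (simp add: bessel_j_def mult.commute)

text \<open>The arc [0, a], on which the phase may be stationary, contributes at most its length; on
  the rest the phase derivative is bounded below. The angle is later taken of order
  m^(-1/3).\<close>

lemma bessel_j_near_turning:
  assumes "0 \<le> a" "a < pi" "0 \<le> t" and pos: "of_int m > t * cos a"
  shows "\<bar>bessel_j m t\<bar> \<le> (a + 2 / (of_int m - t * cos a)) / pi"
proof -
  let ?f = "\<lambda>x. cos (of_int m * x - t * sin x)"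
  have "\<bar>integral {a..pi} ?f\<bar> \<le> (1 + \<bar>sin (of_int m * a - t * sin a)\<bar>) / (of_int m - t * cos a)"
    by (rule bessel_j_decay[OF assms])
  also have "\<dots> \<le> 2 / (of_int m - t * cos a)"
    using pos abs_sin_le_one[of "of_int m * a - t * sin a"] by (intro divide_right_mono) linarith+
  finally have 1: "\<bar>integral {a..pi} ?f\<bar> \<le> 2 / (of_int m - t * cos a)" .
  have "norm (integral (cbox 0 a) ?f) \<le> 1 * measure lborel (cbox 0 a)"
    by (rule integrable_bound) (auto intro!: integrable_continuous_interval continuous_intros simp: cbox_interval)
  then have 2: "\<bar>integral {0..a} ?f\<bar> \<le> a" using assms by (simp add: cbox_interval)
  have "integral {0..a} ?f + integral {a..pi} ?f = integral {0..pi} ?f"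
    using assms by (intro Henstock_Kurzweil_Integration.integral_combine integrable_continuous_interval continuous_intros) auto
  then have "\<bar>integral {0..pi} ?f\<bar> \<le> a + 2 / (of_int m - t * cos a)" using 1 2 by linarith
  then show ?thesis by (simp add: bessel_j_def divide_right_mono)
qed
section \<open>Uniform decay of Bessel functions\<close>

lemma bessel_j_deriv_down:
  assumes "t \<noteq> 0"
  shows "((\<lambda>t. bessel_j n t) has_real_derivative (of_int n / t * bessel_j n t - bessel_j (n + 1) t)) (at t)"
proof -
  have "bessel_j (n - 1) t = 2 * of_int n * bessel_j n t / t - bessel_j (n + 1) t"
    using bessel_j_rec[of n t] assms by (simp add: field_simps)
  then have "(bessel_j (n - 1) t - bessel_j (n + 1) t) / 2 = of_int n / t * bessel_j n t - bessel_j (n + 1) t"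
    by (simp add: field_simps)
  then show ?thesis using bessel_j_deriv[of n t] by (simp only:)
qed

lemma bessel_j_deriv_up:
  assumes "t \<noteq> 0"
  shows "((\<lambda>t. bessel_j (n + 1) t) has_real_derivative (bessel_j n t - (of_int n + 1) / t * bessel_j (n + 1) t)) (at t)"
proof -
  have "bessel_j (n + 2) t = 2 * (of_int n + 1) * bessel_j (n + 1) t / t - bessel_j n t"
    using bessel_j_rec[of "n + 1" t] assms by (simp add: field_simps)
  then have "(bessel_j (n + 1 - 1) t - bessel_j (n + 1 + 1) t) / 2 = bessel_j n t - (of_int n + 1) / t * bessel_j (n + 1) t"
    by (simp add: field_simps)
  then show ?thesis using bessel_j_deriv[of "n + 1" t] by (simp only:)
qed

lemma has_integral_sin_sq: "((\<lambda>x. (sin x)\<^sup>2) has_integral (pi / 2)) {0..pi}"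
proof -
  have "((\<lambda>x. (sin x)\<^sup>2) has_integral ((pi / 2 - sin pi * cos pi / 2) - (0 / 2 - sin 0 * cos 0 / 2))) {0..pi}"
  proof (rule fundamental_theorem_of_calculus)
    fix x :: real
    have "((\<lambda>x. x / 2 - sin x * cos x / 2) has_real_derivative (1 / 2 - (cos x * cos x - sin x * sin x) / 2)) (at x within {0..pi})"
      by (auto intro!: derivative_eq_intros)
    moreover have "1 / 2 - (cos x * cos x - sin x * sin x) / 2 = (sin x)\<^sup>2"
      using sin_cos_squared_add[of x] by (simp add: power2_eq_square field_simps)
    ultimately show "((\<lambda>x. x / 2 - sin x * cos x / 2) has_vector_derivative (sin x)\<^sup>2) (at x within {0..pi})"
      by (simp add: has_real_derivative_iff_has_vector_derivative)
  qed simp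
  then show ?thesis by simp
qed

text \<open>Initial data at t = 1 for the energy estimate below, obtained from quadratic bounds for
  the integrand cos (sin x).\<close>

lemma bessel_j_0_at_1: "3 / 4 \<le> bessel_j 0 1" "bessel_j 0 1 \<le> 19 / 24"
proof -
  \<comment> \<open>The coefficient is 1/2 - 1/24: for |y| at most 1 the fourth-order Taylor
    remainder is at most y^2 / 24.\<close>
  have cos_le: "cos y \<le> 1 - (11/24) * y\<^sup>2" and cos_ge: "1 - y\<^sup>2 / 2 \<le> cos y" if "\<bar>y\<bar> \<le> 1" for y :: real
  proof -
    obtain t where "cos y = (\<Sum>m<4. cos_coeff m * y ^ m) + cos (t + 1 / 2 * real 4 * pi) / fact 4 * y ^ 4"
      using Maclaurin_cos_expansion[of y 4] by blast
    moreover have "(\<Sum>m<4. cos_coeff m * y ^ m) = 1 - y\<^sup>2 / 2"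
      by (simp add: lessThan_nat_numeral lessThan_Suc cos_coeff_def)
    moreover have "cos (t + 1 / 2 * real 4 * pi) / fact 4 * y ^ 4 \<le> 1 / 24 * y\<^sup>2"
    proof -
      have "cos (t + 1 / 2 * real 4 * pi) / fact 4 * y ^ 4 \<le> 1 / fact 4 * y ^ 4"
        by (intro mult_right_mono divide_right_mono) auto
      also have "y ^ 4 \<le> y\<^sup>2"
      proof -
        have "y\<^sup>2 * y\<^sup>2 \<le> y\<^sup>2 * 1" using that by (intro mult_left_mono) (auto simp: abs_square_le_1)
        then show ?thesis by (simp flip: power_add)
      qed
      finally show ?thesis by (simp add: fact_numeral)
    qed
    ultimately show "cos y \<le> 1 - (11/24) * y\<^sup>2" by linarith
    have "cos (2 * (y/2)) = 1 - 2 * (sin (y/2))\<^sup>2" by (rule cos_double_sin)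
    moreover have "(sin (y/2))\<^sup>2 \<le> (y/2)\<^sup>2"
      using abs_sin_x_le_abs_x[of "y/2"] by (simp only: abs_le_square_iff)
    ultimately show "1 - y\<^sup>2 / 2 \<le> cos y" by (simp add: power_divide)
  qed
  have 0: "((\<lambda>x. cos (sin x)) has_integral (pi * bessel_j 0 1)) {0..pi}"
    using bessel_j_has_integral[of 0 1] by simp
  have 1: "((\<lambda>x. 1 - (11/24) * (sin x)\<^sup>2) has_integral (pi - 11/24 * (pi / 2))) {0..pi}"
    by (intro has_integral_diff has_integral_mult_right has_integral_sin_sq)
      (use has_integral_const_real[of "1::real" 0 pi] in auto)
  have 2: "((\<lambda>x. 1 - (sin x)\<^sup>2 / 2) has_integral (pi - (pi / 2) / 2)) {0..pi}"
    by (intro has_integral_diff has_integral_divide has_integral_sin_sq)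
      (use has_integral_const_real[of "1::real" 0 pi] in auto)
  have "pi * bessel_j 0 1 \<le> pi - 11/24 * (pi / 2)"
    by (rule has_integral_le[OF 0 1]) (use cos_le in auto)
  then have "pi * bessel_j 0 1 \<le> pi * (37/48)" by simp
  then show "bessel_j 0 1 \<le> 19 / 24" by (simp del: mult_less_cancel_left)
  have "pi - (pi / 2) / 2 \<le> pi * bessel_j 0 1"
    by (rule has_integral_le[OF 2 0]) (use cos_ge in auto)
  then have "pi * (3/4) \<le> pi * bessel_j 0 1" by simp
  then show "3 / 4 \<le> bessel_j 0 1" by (subst (asm) mult_le_cancel_left_pos) auto
qed

text \<open>Of the two terms of cos (x - sin x), the first is the derivative of sin (sin x) and
  integrates to 0; the second lies between 0 and the square of sin x.\<close>

lemma bessel_j_1_at_1: "0 \<le> bessel_j 1 1" "bessel_j 1 1 \<le> 1 / 2"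
proof -
  have cos_eq: "cos (x - sin x) = cos x * cos (sin x) + sin x * sin (sin x)" for x :: real by (simp add: cos_diff)
  have A: "((\<lambda>x. cos x * cos (sin x)) has_integral (sin (sin pi) - sin (sin 0))) {0..pi}"
    by (rule fundamental_theorem_of_calculus)
      (auto intro!: derivative_eq_intros simp: has_real_derivative_iff_has_vector_derivative[symmetric])
  have "((\<lambda>x. cos (x - sin x) - cos x * cos (sin x)) has_integral (pi * bessel_j 1 1 - (sin (sin pi) - sin (sin 0)))) {0..pi}"
    by (intro has_integral_diff A) (use bessel_j_has_integral[of 1 1] in simp)
  then have 0: "((\<lambda>x. sin x * sin (sin x)) has_integral (pi * bessel_j 1 1)) {0..pi}"
    by (simp add: cos_eq)
  have s: "0 \<le> sin x" "0 \<le> sin (sin x)" if "x \<in> {0..pi}" for x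
  proof -
    show 1: "0 \<le> sin x" using that by (intro sin_ge_zero) auto
    have "sin x \<le> pi" using sin_le_one[of x] pi_gt3 by linarith
    with 1 show "0 \<le> sin (sin x)" by (rule sin_ge_zero)
  qed
  have "0 \<le> pi * bessel_j 1 1"
    by (rule has_integral_nonneg[OF 0]) (use s in auto)
  then show "0 \<le> bessel_j 1 1" using pi_gt_zero by (simp only: zero_le_mult_iff) linarith
  have "pi * bessel_j 1 1 \<le> pi / 2"
  proof (rule has_integral_le[OF 0 has_integral_sin_sq])
    fix x assume "x \<in> {0..pi}"
    then show "sin x * sin (sin x) \<le> (sin x)\<^sup>2"
      using s[of x] sin_x_le_x[of "sin x"] by (simp add: power2_eq_square mult_left_mono)
  qed
  then have "pi * bessel_j 1 1 \<le> pi * (1/2)" by simp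
  then show "bessel_j 1 1 \<le> 1 / 2" by (subst (asm) mult_le_cancel_left_pos) auto
qed

text \<open>For \<open>u = \<surd>t J\<^sub>0\<close> Bessel's equation reads \<open>u'' + (1 + 1/(4t\<^sup>2)) u = 0\<close>; the quantity below is
  \<open>u'\<^sup>2 + (1 + 1/(4t\<^sup>2)) u\<^sup>2\<close>, which decreases.\<close>

lemma bessel_j_0_energy:
  assumes "1 \<le> t"
  shows "t * ((bessel_j 0 t)\<^sup>2 + (bessel_j 1 t)\<^sup>2) - bessel_j 0 t * bessel_j 1 t + (bessel_j 0 t)\<^sup>2 / (2 * t) \<le> 1"
proof -
  define E where "E = (\<lambda>t. t * ((bessel_j 0 t)\<^sup>2 + (bessel_j 1 t)\<^sup>2) - bessel_j 0 t * bessel_j 1 t + (bessel_j 0 t)\<^sup>2 / (2 * t))"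
  have dE: "(E has_real_derivative (- (bessel_j 0 s)\<^sup>2 / (2 * s\<^sup>2))) (at s)" if "s \<ge> 1" for s
  proof -
    have d0: "((\<lambda>t. bessel_j 0 t) has_real_derivative (- bessel_j 1 s)) (at s)"
      using bessel_j_deriv_down[of s 0] that by simp
    have d1: "((\<lambda>t. bessel_j 1 t) has_real_derivative (bessel_j 0 s - bessel_j 1 s / s)) (at s)"
      using bessel_j_deriv_up[of s 0] that by simp
    show ?thesis unfolding E_def
      by (rule derivative_eq_intros d0 d1 refl | use that in \<open>simp; fail\<close>)+
        (use that in \<open>simp add: field_simps power2_eq_square\<close>)
  qed
  have "E t \<le> E 1"
  proof (rule DERIV_nonpos_imp_nonincreasing[OF assms])
    fix s assume "1 \<le> s" "s \<le> t"
    then show "\<exists>y. (E has_real_derivative y) (at s) \<and> y \<le> 0" using dE[of s] by (intro exI conjI) auto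
  qed
  also have "E 1 \<le> 1"
  proof -
    let ?a = "bessel_j 0 1" and ?b = "bessel_j 1 1"
    \<comment> \<open>The energy at 1 equals 3/2 a^2 - b (a - b), and a <= 19/24 makes the first
      term less than 1.\<close>
    have "?b * (?a - ?b) \<ge> 0" using bessel_j_0_at_1 bessel_j_1_at_1 by (intro mult_nonneg_nonneg) auto
    moreover have "?a\<^sup>2 \<le> (19/24)\<^sup>2" using bessel_j_0_at_1 by (intro power_mono) auto
    ultimately show ?thesis unfolding E_def by (simp add: power2_eq_square algebra_simps)
  qed
  finally show ?thesis by (simp add: E_def)
qed

text \<open>Completing the square shows that the terms of the energy other than t J_0^2 are
  nonnegative. For t < 1 the bound |J_0| <= 1 is enough.\<close>

lemma bessel_j_0_sq_le:
  assumes "0 < t" shows "t * (bessel_j 0 t)\<^sup>2 \<le> 1"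
proof (cases "t \<ge> 1")
  case True
  have "t * (bessel_j 1 t)\<^sup>2 - bessel_j 0 t * bessel_j 1 t + (bessel_j 0 t)\<^sup>2 / (2 * t)
    = ((t * bessel_j 1 t - bessel_j 0 t / 2)\<^sup>2 + (bessel_j 0 t)\<^sup>2 / 4) / t"
    using assms by (simp add: field_simps power2_eq_square)
  moreover have "\<dots> \<ge> 0" using assms by simp
  ultimately show ?thesis using bessel_j_0_energy[OF True] by (simp add: distrib_left)
next
  case False
  have "(bessel_j 0 t)\<^sup>2 \<le> 1" using bessel_j_abs_le_1[of 0 t] by (simp add: abs_square_le_1)
  then show ?thesis using False assms by (intro mult_le_one) auto
qed

text \<open>Induction on the order: by the recurrence, passing from the orders m, m + 1 to m + 1, m
  + 2 changes the expression by O(1/t) only. In the base case the mixed term of the energy tends to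
  0.\<close>

lemma bessel_j_energy_limsup:
  fixes m :: nat
  assumes "e > 0"
  shows "\<forall>\<^sub>F t in at_top. t * ((bessel_j (int m) t)\<^sup>2 + (bessel_j (int m + 1) t)\<^sup>2) \<le> 1 + e"
  using assms
proof (induction m arbitrary: e)
  case 0
  have "\<forall>\<^sub>F t::real in at_top. sqrt (1 / t) < e" using 0 by real_asymp
  then show ?case using eventually_ge_at_top[of "1::real"]
  proof eventually_elim
    case (elim t)
    have "(bessel_j 0 t)\<^sup>2 \<le> 1 / t" using bessel_j_0_sq_le[of t] elim by (simp add: field_simps)
    then have "\<bar>bessel_j 0 t\<bar> \<le> sqrt (1 / t)" by (metis real_sqrt_abs real_sqrt_le_iff)
    then have "\<bar>bessel_j 0 t * bessel_j 1 t\<bar> \<le> sqrt (1 / t) * 1"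
      unfolding abs_mult using elim by (intro mult_mono bessel_j_abs_le_1) auto
    moreover have "0 \<le> (bessel_j 0 t)\<^sup>2 / (2 * t)" using elim by auto
    ultimately have "t * ((bessel_j 0 t)\<^sup>2 + (bessel_j 1 t)\<^sup>2) \<le> 1 + e"
      using bessel_j_0_energy[OF elim(2)] elim(1) by linarith
    then show ?case by simp
  qed
next
  case (Suc m)
  define C where "C = 4 * (real m + 1)\<^sup>2 + 4 * (real m + 1)"
  have "\<forall>\<^sub>F t::real in at_top. 2 * C / t < e / 2" using Suc.prems by real_asymp
  moreover have "\<forall>\<^sub>F t in at_top. t * ((bessel_j (int m) t)\<^sup>2 + (bessel_j (int m + 1) t)\<^sup>2) \<le> 1 + min 1 (e / 2)"
    using Suc.prems by (intro Suc.IH) simp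
  ultimately show ?case using eventually_ge_at_top[of "1::real"]
  proof eventually_elim
    case (elim t)
    let ?a = "bessel_j (int m) t" and ?b = "bessel_j (int m + 1) t" and ?c = "bessel_j (int m + 2) t"
    have t: "t > 0" using elim by simp
    have E: "t * ?a\<^sup>2 + t * ?b\<^sup>2 \<le> 2" "t * (?a\<^sup>2 + ?b\<^sup>2) \<le> 1 + e / 2"
      using elim by (auto simp: distrib_left)
    have c: "t * ?c = 2 * (real m + 1) * ?b - t * ?a"
      using bessel_j_rec[of "int m + 1" t] by (simp add: algebra_simps)
    have "t * (t * (?b\<^sup>2 + ?c\<^sup>2)) = t * t * ?b\<^sup>2 + (t * ?c)\<^sup>2" by (simp add: algebra_simps power2_eq_square)
    also have "\<dots> = t * (t * (?a\<^sup>2 + ?b\<^sup>2)) + (4 * (real m + 1)\<^sup>2 * ?b\<^sup>2 - 4 * (real m + 1) * (t * (?a * ?b)))"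
      unfolding c by (simp add: algebra_simps power2_eq_square)
    also have "4 * (real m + 1)\<^sup>2 * ?b\<^sup>2 - 4 * (real m + 1) * (t * (?a * ?b)) \<le> 4 * (real m + 1)\<^sup>2 * 2 + 4 * (real m + 1) * 2"
    proof -
      have "1 * ?b\<^sup>2 \<le> t * ?b\<^sup>2" using elim by (intro mult_right_mono) auto
      moreover have "0 \<le> t * ?a\<^sup>2" "0 \<le> t * ?b\<^sup>2" using t by auto
      ultimately have b: "?b\<^sup>2 \<le> 2" using E by linarith
      have "2 * (- (t * (?a * ?b))) \<le> t * ?a\<^sup>2 + t * ?b\<^sup>2"
      proof -
        have "0 \<le> t * (?a + ?b)\<^sup>2" using t by simp
        then show ?thesis by (simp add: algebra_simps power2_eq_square)
      qed
      then have ab: "- (t * (?a * ?b)) \<le> 2" using E by linarith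
      have "4 * (real m + 1)\<^sup>2 * ?b\<^sup>2 \<le> 4 * (real m + 1)\<^sup>2 * 2" using b by (intro mult_left_mono) auto
      moreover have "4 * (real m + 1) * (- (t * (?a * ?b))) \<le> 4 * (real m + 1) * 2" using ab by (intro mult_left_mono) auto
      ultimately show ?thesis by (simp only: mult_minus_right)
    qed
    finally have "t * (t * (?b\<^sup>2 + ?c\<^sup>2)) \<le> t * (t * (?a\<^sup>2 + ?b\<^sup>2)) + 2 * C" by (simp add: C_def)
    then have "t * (t * (?b\<^sup>2 + ?c\<^sup>2)) / t \<le> (t * (t * (?a\<^sup>2 + ?b\<^sup>2)) + 2 * C) / t"
      using t by (intro divide_right_mono) auto
    then have "t * (?b\<^sup>2 + ?c\<^sup>2) \<le> t * (?a\<^sup>2 + ?b\<^sup>2) + 2 * C / t" using t by (simp add: add_divide_distrib)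
    then show ?case using E elim by (simp add: add.commute add.left_commute)
  qed
qed
text \<open>In the Liouville variables \<open>d\<tau> = \<surd>(t\<^sup>2 - m\<^sup>2) dt/t\<close>, \<open>w = (t\<^sup>2 - m\<^sup>2)\<^bsup>1/4\<^esup> J\<^sub>m\<close>, Bessel's equation
  becomes \<open>w'' + \<phi> w = 0\<close> with \<open>\<phi> > 0\<close> decreasing, so \<open>G = w\<^sup>2 + w'\<^sup>2/\<phi>\<close> increases to its limit
  at infinity, which the previous lemma bounds. Below, \<open>x\<close> is \<open>(t\<^sup>2 - m\<^sup>2)\<^bsup>1/4\<^esup> w'\<close>.\<close>

lemma bessel_j_above_turning:
  fixes m :: nat
  assumes t: "real m < t"
  shows "sqrt (t\<^sup>2 - (real m)\<^sup>2) * (bessel_j (int m) t)\<^sup>2 \<le> 1"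
proof -
  let ?M = "(real m)\<^sup>2"
  define a where "a = (\<lambda>s. bessel_j (int m) s)"
  define b where "b = (\<lambda>s. bessel_j (int m + 1) s)"
  define Q where "Q = (\<lambda>s::real. s\<^sup>2 - ?M)"
  define R where "R = (\<lambda>s. sqrt (Q s))"
  define x where "x = (\<lambda>s. (real m * a s - s * b s) + s\<^sup>2 / (2 * Q s) * a s)"
  define \<phi> where "\<phi> = (\<lambda>s. 1 + s\<^sup>2 * (Q s + 5 * ?M) / (4 * Q s ^ 3))"
  define \<phi>' where "\<phi>' = (\<lambda>s. - (s * (Q s ^ 2 + 12 * ?M * Q s + 15 * ?M\<^sup>2)) / (2 * Q s ^ 4))"
  define G where "G = (\<lambda>s. R s * (a s)\<^sup>2 + (x s)\<^sup>2 / (R s * \<phi> s))"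
  have pos: "s > 0" "Q s > 0" "R s > 0" "\<phi> s \<ge> 1" "\<phi>' s \<le> 0" "(R s)\<^sup>2 = Q s" if "s > real m" for s
  proof -
    show s: "s > 0" using that of_nat_0_le_iff[of m] by linarith
    show Q: "Q s > 0" using that by (simp add: Q_def power_strict_mono)
    then show "R s > 0" "(R s)\<^sup>2 = Q s" by (simp_all add: R_def)
    show "\<phi> s \<ge> 1" "\<phi>' s \<le> 0" using s Q by (simp_all add: \<phi>_def \<phi>'_def)
  qed
  have dQ: "(Q has_real_derivative 2 * s) (at s)" for s
    unfolding Q_def by (auto intro!: derivative_eq_intros)
  have dR: "(R has_real_derivative s / R s) (at s)" if "s > real m" for s
    unfolding R_def using pos[OF that]
    by (auto intro!: derivative_eq_intros dQ simp: R_def field_simps)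
  have da: "(a has_real_derivative (x s / s - s * a s / (2 * Q s))) (at s)" if "s > real m" for s
  proof -
    have "x s / s - s * a s / (2 * Q s) = real m / s * a s - b s"
      using pos[OF that] by (simp add: x_def field_simps power2_eq_square)
    then show ?thesis using bessel_j_deriv_down[of s "int m"] pos(1)[OF that] by (simp add: a_def b_def)
  qed
  have db: "(b has_real_derivative (a s - (real m + 1) / s * b s)) (at s)" if "s > real m" for s
    using bessel_j_deriv_up[of s "int m"] pos(1)[OF that] by (simp add: a_def b_def)
  have dp: "((\<lambda>s. real m * a s - s * b s) has_real_derivative - (Q s / s) * a s) (at s)" if "s > real m" for s
  proof -
    have "((\<lambda>s. real m * a s - s * b s) has_real_derivative
      real m * (real m / s * a s - b s) - (1 * b s + (a s - (real m + 1) / s * b s) * s)) (at s)"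
      using bessel_j_deriv_down[of s "int m"] pos(1)[OF that]
      by (intro DERIV_diff DERIV_cmult DERIV_mult DERIV_ident db that) (simp_all add: a_def b_def)
    moreover have "real m * (real m / s * a s - b s) - (1 * b s + (a s - (real m + 1) / s * b s) * s) = - (Q s / s) * a s"
      using pos(1)[OF that] by (simp add: Q_def field_simps power2_eq_square)
    ultimately show ?thesis by simp
  qed
  have dx: "(x has_real_derivative (s * x s / (2 * Q s) - Q s / s * \<phi> s * a s)) (at s)" if "s > real m" for s
  proof -
    have M: "?M = s\<^sup>2 - Q s" by (simp add: Q_def)
    have g: "((\<lambda>s. s\<^sup>2 / (2 * Q s)) has_real_derivative (- s * ?M / (Q s)\<^sup>2)) (at s)"
      using pos[OF that] unfolding M
      by (auto intro!: derivative_eq_intros dQ simp: field_simps power2_eq_square)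
    have "(x has_real_derivative - (Q s / s) * a s + ((- s * ?M / (Q s)\<^sup>2) * a s +
       (x s / s - s * a s / (2 * Q s)) * (s\<^sup>2 / (2 * Q s)))) (at s)"
      unfolding x_def[abs_def]
      by (rule DERIV_add[OF dp[OF that] DERIV_mult[OF g da[OF that, unfolded x_def]]])
    moreover have "- (Q s / s) * a s + ((- s * ?M / (Q s)\<^sup>2) * a s +
       (x s / s - s * a s / (2 * Q s)) * (s\<^sup>2 / (2 * Q s))) = s * x s / (2 * Q s) - Q s / s * \<phi> s * a s"
      using pos[OF that] unfolding \<phi>_def M by (simp add: field_simps power2_eq_square power3_eq_cube)
    ultimately show ?thesis by simp
  qed
  have dphi: "(\<phi> has_real_derivative \<phi>' s) (at s)" if "s > real m" for s
  proof -
    have M: "?M = s\<^sup>2 - Q s" by (simp add: Q_def)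
    have "(\<phi> has_real_derivative ((2 * s * (Q s + 5 * ?M) + s\<^sup>2 * (2 * s)) * (4 * Q s ^ 3)
        - s\<^sup>2 * (Q s + 5 * ?M) * (4 * (3 * Q s ^ 2 * (2 * s)))) / (4 * Q s ^ 3)\<^sup>2) (at s)"
      unfolding \<phi>_def[abs_def] using pos[OF that]
      by (auto intro!: derivative_eq_intros dQ simp: power2_eq_square)
    moreover have "((2 * s * (Q s + 5 * ?M) + s\<^sup>2 * (2 * s)) * (4 * Q s ^ 3)
        - s\<^sup>2 * (Q s + 5 * ?M) * (4 * (3 * Q s ^ 2 * (2 * s)))) / (4 * Q s ^ 3)\<^sup>2 = \<phi>' s"
      using pos[OF that] unfolding \<phi>'_def M by (simp add: field_simps) (simp add: algebra_simps eval_nat_numeral)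
    ultimately show ?thesis by simp
  qed
  have dG: "(G has_real_derivative - ((x s)\<^sup>2 * \<phi>' s / (R s * (\<phi> s)\<^sup>2))) (at s)" if "s > real m" for s
  proof -
    note P = pos[OF that]
    have "(G has_real_derivative
       (s / R s * (a s)\<^sup>2 + 2 * a s * (x s / s - s * a s / (2 * Q s)) * R s) +
       (2 * x s * (s * x s / (2 * Q s) - Q s / s * \<phi> s * a s) * (R s * \<phi> s) -
         (x s)\<^sup>2 * (s / R s * \<phi> s + \<phi>' s * R s)) / (R s * \<phi> s)\<^sup>2) (at s)"
      unfolding G_def[abs_def] using P
      by (auto intro!: derivative_eq_intros dR da dx dphi that simp: power2_eq_square)
    moreover have "(s / R s * (a s)\<^sup>2 + 2 * a s * (x s / s - s * a s / (2 * Q s)) * R s) +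
       (2 * x s * (s * x s / (2 * Q s) - Q s / s * \<phi> s * a s) * (R s * \<phi> s) -
         (x s)\<^sup>2 * (s / R s * \<phi> s + \<phi>' s * R s)) / (R s * \<phi> s)\<^sup>2 = - ((x s)\<^sup>2 * \<phi>' s / (R s * (\<phi> s)\<^sup>2))"
    proof -
      have "\<phi> s > 0" "R s > 0" "s > 0" using P by auto
      then show ?thesis unfolding P(6)[symmetric] by (simp add: field_simps power2_eq_square)
    qed
    ultimately show ?thesis by simp
  qed
  have mono: "G t \<le> G s" if "t \<le> s" for s
  proof (rule DERIV_nonneg_imp_nondecreasing[OF that])
    fix u assume "t \<le> u" "u \<le> s"
    then have u: "u > real m" using t by simp
    have "(x u)\<^sup>2 * \<phi>' u / (R u * (\<phi> u)\<^sup>2) \<le> 0" using pos[OF u]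
      by (intro divide_nonpos_pos mult_nonneg_nonpos) auto
    then show "\<exists>y. (G has_real_derivative y) (at u) \<and> 0 \<le> y" using dG[OF u] by (intro exI conjI) auto
  qed
  have le_G: "R t * (a t)\<^sup>2 \<le> G t" using pos[OF t] by (simp add: G_def)
  have "G t \<le> 1 + e" if "e > 0" for e
  proof -
    \<comment> \<open>C collects the lower-order terms of x^2: the mixed term is at most 4 k and the
      last one at most 2 k^2, with k <= m + 1.\<close>
    define C where "C = 4 * (real m + 1) + 2 * (real m + 1)\<^sup>2"
    have lim: "\<forall>\<^sub>F s::real in at_top. 2 * (s / sqrt (s\<^sup>2 - ?M) - 1) + C / sqrt (s\<^sup>2 - ?M) < e / 2"
      using that by real_asymp
    have lim2: "\<forall>\<^sub>F s in at_top. s * ((a s)\<^sup>2 + (b s)\<^sup>2) \<le> 1 + min 1 (e / 2)"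
      unfolding a_def b_def by (rule bessel_j_energy_limsup) (use that in auto)
    have "\<forall>\<^sub>F s in at_top. G s \<le> 1 + e \<and> t \<le> s"
      using lim lim2 eventually_ge_at_top[of t] eventually_ge_at_top[of "2 * real m + 1"]
    proof eventually_elim
      case (elim s)
      have s: "s > real m" using elim t by simp
      note P = pos[OF s]
      have ab: "s * (a s)\<^sup>2 + s * (b s)\<^sup>2 \<le> 2" "s * (a s)\<^sup>2 + s * (b s)\<^sup>2 \<le> 1 + e / 2"
        using elim by (auto simp: distrib_left)
      have nn: "0 \<le> s * (a s)\<^sup>2" "0 \<le> s * (b s)\<^sup>2" using P by auto
      have "4 * ?M \<le> s\<^sup>2" using elim power_mono[of "2 * real m" s 2] by (simp add: power_mult_distrib)
      then have half: "s\<^sup>2 / (2 * Q s) \<le> 1" using P by (simp add: divide_le_eq Q_def)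
      have half': "0 \<le> s\<^sup>2 / (2 * Q s)" using P by (intro divide_nonneg_pos) auto
      have Rs: "R s \<le> s" using P unfolding R_def Q_def by (simp add: real_le_lsqrt)
      define k where "k = real m + s\<^sup>2 / (2 * Q s)"
      have k: "0 \<le> k" "k \<le> real m + 1" using half half' by (auto simp: k_def)
      have "(x s)\<^sup>2 = s * (s * (b s)\<^sup>2) + (- 2 * k * (s * (a s * b s))) + k\<^sup>2 * (a s)\<^sup>2"
        by (simp add: x_def k_def power2_eq_square algebra_simps)
      also have "- 2 * k * (s * (a s * b s)) \<le> 4 * (real m + 1)"
      proof -
        have "0 \<le> s * (a s + b s)\<^sup>2" using P by simp
        then have "- (s * (a s * b s)) \<le> 2" using ab by (simp add: algebra_simps power2_eq_square)
        then have "2 * k * (- (s * (a s * b s))) \<le> 2 * k * 2" using k by (intro mult_left_mono) auto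
        then show ?thesis using k by simp
      qed
      also have "k\<^sup>2 * (a s)\<^sup>2 \<le> (real m + 1)\<^sup>2 * 2"
      proof (intro mult_mono power_mono k)
        have "1 * (a s)\<^sup>2 \<le> s * (a s)\<^sup>2" using elim by (intro mult_right_mono) auto
        then show "(a s)\<^sup>2 \<le> 2" using ab nn by linarith
      qed auto
      finally have x2: "(x s)\<^sup>2 \<le> s * (s * (b s)\<^sup>2) + C" by (simp add: C_def)
      have "(x s)\<^sup>2 / (R s * \<phi> s) \<le> (x s)\<^sup>2 / R s"
        using P mult_left_mono[of 1 "\<phi> s" "R s"] by (intro divide_left_mono) auto
      also have "\<dots> \<le> (s * (s * (b s)\<^sup>2) + C) / R s" using x2 P by (intro divide_right_mono) auto
      also have "\<dots> = s * (b s)\<^sup>2 + (s / R s - 1) * (s * (b s)\<^sup>2) + C / R s"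
        using P by (simp add: field_simps)
      also have "(s / R s - 1) * (s * (b s)\<^sup>2) \<le> (s / R s - 1) * 2"
        using ab nn Rs P by (intro mult_left_mono) (linarith, simp)
      finally have "(x s)\<^sup>2 / (R s * \<phi> s) \<le> s * (b s)\<^sup>2 + (2 * (s / R s - 1) + C / R s)"
        by (simp only: mult.commute[of "s / R s - 1"] add.assoc)
      moreover have "R s * (a s)\<^sup>2 \<le> s * (a s)\<^sup>2" using Rs by (intro mult_right_mono) auto
      moreover have "2 * (s / R s - 1) + C / R s < e / 2" using elim by (simp add: R_def Q_def)
      ultimately have "G s \<le> 1 + e" using ab unfolding G_def by linarith
      then show ?case using elim by simp
    qed
    then obtain s where "G s \<le> 1 + e" "t \<le> s"
      using eventually_happens'[OF trivial_limit_at_top_linorder] by blast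
    then show ?thesis using mono[of s] by simp
  qed
  then have "G t \<le> 1" by (rule field_le_epsilon)
  then show ?thesis using le_G by (simp add: R_def Q_def a_def)
qed
section \<open>Integrals of powers of Bessel functions\<close>

lemma sin_ge_linear:
  fixes x :: real assumes "0 \<le> x" "x \<le> pi / 2" shows "2 / pi * x \<le> sin x"
proof -
  have "concave_on {0..pi} (sin :: real \<Rightarrow> real)"
    unfolding concave_on_def
    by (rule f''_ge0_imp_convex[where f' = "\<lambda>x. - cos x" and f'' = sin])
      (auto intro!: derivative_eq_intros sin_ge_zero)
  then have "sin ((1 - 2 * x / pi) *\<^sub>R 0 + (2 * x / pi) *\<^sub>R (pi / 2)) \<ge> (1 - 2 * x / pi) * sin 0 + (2 * x / pi) * sin (pi / 2)"
    using assms by (intro concave_onD) (auto simp: field_simps)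
  then show ?thesis by simp
qed

lemma cos_le_quadratic:
  fixes x :: real assumes "0 \<le> x" "x \<le> pi" shows "cos x \<le> 1 - 2 * x\<^sup>2 / pi\<^sup>2"
proof -
  have "(2 / pi * (x / 2))\<^sup>2 \<le> (sin (x / 2))\<^sup>2"
    using assms by (intro power_mono sin_ge_linear) auto
  then show ?thesis using cos_double_sin[of "x / 2"] by (simp add: power_divide)
qed

text \<open>The Airy zone around the turning point has width y = m^(1/3), and J_m has size 1/y
  there. With an angle a of order 1/y, the gain t (1 - cos a) outweighs the excess t - m <= y by a
  multiple of y.\<close>

lemma bessel_j_transition:
  fixes m :: nat and y :: real
  assumes m: "real m = y ^ 3" and y: "1 \<le> y" and t: "0 \<le> t" "t \<le> real m + y"
  shows "\<bar>bessel_j (int m) t\<bar> \<le> 8 / (5 * y)"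
proof (cases "y \<le> 8/5")
  case True
  then have "1 \<le> 8 / (5 * y)" using y by (simp add: field_simps)
  then show ?thesis using bessel_j_abs_le_1[of "int m" t] by linarith
next
  case False
  \<comment> \<open>For this angle 2 a^2 / pi^2 is at least 2.92 / y^2, so the phase derivative at a
    is at least 1.9 y; the bound then closes because 3.8 + 2 / 1.9 < 8 pi / 5. The assumption y >
    8/5 keeps a below pi.\<close>
  define a where "a = 19 / (5 * y)"
  have pi: "3.14 < pi" "pi < 3.1416" using pi_approx by auto
  have y2: "64 / 25 < y\<^sup>2" using False power_strict_mono[of "8/5" y 2] by (simp add: power2_eq_square)
  have "a \<le> 19 / 8" using False by (simp add: a_def field_simps)
  then have a: "0 \<le> a" "a < pi" using pi y by (auto simp: a_def)
  have key: "1.9 * y \<le> real m - t * cos a"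
  proof (cases "cos a \<le> 0")
    case True
    then have "t * cos a \<le> 0" using t by (simp add: mult_nonneg_nonpos)
    moreover have "1.9 * y \<le> y\<^sup>2 * y" using y2 y by (intro mult_right_mono) auto
    ultimately show ?thesis by (simp add: m power3_eq_cube power2_eq_square)
  next
    case False
    have "pi\<^sup>2 \<le> 3.1416\<^sup>2" using pi by (intro power_mono) auto
    then have "2.92 / y\<^sup>2 \<le> 2 * a\<^sup>2 / pi\<^sup>2"
      using y by (simp add: a_def field_simps)
    then have c: "cos a \<le> 1 - 2.92 / y\<^sup>2" using cos_le_quadratic[of a] a by linarith
    have "t * cos a \<le> (y ^ 3 + y) * cos a" using t False by (intro mult_right_mono) (auto simp: m)
    also have "\<dots> \<le> (y ^ 3 + y) * (1 - 2.92 / y\<^sup>2)" using c y by (intro mult_left_mono) auto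
    also have "\<dots> = y ^ 3 - 1.92 * y - 2.92 / y" using y by (simp add: field_simps eval_nat_numeral)
    also have "\<dots> \<le> y ^ 3 - 1.9 * y"
    proof -
      have "0 \<le> 2.92 / y" using y by simp
      moreover have "192 / 10\<^sup>2 * y \<ge> 19 / 10 * y" using y by simp
      ultimately show ?thesis by linarith
    qed
    finally show ?thesis using m by simp
  qed
  have "\<bar>bessel_j (int m) t\<bar> \<le> (a + 2 / (real m - t * cos a)) / pi"
    using bessel_j_near_turning[of a t "int m"] a t key y by simp
  also have "\<dots> \<le> (a + 2 / (1.9 * y)) / pi"
    using key y by (intro divide_right_mono add_left_mono divide_left_mono mult_pos_pos) auto
  also have "\<dots> = (3.8 + 2 / 1.9) / y / pi" using y by (simp add: a_def field_simps)
  also have "\<dots> \<le> (8 / 5 * pi) / y / pi"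
    using pi y by (intro divide_right_mono) auto
  also have "\<dots> = 8 / (5 * y)" by simp
  finally show ?thesis .
qed

section \<open>Time integrals of third and fourth powers\<close>

lemma nn_integral_Icc_le:
  fixes f g F :: "real \<Rightarrow> real"
  assumes "g \<in> borel_measurable borel" "a \<le> b"
    and "\<And>x. a \<le> x \<Longrightarrow> x \<le> b \<Longrightarrow> (F has_real_derivative g x) (at x)"
    and "\<And>x. a \<le> x \<Longrightarrow> x \<le> b \<Longrightarrow> 0 \<le> f x \<and> f x \<le> g x"
    and "F b - F a \<le> c"
  shows "(\<integral>\<^sup>+x. ennreal (f x) * indicator {a..b} x \<partial>lborel) \<le> ennreal c"
proof -
  have "(\<integral>\<^sup>+x. ennreal (f x) * indicator {a..b} x \<partial>lborel) \<le> (\<integral>\<^sup>+x. ennreal (g x) * indicator {a..b} x \<partial>lborel)"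
    using assms(4) by (intro nn_integral_mono) (auto split: split_indicator intro!: ennreal_leI)
  also have "\<dots> = F b - F a" using assms(1-4) by (intro nn_integral_FTC_Icc) (auto intro: order_trans)
  also have "\<dots> \<le> ennreal c" using assms(5) by (rule ennreal_leI)
  finally show ?thesis .
qed

lemma nn_integral_atLeast_le:
  fixes f g F :: "real \<Rightarrow> real"
  assumes "g \<in> borel_measurable borel"
    and "\<And>x. a \<le> x \<Longrightarrow> (F has_real_derivative g x) (at x)"
    and "\<And>x. a \<le> x \<Longrightarrow> 0 \<le> f x \<and> f x \<le> g x"
    and "(F \<longlongrightarrow> T) at_top" and "T - F a \<le> c"
  shows "(\<integral>\<^sup>+x. ennreal (f x) * indicator {a..} x \<partial>lborel) \<le> ennreal c"
proof -
  have "(\<integral>\<^sup>+x. ennreal (f x) * indicator {a..} x \<partial>lborel) \<le> (\<integral>\<^sup>+x. ennreal (g x) * indicator {a..} x \<partial>lborel)"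
    using assms(3) by (intro nn_integral_mono) (auto split: split_indicator intro!: ennreal_leI)
  also have "\<dots> = T - F a" using assms(1-4) by (intro nn_integral_FTC_atLeast) (auto intro: order_trans)
  also have "\<dots> \<le> ennreal c" using assms(5) by (rule ennreal_leI)
  finally show ?thesis .
qed

lemma DERIV_inverse_power_minus:
  fixes k t :: real assumes "k - t \<noteq> 0"
  shows "((\<lambda>t. 1 / (k - t) ^ Suc n) has_real_derivative real (Suc n) / (k - t) ^ Suc (Suc n)) (at t)"
proof -
  have "((\<lambda>t. inverse (k - t)) has_real_derivative (inverse (k - t))\<^sup>2) (at t)"
    using assms by (auto intro!: derivative_eq_intros simp: power2_eq_square)
  from DERIV_power_Suc[OF this, of n]
  show ?thesis by (simp add: field_simps power2_eq_square)
qed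

lemma DERIV_inverse_power_minus':
  fixes k t c q :: real assumes "k - t \<noteq> 0" "0 < N" "q = real N * c" "c \<noteq> 0"
  shows "((\<lambda>t. 1 / (q * (k - t) ^ N)) has_real_derivative 1 / (c * (k - t) ^ (N + 1))) (at t)"
proof -
  obtain n where n: "N = Suc n" using assms(2) gr0_conv_Suc by auto
  show ?thesis using DERIV_cdivide[OF DERIV_inverse_power_minus[OF assms(1), of n], of q] assms
    by (simp add: n mult_ac del: of_nat_Suc power_Suc)
qed

lemma nn_integral_split4:
  fixes f :: "real \<Rightarrow> ennreal"
  assumes [measurable]: "f \<in> borel_measurable borel"
  shows "(\<integral>\<^sup>+x. f x * indicator {0..} x \<partial>lborel) \<le>
    (\<integral>\<^sup>+x. f x * indicator {0..a} x \<partial>lborel) + (\<integral>\<^sup>+x. f x * indicator {a..b} x \<partial>lborel) +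
    (\<integral>\<^sup>+x. f x * indicator {b..c} x \<partial>lborel) + (\<integral>\<^sup>+x. f x * indicator {c..} x \<partial>lborel)"
proof -
  have "(\<integral>\<^sup>+x. f x * indicator {0..} x \<partial>lborel) \<le>
    (\<integral>\<^sup>+x. f x * indicator {0..a} x + f x * indicator {a..b} x + f x * indicator {b..c} x + f x * indicator {c..} x \<partial>lborel)"
    by (intro nn_integral_mono) (auto split: split_indicator intro: le_cases)
  then show ?thesis by (simp add: nn_integral_add)
qed

text \<open>For t >= 2 m the root of t^2 - m^2 is at least 3 t / 4, since 9/16 <= 1 - 1/4.\<close>

lemma bessel_j_sq_far:
  fixes m :: nat
  assumes "2 * real m \<le> t" "0 < t"
  shows "(bessel_j (int m) t)\<^sup>2 \<le> 4 / (3 * t)"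
proof -
  have "4 * (real m)\<^sup>2 \<le> t\<^sup>2" using assms power_mono[of "2 * real m" t 2] by (simp add: power_mult_distrib)
  moreover have "(3 / 4 * t)\<^sup>2 \<le> 3 / 4 * t\<^sup>2" by (simp add: power2_eq_square)
  ultimately have "3 / 4 * t \<le> sqrt (t\<^sup>2 - (real m)\<^sup>2)" by (intro real_le_rsqrt) linarith
  then have "3 / 4 * t * (bessel_j (int m) t)\<^sup>2 \<le> sqrt (t\<^sup>2 - (real m)\<^sup>2) * (bessel_j (int m) t)\<^sup>2"
    by (rule mult_right_mono) simp
  also have "\<dots> \<le> 1" using assms by (intro bessel_j_above_turning) linarith
  finally show ?thesis using assms by (simp add: field_simps)
qed

lemma bessel_j_measurable [measurable]: "bessel_j n \<in> borel_measurable borel"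
  by (intro borel_measurable_continuous_onI continuous_intros)

lemma cube_root_exists:
  assumes "1 \<le> m" obtains y :: real where "real m = y ^ 3" "1 \<le> y"
  using assms by (intro that[of "root 3 (real m)"]) (auto simp: real_root_pow_pos2)

text \<open>Four regimes: below the turning point, the transition zone, from there to 2 m, and
  beyond. All are O(1/m) except the third, where J^4 <= 1 / (2 m (t - m)) produces the logarithm.
  The transition zone contributes 2 (8/5)^4, most of the constant 15.\<close>

lemma bessel_j_fourth_integral:
  assumes "1 \<le> m"
  shows "(\<integral>\<^sup>+t. ennreal (\<bar>bessel_j (int m) t\<bar> ^ 4) * indicator {0..} t \<partial>lborel) \<le> ennreal ((15 + ln (real m)) / real m)"
proof -
  obtain y where y: "real m = y ^ 3" "1 \<le> y" using cube_root_exists[OF assms] .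
  let ?f = "\<lambda>t. \<bar>bessel_j (int m) t\<bar> ^ 4"
  have m: "real m \<ge> 1" "y \<le> real m" using assms y self_le_power[of y 3] by auto
  have y3: "y ^ 3 = y * y\<^sup>2" by (simp add: power3_eq_cube power2_eq_square)
  have i1: "(\<integral>\<^sup>+t. ennreal (?f t) * indicator {0..real m - y} t \<partial>lborel) \<le> ennreal (1 / (3 * 81 * y ^ 3))"
  proof (rule nn_integral_Icc_le[where g = "\<lambda>t. 1 / (81 * (real m - t) ^ 4)" and F = "\<lambda>t. 1 / (3 * 81 * (real m - t) ^ 3)"])
    fix t assume t: "0 \<le> t" "t \<le> real m - y"
    then have p: "real m - t > 0" using y by simp
    show "((\<lambda>t. 1 / (3 * 81 * (real m - t) ^ 3)) has_real_derivative 1 / (81 * (real m - t) ^ 4)) (at t)"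
      using DERIV_inverse_power_minus'[of "real m" t 3 "3 * 81" 81] p by simp
    have "\<bar>bessel_j (int m) t\<bar> \<le> 1 / (pi * (real m - t))" using bessel_j_below_turning[of t "int m"] t p by simp
    also have "\<dots> \<le> 1 / (3 * (real m - t))" using p pi_gt3 by (intro divide_left_mono mult_right_mono) auto
    finally have "?f t \<le> (1 / (3 * (real m - t))) ^ 4" by (intro power_mono) auto
    also have "(1 / (3 * (real m - t))) ^ 4 = 1 / (81 * (real m - t) ^ 4)"
      by (simp only: power_divide power_mult_distrib power_one) simp
    finally show "0 \<le> ?f t \<and> ?f t \<le> 1 / (81 * (real m - t) ^ 4)" by simp
  qed (use m y in auto)
  have i2: "(\<integral>\<^sup>+t. ennreal (?f t) * indicator {real m - y..real m + y} t \<partial>lborel) \<le> ennreal ((8/5)^4 * 2 / y ^ 3)"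
  proof (rule nn_integral_Icc_le[where g = "\<lambda>t. (8 / (5 * y)) ^ 4" and F = "\<lambda>t. (8 / (5 * y)) ^ 4 * t"])
    fix t assume t: "real m - y \<le> t" "t \<le> real m + y"
    show "((\<lambda>t. (8 / (5 * y)) ^ 4 * t) has_real_derivative (8 / (5 * y)) ^ 4) (at t)"
      by (auto intro!: derivative_eq_intros)
    have "\<bar>bessel_j (int m) t\<bar> \<le> 8 / (5 * y)" using bessel_j_transition[OF y] t m by simp
    then have "?f t \<le> (8 / (5 * y)) ^ 4" by (intro power_mono) auto
    then show "0 \<le> ?f t \<and> ?f t \<le> (8 / (5 * y)) ^ 4" by simp
  next
    show "(8 / (5 * y)) ^ 4 * (real m + y) - (8 / (5 * y)) ^ 4 * (real m - y) \<le> (8/5)^4 * 2 / y ^ 3"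
      using y by (simp add: field_simps eval_nat_numeral)
  qed (use y in auto)
  have i3: "(\<integral>\<^sup>+t. ennreal (?f t) * indicator {real m + y..2 * real m} t \<partial>lborel) \<le> ennreal (ln (real m) / real m)"
  proof (rule nn_integral_Icc_le[where g = "\<lambda>t. 1 / (2 * real m * (t - real m))" and F = "\<lambda>t. ln (t - real m) / (2 * real m)"])
    fix t assume t: "real m + y \<le> t" "t \<le> 2 * real m"
    then have p: "t - real m > 0" using y by simp
    show "((\<lambda>t. ln (t - real m) / (2 * real m)) has_real_derivative 1 / (2 * real m * (t - real m))) (at t)"
      using p m by (auto intro!: derivative_eq_intros simp: field_simps)
    have Q: "2 * real m * (t - real m) \<le> t\<^sup>2 - (real m)\<^sup>2"
      using mult_right_mono[of "2 * real m" "t + real m" "t - real m"] p by (simp add: power2_eq_square algebra_simps)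
    have Qpos: "0 < 2 * real m * (t - real m)" using p m by simp
    have "(sqrt (t\<^sup>2 - (real m)\<^sup>2) * (bessel_j (int m) t)\<^sup>2)\<^sup>2 \<le> 1\<^sup>2"
      using p Q Qpos by (intro power_mono bessel_j_above_turning) auto
    then have "(t\<^sup>2 - (real m)\<^sup>2) * ?f t \<le> 1" using Q Qpos
      by (simp add: power_mult_distrib flip: power_mult)
    then have "2 * real m * (t - real m) * ?f t \<le> 1" using mult_right_mono[OF Q, of "?f t"] by simp
    then show "0 \<le> ?f t \<and> ?f t \<le> 1 / (2 * real m * (t - real m))" using Qpos by (simp add: pos_le_divide_eq mult.commute)
  next
    have "ln (real m) / (2 * real m) - ln y / (2 * real m) \<le> ln (real m) / (2 * real m)" using y m by simp
    also have "\<dots> \<le> ln (real m) / real m" using m by (intro divide_left_mono) auto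
    finally show "ln (2 * real m - real m) / (2 * real m) - ln (real m + y - real m) / (2 * real m) \<le> ln (real m) / real m" by simp
  qed (use y m in auto)
  have i4: "(\<integral>\<^sup>+t. ennreal (?f t) * indicator {2 * real m..} t \<partial>lborel) \<le> ennreal ((8/9) / real m)"
  proof (rule nn_integral_atLeast_le[where g = "\<lambda>t. (16/9) / t\<^sup>2" and F = "\<lambda>t. - (16/9) / t" and T = 0])
    fix t assume t: "2 * real m \<le> t"
    then have p: "t > 0" using m by simp
    show "((\<lambda>t. - (16/9) / t) has_real_derivative (16/9) / t\<^sup>2) (at t)"
      using p by (auto intro!: derivative_eq_intros simp: power2_eq_square)
    have "((bessel_j (int m) t)\<^sup>2)\<^sup>2 \<le> (4 / (3 * t))\<^sup>2" using bessel_j_sq_far[OF t p] by (intro power_mono) auto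
    then show "0 \<le> ?f t \<and> ?f t \<le> (16/9) / t\<^sup>2" by (simp add: power_divide power_mult_distrib flip: power_mult)
  next
    show "((\<lambda>t::real. - (16/9) / t) \<longlongrightarrow> 0) at_top" by real_asymp
  qed (use m in auto)
  have "(\<integral>\<^sup>+t. ennreal (?f t) * indicator {0..} t \<partial>lborel) \<le>
     ennreal (1 / (3 * 81 * y ^ 3)) + ennreal ((8/5)^4 * 2 / y ^ 3) + ennreal (ln (real m) / real m) + ennreal ((8/9) / real m)"
    by (rule order_trans[OF nn_integral_split4[where a = "real m - y" and b = "real m + y" and c = "2 * real m"]
        add_mono[OF add_mono[OF add_mono[OF i1 i2] i3] i4]]) measurable
  also have "\<dots> = ennreal (1 / (3 * 81 * y ^ 3) + (8/5)^4 * 2 / y ^ 3 + ln (real m) / real m + (8/9) / real m)"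
    using y m by (simp flip: ennreal_plus)
  also have "\<dots> \<le> ennreal ((15 + ln (real m)) / real m)"
    using m unfolding y(1)[symmetric] by (intro ennreal_leI) (simp add: field_simps)
  finally show ?thesis .
qed

text \<open>The regimes are those of the fourth power, but the singularity (t - m)^(-3/4) above the
  turning point is integrable, so no logarithm appears. The first two regimes add up to at most 9,
  the others are 4 and 3; the total 16 is the value of \<open>const_C0\<close> in dimension
  3.\<close>

lemma bessel_j_cube_integral:
  assumes "1 \<le> m"
  shows "(\<integral>\<^sup>+t. ennreal (\<bar>bessel_j (int m) t\<bar> ^ 3) * indicator {0..} t \<partial>lborel) \<le> ennreal (16 / sqrt (real m))"
proof -
  obtain y where y: "real m = y ^ 3" "1 \<le> y" using cube_root_exists[OF assms] .
  let ?f = "\<lambda>t. \<bar>bessel_j (int m) t\<bar> ^ 3"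
  have m: "real m \<ge> 1" "y \<le> real m" using assms y self_le_power[of y 3] by auto
  have cube: "\<bar>b\<bar> ^ 3 \<le> c powr (3/2)" if "b\<^sup>2 \<le> c" for b c :: real
  proof -
    have "\<bar>b\<bar> ^ 3 = (b\<^sup>2) powr (3/2)"
    proof (cases "b = 0")
      case False
      then have "(b\<^sup>2) powr (3/2) = (\<bar>b\<bar> powr 2) powr (3/2)" by (simp add: powr_numeral)
      also have "\<dots> = \<bar>b\<bar> powr 3" by (simp only: powr_powr) simp
      also have "\<dots> = \<bar>b\<bar> ^ 3" using False by (subst powr_numeral) auto
      finally show ?thesis by simp
    qed simp
    then show ?thesis using that by (auto intro: powr_mono2)
  qed
  have sm: "sqrt (real m) = real m powr (1/2)" using m by (simp add: powr_half_sqrt)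
  have y2: "1 / y\<^sup>2 \<le> 1 / sqrt (real m)"
  proof -
    have "sqrt (real m) \<le> y\<^sup>2"
      by (rule real_le_lsqrt) (use power_increasing[of 3 4 y] y in \<open>auto simp flip: power_mult\<close>)
    then show ?thesis using m y by (intro divide_left_mono) auto
  qed
  have i1: "(\<integral>\<^sup>+t. ennreal (?f t) * indicator {0..real m - y} t \<partial>lborel) \<le> ennreal (1 / (2 * 27 * y ^ 2))"
  proof (rule nn_integral_Icc_le[where g = "\<lambda>t. 1 / (27 * (real m - t) ^ 3)" and F = "\<lambda>t. 1 / (2 * 27 * (real m - t) ^ 2)"])
    fix t assume t: "0 \<le> t" "t \<le> real m - y"
    then have p: "real m - t > 0" using y by simp
    show "((\<lambda>t. 1 / (2 * 27 * (real m - t) ^ 2)) has_real_derivative 1 / (27 * (real m - t) ^ 3)) (at t)"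
      using DERIV_inverse_power_minus'[of "real m" t 2 "2 * 27" 27] p by simp
    have "\<bar>bessel_j (int m) t\<bar> \<le> 1 / (pi * (real m - t))" using bessel_j_below_turning[of t "int m"] t p by simp
    also have "\<dots> \<le> 1 / (3 * (real m - t))" using p pi_gt3 by (intro divide_left_mono mult_right_mono) auto
    finally have "?f t \<le> (1 / (3 * (real m - t))) ^ 3" by (intro power_mono) auto
    also have "(1 / (3 * (real m - t))) ^ 3 = 1 / (27 * (real m - t) ^ 3)"
      by (simp only: power_divide power_mult_distrib power_one) simp
    finally show "0 \<le> ?f t \<and> ?f t \<le> 1 / (27 * (real m - t) ^ 3)" by simp
  qed (use m y in auto)
  have i2: "(\<integral>\<^sup>+t. ennreal (?f t) * indicator {real m - y..real m + y} t \<partial>lborel) \<le> ennreal ((8/5)^3 * 2 / y ^ 2)"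
  proof (rule nn_integral_Icc_le[where g = "\<lambda>t. (8 / (5 * y)) ^ 3" and F = "\<lambda>t. (8 / (5 * y)) ^ 3 * t"])
    fix t assume t: "real m - y \<le> t" "t \<le> real m + y"
    show "((\<lambda>t. (8 / (5 * y)) ^ 3 * t) has_real_derivative (8 / (5 * y)) ^ 3) (at t)"
      by (auto intro!: derivative_eq_intros)
    have "\<bar>bessel_j (int m) t\<bar> \<le> 8 / (5 * y)" using bessel_j_transition[OF y] t m by simp
    then show "0 \<le> ?f t \<and> ?f t \<le> (8 / (5 * y)) ^ 3" by (auto intro: power_mono)
  next
    show "(8 / (5 * y)) ^ 3 * (real m + y) - (8 / (5 * y)) ^ 3 * (real m - y) \<le> (8/5)^3 * 2 / y ^ 2"
      using y by (simp add: field_simps eval_nat_numeral)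
  qed (use y in auto)
  have i3: "(\<integral>\<^sup>+t. ennreal (?f t) * indicator {real m + y..2 * real m} t \<partial>lborel) \<le> ennreal (4 / sqrt (real m))"
  proof (rule nn_integral_Icc_le[where g = "\<lambda>t. (real m * (t - real m)) powr (-3/4)"
        and F = "\<lambda>t. 4 / real m * (real m * (t - real m)) powr (1/4)"])
    fix t assume t: "real m + y \<le> t" "t \<le> 2 * real m"
    then have p: "t - real m > 0" using y by simp
    show "((\<lambda>t. 4 / real m * (real m * (t - real m)) powr (1/4)) has_real_derivative (real m * (t - real m)) powr (-3/4)) (at t)"
      using p m by (auto intro!: derivative_eq_intros simp: field_simps)
    have Q: "real m * (t - real m) \<le> t\<^sup>2 - (real m)\<^sup>2"
      using mult_right_mono[of "real m" "t + real m" "t - real m"] p m by (simp add: power2_eq_square algebra_simps)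
    have Qpos: "0 < real m * (t - real m)" using p m by simp
    have "sqrt (real m * (t - real m)) * (bessel_j (int m) t)\<^sup>2 \<le> sqrt (t\<^sup>2 - (real m)\<^sup>2) * (bessel_j (int m) t)\<^sup>2"
      using Q by (intro mult_right_mono) auto
    also have "\<dots> \<le> 1" using p by (intro bessel_j_above_turning) auto
    finally have "(bessel_j (int m) t)\<^sup>2 \<le> 1 / sqrt (real m * (t - real m))"
      using Qpos by (simp add: pos_le_divide_eq mult.commute)
    also have "\<dots> = (real m * (t - real m)) powr (-1/2)"
      using Qpos by (simp add: powr_minus_divide powr_half_sqrt[symmetric])
    finally have "?f t \<le> (real m * (t - real m)) powr (-1/2 * (3/2))" unfolding powr_powr[symmetric] by (rule cube)
    then show "0 \<le> ?f t \<and> ?f t \<le> (real m * (t - real m)) powr (-3/4)" by simp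
  next
    have "4 / real m * (real m * real m) powr (1/4) - 4 / real m * (real m * y) powr (1/4) \<le> 4 / real m * (real m * real m) powr (1/4)" using m by simp
    also have "4 / real m * (real m * real m) powr (1/4) = 4 / sqrt (real m)"
    proof -
      have "(real m * real m) powr (1/4) = sqrt (real m)"
        using m by (simp add: powr_mult flip: powr_add powr_half_sqrt)
      then show ?thesis using m by (simp add: field_simps)
    qed
    finally have "4 / real m * (real m * real m) powr (1/4) - 4 / real m * (real m * y) powr (1/4) \<le> 4 / sqrt (real m)" .
    moreover have "2 * real m - real m = real m" "real m + y - real m = y" by auto
    ultimately show "4 / real m * (real m * (2 * real m - real m)) powr (1/4) - 4 / real m * (real m * (real m + y - real m)) powr (1/4) \<le> 4 / sqrt (real m)"
      by (simp only:)
  qed (use y m in auto)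
  have i4: "(\<integral>\<^sup>+t. ennreal (?f t) * indicator {2 * real m..} t \<partial>lborel) \<le> ennreal (3 / sqrt (real m))"
  proof (rule nn_integral_atLeast_le[where g = "\<lambda>t. (3 / 4 * t) powr (-3/2)" and F = "\<lambda>t. - (8/3) * (3 / 4 * t) powr (-1/2)" and T = 0])
    fix t assume t: "2 * real m \<le> t"
    then have p: "t > 0" using m by simp
    show "((\<lambda>t. - (8/3) * (3 / 4 * t) powr (-1/2)) has_real_derivative (3 / 4 * t) powr (-3/2)) (at t)"
      using p by (auto intro!: derivative_eq_intros)
    have "(bessel_j (int m) t)\<^sup>2 \<le> (3 / 4 * t) powr (- 1)"
      using bessel_j_sq_far[OF t p] p by (simp add: powr_minus_divide)
    from cube[OF this] have "?f t \<le> (3 / 4 * t) powr (- 1 * (3/2))" by (simp only: powr_powr)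
    then show "0 \<le> ?f t \<and> ?f t \<le> (3 / 4 * t) powr (-3/2)" by simp
  next
    show "((\<lambda>t::real. - (8/3) * (3 / 4 * t) powr (-1/2)) \<longlongrightarrow> 0) at_top" by real_asymp
    have "(3 / 4 * (2 * real m)) powr (-1/2) \<le> (real m) powr (-1/2)" using m by (intro powr_mono2') auto
    also have "\<dots> = 1 / sqrt (real m)" using m by (simp add: sm powr_minus_divide)
    finally have "(3 / 4 * (2 * real m)) powr (-1/2) \<le> 1 / sqrt (real m)" .
    moreover have "0 \<le> 1 / sqrt (real m)" "3 / sqrt (real m) = 3 * (1 / sqrt (real m))" by simp_all
    ultimately show "0 - - (8/3) * (3 / 4 * (2 * real m)) powr (-1/2) \<le> 3 / sqrt (real m)" by linarith
  qed auto
  have "(\<integral>\<^sup>+t. ennreal (?f t) * indicator {0..} t \<partial>lborel) \<le>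
     ennreal (1 / (2 * 27 * y ^ 2)) + ennreal ((8/5)^3 * 2 / y ^ 2) + ennreal (4 / sqrt (real m)) + ennreal (3 / sqrt (real m))"
    by (rule order_trans[OF nn_integral_split4[where a = "real m - y" and b = "real m + y" and c = "2 * real m"]
        add_mono[OF add_mono[OF add_mono[OF i1 i2] i3] i4]]) measurable
  also have "\<dots> = ennreal (1 / (2 * 27 * y ^ 2) + (8/5)^3 * 2 / y ^ 2 + 4 / sqrt (real m) + 3 / sqrt (real m))"
    using y m by (simp flip: ennreal_plus)
  also have "1 / (2 * 27 * y ^ 2) + (8/5)^3 * 2 / y ^ 2 + 4 / sqrt (real m) + 3 / sqrt (real m)
     = (1 / 54 + (8/5)^3 * 2) * (1 / y\<^sup>2) + 7 * (1 / sqrt (real m))" by (simp add: field_simps)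
  also have "\<dots> \<le> 9 * (1 / sqrt (real m)) + 7 * (1 / sqrt (real m))"
    using y2 by (intro add_right_mono mult_mono) (auto simp: field_simps)
  also have "\<dots> = 16 / sqrt (real m)" by simp
  finally show ?thesis by (simp add: ennreal_leI)
qed

lemma bessel_j_0_integrals:
  "(\<integral>\<^sup>+t. ennreal (\<bar>bessel_j 0 t\<bar> ^ 3) * indicator {0..} t \<partial>lborel) \<le> ennreal 16"
  "(\<integral>\<^sup>+t. ennreal (\<bar>bessel_j 0 t\<bar> ^ 4) * indicator {0..} t \<partial>lborel) \<le> ennreal 4"
proof -
  let ?J = "\<lambda>t. \<bar>bessel_j 0 t\<bar>"
  have unit: "(\<integral>\<^sup>+t. ennreal (?J t ^ k) * indicator {0..1} t \<partial>lborel) \<le> ennreal 1" for k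
    by (rule nn_integral_Icc_le[where g = "\<lambda>_. 1" and F = "\<lambda>t. t"])
      (auto intro!: derivative_eq_intros power_le_one bessel_j_abs_le_1)
  have split: "(\<integral>\<^sup>+t. ennreal (?J t ^ k) * indicator {0..} t \<partial>lborel) \<le>
     (\<integral>\<^sup>+t. ennreal (?J t ^ k) * indicator {0..1} t \<partial>lborel) + (\<integral>\<^sup>+t. ennreal (?J t ^ k) * indicator {1..} t \<partial>lborel)" for k
    by (subst nn_integral_add[symmetric]) (auto intro!: nn_integral_mono split: split_indicator)
  have sq: "(bessel_j 0 t)\<^sup>2 \<le> 1 / t" if "t \<ge> 1" for t
    using bessel_j_0_sq_le[of t] that by (simp add: field_simps)
  have b3: "?J t ^ 3 \<le> t powr (-3/2)" if "t \<ge> 1" for t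
  proof -
    have "?J t \<le> sqrt (1 / t)" using sq[OF that] by (metis real_sqrt_abs real_sqrt_le_iff)
    then have "?J t ^ 3 \<le> sqrt (1 / t) ^ 3" by (intro power_mono) auto
    also have "sqrt (1 / t) = t powr (-1/2)"
      using that by (simp add: powr_minus_divide real_sqrt_divide powr_half_sqrt[symmetric])
    also have "(t powr (-1/2)) ^ 3 = t powr (-3/2)" using that by (simp add: powr_powr flip: powr_numeral)
    finally show ?thesis .
  qed
  have i3: "(\<integral>\<^sup>+t. ennreal (?J t ^ 3) * indicator {1..} t \<partial>lborel) \<le> ennreal 2"
    by (rule nn_integral_atLeast_le[where g = "\<lambda>t. t powr (-3/2)" and F = "\<lambda>t. - 2 * t powr (-1/2)" and T = 0])
      (use b3 in \<open>auto intro!: derivative_eq_intros, real_asymp\<close>)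
  have i4: "(\<integral>\<^sup>+t. ennreal (?J t ^ 4) * indicator {1..} t \<partial>lborel) \<le> ennreal 1"
  proof (rule nn_integral_atLeast_le[where g = "\<lambda>t. 1 / t\<^sup>2" and F = "\<lambda>t. - 1 / t" and T = 0])
    fix t :: real assume t: "1 \<le> t"
    show "((\<lambda>t. - 1 / t) has_real_derivative 1 / t\<^sup>2) (at t)"
      using t by (auto intro!: derivative_eq_intros simp: power2_eq_square)
    have "((bessel_j 0 t)\<^sup>2)\<^sup>2 \<le> (1 / t)\<^sup>2" using sq[OF t] by (intro power_mono) auto
    then show "0 \<le> ?J t ^ 4 \<and> ?J t ^ 4 \<le> 1 / t\<^sup>2" by (simp add: power_divide flip: power_mult)
  next
    show "((\<lambda>t::real. - 1 / t) \<longlongrightarrow> 0) at_top" by real_asymp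
  qed auto
  have "(\<integral>\<^sup>+t. ennreal (?J t ^ 3) * indicator {0..} t \<partial>lborel) \<le> ennreal 1 + ennreal 2"
    by (rule order_trans[OF split add_mono[OF unit i3]])
  then show "(\<integral>\<^sup>+t. ennreal (?J t ^ 3) * indicator {0..} t \<partial>lborel) \<le> ennreal 16"
    by (rule order_trans) (simp flip: ennreal_plus)
  have "(\<integral>\<^sup>+t. ennreal (?J t ^ 4) * indicator {0..} t \<partial>lborel) \<le> ennreal 1 + ennreal 1"
    by (rule order_trans[OF split add_mono[OF unit i4]])
  then show "(\<integral>\<^sup>+t. ennreal (?J t ^ 4) * indicator {0..} t \<partial>lborel) \<le> ennreal 4"
    by (rule order_trans) (simp flip: ennreal_plus)
qed
section \<open>Fourth moments in the index\<close>

text \<open>F is an antiderivative on an interval that contains all shifted periods. Then F (pi + s)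
  - F (s - pi) has derivative f (pi + s) - f (s - pi) = 0 in s.\<close>

lemma integral_periodic_shift:
  fixes f :: "real \<Rightarrow> real"
  assumes f: "continuous_on UNIV f" and per: "\<And>x. f (x + 2 * pi) = f x"
  shows "integral {-pi..pi} (\<lambda>x. f (x + a)) = integral {-pi..pi} f"
proof -
  define b where "b = pi + \<bar>a\<bar> + 1"
  obtain F where F: "\<And>x. x \<in> {-b..b} \<Longrightarrow> (F has_vector_derivative f x) (at x within {-b..b})"
    using antiderivative_continuous[of "-b" b f] continuous_on_subset[OF f] by (metis subset_UNIV)
  have F': "(F has_real_derivative f x) (at x)" if "-b < x" "x < b" for x
  proof -
    have "(F has_vector_derivative f x) (at x within {-b<..<b})"
      using F[of x] that by (auto intro: has_vector_derivative_within_subset)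
    then show ?thesis using that
      by (simp add: has_real_derivative_iff_has_vector_derivative at_within_open[of _ "{-b<..<b}"])
  qed
  let ?S = "{- \<bar>a\<bar> - 1 <..< \<bar>a\<bar> + 1}"
  have "\<exists>c. \<forall>s\<in>?S. F (pi + s) - F (s - pi) = c"
  proof (rule has_field_derivative_zero_constant)
    fix s assume s: "s \<in> ?S"
    have "- b < pi + s" "pi + s < b" "- b < s - pi" "s - pi < b"
      using s pi_gt_zero unfolding b_def greaterThanLessThan_iff by linarith+
    then have "((\<lambda>s. F (pi + s) - F (s - pi)) has_real_derivative (f (pi + s) * 1 - f (s - pi) * 1)) (at s)"
      by (intro DERIV_diff DERIV_chain2[OF F'] derivative_eq_intros) auto
    moreover have "f (pi + s) = f (s - pi)" using per[of "s - pi"] by (simp add: add.commute)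
    ultimately show "((\<lambda>s. F (pi + s) - F (s - pi)) has_real_derivative 0) (at s within ?S)"
      by (simp add: has_field_derivative_at_within)
  qed auto
  then obtain c where c: "\<And>s. s \<in> ?S \<Longrightarrow> F (pi + s) - F (s - pi) = c" by blast
  have "a \<in> ?S" "0 \<in> ?S" by auto
  from this[THEN c] have eq: "F (pi + a) - F (a - pi) = F pi - F (- pi)" by simp
  have int: "((\<lambda>x. f (x + s)) has_integral (F (pi + s) - F (- pi + s))) {-pi..pi}" if "\<bar>s\<bar> \<le> \<bar>a\<bar>" for s
  proof (rule fundamental_theorem_of_calculus)
    fix x assume x: "x \<in> {-pi..pi}"
    have "((\<lambda>x. F (x + s)) has_real_derivative f (x + s) * 1) (at x)"
      by (intro DERIV_chain2[OF F'] derivative_eq_intros) (use x that in \<open>auto simp: b_def abs_if split: if_splits\<close>)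
    then show "((\<lambda>x. F (x + s)) has_vector_derivative f (x + s)) (at x within {-pi..pi})"
      by (simp add: has_real_derivative_iff_has_vector_derivative has_vector_derivative_at_within)
  qed auto
  show ?thesis using int[of a] int[of 0] eq by (simp add: integral_unique)
qed

lemma integral_even:
  fixes f :: "real \<Rightarrow> real"
  assumes "continuous_on UNIV f" "\<And>x. f (- x) = f x"
  shows "integral {-pi..pi} f = 2 * integral {0..pi} f"
proof -
  have "(f has_integral integral {0..pi} f) {0..pi}"
    using assms by (intro integrable_integral integrable_continuous_interval continuous_on_subset[OF assms(1)]) auto
  moreover from this have "(f has_integral integral {0..pi} f) {-pi..0}"
    using has_integral_reflect_real[where f = f and a = 0 and b = pi] assms(2) by simp
  ultimately have "(f has_integral (integral {0..pi} f + integral {0..pi} f)) {-pi..pi}"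
    by (intro has_integral_combine[where c = 0 and a = "-pi" and b = pi]) auto
  then show ?thesis by (simp add: integral_unique)
qed

lemma integral_odd:
  fixes f :: "real \<Rightarrow> real"
  assumes "continuous_on UNIV f" "\<And>x. f (- x) = - f x"
  shows "integral {-pi..pi} f = 0"
proof -
  have "(f has_integral integral {-pi..pi} f) {-pi..pi}"
    using assms by (intro integrable_integral integrable_continuous_interval continuous_on_subset[OF assms(1)]) auto
  then have "((\<lambda>x. - f x) has_integral integral {-pi..pi} f) {-pi..pi}"
    using has_integral_reflect_real[where f = f and a = "-pi" and b = pi] assms(2) by simp
  from integral_unique[OF this] show ?thesis by simp
qed

lemma bessel_j_0_even: "bessel_j 0 (- t) = bessel_j 0 t"
  by (simp add: bessel_j_def)

lemma integral_full_period:
  "integral {-pi..pi} (\<lambda>x. cos (of_int n * x - t * sin x)) = 2 * pi * bessel_j n t"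
  "integral {-pi..pi} (\<lambda>x. sin (of_int n * x - t * sin x)) = 0"
proof -
  have "integral {-pi..pi} (\<lambda>x. cos (of_int n * x - t * sin x)) = 2 * integral {0..pi} (\<lambda>x. cos (of_int n * x - t * sin x))"
  proof (rule integral_even)
    fix x show "cos (of_int n * (- x) - t * sin (- x)) = cos (of_int n * x - t * sin x)"
      using cos_minus[of "of_int n * x - t * sin x"] by (simp add: algebra_simps)
  qed (intro continuous_intros)
  then show "integral {-pi..pi} (\<lambda>x. cos (of_int n * x - t * sin x)) = 2 * pi * bessel_j n t"
    by (simp add: bessel_j_def)
  show "integral {-pi..pi} (\<lambda>x. sin (of_int n * x - t * sin x)) = 0"
  proof (rule integral_odd)
    fix x show "sin (of_int n * (- x) - t * sin (- x)) = - sin (of_int n * x - t * sin x)"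
      using sin_minus[of "of_int n * x - t * sin x"] by (simp add: algebra_simps)
  qed (intro continuous_intros)
qed

lemma cos_of_int_period: "cos (x + of_int n * (2 * pi)) = cos x"
  using cos_integer_2pi[of "of_int n"] sin_integer_2pi[of "of_int n"] by (simp add: cos_add mult_ac)

text \<open>Up to normalization J_n(t)^2 is a Fourier coefficient of the autocorrelation of exp (-i
  t sin x), and the formula for sin (h + x) - sin x identifies the autocorrelation at lag h as J_0
  (2 t sin (h/2)). Fourth moments in n thus become sums of squared Fourier coefficients.\<close>

lemma bessel_j_sq_has_integral:
  "((\<lambda>h. bessel_j 0 (2 * t * sin (h / 2)) * cos (of_int n * h)) has_integral (pi * (bessel_j n t)\<^sup>2)) {0..pi}"
proof -
  let ?p = "\<lambda>x. of_int n * x - t * sin x" and ?I = "{-pi..pi}"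
  let ?X = "\<lambda>h. 2 * t * sin (h / 2)"
  note [continuous_intros] = continuous_on_bessel_j
  have int: "f integrable_on ?I" if "continuous_on UNIV f" for f :: "real \<Rightarrow> real"
    using that by (intro integrable_continuous_interval) (rule continuous_on_subset, auto)
  \<comment> \<open>The sine integrals are 0; adding their product lets the product of cosines
    become the cosine of a difference.\<close>
  have "(2 * pi * bessel_j n t)\<^sup>2 = integral ?I (\<lambda>x. cos (?p x)) * integral ?I (\<lambda>y. cos (?p y)) +
       integral ?I (\<lambda>x. sin (?p x)) * integral ?I (\<lambda>y. sin (?p y))"
    by (simp add: integral_full_period power2_eq_square)
  also have "\<dots> = integral ?I (\<lambda>x. integral ?I (\<lambda>y. cos (?p x) * cos (?p y) + sin (?p x) * sin (?p y)))"
  proof -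
    have inner: "integral ?I (\<lambda>y. cos (?p x) * cos (?p y) + sin (?p x) * sin (?p y)) =
       cos (?p x) * integral ?I (\<lambda>y. cos (?p y)) + sin (?p x) * integral ?I (\<lambda>y. sin (?p y))" for x
      by (subst integral_add) (auto intro!: int continuous_intros)
    show ?thesis unfolding inner
      by (subst integral_add) (auto intro!: int continuous_intros)
  qed
  also have "\<dots> = integral ?I (\<lambda>x. integral ?I (\<lambda>h. cos (of_int n * h - t * (sin (h + x) - sin x))))"
  proof (rule integral_cong)
    fix x
    have "integral ?I (\<lambda>y. cos (?p x) * cos (?p y) + sin (?p x) * sin (?p y)) = integral ?I (\<lambda>y. cos (?p x - ?p y))"
      by (simp add: cos_diff)
    also have "\<dots> = integral ?I (\<lambda>h. cos (?p x - ?p (h + x)))"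
    proof (rule integral_periodic_shift[symmetric])
      fix y
      have "?p x - ?p (y + 2 * pi) = (?p x - ?p y) + of_int (- n) * (2 * pi)"
        by (simp only: sin_periodic) (simp add: algebra_simps)
      then show "cos (?p x - ?p (y + 2 * pi)) = cos (?p x - ?p y)" by (simp only: cos_of_int_period)
    qed (intro continuous_intros)
    also have "\<dots> = integral ?I (\<lambda>h. cos (of_int n * h - t * (sin (h + x) - sin x)))"
    proof (rule integral_cong)
      fix h show "cos (?p x - ?p (h + x)) = cos (of_int n * h - t * (sin (h + x) - sin x))"
        using cos_minus[of "?p x - ?p (h + x)"] by (simp add: algebra_simps)
    qed
    finally show "integral ?I (\<lambda>y. cos (?p x) * cos (?p y) + sin (?p x) * sin (?p y)) = integral ?I (\<lambda>h. cos (of_int n * h - t * (sin (h + x) - sin x)))" .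
  qed
  also have "\<dots> = integral ?I (\<lambda>h. integral ?I (\<lambda>x. cos (of_int n * h - t * (sin (h + x) - sin x))))"
  proof -
    have "continuous_on (cbox (-pi, -pi) (pi, pi)) (\<lambda>(x, h). cos (of_int n * h - t * (sin (h + x) - sin x)))"
      by (auto simp: case_prod_unfold intro!: continuous_intros)
    from integral_swap_continuous[OF this] show ?thesis by (simp add: cbox_interval)
  qed
  also have "\<dots> = integral ?I (\<lambda>h. 2 * pi * (bessel_j 0 (?X h) * cos (of_int n * h)))"
  proof (rule integral_cong)
    fix h
    let ?g = "\<lambda>u. cos (of_int n * h - ?X h * sin u)"
    have "sin (h + x) - sin x = 2 * sin (h / 2) * sin (x + (h / 2 + pi / 2))" for x
    proof -
      have "sin (h + x) - sin x = 2 * sin (h / 2) * cos (h / 2 + x)"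
        by (simp add: sin_diff_sin add_divide_distrib add.commute)
      also have "cos (h / 2 + x) = sin (x + (h / 2 + pi / 2))"
        by (subst add.commute) (simp only: add.assoc[symmetric] sin_add[of "x + h / 2"], simp)
      finally show ?thesis .
    qed
    then have "integral ?I (\<lambda>x. cos (of_int n * h - t * (sin (h + x) - sin x))) = integral ?I (\<lambda>x. ?g (x + (h / 2 + pi / 2)))"
      by (simp add: mult_ac)
    also have "\<dots> = integral ?I ?g"
      by (rule integral_periodic_shift) (auto intro!: continuous_intros)
    also have "\<dots> = integral ?I (\<lambda>u. cos (of_int n * h) * cos (of_int 0 * u - ?X h * sin u) - sin (of_int n * h) * sin (of_int 0 * u - ?X h * sin u))"
      by (simp add: cos_diff)
    also have "\<dots> = cos (of_int n * h) * integral ?I (\<lambda>u. cos (of_int 0 * u - ?X h * sin u)) - sin (of_int n * h) * integral ?I (\<lambda>u. sin (of_int 0 * u - ?X h * sin u))"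
      by (subst integral_diff) (auto intro!: int continuous_intros)
    also have "\<dots> = 2 * pi * (bessel_j 0 (?X h) * cos (of_int n * h))"
      unfolding integral_full_period by simp
    finally show "integral ?I (\<lambda>x. cos (of_int n * h - t * (sin (h + x) - sin x))) = 2 * pi * (bessel_j 0 (?X h) * cos (of_int n * h))" .
  qed
  also have "\<dots> = 2 * pi * integral ?I (\<lambda>h. bessel_j 0 (?X h) * cos (of_int n * h))" by simp
  also have "integral ?I (\<lambda>h. bessel_j 0 (?X h) * cos (of_int n * h)) = 2 * integral {0..pi} (\<lambda>h. bessel_j 0 (?X h) * cos (of_int n * h))"
    by (rule integral_even) (auto intro!: continuous_intros simp: bessel_j_0_even)
  finally have "integral {0..pi} (\<lambda>h. bessel_j 0 (?X h) * cos (of_int n * h)) = pi * (bessel_j n t)\<^sup>2"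
    by (simp add: power2_eq_square mult_ac)
  moreover have "(\<lambda>h. bessel_j 0 (?X h) * cos (of_int n * h)) integrable_on {0..pi}"
    by (intro integrable_continuous_interval continuous_intros) auto
  ultimately show ?thesis by (simp add: has_integral_integral)
qed

text \<open>For t > 0 this is the mean over 0 < h <= pi of the minimum of 1 and pi / (2 t h), a
  majorant of J_0 (2 t sin (h/2))^2.\<close>

definition bessel_fourth_bound :: "real \<Rightarrow> real"
  where "bessel_fourth_bound t = (if 2 * t < 1 then 1 else (1 + ln (2 * t)) / (2 * t))"

lemma bessel_fourth_bound_props: "0 < bessel_fourth_bound t" "bessel_fourth_bound t \<le> 1"
proof -
  have "0 < (1 + ln (2 * t)) / (2 * t)" "(1 + ln (2 * t)) / (2 * t) \<le> 1" if "1 \<le> 2 * t"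
  proof -
    have "0 \<le> ln (2 * t)" "ln (2 * t) \<le> 2 * t - 1" using that ln_le_minus_one[of "2 * t"] by auto
    then have "0 < 1 + ln (2 * t)" "1 + ln (2 * t) \<le> 2 * t" by linarith+
    then show "0 < (1 + ln (2 * t)) / (2 * t)" "(1 + ln (2 * t)) / (2 * t) \<le> 1" using that
      by (auto simp: divide_le_eq intro!: divide_pos_pos)
  qed
  then show "0 < bessel_fourth_bound t" "bessel_fourth_bound t \<le> 1" by (auto simp: bessel_fourth_bound_def)
qed

lemma bessel_fourth_bound_measurable [measurable]: "bessel_fourth_bound \<in> borel_measurable borel"
  unfolding bessel_fourth_bound_def[abs_def] by measurable

text \<open>\<open>bessel_inequality\<close> with zero phase, applied to the function in
  \<open>bessel_j_sq_has_integral\<close>. The cut \<open>x0\<close> is the point where pi / (2 t h)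
  falls below 1; for 2 t < 1 it lies beyond pi and the sum of squares is used instead.\<close>

lemma sum_bessel_j_fourth:
  assumes S: "finite S" and t: "0 \<le> t"
  shows "(\<Sum>n\<in>S. bessel_j n t ^ 4) \<le> bessel_fourth_bound t"
proof (cases "2 * t < 1")
  case True
  have "(\<Sum>n\<in>S. bessel_j n t ^ 4) \<le> (\<Sum>n\<in>S. (bessel_j n t)\<^sup>2)"
  proof (rule sum_mono)
    fix n
    have "(bessel_j n t)\<^sup>2 * (bessel_j n t)\<^sup>2 \<le> (bessel_j n t)\<^sup>2 * 1"
      using bessel_j_abs_le_1[of n t] by (intro mult_left_mono) (auto simp: abs_square_le_1)
    then show "bessel_j n t ^ 4 \<le> (bessel_j n t)\<^sup>2" by (simp flip: power_add)
  qed
  also have "\<dots> \<le> 1" by (rule sum_bessel_j_sq_le_1[OF S])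
  finally show ?thesis using True by (simp add: bessel_fourth_bound_def)
next
  case False
  then have t: "2 * t \<ge> 1" "t > 0" by auto
  define x0 where "x0 = pi / (2 * t)"
  have x0: "0 < x0" "x0 \<le> pi" using t by (auto simp: x0_def field_simps)
  let ?f = "\<lambda>h. (bessel_j 0 (2 * t * sin (h / 2)))\<^sup>2"
  have f: "?f integrable_on {a..b}" for a b
    by (intro integrable_continuous_interval continuous_intros continuous_on_bessel_j) auto
  have 1: "integral {0..x0} ?f \<le> x0"
  proof -
    have "integral {0..x0} ?f \<le> integral {0..x0} (\<lambda>_. 1)"
    proof (rule integral_le[OF f])
      show "?f h \<le> 1" for h using bessel_j_abs_le_1[of 0 "2 * t * sin (h / 2)"] by (simp add: abs_square_le_1)
    qed auto
    then show ?thesis using x0 by simp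
  qed
  have 2: "integral {x0..pi} ?f \<le> x0 * (ln pi - ln x0)"
  proof (rule has_integral_le[OF integrable_integral[OF f]])
    have "((\<lambda>h. x0 * (1 / h)) has_integral (x0 * ln pi - x0 * ln x0)) {x0..pi}"
      by (rule fundamental_theorem_of_calculus)
        (use x0 in \<open>auto intro!: derivative_eq_intros simp: has_real_derivative_iff_has_vector_derivative[symmetric]\<close>)
    then show "((\<lambda>h. x0 * (1 / h)) has_integral (x0 * (ln pi - ln x0))) {x0..pi}" by (simp add: right_diff_distrib)
    fix h assume h: "h \<in> {x0..pi}"
    have s: "h / pi \<le> sin (h / 2)" using sin_ge_linear[of "h / 2"] h x0 by simp
    have hp: "0 < h / pi" using h x0 by simp
    then have X: "0 < 2 * t * sin (h / 2)" using t s by simp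
    from bessel_j_0_sq_le[OF this] X have "?f h \<le> 1 / (2 * t * sin (h / 2))"
      by (simp only: pos_le_divide_eq mult.commute)
    also have "\<dots> \<le> 1 / (2 * t * (h / pi))" using t s hp
      by (intro divide_left_mono mult_left_mono mult_pos_pos) auto
    also have "\<dots> = x0 * (1 / h)" by (simp add: x0_def)
    finally show "?f h \<le> x0 * (1 / h)" .
  qed
  have R: "(?f has_integral (integral {0..x0} ?f + integral {x0..pi} ?f)) {0..pi}"
    using x0 f by (intro has_integral_combine[where c = x0]) (auto intro: integrable_integral)
  have "pi * (\<Sum>n\<in>S. ((bessel_j n t)\<^sup>2)\<^sup>2) \<le> integral {0..x0} ?f + integral {x0..pi} ?f"
    by (rule bessel_inequality[where \<psi> = "\<lambda>_. 0", OF _ R S]) (use bessel_j_sq_has_integral[of t] in simp)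
  also have "\<dots> \<le> x0 * (1 + (ln pi - ln x0))" using 1 2 by (simp add: distrib_left)
  also have "\<dots> = pi * ((1 + ln (2 * t)) / (2 * t))" using t by (simp add: x0_def ln_div)
  finally have "(\<Sum>n\<in>S. ((bessel_j n t)\<^sup>2)\<^sup>2) \<le> (1 + ln (2 * t)) / (2 * t)"
    by (subst (asm) mult_le_cancel_left_pos) auto
  then show ?thesis using False by (simp add: bessel_fourth_bound_def flip: power_mult)
qed

text \<open>This is 1 + u <= exp u at u = e ln (2 t) + e - 1, which yields the best constant in 1 +
  ln x <= c x^e.\<close>

lemma bessel_fourth_bound_le_powr:
  assumes t: "1 \<le> 2 * t" and e: "0 < e"
  shows "bessel_fourth_bound t \<le> exp (e - 1) / e * (2 * t) powr (e - 1)"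
proof -
  have "e * ln (2 * t) + e \<le> exp (e * ln (2 * t) + e - 1)"
    using exp_ge_add_one_self[of "e * ln (2 * t) + e - 1"] by simp
  also have "\<dots> = exp (e - 1) * (2 * t) powr e"
    using t by (simp add: powr_def flip: exp_add)
  finally have "(1 + ln (2 * t)) * e \<le> exp (e - 1) * (2 * t) powr e" by (simp add: algebra_simps)
  then have "1 + ln (2 * t) \<le> exp (e - 1) / e * (2 * t) powr e" using e by (simp add: pos_le_divide_eq)
  then have "(1 + ln (2 * t)) / (2 * t) \<le> exp (e - 1) / e * (2 * t) powr e / (2 * t)"
    using t by (intro divide_right_mono) auto
  also have "\<dots> = exp (e - 1) / e * (2 * t) powr (e - 1)" using t by (simp add: powr_diff)
  finally show ?thesis using t by (simp add: bessel_fourth_bound_def)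
qed

lemma bessel_fourth_bound_integral:
  assumes e: "0 < e" and k: "0 < k" "e < 1" "(1 - e) * k > 1"
  shows "(\<integral>\<^sup>+t. ennreal (bessel_fourth_bound t powr k) * indicator {0..} t \<partial>lborel)
    \<le> ennreal (1 / 2 + (exp (e - 1) / e) powr k / (2 * ((1 - e) * k - 1)))"
proof -
  let ?W = "\<lambda>t. bessel_fourth_bound t powr k"
  define C where "C = (exp (e - 1) / e) powr k"
  define q where "q = (1 - e) * k - 1"
  have q: "q > 0" using k by (simp add: q_def)
  have "(\<integral>\<^sup>+t. ennreal (?W t) * indicator {0..} t \<partial>lborel) \<le>
     (\<integral>\<^sup>+t. ennreal (?W t) * indicator {0..1/2} t \<partial>lborel) + (\<integral>\<^sup>+t. ennreal (?W t) * indicator {1/2..} t \<partial>lborel)"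
    by (subst nn_integral_add[symmetric]) (auto intro!: nn_integral_mono split: split_indicator)
  also have "(\<integral>\<^sup>+t. ennreal (?W t) * indicator {0..1/2} t \<partial>lborel) \<le> ennreal (1 / 2)"
  proof (rule nn_integral_Icc_le[where g = "\<lambda>_. 1" and F = "\<lambda>t. t"])
    fix t show "0 \<le> ?W t \<and> ?W t \<le> 1"
      using bessel_fourth_bound_props[of t] k powr_mono2[of k "bessel_fourth_bound t" 1] by simp
  qed (auto intro!: derivative_eq_intros)
  also have "(\<integral>\<^sup>+t. ennreal (?W t) * indicator {1/2..} t \<partial>lborel) \<le> ennreal (C / (2 * q))"
  proof (rule nn_integral_atLeast_le[where g = "\<lambda>t. C * (2 * t) powr (- q - 1)" and F = "\<lambda>t. - C / (2 * q) * (2 * t) powr (- q)" and T = 0])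
    fix t :: real assume t: "1 / 2 \<le> t"
    then have p: "t > 0" by simp
    show "((\<lambda>t. - C / (2 * q) * (2 * t) powr (- q)) has_real_derivative C * (2 * t) powr (- q - 1)) (at t)"
      using p q by (auto intro!: derivative_eq_intros simp: field_simps)
    have "?W t \<le> (exp (e - 1) / e * (2 * t) powr (e - 1)) powr k"
      using bessel_fourth_bound_le_powr[of t e] bessel_fourth_bound_props[of t] t e k by (intro powr_mono2) auto
    also have "\<dots> = C * (2 * t) powr ((e - 1) * k)"
      by (subst powr_mult) (use e p in \<open>auto simp: powr_powr C_def\<close>)
    also have "(e - 1) * k = - q - 1" by (simp add: q_def algebra_simps)
    finally show "0 \<le> ?W t \<and> ?W t \<le> C * (2 * t) powr (- q - 1)" by simp
  next
    have "((\<lambda>t. (2 * t) powr (- q)) \<longlongrightarrow> 0) at_top"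
      using q by (intro tendsto_neg_powr filterlim_tendsto_pos_mult_at_top[OF tendsto_const] filterlim_ident) auto
    from tendsto_mult_left[OF this, of "- C / (2 * q)"]
    show "((\<lambda>t. - C / (2 * q) * (2 * t) powr (- q)) \<longlongrightarrow> 0) at_top" by simp
  qed auto
  also have "ennreal (1 / 2) + ennreal (C / (2 * q)) = ennreal (1 / 2 + C / (2 * q))"
    using q by (intro ennreal_plus[symmetric]) (auto simp: C_def)
  finally show ?thesis by (simp add: add_mono C_def q_def)
qed

text \<open>Dimension 5 is closest to the critical exponent 1 and gets its own parameter 1/10. From
  dimension 6 on, the exponent 3/2 dominates, because the base is at most 1, and
  \<open>const_C0\<close> is bounded below by seven times the minimum of 2^x / x.\<close>

lemma bessel_fourth_bound_integral_dim:
  assumes "5 \<le> d"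
  shows "(\<integral>\<^sup>+t. ennreal (bessel_fourth_bound t powr (real d / 4)) * indicator {0..} t \<partial>lborel) \<le> ennreal (1 + const_C0 d)"
proof (cases "d = 5")
  case True
  have "(\<integral>\<^sup>+t. ennreal (bessel_fourth_bound t powr (real d / 4)) * indicator {0..} t \<partial>lborel)
     \<le> ennreal (1 / 2 + (exp (1/10 - 1) / (1/10)) powr (5/4) / (2 * ((1 - 1/10) * (5/4) - 1)))"
    using bessel_fourth_bound_integral[of "1/10" "5/4"] True by simp
  also have "1 / 2 + (exp (1/10 - 1) / (1/10)) powr (5/4) / (2 * ((1 - 1/10) * (5/4) - 1)) \<le> 1 + const_C0 d"
  proof -
    have "(exp (1/10 - 1) / (1/10)) powr (5/4) = 10 powr (5/4) * exp (- (9/8) :: real)"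
    proof -
      have "(exp (1/10 - 1) / (1/10)) powr (5/4) = (10 * exp (- (9/10))) powr (5/4 :: real)" by (simp add: mult.commute)
      also have "\<dots> = 10 powr (5/4) * exp (- (9/8) :: real)" by (simp only: powr_mult exp_powr_real) simp
      finally show ?thesis .
    qed
    also have "10 powr (5/4 :: real) = 10 * 10 powr (1/4)" using powr_add[of 10 1 "1/4::real"] by simp
    also have "10 powr (1/4 :: real) \<le> 9/5"
    proof -
      have "10 powr (1/4 :: real) \<le> ((9/5) powr 4) powr (1/4)" by (intro powr_mono2) (auto simp: power4_eq_xxxx)
      then show ?thesis by (simp only: powr_powr) simp
    qed
    also have "exp (- (9/8) :: real) \<le> 1 / (1 + 9/8 + (9/8)\<^sup>2 / 2)"
      using exp_lower_Taylor_quadratic[of "9/8::real"] by (simp add: exp_minus field_simps)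
    finally have "(exp (1/10 - 1) / (1/10)) powr (5/4) \<le> (10 * (9/5)) * (1 / (1 + 9/8 + (9/8)\<^sup>2 / 2) :: real)"
      by simp
    moreover have "59/50 \<le> 2 powr (1/4 :: real)"
    proof -
      have "((59/50) powr 4) powr (1/4) \<le> 2 powr (1/4 :: real)" by (intro powr_mono2) (auto simp: power4_eq_xxxx)
      then show ?thesis by (simp only: powr_powr) simp
    qed
    moreover have "2 powr (5/4 :: real) = 2 * 2 powr (1/4)" using powr_add[of 2 1 "1/4::real"] by simp
    ultimately show ?thesis using True by (simp add: const_C0_def power2_eq_square)
  qed
  finally show ?thesis by (simp add: ennreal_leI)
next
  case False
  then have d: "6 \<le> d" using assms by simp
  have "(\<integral>\<^sup>+t. ennreal (bessel_fourth_bound t powr (real d / 4)) * indicator {0..} t \<partial>lborel)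
     \<le> (\<integral>\<^sup>+t. ennreal (bessel_fourth_bound t powr (3/2)) * indicator {0..} t \<partial>lborel)"
    using bessel_fourth_bound_props d
    by (intro nn_integral_mono mult_right_mono ennreal_leI powr_mono') (auto intro: less_imp_le)
  also have "\<dots> \<le> ennreal (1 / 2 + (exp (1/6 - 1) / (1/6)) powr (3/2) / (2 * ((1 - 1/6) * (3/2) - 1)))"
    by (rule bessel_fourth_bound_integral) auto
  also have "1 / 2 + (exp (1/6 - 1) / (1/6)) powr (3/2) / (2 * ((1 - 1/6) * (3/2) - 1)) \<le> 1 + const_C0 d"
  proof -
    have "(exp (1/6 - 1) / (1/6)) powr (3/2) = 6 powr (3/2) * exp (- (5/4) :: real)"
    proof -
      have "(exp (1/6 - 1) / (1/6)) powr (3/2) = (6 * exp (- (5/6))) powr (3/2 :: real)" by (simp add: mult.commute)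
      also have "\<dots> = 6 powr (3/2) * exp (- (5/4) :: real)" by (simp only: powr_mult exp_powr_real) simp
      finally show ?thesis .
    qed
    also have "6 powr (3/2 :: real) \<le> 15"
    proof -
      have "6 powr (3/2 :: real) \<le> (15 powr (2/3)) powr (3/2)"
      proof (intro powr_mono2)
        have "(6 powr 3) powr (1/3) \<le> (15 powr 2) powr (1/3 :: real)" by (intro powr_mono2) auto
        then show "6 \<le> 15 powr (2/3 :: real)" by (simp only: powr_powr) simp
      qed auto
      then show ?thesis by (simp only: powr_powr) simp
    qed
    also have "exp (- (5/4) :: real) \<le> 1 / (1 + 5/4 + (5/4)\<^sup>2 / 2)"
      using exp_lower_Taylor_quadratic[of "5/4::real"] by (simp add: exp_minus field_simps)
    finally have 1: "(exp (1/6 - 1) / (1/6)) powr (3/2) \<le> 15 * (1 / (1 + 5/4 + (5/4)\<^sup>2 / 2) :: real)" by simp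
    define x where "x = (real d - 4) / 4"
    have x: "x > 0" using d by (simp add: x_def)
    \<comment> \<open>u <= exp (u - 1) at u = x ln 2 gives 2^x / x >= exp 1 * ln 2, which is the
      exact minimum.\<close>
    have "x * ln 2 \<le> exp (x * ln 2 - 1)" using exp_ge_add_one_self[of "x * ln 2 - 1"] by simp
    also have "\<dots> = 2 powr x / exp 1" by (simp add: powr_def exp_diff)
    finally have "x * ln 2 * exp 1 \<le> 2 powr x" by (simp add: field_simps)
    moreover have "x * (2/3) * (5/2) \<le> x * ln 2 * exp 1"
      using x exp_lower_Taylor_quadratic[of "1::real"] ln2_ge_two_thirds by (intro mult_mono mult_left_mono) auto
    ultimately have "5/3 * x \<le> 2 powr x" by simp
    then have "5/3 \<le> 2 powr x / x" using x by (simp add: pos_le_divide_eq)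
    moreover have "const_C0 d = 7 * (2 powr x / x)"
    proof -
      have "2 powr (real d / 4) = 2 powr (1 + x)" by (simp add: x_def diff_divide_distrib)
      also have "\<dots> = 2 * 2 powr x" by (simp add: powr_add)
      finally show ?thesis using d by (simp add: const_C0_def x_def)
    qed
    ultimately show ?thesis using 1 by (simp add: power2_eq_square)
  qed
  finally show ?thesis by (simp add: ennreal_leI)
qed
section \<open>Bounds for the kernel of the resolvent\<close>

text \<open>The majorant G of the overview, the time integral of the modulus of the propagator. It
  takes extended values because its finiteness is a later result,
  \<open>kernel_bound_finite\<close>, for dimension at least 3.\<close>

definition kernel_bound :: "int ^ 'd::finite \<Rightarrow> ennreal"
  where "kernel_bound n = (\<integral>\<^sup>+t. ennreal (\<Prod>i\<in>UNIV. \<bar>bessel_j (n $ i) t\<bar>) * indicator {0..} t \<partial>lborel)"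

text \<open>Hoelder's inequality with d factors: each factor is divided by the bound for its L^d
  norm, and the arithmetic-geometric mean replaces the product by an average of d-th powers, each of
  which integrates to at most 1.\<close>

lemma kernel_bound_hoelder:
  fixes n :: "int ^ 'd::finite" and a :: "nat \<Rightarrow> real"
  assumes a: "\<And>m. 0 < a m"
    and int: "\<And>m. (\<integral>\<^sup>+t. ennreal (\<bar>bessel_j (int m) t\<bar> ^ CARD('d)) * indicator {0..} t \<partial>lborel) \<le> ennreal (a m)"
  shows "kernel_bound n \<le> ennreal (\<Prod>i\<in>UNIV. a (nat \<bar>n $ i\<bar>) powr (1 / CARD('d)))"
proof -
  let ?d = "CARD('d)" and ?m = "\<lambda>i. nat \<bar>n $ i\<bar>"
  let ?J = "\<lambda>i t. \<bar>bessel_j (n $ i) t\<bar>" and ?b = "\<lambda>i. a (?m i) powr (1 / CARD('d))"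
  let ?B = "\<Prod>i\<in>UNIV. ?b i"
  have J: "?J i t = \<bar>bessel_j (int (?m i)) t\<bar>" for i t by (simp add: bessel_j_abs)
  have b: "?b i > 0" for i using a[of "?m i"] by simp
  have bd: "?b i ^ ?d = a (?m i)" for i
    using a[of "?m i"] by (simp add: powr_powr flip: powr_realpow)
  have pw: "(\<Prod>i\<in>UNIV. ?J i t) \<le> (\<Sum>i\<in>UNIV. ?B / (?d * a (?m i)) * ?J i t ^ ?d)" for t
  proof -
    let ?y = "\<lambda>i. ?J i t / ?b i"
    have "(\<Prod>i\<in>UNIV. ?y i ^ ?d) powr (1 / ?d) \<le> (\<Sum>i\<in>UNIV. ?y i ^ ?d / ?d)"
      using b by (intro arith_geom_mean) (auto intro: less_imp_le)
    moreover have "(\<Prod>i\<in>UNIV. ?y i ^ ?d) powr (1 / ?d) = (\<Prod>i\<in>UNIV. ?y i)"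
    proof -
      have "(\<Prod>i\<in>UNIV. ?y i ^ ?d) = (\<Prod>i\<in>UNIV. ?y i) ^ ?d" by (simp add: prod_power_distrib)
      moreover have "0 \<le> (\<Prod>i\<in>UNIV. ?y i)" using b by (intro prod_nonneg) (auto intro: less_imp_le)
      moreover have "(x ^ ?d) powr (1 / ?d) = x" if "0 \<le> x" for x :: real
        using that by (cases "x = 0") (simp_all add: powr_powr flip: powr_realpow)
      ultimately show ?thesis by simp
    qed
    ultimately have 1: "(\<Prod>i\<in>UNIV. ?y i) \<le> (\<Sum>i\<in>UNIV. ?y i ^ ?d / ?d)" by simp
    have "(\<Prod>i\<in>UNIV. ?J i t) = ?B * (\<Prod>i\<in>UNIV. ?y i)"
      using b by (simp add: prod_dividef less_imp_neq[OF b, symmetric])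
    also have "\<dots> \<le> ?B * (\<Sum>i\<in>UNIV. ?y i ^ ?d / ?d)"
      using b by (intro mult_left_mono[OF 1] prod_nonneg) (auto intro: less_imp_le)
    also have "\<dots> = (\<Sum>i\<in>UNIV. ?B / (?d * a (?m i)) * ?J i t ^ ?d)"
      by (simp add: sum_distrib_left power_divide bd mult_ac)
    finally show ?thesis .
  qed
  have B: "?B > 0" using b by (intro prod_pos) auto
  have c: "0 \<le> ?B / (?d * a (?m i))" for i
    using B a[of "?m i"] by (intro divide_nonneg_nonneg mult_nonneg_nonneg) (simp_all add: less_imp_le)
  have "kernel_bound n \<le> (\<integral>\<^sup>+t. (\<Sum>i\<in>UNIV. ennreal (?B / (?d * a (?m i))) * (ennreal (?J i t ^ ?d) * indicator {0..} t)) \<partial>lborel)"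
    unfolding kernel_bound_def
  proof (rule nn_integral_mono)
    fix t :: real
    have "ennreal (\<Prod>i\<in>UNIV. ?J i t) \<le> ennreal (\<Sum>i\<in>UNIV. ?B / (?d * a (?m i)) * ?J i t ^ ?d)"
      by (rule ennreal_leI[OF pw])
    also have "\<dots> = (\<Sum>i\<in>UNIV. ennreal (?B / (?d * a (?m i)) * ?J i t ^ ?d))"
      by (subst sum_ennreal) (intro mult_nonneg_nonneg c, auto)
    also have "\<dots> = (\<Sum>i\<in>UNIV. ennreal (?B / (?d * a (?m i))) * ennreal (?J i t ^ ?d))"
      by (intro sum.cong refl ennreal_mult c) auto
    finally show "ennreal (\<Prod>i\<in>UNIV. ?J i t) * indicator {0..} t \<le>
      (\<Sum>i\<in>UNIV. ennreal (?B / (?d * a (?m i))) * (ennreal (?J i t ^ ?d) * indicator {0..} t))"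
      by (auto split: split_indicator)
  qed
  also have "\<dots> = (\<Sum>i\<in>UNIV. ennreal (?B / (?d * a (?m i))) * (\<integral>\<^sup>+t. ennreal (?J i t ^ ?d) * indicator {0..} t \<partial>lborel))"
    by (subst nn_integral_sum) (auto simp: nn_integral_cmult)
  also have "\<dots> \<le> (\<Sum>i\<in>(UNIV::'d set). ennreal (?B / (?d * a (?m i))) * ennreal (a (?m i)))"
    unfolding J by (intro sum_mono mult_left_mono int) auto
  also have "\<dots> = (\<Sum>i\<in>(UNIV::'d set). ennreal (?B / ?d))"
    using less_imp_le[OF a] less_imp_neq[OF a, symmetric]
    by (intro sum.cong refl, subst ennreal_mult[symmetric, OF c]) simp_all
  also have "\<dots> = ennreal ?B" using B by (subst sum_ennreal) auto
  finally show ?thesis .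
qed

text \<open>The finite set is enclosed in a box, over which the sum of products factorizes.\<close>

lemma sum_prod_le_power:
  fixes f :: "int \<Rightarrow> real" and S :: "(int ^ 'd::finite) set"
  assumes f: "\<And>m. 0 \<le> f m" and T: "\<And>T. finite T \<Longrightarrow> (\<Sum>m\<in>T. f m) \<le> Z" and S: "finite S"
  shows "(\<Sum>n\<in>S. \<Prod>i\<in>UNIV. f (n $ i)) \<le> Z ^ CARD('d)"
proof -
  define T where "T = (\<Union>i\<in>UNIV. (\<lambda>n. n $ i) ` S)"
  have "finite T" using S by (auto simp: T_def)
  let ?P = "PiE (UNIV :: 'd set) (\<lambda>_. T)"
  have inj: "inj_on (\<lambda>n i. n $ i) S" by (auto simp: inj_on_def vec_eq_iff fun_eq_iff)
  have "(\<Sum>n\<in>S. \<Prod>i\<in>UNIV. f (n $ i)) = (\<Sum>g\<in>(\<lambda>n i. n $ i) ` S. \<Prod>i\<in>UNIV. f (g i))"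
    using inj by (simp add: sum.reindex)
  also have "\<dots> \<le> (\<Sum>g\<in>?P. \<Prod>i\<in>UNIV. f (g i))"
    using \<open>finite T\<close> f by (intro sum_mono2 finite_PiE prod_nonneg) (auto simp: T_def)
  also have "\<dots> = (\<Prod>i\<in>(UNIV::'d set). \<Sum>m\<in>T. f m)"
    using \<open>finite T\<close> by (subst prod_sum_PiE) auto
  also have "\<dots> = (\<Sum>m\<in>T. f m) ^ CARD('d)" by simp
  also have "\<dots> \<le> Z ^ CARD('d)" using \<open>finite T\<close> f T by (intro power_mono sum_nonneg) auto
  finally show ?thesis .
qed

lemma sum_int_le:
  fixes f :: "nat \<Rightarrow> real"
  assumes f: "\<And>m. 0 \<le> f m" and Z: "\<And>M. f 0 + 2 * (\<Sum>m=1..M. f m) \<le> Z" and T: "finite T"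
  shows "(\<Sum>m\<in>T. f (nat \<bar>m\<bar>)) \<le> Z"
proof -
  obtain M where M: "\<And>m. m \<in> T \<Longrightarrow> \<bar>m\<bar> \<le> int M"
  proof -
    have "\<bar>m\<bar> \<le> int (nat (\<Sum>k\<in>T. \<bar>k\<bar>))" if "m \<in> T" for m
      using member_le_sum[of m T abs] that T by (auto simp: sum_nonneg)
    then show ?thesis using that by blast
  qed
  have "(\<Sum>m\<in>T. f (nat \<bar>m\<bar>)) \<le> (\<Sum>m\<in>{- int M..int M}. f (nat \<bar>m\<bar>))"
    using M f by (intro sum_mono2) (auto simp: abs_le_iff minus_le_iff)
  also have "\<dots> = f 0 + 2 * (\<Sum>m=1..M. f m)"
  proof (induction M)
    case (Suc M)
    have "{- int (Suc M)..int (Suc M)} = insert (- int (Suc M)) (insert (int (Suc M)) {- int M..int M})" by auto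
    moreover have "nat (1 + int M) = Suc M" "nat (int M + 1) = Suc M" by auto
    ultimately show ?case using Suc by simp
  qed simp
  also have "\<dots> \<le> Z" by (rule Z)
  finally show ?thesis .
qed

text \<open>Comparison with the integral of x^(-s), telescoped by the mean value theorem.\<close>

lemma sum_powr_le:
  fixes s :: real assumes s: "1 < s"
  shows "(\<Sum>m=1..M. real m powr (- s)) \<le> 1 + 1 / (s - 1)"
proof -
  have step: "real (Suc m) powr (- s) \<le> (real m powr (1 - s) - real (Suc m) powr (1 - s)) / (s - 1)" if m: "1 \<le> m" for m
  proof -
    have "\<exists>z. real m < z \<and> z < real (Suc m) \<and> real (Suc m) powr (1 - s) - real m powr (1 - s) = (real (Suc m) - real m) * ((1 - s) * z powr (- s))"
      by (rule MVT2) (use m in \<open>auto intro!: derivative_eq_intros\<close>)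
    then obtain z where z: "real m < z" "z < real (Suc m)" "real (Suc m) powr (1 - s) - real m powr (1 - s) = (1 - s) * z powr (- s)" by auto
    have "real (Suc m) powr (- s) \<le> z powr (- s)" using z m s by (intro powr_mono2') auto
    then have "(s - 1) * real (Suc m) powr (- s) \<le> (s - 1) * z powr (- s)" using s by (intro mult_left_mono) auto
    also have "\<dots> = real m powr (1 - s) - real (Suc m) powr (1 - s)" using z(3) by (simp add: algebra_simps)
    finally show ?thesis using s by (simp add: pos_le_divide_eq mult.commute)
  qed
  have "(\<Sum>m=1..Suc M. real m powr (- s)) \<le> 1 + (1 - real (Suc M) powr (1 - s)) / (s - 1)" for M
  proof (induction M)
    case (Suc M)
    have "(\<Sum>m=1..Suc (Suc M). real m powr (- s)) = (\<Sum>m=1..Suc M. real m powr (- s)) + real (Suc (Suc M)) powr (- s)" by simp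
    also have "\<dots> \<le> 1 + (1 - real (Suc M) powr (1 - s)) / (s - 1) + (real (Suc M) powr (1 - s) - real (Suc (Suc M)) powr (1 - s)) / (s - 1)"
      using Suc step[of "Suc M"] by (intro add_mono) auto
    also have "\<dots> = 1 + (1 - real (Suc (Suc M)) powr (1 - s)) / (s - 1)" by (simp add: diff_divide_distrib)
    finally show ?case .
  qed simp
  moreover have "1 + (1 - real (Suc M) powr (1 - s)) / (s - 1) \<le> 1 + 1 / (s - 1)" for M
    using s by (intro add_left_mono divide_right_mono) auto
  ultimately have *: "(\<Sum>m=1..Suc M. real m powr (- s)) \<le> 1 + 1 / (s - 1)" for M by (meson order_trans)
  show ?thesis using *[of "M - 1"] s by (cases M) auto
qed

text \<open>The Hoelder bound is a product over coordinates, so its lattice sum is at most the d-th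
  power of a sum over the integers, in which every m >= 1 counts twice.\<close>

lemma kernel_bound_sum_hoelder:
  fixes a :: "nat \<Rightarrow> real" and S :: "(int ^ 'd::finite) set"
  assumes a: "\<And>m. 0 < a m"
    and int: "\<And>m. (\<integral>\<^sup>+t. ennreal (\<bar>bessel_j (int m) t\<bar> ^ CARD('d)) * indicator {0..} t \<partial>lborel) \<le> ennreal (a m)"
    and q: "0 < q" and S: "finite S"
    and Z: "\<And>M. a 0 powr (q / CARD('d)) + 2 * (\<Sum>m=1..M. a m powr (q / CARD('d))) \<le> Z"
  shows "(\<Sum>n\<in>S. enn2real (kernel_bound n) powr q) \<le> Z ^ CARD('d)"
proof -
  have "(\<Sum>n\<in>S. enn2real (kernel_bound n) powr q) \<le> (\<Sum>n\<in>S. \<Prod>i\<in>UNIV. a (nat \<bar>n $ i\<bar>) powr (q / CARD('d)))"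
  proof (rule sum_mono)
    fix n :: "int ^ 'd"
    have "enn2real (kernel_bound n) \<le> (\<Prod>i\<in>UNIV. a (nat \<bar>n $ i\<bar>) powr (1 / CARD('d)))"
      by (rule enn2real_leI[OF prod_nonneg kernel_bound_hoelder[OF a int]]) auto
    then have "enn2real (kernel_bound n) powr q \<le> (\<Prod>i\<in>UNIV. a (nat \<bar>n $ i\<bar>) powr (1 / CARD('d))) powr q"
      using q by (intro powr_mono2) auto
    also have "\<dots> = (\<Prod>i\<in>UNIV. a (nat \<bar>n $ i\<bar>) powr (q / CARD('d)))"
      by (subst prod_powr_distrib) (auto simp: powr_powr)
    finally show "enn2real (kernel_bound n) powr q \<le> (\<Prod>i\<in>UNIV. a (nat \<bar>n $ i\<bar>) powr (q / CARD('d)))" .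
  qed
  also have "\<dots> \<le> Z ^ CARD('d)"
    by (rule sum_prod_le_power[where f = "\<lambda>m. a (nat \<bar>m\<bar>) powr (q / CARD('d))"])
      (use S in \<open>auto intro!: sum_int_le[where f = "\<lambda>m. a m powr (q / CARD('d))"] Z\<close>)
  finally show ?thesis .
qed

text \<open>Hoelder with exponents 4/3 and 4 for k = w^(3/4) (k w^(-3/4)), carried out as two
  Cauchy-Schwarz steps. The weight will be chosen so that the second integral, summed over the
  lattice, is again at most I.\<close>

lemma power4_le_of_fourth_moment:
  fixes w k :: "real \<Rightarrow> real"
  assumes [measurable]: "w \<in> borel_measurable borel" "k \<in> borel_measurable borel"
    and w: "\<And>t. 0 < w t" and k: "\<And>t. 0 \<le> k t"
  defines "I \<equiv> (\<integral>\<^sup>+t. ennreal (w t) * indicator {0..} t \<partial>lborel)"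
  shows "(\<integral>\<^sup>+t. ennreal (k t) * indicator {0..} t \<partial>lborel) ^ 4
    \<le> I ^ 3 * (\<integral>\<^sup>+t. ennreal (k t ^ 4 / w t ^ 3) * indicator {0..} t \<partial>lborel)"
proof -
  let ?i = "\<lambda>t::real. indicator {0..} t :: ennreal"
  have e: "ennreal (x * y) = ennreal x * ennreal y" if "0 \<le> x" for x y using that by (rule ennreal_mult')
  have sq: "(ennreal x)\<^sup>2 = ennreal (x\<^sup>2)" if "0 \<le> x" for x using that by (simp add: ennreal_power)
  let ?s = "\<lambda>t. ennreal (sqrt (w t)) * ?i t"
  have s2: "(?s t)\<^sup>2 = ennreal (w t) * ?i t" for t using w[of t]
    by (auto simp: power_mult_distrib sq less_imp_le split: split_indicator)
  have 1: "(\<integral>\<^sup>+t. ennreal (k t) * ?i t \<partial>lborel)\<^sup>2 \<le> I * (\<integral>\<^sup>+t. ennreal ((k t)\<^sup>2 / w t) * ?i t \<partial>lborel)"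
  proof -
    let ?g = "\<lambda>t. ennreal (k t / sqrt (w t)) * ?i t"
    have "(\<integral>\<^sup>+t. ?s t * ?g t \<partial>lborel)\<^sup>2 \<le> (\<integral>\<^sup>+t. (?s t)\<^sup>2 \<partial>lborel) * (\<integral>\<^sup>+t. (?g t)\<^sup>2 \<partial>lborel)"
      by (rule Cauchy_Schwarz_nn_integral) measurable
    moreover have "?s t * ?g t = ennreal (k t) * ?i t" for t
      using w[of t] k[of t] by (auto split: split_indicator simp flip: ennreal_mult)
    moreover have "(?g t)\<^sup>2 = ennreal ((k t)\<^sup>2 / w t) * ?i t" for t
      using w[of t] k[of t] by (auto split: split_indicator simp: power_mult_distrib sq power_divide less_imp_le)
    ultimately show ?thesis by (simp only: s2 I_def)
  qed
  have 2: "(\<integral>\<^sup>+t. ennreal ((k t)\<^sup>2 / w t) * ?i t \<partial>lborel)\<^sup>2 \<le> I * (\<integral>\<^sup>+t. ennreal (k t ^ 4 / w t ^ 3) * ?i t \<partial>lborel)"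
  proof -
    let ?g = "\<lambda>t. ennreal ((k t)\<^sup>2 / (w t * sqrt (w t))) * ?i t"
    have "(\<integral>\<^sup>+t. ?s t * ?g t \<partial>lborel)\<^sup>2 \<le> (\<integral>\<^sup>+t. (?s t)\<^sup>2 \<partial>lborel) * (\<integral>\<^sup>+t. (?g t)\<^sup>2 \<partial>lborel)"
      by (rule Cauchy_Schwarz_nn_integral) measurable
    moreover have "?s t * ?g t = ennreal ((k t)\<^sup>2 / w t) * ?i t" for t
      using w[of t] k[of t] by (auto split: split_indicator simp flip: ennreal_mult)
    moreover have "(?g t)\<^sup>2 = ennreal (k t ^ 4 / w t ^ 3) * ?i t" for t
    proof -
      have "((k t)\<^sup>2 / (w t * sqrt (w t)))\<^sup>2 = k t ^ 4 / w t ^ 3"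
      proof -
        have "(w t * sqrt (w t))\<^sup>2 = w t ^ 3"
          using w[of t] by (simp add: power_mult_distrib less_imp_le power3_eq_cube power2_eq_square)
        then show ?thesis by (simp add: power_divide flip: power_mult)
      qed
      then show ?thesis using w[of t] k[of t]
        by (auto split: split_indicator simp: power_mult_distrib sq less_imp_le)
    qed
    ultimately show ?thesis by (simp only: s2 I_def)
  qed
  have "(\<integral>\<^sup>+t. ennreal (k t) * ?i t \<partial>lborel) ^ 4 = ((\<integral>\<^sup>+t. ennreal (k t) * ?i t \<partial>lborel)\<^sup>2)\<^sup>2" by (simp flip: power_mult)
  also have "\<dots> \<le> (I * (\<integral>\<^sup>+t. ennreal ((k t)\<^sup>2 / w t) * ?i t \<partial>lborel))\<^sup>2" using 1 by (rule power_mono) simp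
  also have "\<dots> = I\<^sup>2 * (\<integral>\<^sup>+t. ennreal ((k t)\<^sup>2 / w t) * ?i t \<partial>lborel)\<^sup>2" by (rule power_mult_distrib)
  also have "\<dots> \<le> I\<^sup>2 * (I * (\<integral>\<^sup>+t. ennreal (k t ^ 4 / w t ^ 3) * ?i t \<partial>lborel))" using 2 by (rule mult_left_mono) simp
  also have "\<dots> = I ^ 3 * (\<integral>\<^sup>+t. ennreal (k t ^ 4 / w t ^ 3) * ?i t \<partial>lborel)" by (simp add: power3_eq_cube power2_eq_square mult_ac)
  finally show ?thesis .
qed

text \<open>The weight is w = W^(d/4) with W the bound for the fourth moment in the index. The
  lattice sum of the fourth powers of the propagator factorizes and is at most W^d = w^4, so the
  weighted sum is at most w and the total is I^4.\<close>

lemma kernel_bound_sum_fourth: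
  fixes S :: "(int ^ 'd::finite) set"
  assumes d: "5 \<le> CARD('d)" and S: "finite S"
  shows "(\<Sum>n\<in>S. kernel_bound n ^ 4) \<le> ennreal (1 + const_C0 CARD('d)) ^ 4"
proof -
  let ?d = "CARD('d)" and ?i = "\<lambda>t::real. indicator {0..} t :: ennreal"
  define w where "w = (\<lambda>t. bessel_fourth_bound t powr (real ?d / 4))"
  let ?k = "\<lambda>(n :: int ^ 'd) t. \<Prod>i\<in>UNIV. \<bar>bessel_j (n $ i) t\<bar>"
  define I where "I = (\<integral>\<^sup>+t. ennreal (w t) * ?i t \<partial>lborel)"
  have I: "I \<le> ennreal (1 + const_C0 ?d)"
    unfolding I_def w_def by (rule bessel_fourth_bound_integral_dim[OF d])
  have [measurable]: "w \<in> borel_measurable borel" unfolding w_def by measurable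
  have w: "0 < w t" "w t ^ 4 = bessel_fourth_bound t ^ ?d" for t
    using bessel_fourth_bound_props[of t] by (auto simp: w_def powr_powr simp flip: powr_realpow)
  have "(\<Sum>n\<in>S. kernel_bound n ^ 4) \<le> (\<Sum>n\<in>S. I ^ 3 * (\<integral>\<^sup>+t. ennreal (?k n t ^ 4 / w t ^ 3) * ?i t \<partial>lborel))"
    unfolding kernel_bound_def I_def
    by (intro sum_mono power4_le_of_fourth_moment w prod_nonneg) auto
  also have "\<dots> = I ^ 3 * (\<integral>\<^sup>+t. (\<Sum>n\<in>S. ennreal (?k n t ^ 4 / w t ^ 3) * ?i t) \<partial>lborel)"
    by (subst nn_integral_sum) (auto simp: sum_distrib_left)
  also have "(\<integral>\<^sup>+t. (\<Sum>n\<in>S. ennreal (?k n t ^ 4 / w t ^ 3) * ?i t) \<partial>lborel) \<le> I"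
    unfolding I_def
  proof (rule nn_integral_mono)
    fix t :: real
    show "(\<Sum>n\<in>S. ennreal (?k n t ^ 4 / w t ^ 3) * ?i t) \<le> ennreal (w t) * ?i t"
    proof (cases "0 \<le> t")
      case True
      have "(\<Sum>n\<in>S. ?k n t ^ 4) = (\<Sum>n\<in>S. \<Prod>i\<in>UNIV. bessel_j (n $ i) t ^ 4)"
        by (simp add: prod_power_distrib[symmetric] flip: abs_prod)
      also have "\<dots> \<le> bessel_fourth_bound t ^ ?d"
        by (rule sum_prod_le_power[where f = "\<lambda>m. bessel_j m t ^ 4"]) (use S True sum_bessel_j_fourth in auto)
      finally have "(\<Sum>n\<in>S. ?k n t ^ 4) \<le> w t ^ 4" by (simp add: w)
      then have "(\<Sum>n\<in>S. ?k n t ^ 4) / w t ^ 3 \<le> w t"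
        using w(1)[of t] by (simp add: divide_le_eq eval_nat_numeral)
      then have "ennreal (\<Sum>n\<in>S. ?k n t ^ 4 / w t ^ 3) \<le> ennreal (w t)"
        by (intro ennreal_leI) (simp add: sum_divide_distrib)
      moreover have "ennreal (\<Sum>n\<in>S. ?k n t ^ 4 / w t ^ 3) = (\<Sum>n\<in>S. ennreal (?k n t ^ 4 / w t ^ 3))"
        using w(1)[of t] by (intro sum_ennreal[symmetric]) (auto intro!: divide_nonneg_nonneg less_imp_le)
      ultimately show ?thesis using True by simp
    qed simp
  qed
  also have "I ^ 3 * I = I ^ 4" by (simp add: eval_nat_numeral mult_ac)
  also have "I ^ 4 \<le> ennreal (1 + const_C0 ?d) ^ 4" using I by (rule power_mono) simp
  finally show ?thesis by (simp add: mult_left_mono)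
qed

section \<open>The constants, and the norms of the kernel bound in each dimension\<close>

lemma const_C_ge_1: assumes "1 \<le> p" shows "1 \<le> const_C p d"
  using assms by (auto simp: const_C_def intro!: ge_one_powr_ge_zero)

text \<open>The exponents cancel: kappa to the power 4 (q - 1) / q is (5 q - 1) / (4 - 3 q) to the
  power (5 q - 4) / q, which tends to 4. The summand 3 is negligible as kappa tends to infinity, and
  the power of 2 tends to 1.\<close>

lemma const_Gamma_4_at_1: "const_Gamma 1 4 = 4"
proof -
  have "((\<lambda>q. (3 + 2 * const_kappa q 4) powr (real 4 * (q - 1) / q)) \<longlongrightarrow> 4) (at_right 1)"
    unfolding const_kappa_def by simp real_asymp
  then show ?thesis by (simp add: const_Gamma_def Let_def tendsto_Lim)
qed

lemma const_Gamma_at_1: assumes "d \<noteq> 4" shows "const_Gamma 1 d = 1"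
  using assms by (simp add: const_Gamma_def Let_def const_kappa_def)

lemma const_kappa_nonneg:
  assumes "1 < p" "3 \<le> d" "d = 3 \<Longrightarrow> p < 6 / 5" "4 \<le> d \<Longrightarrow> p < 4 / 3"
  shows "0 \<le> const_kappa p d"
proof -
  consider "d = 3" | "d = 4" | "5 \<le> d" using assms by linarith
  then show ?thesis
  proof cases
    case 3
    have "(2 * real d + 1) * p \<le> (2 * real d + 1) * (4 / 3)" using assms 3 by (intro mult_left_mono) auto
    also have "\<dots> \<le> 3 * real d" using 3 by simp
    finally show ?thesis using 3 assms by (auto simp: const_kappa_def intro!: divide_nonneg_nonneg)
  qed (use assms in \<open>auto simp: const_kappa_def\<close>)
qed

lemma const_Gamma_ge_1:
  assumes "1 \<le> p" "3 \<le> d" "d = 3 \<Longrightarrow> p < 6 / 5" "4 \<le> d \<Longrightarrow> p < 4 / 3"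
  shows "1 \<le> const_Gamma p d"
proof (cases "p = 1")
  case True
  then show ?thesis by (cases "d = 4") (auto simp: const_Gamma_4_at_1 const_Gamma_at_1)
next
  case False
  then show ?thesis using const_kappa_nonneg[of p d] assms
    by (auto simp: const_Gamma_def Let_def intro!: ge_one_powr_ge_zero)
qed

lemma const_C0_pos: assumes "3 \<le> d" shows "0 < const_C0 d"
  using assms by (auto simp: const_C0_def intro!: divide_pos_pos)

definition bessel_cube_bound :: "nat \<Rightarrow> real"
  where "bessel_cube_bound m = (if m = 0 then 16 else 16 / sqrt (real m))"

definition bessel_fourth_power_bound :: "nat \<Rightarrow> real"
  where "bessel_fourth_power_bound m = (if m = 0 then 4 else (15 + ln (real m)) / real m)"

lemma bessel_cube_bound:
  "0 < bessel_cube_bound m" "bessel_cube_bound m \<le> 16"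
  "(\<integral>\<^sup>+t. ennreal (\<bar>bessel_j (int m) t\<bar> ^ 3) * indicator {0..} t \<partial>lborel) \<le> ennreal (bessel_cube_bound m)"
  using bessel_j_cube_integral[of m] bessel_j_0_integrals
  by (auto simp: bessel_cube_bound_def divide_le_eq)

lemma bessel_fourth_power_bound:
  "0 < bessel_fourth_power_bound m" "bessel_fourth_power_bound m \<le> 16"
  "(\<integral>\<^sup>+t. ennreal (\<bar>bessel_j (int m) t\<bar> ^ 4) * indicator {0..} t \<partial>lborel) \<le> ennreal (bessel_fourth_power_bound m)"
proof -
  have "0 \<le> ln (real m) \<and> ln (real m) \<le> real m - 1" if "m > 0"
    using that ln_le_minus_one[of "real m"] by auto
  then show "0 < bessel_fourth_power_bound m" "bessel_fourth_power_bound m \<le> 16"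
    by (auto simp: bessel_fourth_power_bound_def divide_le_eq intro!: divide_pos_pos add_pos_nonneg)
  show "(\<integral>\<^sup>+t. ennreal (\<bar>bessel_j (int m) t\<bar> ^ 4) * indicator {0..} t \<partial>lborel) \<le> ennreal (bessel_fourth_power_bound m)"
    using bessel_j_fourth_integral[of m] bessel_j_0_integrals
    by (auto simp: bessel_fourth_power_bound_def)
qed

lemma prod_powr_inverse_card_le:
  fixes a :: "'d::finite \<Rightarrow> real"
  assumes "\<And>i. 0 < a i" "\<And>i. a i \<le> c"
  shows "(\<Prod>i\<in>UNIV. a i powr (1 / CARD('d))) \<le> c"
proof -
  have c: "0 < c" using assms less_le_trans by blast
  have "(\<Prod>i\<in>UNIV. a i powr (1 / CARD('d))) \<le> (\<Prod>i\<in>(UNIV::'d set). c powr (1 / CARD('d)))"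
    using assms by (intro prod_mono conjI powr_mono2) (auto intro: less_imp_le)
  also have "\<dots> = c" using c by (simp add: powr_powr flip: powr_realpow)
  finally show ?thesis .
qed

text \<open>For p = 1 the conjugate exponent is infinite, and the sup norm of the kernel bound takes
  the place of its l^q norm.\<close>

lemma kernel_bound_le_C_star_1:
  fixes n :: "int ^ 'd::finite"
  assumes d: "3 \<le> CARD('d)"
  shows "kernel_bound n \<le> ennreal (C_star 1 CARD('d))"
proof -
  consider "CARD('d) = 3" | "CARD('d) = 4" | "5 \<le> CARD('d)" using assms by linarith
  then show ?thesis
  proof cases
    case 1
    have "kernel_bound n \<le> ennreal (\<Prod>i\<in>UNIV. bessel_cube_bound (nat \<bar>n $ i\<bar>) powr (1 / CARD('d)))"
      by (rule kernel_bound_hoelder) (use 1 bessel_cube_bound in auto)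
    also have "\<dots> \<le> ennreal 16"
      by (intro ennreal_leI prod_powr_inverse_card_le bessel_cube_bound)
    also have "\<dots> \<le> ennreal (C_star 1 CARD('d))"
      using 1 by (intro ennreal_leI) (simp add: C_star_def const_C_def const_C0_def const_Gamma_at_1)
    finally show ?thesis .
  next
    case 2
    have "kernel_bound n \<le> ennreal (\<Prod>i\<in>UNIV. bessel_fourth_power_bound (nat \<bar>n $ i\<bar>) powr (1 / CARD('d)))"
      by (rule kernel_bound_hoelder) (use 2 bessel_fourth_power_bound in auto)
    \<comment> \<open>16 is the product of \<open>const_C0\<close>, which is 4, and the limit value
      4 of \<open>const_Gamma\<close>.\<close>
    also have "\<dots> \<le> ennreal 16"
      by (intro ennreal_leI prod_powr_inverse_card_le bessel_fourth_power_bound)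
    also have "\<dots> \<le> ennreal (C_star 1 CARD('d))"
      using 2 by (intro ennreal_leI) (simp add: C_star_def const_C_def const_C0_def const_Gamma_4_at_1)
    finally show ?thesis .
  next
    case 3
    \<comment> \<open>A single term of the l^4 sum. It also shows finiteness, so that the fourth
      root can be taken among the reals.\<close>
    have le4: "kernel_bound n ^ 4 \<le> ennreal (1 + const_C0 CARD('d)) ^ 4"
      using kernel_bound_sum_fourth[OF 3, of "{n}"] by simp
    moreover have "ennreal (1 + const_C0 CARD('d)) ^ 4 < top" by (simp add: power_less_top_ennreal)
    ultimately have "kernel_bound n ^ 4 < top" by (rule le_less_trans)
    then have "kernel_bound n < top" by (simp add: power_less_top_ennreal)
    then obtain r where r: "kernel_bound n = ennreal r" "0 \<le> r" by (cases "kernel_bound n") auto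
    have c: "0 \<le> 1 + const_C0 CARD('d)" using const_C0_pos[OF d] by simp
    have "r ^ 4 \<le> (1 + const_C0 CARD('d)) ^ 4" using le4 r c by (simp add: ennreal_power)
    then have "r \<le> 1 + const_C0 CARD('d)" using c r by (simp add: power_mono_iff)
    then have "kernel_bound n \<le> ennreal (1 + const_C0 CARD('d))" using r by (simp add: ennreal_leI)
    also have "\<dots> \<le> ennreal (C_star 1 CARD('d))"
      using 3 by (intro ennreal_leI) (simp add: C_star_def const_C_def const_Gamma_at_1)
    finally show ?thesis .
  qed
qed

lemma kernel_bound_finite:
  fixes n :: "int ^ 'd::finite"
  assumes d: "3 \<le> CARD('d)"
  shows "kernel_bound n < \<infinity>"
  using kernel_bound_le_C_star_1[OF d, of n] by (simp add: le_less_trans)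

text \<open>In dimensions 3 and 4 the factor 3 + 2 kappa bounds the one-dimensional sum from
  \<open>kernel_bound_sum_hoelder\<close> relative to C0^(q/d). In higher dimensions the l^q bound
  is interpolated between l^4 and the sup norm.\<close>

lemma kernel_bound_sum_le_C_star:
  fixes S :: "(int ^ 'd::finite) set"
  assumes d: "3 \<le> CARD('d)" and p: "1 < p" and p3: "CARD('d) = 3 \<Longrightarrow> p < 6 / 5"
    and p4: "4 \<le> CARD('d) \<Longrightarrow> p < 4 / 3" and S: "finite S"
  shows "(\<Sum>n\<in>S. enn2real (kernel_bound n) powr (p / (p - 1))) \<le> C_star p CARD('d) powr (p / (p - 1))"
proof -
  define q where "q = p / (p - 1)"
  have q: "0 < q" using p by (simp add: q_def)
  let ?\<kappa> = "const_kappa p CARD('d)"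
  have \<kappa>: "0 \<le> ?\<kappa>" using const_kappa_nonneg d p p3 p4 by blast
  have C: "const_C0 CARD('d) * const_Gamma p CARD('d) \<le> C_star p CARD('d)"
    using const_C_ge_1[of p "CARD('d)"] p unfolding C_star_def by linarith
  have G: "const_Gamma p CARD('d) = (3 + 2 * ?\<kappa>) powr (CARD('d) / q)"
    using p by (simp add: const_Gamma_def Let_def q_def)
  \<comment> \<open>The d-th power of C0^(q/d) (3 + 2 kappa) is (C0 Gamma)^q; this accounts for the
    exponent in \<open>const_Gamma\<close>.\<close>
  have pow: "(const_C0 CARD('d) powr (q / CARD('d)) * (3 + 2 * ?\<kappa>)) ^ CARD('d) \<le> C_star p CARD('d) powr q"
  proof -
    have "(const_C0 CARD('d) powr (q / CARD('d)) * (3 + 2 * ?\<kappa>)) ^ CARD('d)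
       = const_C0 CARD('d) powr q * (3 + 2 * ?\<kappa>) powr CARD('d)"
    proof -
      have "(const_C0 CARD('d) powr (q / CARD('d))) ^ CARD('d) = const_C0 CARD('d) powr q"
        using const_C0_pos[OF d] by (simp add: powr_powr flip: powr_realpow)
      moreover have "(3 + 2 * ?\<kappa>) ^ CARD('d) = (3 + 2 * ?\<kappa>) powr CARD('d)"
        using \<kappa> by (simp add: powr_realpow add_pos_nonneg)
      ultimately show ?thesis by (simp only: power_mult_distrib)
    qed
    also have "\<dots> = (const_C0 CARD('d) * const_Gamma p CARD('d)) powr q"
      using const_C0_pos[OF d] \<kappa> q by (simp add: G powr_mult powr_powr)
    also have "\<dots> \<le> C_star p CARD('d) powr q"
      using C q const_C0_pos[OF d] by (intro powr_mono2) (auto simp: G)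
    finally show ?thesis .
  qed
  consider "CARD('d) = 3" | "CARD('d) = 4" | "5 \<le> CARD('d)" using d by linarith
  then show ?thesis unfolding q_def[symmetric]
  proof cases
    case 1
    \<comment> \<open>p < 6/5 means q > 6, so the sum of m^(-q/6) converges; kappa is the value 1 /
      (q/6 - 1) of the comparison integral.\<close>
    have "6 * (p - 1) < p" using p3[OF 1] by simp
    then have q6: "6 < q" using p by (simp add: q_def less_divide_eq)
    have kap: "?\<kappa> = 1 / (q / 6 - 1)"
      using p p3[OF 1] unfolding const_kappa_def q_def by (simp add: 1 field_simps)
    have "(\<Sum>n\<in>S. enn2real (kernel_bound n) powr q) \<le> (const_C0 CARD('d) powr (q / CARD('d)) * (3 + 2 * ?\<kappa>)) ^ CARD('d)"
    proof (rule kernel_bound_sum_hoelder[where a = bessel_cube_bound, OF _ _ q S])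
      fix M
      have "bessel_cube_bound m powr (q / 3) = 16 powr (q / 3) * real m powr (- (q / 6))" if "1 \<le> m" for m
      proof -
        have "bessel_cube_bound m = 16 * real m powr (- (1/2))"
          using that by (simp add: bessel_cube_bound_def powr_minus_divide powr_half_sqrt)
        then have "bessel_cube_bound m powr (q / 3) = 16 powr (q / 3) * (real m powr (- (1/2))) powr (q / 3)"
          by (simp add: powr_mult)
        then show ?thesis by (simp only: powr_powr) simp
      qed
      then have "bessel_cube_bound 0 powr (q / CARD('d)) + 2 * (\<Sum>m=1..M. bessel_cube_bound m powr (q / CARD('d)))
        = 16 powr (q / 3) * (1 + 2 * (\<Sum>m=1..M. real m powr (- (q / 6))))"
        by (simp add: 1 sum_distrib_left distrib_left) (simp add: bessel_cube_bound_def mult_ac)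
      also have "\<dots> \<le> 16 powr (q / 3) * (1 + 2 * (1 + 1 / (q / 6 - 1)))"
        using q6 sum_powr_le[of "q / 6" M] by (intro mult_left_mono add_left_mono) auto
      also have "\<dots> = const_C0 CARD('d) powr (q / CARD('d)) * (3 + 2 * ?\<kappa>)"
        unfolding kap by (simp add: 1 const_C0_def)
      finally show "bessel_cube_bound 0 powr (q / CARD('d)) + 2 * (\<Sum>m=1..M. bessel_cube_bound m powr (q / CARD('d)))
        \<le> const_C0 CARD('d) powr (q / CARD('d)) * (3 + 2 * ?\<kappa>)" .
    qed (use 1 bessel_cube_bound in auto)
    then show "(\<Sum>n\<in>S. enn2real (kernel_bound n) powr q) \<le> C_star p CARD('d) powr q" using pow by linarith
  next
    case 2
    have p43: "p < 4 / 3" using p4 2 by simp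
    \<comment> \<open>The summands behave like (log m / m)^x with x = q/4 > 1. Half of the surplus y
      = x - 1 is spent on the logarithm, the other half keeps the sum convergent; r is the base of
      the power in \<open>const_kappa\<close>.\<close>
    define x where "x = q / 4"
    define y where "y = x - 1"
    define r where "r = 4 + 17 / (4 * y)"
    have y: "0 < y" using p p43 by (simp add: y_def x_def q_def field_simps)
    have x: "x > 1" using y by (simp add: y_def)
    have r: "r = (16 * x + 1) / (4 * y)" using y by (simp add: r_def x_def y_def field_simps)
    have kap: "?\<kappa> = r powr (x + 1)"
    proof -
      have "r = (5 * p - 1) / (4 - 3 * p)"
      proof -
        have "4 * y = (4 - 3 * p) / (p - 1)" "16 * x + 1 = (5 * p - 1) / (p - 1)"
          using p by (simp_all add: y_def x_def q_def field_simps)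
        then show ?thesis using p by (simp only: r) simp
      qed
      moreover have "x + 1 = (5 * p - 4) / (4 * (p - 1))" using p by (simp add: x_def q_def field_simps)
      ultimately show ?thesis by (simp add: const_kappa_def 2)
    qed
    have r4: "r > 4" using y by (simp add: r_def)
    \<comment> \<open>This choice gives (e - 1) x = - (1 + y/2). Since 1/e <= 4 r, the logarithm is
      at most 4 r (m^e - 1), and 4 r > 16 takes up the constant 15.\<close>
    define e where "e = y / (2 * x)"
    have e: "e > 0" "1 / e \<le> 4 * r" using x y by (auto simp: e_def r field_simps)
    have summand: "bessel_fourth_power_bound m powr x \<le> (4 * r) powr x * real m powr (- (1 + y / 2))" if m: "1 \<le> m" for m
    proof -
      have "exp (e * ln (real m)) \<ge> 1 + e * ln (real m)" by (rule exp_ge_add_one_self)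
      moreover have "exp (e * ln (real m)) = real m powr e" using m by (simp add: powr_def)
      ultimately have "e * ln (real m) \<le> real m powr e - 1" by linarith
      then have "ln (real m) \<le> 1 / e * (real m powr e - 1)" using e by (simp add: field_simps)
      also have "\<dots> \<le> 4 * r * (real m powr e - 1)"
        using e m by (intro mult_right_mono) (auto intro!: ge_one_powr_ge_zero)
      finally have "15 + ln (real m) \<le> 4 * r * real m powr e" using r4 by (simp add: algebra_simps)
      then have "(15 + ln (real m)) / real m \<le> 4 * r * real m powr e / real m" using m by (intro divide_right_mono) auto
      also have "\<dots> = 4 * r * real m powr (e - 1)" using m by (simp add: powr_diff)
      finally have "bessel_fourth_power_bound m powr x \<le> (4 * r * real m powr (e - 1)) powr x"
        using m x bessel_fourth_power_bound(1)[of m] by (intro powr_mono2) (auto simp: bessel_fourth_power_bound_def)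
      also have "\<dots> = (4 * r) powr x * real m powr ((e - 1) * x)" using r4 m by (simp add: powr_mult powr_powr)
      also have "(e - 1) * x = - (1 + y / 2)" using x by (simp add: e_def y_def field_simps)
      finally show ?thesis .
    qed
    have "(\<Sum>n\<in>S. enn2real (kernel_bound n) powr q) \<le> (const_C0 CARD('d) powr (q / CARD('d)) * (3 + 2 * ?\<kappa>)) ^ CARD('d)"
    proof (rule kernel_bound_sum_hoelder[where a = bessel_fourth_power_bound, OF _ _ q S])
      fix M
      have "(\<Sum>m=1..M. bessel_fourth_power_bound m powr x) \<le> (\<Sum>m=1..M. (4 * r) powr x * real m powr (- (1 + y / 2)))"
        by (intro sum_mono summand) auto
      also have "\<dots> = (4 * r) powr x * (\<Sum>m=1..M. real m powr (- (1 + y / 2)))" by (simp add: sum_distrib_left)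
      also have "\<dots> \<le> (4 * r) powr x * (1 + 1 / (1 + y / 2 - 1))"
        using y by (intro mult_left_mono sum_powr_le) auto
      also have "\<dots> \<le> (4 * r) powr x * r" using y by (intro mult_left_mono) (auto simp: r_def field_simps)
      also have "\<dots> = 4 powr x * ?\<kappa>" using r4 by (simp add: kap powr_mult powr_add)
      finally have A: "(\<Sum>m=1..M. bessel_fourth_power_bound m powr x) \<le> 4 powr x * ?\<kappa>" .
      have "bessel_fourth_power_bound 0 powr (q / CARD('d)) + 2 * (\<Sum>m=1..M. bessel_fourth_power_bound m powr (q / CARD('d)))
        = 4 powr x + 2 * (\<Sum>m=1..M. bessel_fourth_power_bound m powr x)"
        by (simp add: 2 x_def) (simp add: bessel_fourth_power_bound_def)
      also have "\<dots> \<le> 4 powr x * 3 + 2 * (4 powr x * ?\<kappa>)" using A by (intro add_mono) auto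
      also have "\<dots> = const_C0 CARD('d) powr (q / CARD('d)) * (3 + 2 * ?\<kappa>)"
        by (simp add: 2 x_def const_C0_def distrib_left)
      finally show "bessel_fourth_power_bound 0 powr (q / CARD('d)) + 2 * (\<Sum>m=1..M. bessel_fourth_power_bound m powr (q / CARD('d)))
        \<le> const_C0 CARD('d) powr (q / CARD('d)) * (3 + 2 * ?\<kappa>)" .
    qed (use 2 bessel_fourth_power_bound in auto)
    then show "(\<Sum>n\<in>S. enn2real (kernel_bound n) powr q) \<le> C_star p CARD('d) powr q" using pow by linarith
  next
    case 3
    have "4 * (p - 1) < p" using p4 3 by simp
    then have q4: "4 < q" using p by (simp add: q_def less_divide_eq)
    let ?I = "1 + const_C0 CARD('d)" and ?g = "\<lambda>n. enn2real (kernel_bound (n :: int ^ 'd))"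
    have I: "0 < ?I" using const_C0_pos[OF d] by simp
    have g: "ennreal (?g n) = kernel_bound n" for n using kernel_bound_finite[OF d, of n] by simp
    have g4: "kernel_bound n ^ 4 = ennreal (?g n ^ 4)" for n
      using ennreal_power[of "?g n" 4] unfolding g by simp
    have sum4: "(\<Sum>n\<in>T. ?g n ^ 4) \<le> ?I ^ 4" if "finite T" for T
    proof -
      have "ennreal (\<Sum>n\<in>T. ?g n ^ 4) = (\<Sum>n\<in>T. kernel_bound n ^ 4)"
        unfolding g4 by (rule sum_ennreal[symmetric]) simp
      also have "\<dots> \<le> ennreal ?I ^ 4" by (rule kernel_bound_sum_fourth[OF 3 that])
      also have "\<dots> = ennreal (?I ^ 4)" using I by (intro ennreal_power) simp
      finally show ?thesis using I by (subst (asm) ennreal_le_iff) simp_all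
    qed
    have gI: "?g n \<le> ?I" for n
      using sum4[of "{n}"] I by (simp add: power_mono_iff)
    \<comment> \<open>Interpolation: of g^q = g^4 g^(q-4) the first factor is summed and the second
      is bounded by the supremum.\<close>
    have "(\<Sum>n\<in>S. ?g n powr q) \<le> (\<Sum>n\<in>S. ?g n ^ 4 * ?I powr (q - 4))"
    proof (rule sum_mono)
      fix n
      show "?g n powr q \<le> ?g n ^ 4 * ?I powr (q - 4)"
      proof (cases "?g n = 0")
        case False
        then have g0: "?g n > 0" by (simp add: less_le)
        then have "?g n powr q = ?g n ^ 4 * ?g n powr (q - 4)"
          using powr_add[of "?g n" 4 "q - 4"] by simp
        also have "\<dots> \<le> ?g n ^ 4 * ?I powr (q - 4)"
          using g0 gI q4 by (intro mult_left_mono powr_mono2) auto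
        finally show ?thesis .
      qed (use q in simp)
    qed
    also have "\<dots> = (\<Sum>n\<in>S. ?g n ^ 4) * ?I powr (q - 4)" by (simp add: sum_distrib_right)
    also have "\<dots> \<le> ?I ^ 4 * ?I powr (q - 4)" using sum4[OF S] by (intro mult_right_mono) auto
    also have "\<dots> = ?I powr q" using powr_add[of ?I 4 "q - 4"] I by simp
    also have "\<dots> \<le> C_star p CARD('d) powr q"
    proof (intro powr_mono2)
      have "const_C0 CARD('d) * 1 \<le> const_C0 CARD('d) * const_Gamma p CARD('d)"
        using const_C0_pos[OF d] const_Gamma_ge_1[of p "CARD('d)"] p d p3 p4 by (intro mult_left_mono) auto
      then show "?I \<le> C_star p CARD('d)" using const_C_ge_1[of p "CARD('d)"] p by (simp add: C_star_def)
    qed (use I q in auto)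
    finally show "(\<Sum>n\<in>S. ?g n powr q) \<le> C_star p CARD('d) powr q" .
  qed
qed
section \<open>The free propagator and the Green function\<close>

lemma neighbours_0:
  "neighbours (0 :: int ^ 'd::finite) = (\<lambda>i. axis i 1) ` UNIV \<union> (\<lambda>i. axis i (-1)) ` UNIV"
proof (intro equalityI subsetI)
  fix e :: "int ^ 'd" assume "e \<in> neighbours 0"
  then have s: "(\<Sum>i\<in>UNIV. (real_of_int (e $ i))\<^sup>2) = 1" by (simp add: neighbours_def)
  then have s: "(\<Sum>i\<in>UNIV. (e $ i)\<^sup>2) = 1" by (metis (mono_tags, lifting) of_int_1 of_int_eq_iff of_int_power of_int_sum sum.cong)
  then have "\<exists>i. (e $ i)\<^sup>2 \<noteq> 0" by (metis (mono_tags, lifting) sum.neutral zero_neq_one)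
  then obtain i where i: "(e $ i)\<^sup>2 \<noteq> 0" by blast
  have split: "(e $ i)\<^sup>2 + (\<Sum>j\<in>UNIV - {i}. (e $ j)\<^sup>2) = 1" using s by (simp add: sum.remove[of UNIV i])
  moreover have "(e $ i)\<^sup>2 \<ge> 1" using i zero_le_power2[of "e $ i"] by linarith
  moreover have "(\<Sum>j\<in>UNIV - {i}. (e $ j)\<^sup>2) \<ge> 0" by (simp add: sum_nonneg)
  ultimately have 1: "(e $ i)\<^sup>2 = 1" and 0: "(\<Sum>j\<in>UNIV - {i}. (e $ j)\<^sup>2) = 0" by linarith+
  from 0 have z: "e $ j = 0" if "j \<noteq> i" for j
    using that by (subst (asm) sum_nonneg_eq_0_iff) auto
  from 1 have "e $ i = 1 \<or> e $ i = -1" by (simp add: power2_eq_1_iff)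
  then have "e = axis i 1 \<or> e = axis i (-1)" using z by (auto simp: vec_eq_iff axis_def)
  then show "e \<in> (\<lambda>i. axis i 1) ` UNIV \<union> (\<lambda>i. axis i (-1)) ` UNIV" by blast
next
  fix e :: "int ^ 'd" assume "e \<in> (\<lambda>i. axis i 1) ` UNIV \<union> (\<lambda>i. axis i (-1)) ` UNIV"
  then obtain i c where e: "e = axis i c" "c = 1 \<or> c = -1" by auto
  have "(\<Sum>j\<in>UNIV. (real_of_int (axis i c $ j))\<^sup>2) = (\<Sum>j\<in>UNIV. if j = i then 1 else 0)"
    using e by (intro sum.cong) (auto simp: axis_def)
  then show "e \<in> neighbours 0" using e by (simp add: neighbours_def)
qed

lemma sum_neighbours:
  "(\<Sum>m\<in>neighbours n. f m) = (\<Sum>i\<in>(UNIV::'d::finite set). f (n + axis i 1) + f (n + axis i (-1)))"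
  for f :: "int ^ 'd \<Rightarrow> 'b::comm_monoid_add"
proof -
  have inj: "inj (\<lambda>i. axis i c :: int ^ 'd)" if "c \<noteq> 0" for c
    using that by (auto simp: inj_on_def axis_eq_axis)
  have "(\<Sum>m\<in>neighbours n. f m) = (\<Sum>e\<in>neighbours 0. f (n + e))"
    by (subst neighbours_eq_image, subst sum.reindex) auto
  also have "\<dots> = (\<Sum>e\<in>range (\<lambda>i::'d. axis i 1). f (n + e)) + (\<Sum>e\<in>range (\<lambda>i::'d. axis i (-1)). f (n + e))"
    unfolding neighbours_0 by (rule sum.union_disjoint) (auto simp: axis_eq_axis)
  also have "\<dots> = (\<Sum>i\<in>UNIV. f (n + axis i 1)) + (\<Sum>i\<in>UNIV. f (n + axis i (-1)))"
    using inj[of 1] inj[of "-1"] by (simp add: sum.reindex)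
  finally show ?thesis by (simp add: sum.distrib)
qed

lemma card_neighbours: "card (neighbours (n :: int ^ 'd::finite)) = 2 * CARD('d)"
  using sum_neighbours[of "\<lambda>_. 1::nat" n] by simp

text \<open>By the Jacobi-Anger expansion these are the Fourier coefficients of exp (-i t cos x),
  the one-dimensional propagator in momentum space.\<close>

definition bessel_phase :: "int \<Rightarrow> real \<Rightarrow> complex"
  where "bessel_phase n t = (- \<i>) powi n * of_real (bessel_j n t)"

text \<open>The kernel of \<open>exp (-i t \<Delta>)\<close>.\<close>

definition propagator :: "real \<Rightarrow> int ^ 'd::finite \<Rightarrow> complex"
  where "propagator t n = (\<Prod>i\<in>UNIV. bessel_phase (n $ i) t)"

lemma norm_bessel_phase: "cmod (bessel_phase n t) = \<bar>bessel_j n t\<bar>"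
  by (simp add: bessel_phase_def norm_mult norm_power_int)

lemma norm_propagator: "cmod (propagator t n) = (\<Prod>i\<in>UNIV. \<bar>bessel_j (n $ i) t\<bar>)"
  by (simp add: propagator_def norm_bessel_phase flip: prod_norm)

lemma norm_propagator_le_1: "cmod (propagator t n) \<le> 1"
  unfolding norm_propagator by (intro prod_le_1) (auto simp: bessel_j_abs_le_1)

lemma sum_propagator_sq_le_1:
  assumes "finite S" shows "(\<Sum>n\<in>S. (cmod (propagator t n))\<^sup>2) \<le> 1"
proof -
  have "(\<Sum>n\<in>S. (cmod (propagator t n))\<^sup>2) = (\<Sum>n\<in>S. \<Prod>i\<in>UNIV. (bessel_j (n $ i) t)\<^sup>2)"
    unfolding norm_propagator by (simp add: prod_power_distrib[symmetric] flip: abs_prod)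
  also have "\<dots> \<le> 1 ^ CARD('a)"
    using assms sum_bessel_j_sq_le_1 by (intro sum_prod_le_power[where f = "\<lambda>m. (bessel_j m t)\<^sup>2"]) auto
  finally show ?thesis by simp
qed

lemma propagator_0: "propagator 0 n = (if n = 0 then 1 else 0)"
  by (auto simp: propagator_def bessel_phase_def bessel_j_0 vec_eq_iff)

lemma bessel_phase_deriv:
  "(bessel_phase n has_vector_derivative - \<i> / 2 * (bessel_phase (n + 1) t + bessel_phase (n - 1) t)) (at t)"
proof -
  have "(bessel_phase n has_vector_derivative (- \<i>) powi n * of_real ((bessel_j (n - 1) t - bessel_j (n + 1) t) / 2)) (at t)"
    unfolding bessel_phase_def[abs_def]
    by (intro has_vector_derivative_mult_right has_vector_derivative_of_real)
      (use bessel_j_deriv in \<open>simp add: has_real_derivative_iff_has_vector_derivative\<close>)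
  moreover have "(- \<i>) powi n * of_real ((bessel_j (n - 1) t - bessel_j (n + 1) t) / 2)
     = - \<i> / 2 * (bessel_phase (n + 1) t + bessel_phase (n - 1) t)"
  proof -
    have "(- \<i>) powi (n + 1) = (- \<i>) powi n * (- \<i>)" "(- \<i>) powi (n - 1) = (- \<i>) powi n * \<i>"
      by (simp_all add: power_int_add power_int_diff) (simp add: divide_eq_eq)?
    then show ?thesis by (simp add: bessel_phase_def field_simps)
  qed
  ultimately show ?thesis by simp
qed

text \<open>The Schroedinger equation. Differentiating the factor of coordinate i shifts that
  coordinate by one step in both directions, which gives the two neighbours along axis i.\<close>

lemma propagator_deriv:
  "((\<lambda>t. propagator t n) has_vector_derivative - \<i> * laplacian_fun (propagator t) n) (at t)"
proof -
  let ?P = "\<lambda>i. \<Prod>j\<in>UNIV - {i}. bessel_phase (n $ j) t"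
  have "((\<lambda>t. propagator t n) has_derivative
     (\<lambda>y. \<Sum>i\<in>UNIV. (y *\<^sub>R (- \<i> / 2 * (bessel_phase (n $ i + 1) t + bessel_phase (n $ i - 1) t))) * ?P i)) (at t)"
    unfolding propagator_def
    by (rule has_derivative_prod) (use bessel_phase_deriv in \<open>simp add: has_vector_derivative_def\<close>)
  moreover have "(\<Sum>i\<in>UNIV. (y *\<^sub>R (- \<i> / 2 * (bessel_phase (n $ i + 1) t + bessel_phase (n $ i - 1) t))) * ?P i)
     = y *\<^sub>R (- \<i> * laplacian_fun (propagator t) n)" for y
  proof -
    have *: "propagator t (n + axis i c) = bessel_phase (n $ i + c) t * ?P i" for i c
    proof -
      have "propagator t (n + axis i c) = bessel_phase ((n + axis i c) $ i) t * (\<Prod>j\<in>UNIV - {i}. bessel_phase ((n + axis i c) $ j) t)"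
        unfolding propagator_def by (rule prod.remove) auto
      also have "(\<Prod>j\<in>UNIV - {i}. bessel_phase ((n + axis i c) $ j) t) = ?P i"
        by (intro prod.cong) (auto simp: axis_def)
      finally show ?thesis by (simp add: axis_def)
    qed
    show ?thesis unfolding laplacian_fun_def sum_neighbours *
      by (simp add: sum_distrib_left scaleR_sum_right algebra_simps scaleR_conv_of_real)
  qed
  ultimately show ?thesis by (simp add: has_vector_derivative_def)
qed

lemma continuous_on_propagator [continuous_intros]:
  "continuous_on S f \<Longrightarrow> continuous_on S (\<lambda>x. propagator (f x) n)"
  unfolding propagator_def bessel_phase_def by (intro continuous_intros)

lemma propagator_measurable [measurable]: "(\<lambda>t. propagator t n) \<in> borel_measurable borel"
  by (intro borel_measurable_continuous_onI continuous_intros)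

text \<open>For Im l > 0 the Laplace transform of exp (-i t Delta), multiplied by i, is the inverse
  of Delta - l. For real l the integral still converges absolutely in dimension at least 3.\<close>

definition green :: "complex \<Rightarrow> int ^ 'd::finite \<Rightarrow> complex"
  where "green l n = \<i> * (LINT t:{0<..}|lborel. exp (\<i> * l * of_real t) * propagator t n)"

lemma norm_exp_i_mult: "cmod (exp (\<i> * l * of_real t)) = exp (- Im l * t)"
  by (simp add: norm_exp_eq_Re)

lemma exp_decay_nn_integral:
  assumes "0 < e" shows "(\<integral>\<^sup>+t. ennreal (exp (- e * t)) * indicator {0<..} t \<partial>lborel) \<le> ennreal (1 / e)"
proof -
  have "(\<integral>\<^sup>+t. ennreal (exp (- e * t)) * indicator {0<..} t \<partial>lborel) \<le> (\<integral>\<^sup>+t. ennreal (exp (- e * t)) * indicator {0..} t \<partial>lborel)"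
    by (intro nn_integral_mono) (auto split: split_indicator)
  also have "\<dots> \<le> ennreal (1 / e)"
  proof (rule nn_integral_atLeast_le[where g = "\<lambda>t. exp (- e * t)" and F = "\<lambda>t. - exp (- e * t) / e" and T = 0])
    show "((\<lambda>t. - exp (- e * t) / e) \<longlongrightarrow> 0) at_top" using assms by real_asymp
  qed (use assms in \<open>auto intro!: derivative_eq_intros\<close>)
  finally show ?thesis .
qed

lemma green_integrable:
  assumes "0 < Im l"
  shows "set_integrable lborel {0<..} (\<lambda>t. exp (\<i> * l * of_real t) * propagator t n)"
  unfolding set_integrable_def
proof (rule integrableI_bounded)
  have "(\<integral>\<^sup>+t. ennreal (norm (indicator {0<..} t *\<^sub>R (exp (\<i> * l * of_real t) * propagator t n))) \<partial>lborel)
     \<le> (\<integral>\<^sup>+t. ennreal (exp (- Im l * t)) * indicator {0<..} t \<partial>lborel)"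
  proof (intro nn_integral_mono)
    fix t :: real
    have "cmod (exp (\<i> * l * of_real t) * propagator t n) \<le> exp (- Im l * t) * 1"
      unfolding norm_mult norm_exp_i_mult by (intro mult_left_mono norm_propagator_le_1) auto
    then show "ennreal (norm (indicator {0<..} t *\<^sub>R (exp (\<i> * l * of_real t) * propagator t n))) \<le> ennreal (exp (- Im l * t)) * indicator {0<..} t"
      by (auto split: split_indicator intro!: ennreal_leI)
  qed
  also have "\<dots> < \<infinity>" using exp_decay_nn_integral[OF assms] by (simp add: le_less_trans)
  finally show "(\<integral>\<^sup>+t. ennreal (norm (indicator {0<..} t *\<^sub>R (exp (\<i> * l * of_real t) * propagator t n))) \<partial>lborel) < \<infinity>" .
qed measurable

text \<open>The fundamental theorem of calculus for exp (i l t) times the propagator: its derivative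
  is the integrand of the left side up to sign, its value at 0 is the delta, and it decays
  exponentially at infinity.\<close>

lemma green_equation:
  fixes n :: "int ^ 'd::finite"
  assumes l: "0 < Im l"
  shows "laplacian_fun (green l) n - l * green l n = (if n = 0 then 1 else 0)"
proof -
  let ?F = "\<lambda>t. exp (\<i> * l * of_real t) * propagator t n"
  let ?f = "\<lambda>t. \<i> * (l * exp (\<i> * l * of_real t) * propagator t n - exp (\<i> * l * of_real t) * laplacian_fun (propagator t) n)"
  have int: "set_integrable lborel {0<..} (\<lambda>t. exp (\<i> * l * of_real t) * propagator t m)" for m :: "int ^ 'd"
    by (rule green_integrable[OF l])
  have lapl: "exp (\<i> * l * of_real t) * laplacian_fun (propagator t) n
     = (1/2) * (\<Sum>m\<in>neighbours n. exp (\<i> * l * of_real t) * propagator t m)" for t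
    by (simp add: laplacian_fun_def sum_distrib_left)
  have i2: "set_integrable lborel {0<..} (\<lambda>t. exp (\<i> * l * of_real t) * laplacian_fun (propagator t) n)"
    unfolding lapl using int
    by (intro set_integrable_mult_right)
      (auto simp: set_integrable_def scaleR_sum_right intro!: Bochner_Integration.integrable_sum)
  have v2: "(LINT t:{0<..}|lborel. exp (\<i> * l * of_real t) * laplacian_fun (propagator t) n)
     = (1/2) * (\<Sum>m\<in>neighbours n. (LINT t:{0<..}|lborel. exp (\<i> * l * of_real t) * propagator t m))"
    unfolding lapl using int
    by (subst set_integral_mult_right)
      (simp add: set_integrable_def set_lebesgue_integral_def scaleR_sum_right Bochner_Integration.integral_sum)
  have i1: "set_integrable lborel {0<..} (\<lambda>t. l * exp (\<i> * l * of_real t) * propagator t n)"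
    using set_integrable_mult_right[OF int, of l] by (simp add: mult.assoc)
  have v1: "(LINT t:{0<..}|lborel. l * exp (\<i> * l * of_real t) * propagator t n) = l * (LINT t:{0<..}|lborel. exp (\<i> * l * of_real t) * propagator t n)"
    by (simp add: mult.assoc)
  have fi: "set_integrable lborel {0<..} ?f" by (intro set_integrable_mult_right set_integral_diff(1) i1 i2)
  have "(LBINT t=0..\<infinity>. ?f t) = 0 - (if n = 0 then 1 else 0)"
  proof (rule interval_integral_FTC_integrable[where F = ?F])
    fix t :: real
    have "((\<lambda>t. exp (\<i> * l * of_real t)) has_vector_derivative \<i> * l * exp (\<i> * l * of_real t)) (at t)"
    proof -
      have "((\<lambda>z. exp (\<i> * l * z)) has_field_derivative (exp (\<i> * l * of_real t) * (\<i> * l))) (at (of_real t))"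
        by (auto intro!: derivative_eq_intros)
      from has_vector_derivative_real_field[OF this] show ?thesis by (simp add: mult.commute)
    qed
    from has_vector_derivative_mult[OF this propagator_deriv, of n]
    show "(?F has_vector_derivative ?f t) (at t)" by (simp add: algebra_simps)
    show "isCont ?f t"
      unfolding lapl by (intro continuous_intros continuous_on_interior[where S = UNIV] continuous_on_propagator) auto
  next
    show "set_integrable lborel (einterval 0 \<infinity>) ?f" using fi by (simp add: zero_ereal_def)
    have "continuous_on UNIV ?F" by (intro continuous_intros)
    then have "(?F \<longlongrightarrow> ?F 0) (at 0)" unfolding continuous_on_def by blast
    then have "(?F \<longlongrightarrow> (if n = 0 then 1 else 0)) (at_right 0)"
      by (simp add: propagator_0 filterlim_at_split)
    then show "((?F \<circ> real_of_ereal) \<longlongrightarrow> (if n = 0 then 1 else 0)) (at_right 0)"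
      by (simp add: zero_ereal_def ereal_tendsto_simps)
    have "((\<lambda>t. exp (- Im l * t)) \<longlongrightarrow> 0) at_top" using l by real_asymp
    then have "(?F \<longlongrightarrow> 0) at_top"
    proof (rule Lim_null_comparison[rotated])
      show "\<forall>\<^sub>F t in at_top. norm (?F t) \<le> exp (- Im l * t)"
        unfolding norm_mult norm_exp_i_mult
        by (intro always_eventually allI mult_left_le norm_propagator_le_1) auto
    qed
    then show "((?F \<circ> real_of_ereal) \<longlongrightarrow> 0) (at_left \<infinity>)" by (simp add: ereal_tendsto_simps)
  qed auto
  moreover have "(LBINT t=0..\<infinity>. ?f t) = (LINT t:{0<..}|lborel. ?f t)"
    by (simp add: interval_lebesgue_integral_def zero_ereal_def)
  moreover have "(LINT t:{0<..}|lborel. ?f t) = \<i> * (l * (LINT t:{0<..}|lborel. exp (\<i> * l * of_real t) * propagator t n)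
      - (1/2) * (\<Sum>m\<in>neighbours n. (LINT t:{0<..}|lborel. exp (\<i> * l * of_real t) * propagator t m)))"
    by (subst set_integral_mult_right, subst set_integral_diff(2)[OF i1 i2]) (simp add: v1 v2)
  ultimately have "\<i> * (l * (LINT t:{0<..}|lborel. exp (\<i> * l * of_real t) * propagator t n)
      - (1/2) * (\<Sum>m\<in>neighbours n. (LINT t:{0<..}|lborel. exp (\<i> * l * of_real t) * propagator t m)))
      = - (if n = 0 then 1 else 0)" by simp
  then show ?thesis by (simp add: laplacian_fun_def green_def sum_distrib_left algebra_simps minus_equation_iff)
qed

lemma norm_green_le:
  "ennreal (cmod (green l n)) \<le> (\<integral>\<^sup>+t. ennreal (exp (- Im l * t) * cmod (propagator t n)) * indicator {0<..} t \<partial>lborel)"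
proof -
  have "ennreal (cmod (green l n)) \<le> (\<integral>\<^sup>+t. ennreal (norm (indicator {0<..} t *\<^sub>R (exp (\<i> * l * of_real t) * propagator t n))) \<partial>lborel)"
  proof (cases "integrable lborel (\<lambda>t. indicator {0<..} t *\<^sub>R (exp (\<i> * l * of_real t) * propagator t n))")
    case True
    from integral_norm_bound_ennreal[OF this] show ?thesis
      by (simp only: green_def norm_mult[of \<i>] set_lebesgue_integral_def norm_ii mult_1_left)
  qed (simp add: green_def set_lebesgue_integral_def not_integrable_integral_eq)
  also have "\<dots> = (\<integral>\<^sup>+t. ennreal (exp (- Im l * t) * cmod (propagator t n)) * indicator {0<..} t \<partial>lborel)"
    by (intro nn_integral_cong) (auto simp: norm_mult norm_exp_i_mult simp del: norm_exp_eq_Re split: split_indicator)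
  finally show ?thesis .
qed

lemma norm_green_le_kernel_bound:
  assumes "0 \<le> Im l" shows "ennreal (cmod (green l n)) \<le> kernel_bound n"
proof -
  have "ennreal (cmod (green l n)) \<le> (\<integral>\<^sup>+t. ennreal (exp (- Im l * t) * cmod (propagator t n)) * indicator {0<..} t \<partial>lborel)"
    by (rule norm_green_le)
  also have "\<dots> \<le> kernel_bound n"
    unfolding kernel_bound_def
  proof (intro nn_integral_mono)
    fix t :: real
    have "exp (- Im l * t) * cmod (propagator t n) \<le> 1 * cmod (propagator t n)" if "0 < t"
      using assms that by (intro mult_right_mono) auto
    then show "ennreal (exp (- Im l * t) * cmod (propagator t n)) * indicator {0<..} t
      \<le> ennreal (\<Prod>i\<in>UNIV. \<bar>bessel_j (n $ i) t\<bar>) * indicator {0..} t"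
      by (auto simp: norm_propagator intro!: ennreal_leI split: split_indicator)
  qed
  finally show ?thesis .
qed

text \<open>Square summability is what allows the Green function to be recognized as a column of the
  resolvent. The exponential weight is shared equally between the two factors of Cauchy-Schwarz,
  after which the squares of the propagator sum to at most 1.\<close>

lemma sum_green_sq_le:
  assumes l: "0 < Im l" and S: "finite S"
  shows "(\<Sum>n\<in>S. (cmod (green l n))\<^sup>2) \<le> (1 / Im l)\<^sup>2"
proof -
  let ?i = "\<lambda>t::real. indicator {0<..} t :: ennreal" and ?e = "Im l"
  let ?E = "\<integral>\<^sup>+t. ennreal (exp (- ?e * t)) * ?i t \<partial>lborel"
  have sq: "(ennreal x)\<^sup>2 = ennreal (x\<^sup>2)" if "0 \<le> x" for x using that by (simp add: ennreal_power)
  have ex': "(exp (- (?e * t / 2)))\<^sup>2 = exp (- (?e * t))" for t by (simp add: power2_eq_square flip: exp_add)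
  then have ex: "(exp (- ?e * t / 2))\<^sup>2 = exp (- ?e * t)" for t by simp
  have 1: "ennreal ((cmod (green l n))\<^sup>2) \<le> ?E * (\<integral>\<^sup>+t. ennreal (exp (- ?e * t) * (cmod (propagator t n))\<^sup>2) * ?i t \<partial>lborel)" for n
  proof -
    let ?f = "\<lambda>t. ennreal (exp (- ?e * t / 2)) * ?i t" and ?g = "\<lambda>t. ennreal (exp (- ?e * t / 2) * cmod (propagator t n)) * ?i t"
    have "ennreal ((cmod (green l n))\<^sup>2) = (ennreal (cmod (green l n)))\<^sup>2" by (simp add: sq)
    also have "\<dots> \<le> (\<integral>\<^sup>+t. ennreal (exp (- ?e * t) * cmod (propagator t n)) * ?i t \<partial>lborel)\<^sup>2"
      by (intro power_mono norm_green_le) simp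
    also have "(\<integral>\<^sup>+t. ennreal (exp (- ?e * t) * cmod (propagator t n)) * ?i t \<partial>lborel) = (\<integral>\<^sup>+t. ?f t * ?g t \<partial>lborel)"
    proof (intro nn_integral_cong)
      fix t :: real
      have "exp (- ?e * t) * cmod (propagator t n) = exp (- ?e * t / 2) * (exp (- ?e * t / 2) * cmod (propagator t n))"
        using ex[of t] by (simp add: power2_eq_square)
      then show "ennreal (exp (- ?e * t) * cmod (propagator t n)) * ?i t = ?f t * ?g t"
        by (auto split: split_indicator simp: ennreal_mult'[symmetric])
    qed
    also have "\<dots>\<^sup>2 \<le> (\<integral>\<^sup>+t. (?f t)\<^sup>2 \<partial>lborel) * (\<integral>\<^sup>+t. (?g t)\<^sup>2 \<partial>lborel)"
      by (rule Cauchy_Schwarz_nn_integral) measurable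
    also have "(\<integral>\<^sup>+t. (?f t)\<^sup>2 \<partial>lborel) = ?E"
      by (intro nn_integral_cong) (auto split: split_indicator simp: power_mult_distrib sq ex')
    also have "(\<integral>\<^sup>+t. (?g t)\<^sup>2 \<partial>lborel) = (\<integral>\<^sup>+t. ennreal (exp (- ?e * t) * (cmod (propagator t n))\<^sup>2) * ?i t \<partial>lborel)"
      by (intro nn_integral_cong) (auto split: split_indicator simp: power_mult_distrib sq ex')
    finally show ?thesis .
  qed
  have "ennreal (\<Sum>n\<in>S. (cmod (green l n))\<^sup>2) = (\<Sum>n\<in>S. ennreal ((cmod (green l n))\<^sup>2))" by (simp add: sum_ennreal)
  also have "\<dots> \<le> (\<Sum>n\<in>S. ?E * (\<integral>\<^sup>+t. ennreal (exp (- ?e * t) * (cmod (propagator t n))\<^sup>2) * ?i t \<partial>lborel))"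
    by (intro sum_mono 1)
  also have "\<dots> = ?E * (\<integral>\<^sup>+t. (\<Sum>n\<in>S. ennreal (exp (- ?e * t) * (cmod (propagator t n))\<^sup>2) * ?i t) \<partial>lborel)"
    by (subst nn_integral_sum) (auto simp: sum_distrib_left)
  also have "\<dots> \<le> ?E * ?E"
  proof (intro mult_left_mono nn_integral_mono)
    fix t :: real
    have "(\<Sum>n\<in>S. exp (- ?e * t) * (cmod (propagator t n))\<^sup>2) = exp (- ?e * t) * (\<Sum>n\<in>S. (cmod (propagator t n))\<^sup>2)"
      by (simp add: sum_distrib_left)
    also have "\<dots> \<le> exp (- ?e * t) * 1" by (intro mult_left_mono sum_propagator_sq_le_1 S) auto
    finally have "ennreal (\<Sum>n\<in>S. exp (- ?e * t) * (cmod (propagator t n))\<^sup>2) \<le> ennreal (exp (- ?e * t))" by (simp add: ennreal_leI)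
    then show "(\<Sum>n\<in>S. ennreal (exp (- ?e * t) * (cmod (propagator t n))\<^sup>2) * ?i t) \<le> ennreal (exp (- ?e * t)) * ?i t"
      by (auto split: split_indicator simp: sum_ennreal)
  qed simp
  also have "\<dots> \<le> ennreal (1 / ?e) * ennreal (1 / ?e)"
    by (intro mult_mono exp_decay_nn_integral l) auto
  also have "\<dots> = ennreal ((1 / ?e)\<^sup>2)" using l by (simp add: power2_eq_square ennreal_mult'[symmetric])
  finally show ?thesis by (subst (asm) ennreal_le_iff) auto
qed

text \<open>Dominated convergence with the modulus of the propagator as majorant, integrable by
  \<open>kernel_bound_finite\<close>. The boundary point may lie inside the spectrum.\<close>

lemma green_tendsto_boundary:
  fixes n :: "int ^ 'd::finite"
  assumes d: "3 \<le> CARD('d)" and x: "Im x = 0"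
  shows "((\<lambda>l. green l n) \<longlongrightarrow> green x n) (at x within {l. 0 < Im l})"
  unfolding tendsto_at_iff_sequentially
proof (intro allI impI)
  fix X :: "nat \<Rightarrow> complex"
  assume X: "\<forall>i. X i \<in> {l. 0 < Im l} - {x}" "X \<longlonglongrightarrow> x"
  have "(\<lambda>k. LINT t|lborel. indicator {0<..} t *\<^sub>R (exp (\<i> * X k * of_real t) * propagator t n))
    \<longlonglongrightarrow> (LINT t|lborel. indicator {0<..} t *\<^sub>R (exp (\<i> * x * of_real t) * propagator t n))"
  proof (rule integral_dominated_convergence[where w = "\<lambda>t. indicator {0<..} t * cmod (propagator t n)"])
    show "integrable lborel (\<lambda>t. indicator {0<..} t * cmod (propagator t n))"
    proof (rule integrableI_bounded)
      have "(\<integral>\<^sup>+t. ennreal (norm (indicator {0<..} t * cmod (propagator t n))) \<partial>lborel) \<le> kernel_bound n"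
        unfolding kernel_bound_def norm_propagator
        by (intro nn_integral_mono) (auto split: split_indicator simp: abs_prod)
      also have "\<dots> < \<infinity>" by (rule kernel_bound_finite[OF d])
      finally show "(\<integral>\<^sup>+t. ennreal (norm (indicator {0<..} t * cmod (propagator t n))) \<partial>lborel) < \<infinity>" .
    qed measurable
    show "AE t in lborel. (\<lambda>k. indicator {0<..} t *\<^sub>R (exp (\<i> * X k * of_real t) * propagator t n)) \<longlonglongrightarrow> indicator {0<..} t *\<^sub>R (exp (\<i> * x * of_real t) * propagator t n)"
      by (intro AE_I2 tendsto_intros X)
    fix k
    show "AE t in lborel. norm (indicator {0<..} t *\<^sub>R (exp (\<i> * X k * of_real t) * propagator t n)) \<le> indicator {0<..} t * cmod (propagator t n)"
    proof (intro AE_I2)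
      fix t :: real
      have "0 \<le> Im (X k)" using X(1) by (auto intro: less_imp_le)
      then have "cmod (exp (\<i> * X k * of_real t) * propagator t n) \<le> 1 * cmod (propagator t n)" if "0 < t"
        unfolding norm_mult norm_exp_i_mult using that by (intro mult_right_mono) auto
      then show "norm (indicator {0<..} t *\<^sub>R (exp (\<i> * X k * of_real t) * propagator t n)) \<le> indicator {0<..} t * cmod (propagator t n)"
        by (auto split: split_indicator)
    qed
  qed measurable
  then show "((\<lambda>l. green l n) \<circ> X) \<longlonglongrightarrow> green x n"
    unfolding comp_def green_def set_lebesgue_integral_def by (rule tendsto_mult_left)
qed
section \<open>The free resolvent\<close>

abbreviation scalar_op :: "complex \<Rightarrow> 'i ell2_op" where "scalar_op c \<equiv> mult_op (\<lambda>_. c)"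

lemma ell2_eqI: "(\<And>n. ell2_fun f n = ell2_fun g n) \<Longrightarrow> f = g"
  by (simp add: fun_eq_iff flip: ell2_fun_inject)

lemma scalar_op_apply [simp]: "ell2_fun (scalar_op c f) n = c * ell2_fun f n"
  by (rule mult_op_apply) simp

lemma norm_scalar_op_apply: "norm (scalar_op c f) = cmod c * norm f"
proof -
  have "(\<Sum>\<^sub>\<infinity>x. (cmod (c * ell2_fun f x))\<^sup>2) = (cmod c)\<^sup>2 * (\<Sum>\<^sub>\<infinity>x. (cmod (ell2_fun f x))\<^sup>2)"
    by (simp add: norm_mult power_mult_distrib infsum_cmult_right')
  then show ?thesis by (simp add: norm_ell2_def real_sqrt_mult)
qed

lemma norm_scalar_op_le: "norm (scalar_op c) \<le> cmod c"
  by (rule norm_blinfun_bound) (simp_all add: norm_scalar_op_apply)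

lemma scalar_op_diff: "scalar_op (a - b) = scalar_op a - scalar_op b"
  by (intro blinfun_eqI ell2_eqI) (simp add: minus_blinfun.rep_eq minus_ell2.rep_eq left_diff_distrib)

lemma scalar_op_compose: "scalar_op a o\<^sub>L scalar_op b = scalar_op (a * b)"
  by (intro blinfun_eqI ell2_eqI) simp

lemma scalar_op_1: "scalar_op 1 = id_blinfun"
  by (intro blinfun_eqI ell2_eqI) simp

lemma scalar_op_uminus: "scalar_op (- a) = - scalar_op a"
  by (intro blinfun_eqI ell2_eqI) (simp add: uminus_blinfun.rep_eq uminus_ell2.rep_eq)

text \<open>Operators are real-linear maps by type, and matrix entries multiply under composition
  only if complex scalars can be pulled out. The form as a commutation relation lets the property
  pass to exponentials through \<open>exp_commute_algebra\<close>.\<close>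

definition complex_linear_op :: "'i ell2_op \<Rightarrow> bool"
  where "complex_linear_op T \<longleftrightarrow> (\<forall>c. T o\<^sub>L scalar_op c = scalar_op c o\<^sub>L T)"

lemma complex_linear_opD:
  fixes T :: "'i ell2_op" shows "complex_linear_op T \<Longrightarrow> T (scalar_op c f) = scalar_op c (T f)"
  unfolding complex_linear_op_def by (metis (full_types) blinfun_apply_blinfun_compose)

lemma complex_linear_opI:
  fixes T :: "'i ell2_op" shows "(\<And>c f n. ell2_fun (T (scalar_op c f)) n = c * ell2_fun (T f) n) \<Longrightarrow> complex_linear_op T"
  unfolding complex_linear_op_def by (intro allI blinfun_eqI ell2_eqI) simp

lemma complex_linear_op_apply:
  fixes T :: "'i ell2_op" shows "complex_linear_op T \<Longrightarrow> ell2_fun (T (scalar_op c f)) n = c * ell2_fun (T f) n"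
  by (simp add: complex_linear_opD)

lemma complex_linear_op_compose:
  "complex_linear_op S \<Longrightarrow> complex_linear_op T \<Longrightarrow> complex_linear_op (S o\<^sub>L T)"
  by (rule complex_linear_opI) (simp add: complex_linear_opD)

lemma complex_linear_op_add:
  "complex_linear_op S \<Longrightarrow> complex_linear_op T \<Longrightarrow> complex_linear_op (S + T)"
  by (rule complex_linear_opI) (simp add: complex_linear_opD plus_blinfun.rep_eq plus_ell2.rep_eq distrib_left)

lemma complex_linear_op_diff:
  "complex_linear_op S \<Longrightarrow> complex_linear_op T \<Longrightarrow> complex_linear_op (S - T)"
  by (rule complex_linear_opI) (simp add: complex_linear_opD minus_blinfun.rep_eq minus_ell2.rep_eq right_diff_distrib)

lemma complex_linear_op_uminus: "complex_linear_op S \<Longrightarrow> complex_linear_op (- S)"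
  by (rule complex_linear_opI) (simp add: complex_linear_opD uminus_blinfun.rep_eq uminus_ell2.rep_eq)

lemma complex_linear_op_scaleR: "complex_linear_op S \<Longrightarrow> complex_linear_op (r *\<^sub>R S)"
  by (rule complex_linear_opI) (simp add: complex_linear_opD scaleR_blinfun.rep_eq scaleR_ell2.rep_eq)

lemma complex_linear_op_mult_op: "bounded (range V) \<Longrightarrow> complex_linear_op (mult_op V)"
  by (rule complex_linear_opI) (simp add: mult_op_apply)

lemma complex_linear_op_id: "complex_linear_op id_blinfun"
  by (rule complex_linear_opI) simp

lemma complex_linear_op_laplacian: "complex_linear_op laplacian"
  by (rule complex_linear_opI) (simp add: laplacian_apply sum_distrib_left mult_ac)

lemma op_inverseI:
  fixes A B :: "'i ell2_op"
  assumes "A o\<^sub>L B = id_blinfun" "B o\<^sub>L A = id_blinfun"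
  shows "op_inverse A = B"
  unfolding op_inverse_def
proof (rule the_equality)
  fix C assume C: "A o\<^sub>L C = id_blinfun \<and> C o\<^sub>L A = id_blinfun"
  have "C = (B o\<^sub>L A) o\<^sub>L C" using assms by (simp add: blinfun_eqI)
  also have "\<dots> = B o\<^sub>L (A o\<^sub>L C)" by (rule blinfun_eqI) simp
  also have "\<dots> = B" using C by (simp add: blinfun_eqI)
  finally show "C = B" .
qed (use assms in auto)

section \<open>Invertibility of Delta - lambda off the spectrum\<close>

definition invertible_op :: "'i ell2_op \<Rightarrow> bool"
  where "invertible_op A \<longleftrightarrow> (\<exists>B. A o\<^sub>L B = id_blinfun \<and> B o\<^sub>L A = id_blinfun)"

lemma op_inverse:
  assumes "invertible_op A"
  shows "A o\<^sub>L op_inverse A = id_blinfun" "op_inverse A o\<^sub>L A = id_blinfun"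
proof -
  obtain B where B: "A o\<^sub>L B = id_blinfun" "B o\<^sub>L A = id_blinfun" using assms by (auto simp: invertible_op_def)
  from op_inverseI[OF this] B show "A o\<^sub>L op_inverse A = id_blinfun" "op_inverse A o\<^sub>L A = id_blinfun" by simp_all
qed

lemma op_inverse_apply:
  fixes A :: "'i ell2_op"
  assumes "invertible_op A"
  shows "A (op_inverse A f) = f" "op_inverse A (A f) = f"
  using arg_cong[OF op_inverse(1)[OF assms], of "\<lambda>T. blinfun_apply T f"]
    arg_cong[OF op_inverse(2)[OF assms], of "\<lambda>T. blinfun_apply T f"] by simp_all

lemma norm_op_inverse_le:
  fixes A :: "'i ell2_op"
  assumes "invertible_op A" "0 < c" "\<And>f. c * norm f \<le> norm (A f)"
  shows "norm (op_inverse A) \<le> 1 / c"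
proof (rule norm_blinfun_bound)
  fix f
  have "c * norm (op_inverse A f) \<le> norm f" using assms(3)[of "op_inverse A f"] op_inverse_apply[OF assms(1)] by simp
  then show "norm (op_inverse A f) \<le> 1 / c * norm f" using assms(2) by (simp add: field_simps)
qed (use assms in auto)

text \<open>Neumann's argument in fixed point form: with B the inverse of A, the equation (A + T) x
  = y says x = B y - B T x, and the right side is a contraction in x.\<close>

lemma invertible_op_perturb:
  fixes A T :: "'i ell2_op"
  assumes A: "invertible_op A" and small: "norm (op_inverse A) * norm T < 1"
  shows "invertible_op (A + T)"
proof -
  define B where "B = op_inverse A"
  define q where "q = norm B * norm T"
  have q: "0 \<le> q" "q < 1" using small by (simp_all add: q_def B_def)
  have BT: "norm (B (T x)) \<le> q * norm x" for x
  proof -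
    have "norm (B (T x)) \<le> norm B * norm (T x)" by (rule norm_blinfun)
    also have "\<dots> \<le> norm B * (norm T * norm x)" by (intro mult_left_mono norm_blinfun) auto
    finally show ?thesis by (simp add: q_def mult.assoc)
  qed
  have AB: "A (B y) = y" "B (A x) = x" for x y using op_inverse_apply[OF A] by (simp_all add: B_def)
  have eq: "(A + T) x = y \<longleftrightarrow> B y - B (T x) = x" for x y
  proof
    assume "(A + T) x = y"
    then have "B y = B (A x + T x)" by (simp add: plus_blinfun.rep_eq)
    then have "B y = B (A x) + B (T x)" by (simp add: blinfun.add_right)
    then show "B y - B (T x) = x" by (simp add: AB)
  next
    assume "B y - B (T x) = x"
    then have "A x = A (B y) - A (B (T x))" by (simp flip: blinfun.diff_right)
    then show "(A + T) x = y" by (simp add: AB plus_blinfun.rep_eq)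
  qed
  have ex1: "\<exists>!x. (A + T) x = y" for y
  proof -
    have "\<exists>!x. B y - B (T x) = x"
    proof (rule banach_fix_type[OF q], intro allI)
      fix x z
      have "dist (B y - B (T x)) (B y - B (T z)) = norm (B (T (z - x)))"
        by (simp add: dist_norm blinfun.diff_right)
      also have "\<dots> \<le> q * norm (z - x)" by (rule BT)
      finally show "dist (B y - B (T x)) (B y - B (T z)) \<le> q * dist x z" by (simp add: dist_norm norm_minus_commute)
    qed
    then show ?thesis by (simp add: eq)
  qed
  define S where "S = (\<lambda>y. THE x. (A + T) x = y)"
  have S: "(A + T) (S y) = y" for y unfolding S_def by (rule theI'[OF ex1])
  have S': "S ((A + T) x) = x" for x using ex1[of "(A + T) x"] S by blast
  have bl: "bounded_linear S"
  proof (rule bounded_linear_intro[where K = "norm B / (1 - q)"])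
    fix x y :: "'i ell2" and r :: real
    show "S (x + y) = S x + S y" using S'[of "S x + S y"] by (simp add: blinfun.add_right S)
    show "S (r *\<^sub>R x) = r *\<^sub>R S x" using S'[of "r *\<^sub>R S x"] by (simp add: blinfun.scaleR_right S)
    have "S x = B x - B (T (S x))" using eq[of "S x" x] S[of x] by simp
    then have "norm (S x) \<le> norm (B x) + norm (B (T (S x)))" using norm_triangle_ineq4[of "B x" "B (T (S x))"] by simp
    also have "\<dots> \<le> norm B * norm x + q * norm (S x)" by (intro add_mono norm_blinfun BT)
    finally have "(1 - q) * norm (S x) \<le> norm B * norm x" by (simp add: algebra_simps)
    then show "norm (S x) \<le> norm x * (norm B / (1 - q))" using q by (simp add: field_simps)
  qed
  have "(A + T) o\<^sub>L Blinfun S = id_blinfun" "Blinfun S o\<^sub>L (A + T) = id_blinfun"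
    using bl by (auto intro!: blinfun_eqI simp: bounded_linear_Blinfun_apply S S')
  then show ?thesis by (auto simp: invertible_op_def)
qed

lemma op_inverse_scalar:
  assumes "c \<noteq> 0"
  shows "invertible_op (scalar_op c)" "op_inverse (scalar_op c) = scalar_op (1 / c)"
proof -
  have "scalar_op c o\<^sub>L scalar_op (1 / c) = id_blinfun" "scalar_op (1 / c) o\<^sub>L scalar_op c = id_blinfun"
    using assms by (simp_all add: scalar_op_compose scalar_op_1)
  then show "invertible_op (scalar_op c)" "op_inverse (scalar_op c) = scalar_op (1 / c)"
    by (auto simp: invertible_op_def intro: op_inverseI)
qed

lemma ell2_fun_translate: "ell2_fun (ell2_translate e f) n = ell2_fun f (n + e)"
  by (simp add: ell2_translate.rep_eq)

lemma norm_translate [simp]: "norm (ell2_translate e f) = norm f"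
  using ell2_shift(2)[of f e] by (simp add: ell2_translate_def)

lemma laplacian_eq_translates:
  "laplacian f = (1/2) *\<^sub>R (\<Sum>e\<in>neighbours 0. ell2_translate e f)"
  by (simp add: laplacian.rep_eq laplacian_fun_eq ell2_fun_inverse)

lemma norm_laplacian_le: "norm (laplacian :: (int ^ 'd::finite) ell2_op) \<le> CARD('d)"
proof (rule norm_blinfun_bound)
  fix f :: "(int ^ 'd) ell2"
  have "norm (laplacian f) \<le> (1/2) * (\<Sum>e\<in>neighbours (0 :: int ^ 'd). norm (ell2_translate e f))"
    unfolding laplacian_eq_translates using norm_sum[of "\<lambda>e. ell2_translate e f" "neighbours 0"] by simp
  then show "norm (laplacian f) \<le> real CARD('d) * norm f" by (simp add: card_neighbours)
qed auto

lemma inner_ell2_scalar_i: "f \<bullet> scalar_op \<i> g = - (scalar_op \<i> f \<bullet> g)"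
  unfolding inner_ell2_def by (simp add: inner_complex_def algebra_simps flip: infsum_uminus)

lemma inner_translate: "ell2_translate e f \<bullet> g = f \<bullet> ell2_translate (- e) g"
proof -
  have "bij_betw (\<lambda>n. n + e) UNIV UNIV"
    by (rule bij_betw_byWitness[where f' = "\<lambda>n. n - e"]) auto
  from infsum_reindex_bij_betw[OF this, of "\<lambda>n. ell2_fun f n \<bullet> ell2_fun g (n - e)"]
  show ?thesis unfolding inner_ell2_def by (simp add: ell2_fun_translate)
qed

lemma uminus_neighbours_0: "uminus ` neighbours (0 :: int ^ 'd::finite) = neighbours 0"
proof -
  have "- e \<in> neighbours 0" if "e \<in> neighbours 0" for e :: "int ^ 'd"
    using that by (simp add: neighbours_def)
  note nb = this
  show ?thesis
  proof (intro equalityI subsetI)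
    fix e :: "int ^ 'd" assume "e \<in> neighbours 0"
    then have "- e \<in> neighbours 0" by (rule nb)
    then have "- (- e) \<in> uminus ` neighbours 0" by (rule imageI)
    then show "e \<in> uminus ` neighbours 0" by simp
  qed (use nb in auto)
qed

lemma inner_laplacian: "laplacian f \<bullet> g = f \<bullet> laplacian g"
proof -
  have "(\<Sum>e\<in>neighbours 0. ell2_translate e f \<bullet> g) = (\<Sum>e\<in>neighbours 0. f \<bullet> ell2_translate (- e) g)"
    by (simp add: inner_translate)
  also have "\<dots> = (\<Sum>e\<in>uminus ` neighbours 0. f \<bullet> ell2_translate e g)"
    by (subst sum.reindex) (auto simp: inj_on_def)
  finally show ?thesis
    by (simp add: laplacian_eq_translates inner_sum_left inner_sum_right uminus_neighbours_0)
qed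

text \<open>Delta is symmetric, so (Delta - Re l) f is orthogonal to i f in the real inner product.
  By Pythagoras the norm is at least that of the component Im l times i f.\<close>

lemma norm_laplacian_minus_ge:
  "\<bar>Im l\<bar> * norm f \<le> norm ((laplacian - scalar_op l) f)"
proof -
  define g where "g = laplacian f - Re l *\<^sub>R f"
  define h where "h = Im l *\<^sub>R scalar_op \<i> f"
  have split: "(laplacian - scalar_op l) f = g - h"
    by (rule ell2_eqI) (simp add: g_def h_def minus_blinfun.rep_eq minus_ell2.rep_eq plus_ell2.rep_eq scaleR_ell2.rep_eq
        scaleR_conv_of_real complex_eq_iff algebra_simps)
  have sf: "scalar_op \<i> f \<bullet> f = 0" using inner_ell2_scalar_i[of f f] inner_commute[of f "scalar_op \<i> f"] by simp
  have "laplacian f \<bullet> scalar_op \<i> f = 0"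
  proof -
    have "laplacian f \<bullet> scalar_op \<i> f = f \<bullet> laplacian (scalar_op \<i> f)" by (rule inner_laplacian)
    also have "\<dots> = f \<bullet> scalar_op \<i> (laplacian f)" by (simp add: complex_linear_opD complex_linear_op_laplacian)
    also have "\<dots> = - (laplacian f \<bullet> scalar_op \<i> f)"
      using inner_ell2_scalar_i[of f "laplacian f"] inner_commute[of "scalar_op \<i> f" "laplacian f"] by simp
    finally show ?thesis by simp
  qed
  moreover have "f \<bullet> scalar_op \<i> f = 0" using sf by (simp add: inner_commute)
  ultimately have "g \<bullet> h = 0" by (simp add: g_def h_def inner_diff_left)
  then have "(norm (g - h))\<^sup>2 = (norm g)\<^sup>2 + (norm h)\<^sup>2"
    by (simp add: power2_norm_eq_inner inner_diff_left inner_diff_right inner_commute)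
  then have "(norm h)\<^sup>2 \<le> (norm (g - h))\<^sup>2" by simp
  then have "norm h \<le> norm (g - h)" by (rule power2_le_imp_le) simp
  then show ?thesis by (simp add: split h_def norm_scalar_op_apply)
qed

lemma invertible_laplacian_minus_of_large:
  assumes "norm (laplacian :: (int ^ 'd::finite) ell2_op) < cmod l"
  shows "invertible_op ((laplacian :: (int ^ 'd) ell2_op) - scalar_op l)"
proof -
  have l: "l \<noteq> 0" using assms by auto
  have "invertible_op (scalar_op (- l) + (laplacian :: (int ^ 'd) ell2_op))"
  proof (rule invertible_op_perturb)
    have "norm (op_inverse (scalar_op (- l)) :: (int ^ 'd) ell2_op) \<le> 1 / cmod l"
      using norm_scalar_op_le[of "1 / (- l)"] l by (simp add: op_inverse_scalar norm_divide)
    then have "norm (op_inverse (scalar_op (- l)) :: (int ^ 'd) ell2_op) * norm (laplacian :: (int ^ 'd) ell2_op)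
      \<le> 1 / cmod l * norm (laplacian :: (int ^ 'd) ell2_op)" by (rule mult_right_mono) simp
    also have "\<dots> < 1" using assms l by (simp add: divide_less_eq)
    finally show "norm (op_inverse (scalar_op (- l)) :: (int ^ 'd) ell2_op) * norm (laplacian :: (int ^ 'd) ell2_op) < 1" .
  qed (use l in \<open>auto intro: op_inverse_scalar\<close>)
  then show ?thesis by (simp add: scalar_op_uminus)
qed

lemma invertible_laplacian_minus:
  fixes l :: complex
  assumes "l \<in> Lambda_dom CARD('d)"
  shows "invertible_op ((laplacian :: (int ^ 'd::finite) ell2_op) - scalar_op l)"
proof (cases "Im l = 0")
  case True
  then have l: "l = of_real (Re l)" by (simp add: complex_eq_iff)
  have "Re l \<notin> {- real CARD('d)..real CARD('d)}"
  proof
    assume "Re l \<in> {- real CARD('d)..real CARD('d)}"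
    then have "of_real (Re l) \<in> complex_of_real ` {- real CARD('d)..real CARD('d)}" by (rule imageI)
    then show False using assms l by (simp add: Lambda_dom_def)
  qed
  then have "CARD('d) < \<bar>Re l\<bar>" by auto
  also have "\<bar>Re l\<bar> = cmod l" by (subst (2) l) simp
  finally have "norm (laplacian :: (int ^ 'd) ell2_op) < cmod l"
    using norm_laplacian_le[where 'd = 'd] by linarith
  then show ?thesis by (rule invertible_laplacian_minus_of_large)
next
  case False
  let ?L = "laplacian :: (int ^ 'd) ell2_op"
  define s where "s = sgn (Im l)"
  have s: "\<bar>s\<bar> = 1" "s * Im l = \<bar>Im l\<bar>" using False by (auto simp: s_def sgn_real_def)
  \<comment> \<open>The point \<open>l0\<close> lies on the imaginary axis on the same side as l,
    and its resolvent has norm at most 1/K. Perturbation thus reaches the open disk of radius K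
    around \<open>l0\<close>, which touches the real axis; the summand |l|^2 / |Im l| makes the disk
    large enough to contain l.\<close>
  define K where "K = norm ?L + (cmod l)\<^sup>2 / \<bar>Im l\<bar> + 1"
  have K: "K > norm ?L" "K > 0" "(cmod l)\<^sup>2 / \<bar>Im l\<bar> < K"
    using norm_ge_zero[of ?L] by (auto simp: K_def add_nonneg_pos intro!: add_nonneg_pos)
  define l0 where "l0 = \<i> * of_real (s * K)"
  have n0: "cmod l0 = K" using s K by (simp add: l0_def norm_mult abs_mult)
  have Im0: "\<bar>Im l0\<bar> = K" using s K by (simp add: l0_def abs_mult)
  have inv0: "invertible_op (?L - scalar_op l0)"
    by (rule invertible_laplacian_minus_of_large) (use K n0 in simp)
  have nb: "norm (op_inverse (?L - scalar_op l0)) \<le> 1 / K"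
    by (rule norm_op_inverse_le[OF inv0 K(2)]) (use norm_laplacian_minus_ge[of l0] Im0 in simp)
  have "cmod (l0 - l) < K"
  proof (rule power2_less_imp_less)
    have "(cmod (l0 - l))\<^sup>2 = (Re l)\<^sup>2 + (s * K - Im l)\<^sup>2" by (simp add: cmod_power2 l0_def)
    also have "\<dots> = (cmod l)\<^sup>2 + (s * K)\<^sup>2 - 2 * K * (s * Im l)" by (simp add: cmod_power2 power2_diff)
    also have "(s * K)\<^sup>2 = K\<^sup>2" using s by (metis abs_mult mult_1 power2_abs)
    also have "(cmod l)\<^sup>2 + K\<^sup>2 - 2 * K * (s * Im l) < K\<^sup>2"
    proof -
      have "(cmod l)\<^sup>2 < K * \<bar>Im l\<bar>" using K(3) False by (simp add: divide_less_eq)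
      moreover have "0 \<le> K * \<bar>Im l\<bar>" using K by simp
      ultimately show ?thesis unfolding s(2) by simp
    qed
    finally show "(cmod (l0 - l))\<^sup>2 < K\<^sup>2" .
  qed (use K in simp)
  moreover have "norm (scalar_op (l0 - l) :: (int ^ 'd) ell2_op) \<le> cmod (l0 - l)" by (rule norm_scalar_op_le)
  ultimately have "norm (op_inverse (?L - scalar_op l0)) * norm (scalar_op (l0 - l) :: (int ^ 'd) ell2_op) \<le> 1 / K * cmod (l0 - l)"
    using nb K by (intro mult_mono) auto
  also have "\<dots> < 1" using \<open>cmod (l0 - l) < K\<close> K by (simp add: divide_less_eq)
  finally have "invertible_op ((?L - scalar_op l0) + scalar_op (l0 - l))" by (intro invertible_op_perturb inv0)
  then show ?thesis by (simp add: scalar_op_diff)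
qed

context
  fixes l :: complex
  assumes l: "l \<in> Lambda_dom CARD('d::finite)"
begin

lemma free_resolvent_apply:
  "(laplacian - scalar_op l) (free_resolvent l f) = (f :: (int ^ 'd) ell2)"
  "free_resolvent l ((laplacian - scalar_op l) f) = (f :: (int ^ 'd) ell2)"
  unfolding free_resolvent_def by (intro op_inverse_apply invertible_laplacian_minus l)+

lemma complex_linear_free_resolvent: "complex_linear_op (free_resolvent l :: (int ^ 'd) ell2_op)"
proof (rule complex_linear_opI)
  fix c n and f :: "(int ^ 'd) ell2"
  have "complex_linear_op (laplacian - scalar_op l :: (int ^ 'd) ell2_op)"
    by (intro complex_linear_op_diff complex_linear_op_laplacian complex_linear_op_mult_op) simp
  then have "(laplacian - scalar_op l) (scalar_op c (free_resolvent l f)) = scalar_op c f"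
    using free_resolvent_apply(1)[of f] by (simp add: complex_linear_opD)
  then have "free_resolvent l (scalar_op c f) = scalar_op c (free_resolvent l f)"
    using free_resolvent_apply(2)[of "scalar_op c (free_resolvent l f)"] by simp
  then show "ell2_fun (free_resolvent l (scalar_op c f)) n = c * ell2_fun (free_resolvent l f) n" by simp
qed

lemma norm_free_resolvent_le:
  assumes "CARD('d) < cmod l"
  shows "norm (free_resolvent l :: (int ^ 'd) ell2_op) \<le> 1 / (cmod l - CARD('d))"
  unfolding free_resolvent_def
proof (rule norm_op_inverse_le[OF invertible_laplacian_minus[OF l]])
  fix f :: "(int ^ 'd) ell2"
  have "norm (laplacian f) \<le> real CARD('d) * norm f"
    using norm_blinfun[of "laplacian :: (int ^ 'd) ell2_op" f] norm_laplacian_le[where 'd = 'd]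
    by (meson mult_right_mono norm_ge_zero order_trans)
  moreover have "norm (scalar_op l f) - norm (laplacian f) \<le> norm ((laplacian - scalar_op l) f)"
    unfolding minus_blinfun.rep_eq using norm_triangle_ineq2[of "scalar_op l f" "laplacian f"] by (simp add: norm_minus_commute)
  ultimately show "(cmod l - CARD('d)) * norm f \<le> norm ((laplacian - scalar_op l) f)"
    by (simp add: norm_scalar_op_apply left_diff_distrib)
qed (use assms in simp)

end
section \<open>Matrix entries of the resolvent on the unit disk\<close>

lemma norm_ell2_delta [simp]: "norm (ell2_delta n) = 1"
proof -
  have "(\<Sum>\<^sub>\<infinity>x. (cmod (ell2_fun (ell2_delta n) x))\<^sup>2) = (\<Sum>\<^sub>\<infinity>x\<in>{n}. (1::real))"
    by (rule infsum_cong_neutral) (auto simp: ell2_delta.rep_eq)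
  then show ?thesis by (simp add: norm_ell2_def)
qed

lemma norm_matrix_entry_le: "cmod (matrix_entry T m n) \<le> norm T"
  unfolding matrix_entry_def using ell2_coord_le norm_blinfun[of T "ell2_delta n"] by (metis mult.right_neutral norm_ell2_delta order_trans)

lemma free_resolvent_delta_eqI:
  fixes g :: "(int ^ 'd::finite) ell2"
  assumes l: "l \<in> Lambda_dom CARD('d)"
    and g: "\<And>m. laplacian_fun (ell2_fun g) m - l * ell2_fun g m = (if m = n then 1 else 0)"
  shows "free_resolvent l (ell2_delta n) = g"
proof -
  have "(laplacian - scalar_op l) g = ell2_delta n"
    by (rule ell2_eqI) (use g in \<open>simp add: minus_blinfun.rep_eq minus_ell2.rep_eq laplacian_apply laplacian_fun_def ell2_delta.rep_eq\<close>)
  then show ?thesis using free_resolvent_apply(2)[OF l, of g] by simp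
qed

lemma laplacian_fun_shift: "laplacian_fun (\<lambda>m. f (m - n)) m = laplacian_fun f (m - n)"
proof -
  have "(\<Sum>k\<in>neighbours m. f (k - n)) = (\<Sum>k\<in>neighbours (m - n). f k)"
    by (subst neighbours_eq_image[of m], subst neighbours_eq_image[of "m - n"])
      (simp add: sum.reindex inj_on_def algebra_simps)
  then show ?thesis by (simp add: laplacian_fun_def)
qed

lemma laplacian_fun_cnj: "laplacian_fun (\<lambda>m. cnj (f m)) m = cnj (laplacian_fun f m)"
  by (simp add: laplacian_fun_def cnj_sum)

lemma Lambda_domI: "Im l \<noteq> 0 \<Longrightarrow> l \<in> Lambda_dom d"
  by (auto simp: Lambda_dom_def)

lemma green_shift_in_ell2:
  fixes n :: "int ^ 'd::finite"
  assumes "0 < Im l"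
  shows "(\<lambda>m. (cmod (green l (m - n)))\<^sup>2) summable_on UNIV"
proof (rule ell2_bdd_sums(1))
  fix F :: "(int ^ 'd) set" assume F: "finite F"
  have "(\<Sum>m\<in>F. (cmod (green l (m - n)))\<^sup>2) = (\<Sum>m\<in>(\<lambda>m. m - n) ` F. (cmod (green l m))\<^sup>2)"
    by (subst sum.reindex) (auto simp: inj_on_def)
  also have "\<dots> \<le> (1 / Im l)\<^sup>2" using F by (intro sum_green_sq_le assms) auto
  finally show "(\<Sum>m\<in>F. (cmod (green l (m - n)))\<^sup>2) \<le> (1 / Im l)\<^sup>2" .
qed (use assms in auto)

lemma resolvent_entry_upper:
  fixes m n :: "int ^ 'd::finite"
  assumes l: "0 < Im l"
  shows "matrix_entry (free_resolvent l) m n = green l (m - n)"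
proof -
  define g where "g = Abs_ell2 (\<lambda>m. green l (m - n))"
  have g: "ell2_fun g = (\<lambda>m. green l (m - n))"
    using green_shift_in_ell2[OF l, of n] by (simp add: g_def Abs_ell2_inverse)
  have "free_resolvent l (ell2_delta n) = g"
  proof (rule free_resolvent_delta_eqI)
    fix m
    show "laplacian_fun (ell2_fun g) m - l * ell2_fun g m = (if m = n then 1 else 0)"
      using green_equation[OF l, of "m - n"] by (simp add: g laplacian_fun_shift)
  qed (use l in \<open>auto intro: Lambda_domI\<close>)
  then show ?thesis by (simp add: matrix_entry_def g)
qed

text \<open>The defining integral of \<open>green\<close> decays only in the upper half plane. Delta
  has real coefficients, so conjugation carries the column at \<open>cnj l\<close> to the column at
  l.\<close>

lemma resolvent_entry_lower:
  fixes m n :: "int ^ 'd::finite"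
  assumes l: "Im l < 0"
  shows "matrix_entry (free_resolvent l) m n = cnj (green (cnj l) (m - n))"
proof -
  define g where "g = Abs_ell2 (\<lambda>m. cnj (green (cnj l) (m - n)))"
  have l': "0 < Im (cnj l)" using l by simp
  have g: "ell2_fun g = (\<lambda>m. cnj (green (cnj l) (m - n)))"
    using green_shift_in_ell2[OF l', of n] by (simp add: g_def Abs_ell2_inverse)
  have "free_resolvent l (ell2_delta n) = g"
  proof (rule free_resolvent_delta_eqI)
    fix m
    have "laplacian_fun (ell2_fun g) m - l * ell2_fun g m
       = cnj (laplacian_fun (green (cnj l)) (m - n) - cnj l * green (cnj l) (m - n))"
      unfolding g laplacian_fun_cnj laplacian_fun_shift by simp
    then show "laplacian_fun (ell2_fun g) m - l * ell2_fun g m = (if m = n then 1 else 0)"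
      unfolding green_equation[OF l'] by simp
  qed (use l in \<open>auto intro: Lambda_domI\<close>)
  then show ?thesis by (simp add: matrix_entry_def g)
qed

lemma matrix_entry_diff: "matrix_entry (S - T) m n = matrix_entry S m n - matrix_entry T m n"
  by (simp add: matrix_entry_def minus_blinfun.rep_eq minus_ell2.rep_eq)

lemma matrix_entry_add: "matrix_entry (S + T) m n = matrix_entry S m n + matrix_entry T m n"
  by (simp add: matrix_entry_def plus_blinfun.rep_eq plus_ell2.rep_eq)

lemma matrix_entry_scalar_op: "matrix_entry (scalar_op c o\<^sub>L T) m n = c * matrix_entry T m n"
  by (simp add: matrix_entry_def)

lemma resolvent_identity:
  fixes l k :: complex
  assumes l: "l \<in> Lambda_dom CARD('d)" and k: "k \<in> Lambda_dom CARD('d)"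
  shows "(free_resolvent l :: (int ^ 'd::finite) ell2_op) - free_resolvent k
    = scalar_op (l - k) o\<^sub>L (free_resolvent l o\<^sub>L free_resolvent k)"
proof (rule blinfun_eqI)
  fix f :: "(int ^ 'd) ell2"
  let ?f = "free_resolvent k f"
  have e: "laplacian - scalar_op l = (laplacian - scalar_op k) - (scalar_op (l - k) :: (int ^ 'd) ell2_op)"
    by (simp add: scalar_op_diff)
  have "(laplacian - scalar_op l) ?f = f - scalar_op (l - k) ?f"
    unfolding e minus_blinfun.rep_eq[of "laplacian - scalar_op k"] free_resolvent_apply(1)[OF k] ..
  then have "?f = free_resolvent l (f - scalar_op (l - k) ?f)"
    using free_resolvent_apply(2)[OF l, of ?f] by simp
  also have "\<dots> = free_resolvent l f - scalar_op (l - k) (free_resolvent l ?f)"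
    by (simp add: blinfun.diff_right complex_linear_opD[OF complex_linear_free_resolvent[OF l]])
  finally show "blinfun_apply (free_resolvent l - free_resolvent k) f
    = blinfun_apply (scalar_op (l - k) o\<^sub>L (free_resolvent l o\<^sub>L free_resolvent k)) f"
    by (simp add: minus_blinfun.rep_eq algebra_simps)
qed

lemma open_Lambda_dom: "open (Lambda_dom d)"
  unfolding Lambda_dom_def
  by (intro open_Compl compact_imp_closed compact_continuous_image continuous_intros) auto

lemma norm_resolvent_diff_le:
  assumes l: "l \<in> Lambda_dom CARD('d)" and k: "k \<in> Lambda_dom CARD('d)"
    and near: "cmod (l - k) * norm (free_resolvent k :: (int ^ 'd::finite) ell2_op) \<le> 1 / 2"
  shows "norm ((free_resolvent l :: (int ^ 'd) ell2_op) - free_resolvent k)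
    \<le> 2 * cmod (l - k) * (norm (free_resolvent k :: (int ^ 'd) ell2_op))\<^sup>2"
proof -
  let ?R = "\<lambda>l. free_resolvent l :: (int ^ 'd) ell2_op"
  have 1: "norm (?R l - ?R k) \<le> cmod (l - k) * (norm (?R l) * norm (?R k))"
  proof -
    have "norm (?R l - ?R k) \<le> norm (scalar_op (l - k) :: (int ^ 'd) ell2_op) * norm (?R l o\<^sub>L ?R k)"
      unfolding resolvent_identity[OF l k] by (rule norm_blinfun_compose)
    also have "\<dots> \<le> cmod (l - k) * (norm (?R l) * norm (?R k))"
      by (intro mult_mono norm_scalar_op_le norm_blinfun_compose) auto
    finally show ?thesis .
  qed
  have "norm (?R l) \<le> norm (?R k) + norm (?R l - ?R k)" by (metis norm_triangle_sub)
  also have "norm (?R l - ?R k) \<le> (cmod (l - k) * norm (?R k)) * norm (?R l)" using 1 by (simp add: mult_ac)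
  also have "\<dots> \<le> 1 / 2 * norm (?R l)" using near by (intro mult_right_mono) auto
  finally have "norm (?R l) \<le> 2 * norm (?R k)" by simp
  then have "cmod (l - k) * (norm (?R l) * norm (?R k)) \<le> cmod (l - k) * (2 * norm (?R k) * norm (?R k))"
    by (intro mult_left_mono mult_right_mono) auto
  then show ?thesis using 1 by (simp add: power2_eq_square mult_ac)
qed

text \<open>By the resolvent identity the difference quotient is exactly an entry of R(l) R(k), so
  only norm continuity of R remains to be used.\<close>

lemma resolvent_entry_deriv:
  fixes m n :: "int ^ 'd::finite"
  assumes k: "k \<in> Lambda_dom CARD('d)"
  shows "((\<lambda>l. matrix_entry (free_resolvent l) m n) has_field_derivative matrix_entry (free_resolvent k o\<^sub>L free_resolvent k) m n) (at k)"
proof -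
  let ?R = "\<lambda>l. free_resolvent l :: (int ^ 'd) ell2_op"
  define c where "c = norm (?R k)"
  have c: "c \<ge> 0" by (simp add: c_def)
  have ev: "\<forall>\<^sub>F l in at k. l \<in> Lambda_dom CARD('d)"
    using open_Lambda_dom k by (simp add: eventually_at_in_open')
  have ev2: "\<forall>\<^sub>F l in at k. cmod (l - k) * c \<le> 1 / 2"
  proof -
    have "((\<lambda>l. cmod (l - k) * c) \<longlongrightarrow> cmod (k - k) * c) (at k)" by (intro tendsto_intros)
    then have "\<forall>\<^sub>F l in at k. cmod (l - k) * c < 1 / 2" by (rule order_tendstoD) simp
    then show ?thesis by eventually_elim simp
  qed
  have "((\<lambda>l. matrix_entry (?R l o\<^sub>L ?R k) m n - matrix_entry (?R k o\<^sub>L ?R k) m n) \<longlongrightarrow> 0) (at k)"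
  proof (rule Lim_null_comparison)
    show "((\<lambda>l. 2 * cmod (l - k) * c\<^sup>2 * c) \<longlongrightarrow> 0) (at k)" by (auto intro!: tendsto_eq_intros)
    show "\<forall>\<^sub>F l in at k. norm (matrix_entry (?R l o\<^sub>L ?R k) m n - matrix_entry (?R k o\<^sub>L ?R k) m n) \<le> 2 * cmod (l - k) * c\<^sup>2 * c"
      using ev ev2
    proof eventually_elim
      case (elim l)
      have "(?R l o\<^sub>L ?R k) - (?R k o\<^sub>L ?R k) = (?R l - ?R k) o\<^sub>L ?R k"
        by (rule blinfun_eqI) (simp add: minus_blinfun.rep_eq)
      then have "norm (matrix_entry (?R l o\<^sub>L ?R k) m n - matrix_entry (?R k o\<^sub>L ?R k) m n) \<le> norm ((?R l - ?R k) o\<^sub>L ?R k)"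
        using norm_matrix_entry_le[of "(?R l - ?R k) o\<^sub>L ?R k" m n] by (simp flip: matrix_entry_diff)
      also have "\<dots> \<le> norm (?R l - ?R k) * c" unfolding c_def by (rule norm_blinfun_compose)
      also have "\<dots> \<le> 2 * cmod (l - k) * c\<^sup>2 * c"
        using norm_resolvent_diff_le[OF elim(1) k] elim(2) c unfolding c_def by (intro mult_right_mono) auto
      finally show ?case .
    qed
  qed
  then have lim: "((\<lambda>l. matrix_entry (?R l o\<^sub>L ?R k) m n) \<longlongrightarrow> matrix_entry (?R k o\<^sub>L ?R k) m n) (at k)"
    by (rule LIM_zero_cancel)
  show ?thesis unfolding has_field_derivative_iff
  proof (rule Lim_transform_eventually[OF lim])
    have "\<forall>\<^sub>F l in at k. l \<noteq> k" by (simp add: eventually_at_filter)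
    with ev show "\<forall>\<^sub>F l in at k. matrix_entry (?R l o\<^sub>L ?R k) m n = (matrix_entry (?R l) m n - matrix_entry (?R k) m n) / (l - k)"
    proof eventually_elim
      case (elim l)
      have "matrix_entry (?R l) m n - matrix_entry (?R k) m n = (l - k) * matrix_entry (?R l o\<^sub>L ?R k) m n"
        unfolding matrix_entry_diff[symmetric] resolvent_identity[OF elim(1) k] by (rule matrix_entry_scalar_op)
      then show ?case using elim by simp
    qed
  qed
qed

lemma holomorphic_resolvent_entry:
  fixes m n :: "int ^ 'd::finite"
  shows "(\<lambda>l. matrix_entry (free_resolvent l) m n) holomorphic_on Lambda_dom CARD('d)"
  using resolvent_entry_deriv[of _ m n] open_Lambda_dom by (auto simp: holomorphic_on_open)

text \<open>Off the real axis this is the bound for \<open>green\<close>. A real l outside the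
  spectrum is covered by a vertical limit, since the entries are continuous there.\<close>

lemma norm_resolvent_entry_le_kernel_bound:
  fixes m n :: "int ^ 'd::finite"
  assumes d: "3 \<le> CARD('d)" and l: "l \<in> Lambda_dom CARD('d)"
  shows "cmod (matrix_entry (free_resolvent l) m n) \<le> enn2real (kernel_bound (m - n))"
proof -
  have fin: "kernel_bound (m - n) = ennreal (enn2real (kernel_bound (m - n)))"
    using kernel_bound_finite[OF d, of "m - n"] by simp
  have nonreal: "cmod (matrix_entry (free_resolvent l) m n) \<le> enn2real (kernel_bound (m - n))" if "Im l \<noteq> 0" for l
  proof -
    have "ennreal (cmod (matrix_entry (free_resolvent l) m n)) \<le> kernel_bound (m - n)"
      using that resolvent_entry_upper[of l m n] resolvent_entry_lower[of l m n]
        norm_green_le_kernel_bound[of l "m - n"] norm_green_le_kernel_bound[of "cnj l" "m - n"]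
      by (cases "Im l > 0") auto
    then show ?thesis by (subst (asm) fin) (simp add: ennreal_le_iff)
  qed
  have "((\<lambda>e. cmod (matrix_entry (free_resolvent (l + \<i> * of_real e)) m n)) \<longlongrightarrow> cmod (matrix_entry (free_resolvent l) m n)) (at_right 0)"
  proof (intro tendsto_norm)
    have "isCont (\<lambda>l. matrix_entry (free_resolvent l) m n) l"
      using resolvent_entry_deriv[OF l] by (rule DERIV_isCont)
    moreover have "((\<lambda>e. l + \<i> * of_real e) \<longlongrightarrow> l) (at_right 0)" by (auto intro!: tendsto_eq_intros)
    ultimately show "((\<lambda>e. matrix_entry (free_resolvent (l + \<i> * of_real e)) m n) \<longlongrightarrow> matrix_entry (free_resolvent l) m n) (at_right 0)"
      by (rule isCont_tendsto_compose)
  qed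
  moreover have "\<forall>\<^sub>F e in at_right 0. Im (l + \<i> * of_real e) \<noteq> 0"
  proof (cases "Im l < 0")
    case True
    have "\<forall>\<^sub>F e in at_right 0. e < - Im l" using True by (intro eventually_at_rightI[of 0 "- Im l"]) auto
    then show ?thesis by eventually_elim auto
  next
    case False
    then have "\<forall>\<^sub>F e in at_right 0. Im l + e \<noteq> 0" by (intro eventually_at_rightI[of 0 1]) auto
    then show ?thesis by simp
  qed
  then have "\<forall>\<^sub>F e in at_right 0. cmod (matrix_entry (free_resolvent (l + \<i> * of_real e)) m n) \<le> enn2real (kernel_bound (m - n))"
    by eventually_elim (rule nonreal)
  ultimately show ?thesis by (rule tendsto_upperbound) simp
qed

section \<open>The resolvent in the disk variable and its boundary limits\<close>

lemma joukowski_in_Lambda_dom: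
  assumes d: "0 < d" and z: "z \<noteq> 0" "cmod z < 1"
  shows "joukowski d z \<in> Lambda_dom d"
proof (rule ccontr)
  assume "joukowski d z \<notin> Lambda_dom d"
  then obtain x where x: "- real d \<le> x" "x \<le> real d" "joukowski d z = of_real x" by (auto simp: Lambda_dom_def)
  define c where "c = x / real d"
  have "(real d)\<^sup>2 * c\<^sup>2 \<le> (real d)\<^sup>2" using x d abs_le_square_iff[of x "real d"] by (auto simp: c_def power_divide)
  then have c: "c\<^sup>2 \<le> 1" using d by simp
  \<comment> \<open>A value d c with |c| <= 1 makes z a root of z^2 - 2 c z + 1, and both roots of
    this polynomial lie on the unit circle.\<close>
  have "z + 1 / z = 2 * of_real c" using x(3) d by (simp add: joukowski_def c_def field_simps)
  then have q: "z * z + 1 = 2 * of_real c * z" using z by (simp add: field_simps)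
  then have "(z - of_real c)\<^sup>2 = of_real (c\<^sup>2 - 1)" by (simp add: power2_eq_square algebra_simps)
  also have "\<dots> = (\<i> * of_real (sqrt (1 - c\<^sup>2)))\<^sup>2" using c by (simp add: power_mult_distrib flip: of_real_power)
  finally have "z - of_real c = \<i> * of_real (sqrt (1 - c\<^sup>2)) \<or> z - of_real c = - (\<i> * of_real (sqrt (1 - c\<^sup>2)))"
    by (rule power2_eq_iff[THEN iffD1])
  then have "Re z = c" "(Im z)\<^sup>2 = 1 - c\<^sup>2" using c by (auto simp: complex_eq_iff)
  then have "(cmod z)\<^sup>2 = 1" by (simp add: cmod_power2)
  then show False using z power_strict_mono[of "cmod z" 1 2] by simp
qed

lemma holomorphic_joukowski: "0 \<notin> S \<Longrightarrow> joukowski d holomorphic_on S"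
  unfolding joukowski_def[abs_def] by (intro holomorphic_intros) auto

text \<open>The origin corresponds to lambda = infinity, where the resolvent tends to 0; this value
  removes the singularity.\<close>

definition disk_resolvent :: "int ^ 'd::finite \<Rightarrow> int ^ 'd \<Rightarrow> complex \<Rightarrow> complex"
  where "disk_resolvent m n z = (if z = 0 then 0 else matrix_entry (free_resolvent (joukowski CARD('d) z)) m n)"

lemma filterlim_joukowski_0: "0 < d \<Longrightarrow> filterlim (joukowski d) at_infinity (at 0)"
proof -
  assume d: "0 < d"
  have "filterlim (\<lambda>z::complex. inverse z) at_infinity (at 0)" by (rule filterlim_inverse_at_infinity)
  then have "filterlim (\<lambda>z. z + inverse z) at_infinity (at (0::complex))"
    by (intro tendsto_add_filterlim_at_infinity[where c = 0]) auto
  then have "filterlim (\<lambda>z. (of_nat d / 2) * (z + inverse z)) at_infinity (at (0::complex))"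
    using d by (intro tendsto_mult_filterlim_at_infinity[OF tendsto_const]) auto
  then show ?thesis by (simp add: joukowski_def[abs_def] inverse_eq_divide)
qed

lemma holomorphic_disk_resolvent:
  fixes m n :: "int ^ 'd::finite"
  shows "disk_resolvent m n holomorphic_on ball 0 1"
proof (rule no_isolated_singularity[where K = "{0}"])
  let ?E = "\<lambda>l. matrix_entry (free_resolvent l :: (int ^ 'd) ell2_op) m n"
  have hol: "(\<lambda>z. ?E (joukowski CARD('d) z)) holomorphic_on ball 0 1 - {0}"
  proof -
    have "joukowski CARD('d) ` (ball 0 1 - {0}) \<subseteq> Lambda_dom CARD('d)"
      by (auto intro!: joukowski_in_Lambda_dom)
    from holomorphic_on_compose_gen[OF holomorphic_joukowski holomorphic_resolvent_entry this, of m n]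
    show ?thesis by (simp add: o_def)
  qed
  show hol': "disk_resolvent m n holomorphic_on ball 0 1 - {0}"
    by (rule holomorphic_transform[OF hol]) (simp add: disk_resolvent_def)
  show "continuous_on (ball 0 1) (disk_resolvent m n)"
  proof -
    have "isCont (disk_resolvent m n) z" if "z \<in> ball 0 1" for z
    proof (cases "z = 0")
      case False
      have "open (ball (0::complex) 1 - {0})" by auto
      then show ?thesis using hol' False that
        by (metis continuous_on_eq_continuous_at holomorphic_on_imp_continuous_on Diff_iff singletonD)
    next
      case True
      have "filterlim (\<lambda>z. cmod (joukowski CARD('d) z)) at_top (at 0)"
        using filterlim_joukowski_0[of "CARD('d)"] by (simp add: filterlim_at_infinity_conv_norm_at_top)
      then have top: "filterlim (\<lambda>z. cmod (joukowski CARD('d) z) - CARD('d)) at_top (at 0)"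
        using filterlim_tendsto_add_at_top[OF tendsto_const[of "- real CARD('d)"]] by simp
      then have "\<forall>\<^sub>F z in at 0. 0 < cmod (joukowski CARD('d) z) - CARD('d)"
        unfolding filterlim_at_top_dense by (rule spec)
      moreover have "\<forall>\<^sub>F z in at (0::complex). z \<in> ball 0 1 - {0}"
        using eventually_at_in_open[of "ball 0 1" "0::complex"] by simp
      ultimately have bound: "\<forall>\<^sub>F z in at 0. norm (disk_resolvent m n z) \<le> inverse (cmod (joukowski CARD('d) z) - CARD('d))"
      proof eventually_elim
        case (elim z)
        have "norm (disk_resolvent m n z) \<le> norm (free_resolvent (joukowski CARD('d) z) :: (int ^ 'd) ell2_op)"
          using elim norm_matrix_entry_le by (simp add: disk_resolvent_def)
        also have "\<dots> \<le> 1 / (cmod (joukowski CARD('d) z) - CARD('d))"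
          using elim joukowski_in_Lambda_dom[of "CARD('d)" z] by (intro norm_free_resolvent_le) auto
        finally show ?case by (simp add: inverse_eq_divide)
      qed
      have "(disk_resolvent m n \<longlongrightarrow> 0) (at 0)"
        by (rule Lim_null_comparison[OF bound tendsto_inverse_0_at_top[OF top]])
      then show ?thesis using True by (simp add: isCont_def disk_resolvent_def)
    qed
    then show ?thesis by (simp add: continuous_at_imp_continuous_on)
  qed
qed auto

lemma norm_disk_resolvent_le:
  fixes m n :: "int ^ 'd::finite"
  assumes "3 \<le> CARD('d)" "z \<in> ball 0 1"
  shows "cmod (disk_resolvent m n z) \<le> enn2real (kernel_bound (m - n))"
  using norm_resolvent_entry_le_kernel_bound[of "joukowski CARD('d) z" m n] joukowski_in_Lambda_dom[of "CARD('d)" z] assms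
  by (auto simp: disk_resolvent_def)

lemma Im_joukowski: "z \<noteq> 0 \<Longrightarrow> Im (joukowski d z) = real d / 2 * (Im z * (1 - 1 / (cmod z)\<^sup>2))"
proof -
  assume z: "z \<noteq> 0"
  have "Im (1 / z) = - Im z / (cmod z)\<^sup>2" using z by (simp add: Im_divide cmod_power2)
  moreover have "Im (joukowski d z) = real d / 2 * (Im z + Im (1 / z))"
  proof -
    have "joukowski d z = of_real (real d / 2) * (z + 1 / z)" by (simp add: joukowski_def)
    then show ?thesis by (simp only: times_complex.sel plus_complex.sel Re_complex_of_real Im_complex_of_real)
  qed
  ultimately show ?thesis by (simp add: right_diff_distrib)
qed

text \<open>Inside the disk \<open>joukowski\<close> exchanges the upper and the lower half plane.
  Near a boundary point with nonzero sine only one half plane occurs, so the one-sided limit of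
  \<open>green\<close> applies; at 1 and -1 both would meet.\<close>

lemma disk_resolvent_boundary:
  fixes m n :: "int ^ 'd::finite"
  assumes d: "3 \<le> CARD('d)" and t: "sin t \<noteq> 0"
  shows "\<exists>L. (disk_resolvent m n \<longlongrightarrow> L) (at (cis t) within ball 0 1)"
proof -
  let ?J = "joukowski CARD('d)" and ?F = "at (cis t) within ball 0 1"
  define x where "x = ?J (cis t)"
  have x: "Im x = 0" by (simp add: x_def Im_joukowski)
  have J: "(?J \<longlongrightarrow> x) ?F"
    unfolding x_def joukowski_def[abs_def] by (intro tendsto_intros) auto
  have in_ball: "\<forall>\<^sub>F z in ?F. z \<in> ball 0 1" by (simp add: eventually_at_filter)
  have nz: "\<forall>\<^sub>F z in ?F. z \<noteq> 0"
    by (rule tendsto_imp_eventually_ne[OF tendsto_ident_at]) auto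
  have sq: "1 - 1 / (cmod z)\<^sup>2 < 0" if "z \<in> ball 0 1" "z \<noteq> 0" for z
  proof -
    have "(cmod z)\<^sup>2 < 1\<^sup>2" using that by (intro power_strict_mono) auto
    then show ?thesis using that by simp
  qed
  have Im: "((\<lambda>z. Im z) \<longlongrightarrow> sin t) ?F" by (auto intro!: tendsto_eq_intros)
  show ?thesis
  proof (cases "sin t > 0")
    case True
    have ev: "\<forall>\<^sub>F z in ?F. Im (?J z) < 0 \<and> z \<noteq> 0"
      using order_tendstoD(1)[OF Im True] in_ball nz
    proof eventually_elim
      case (elim z)
      then show ?case using sq[of z] d by (simp add: Im_joukowski mult_pos_neg)
    qed
    have "filterlim (\<lambda>z. cnj (?J z)) (at (cnj x) within {l. 0 < Im l}) ?F"
      unfolding filterlim_at using ev x by (intro conjI tendsto_cnj J) (auto elim!: eventually_mono)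
    from filterlim_compose[OF green_tendsto_boundary[OF d] this, of "m - n"]
    have "((\<lambda>z. cnj (green (cnj (?J z)) (m - n))) \<longlongrightarrow> cnj (green (cnj x) (m - n))) ?F"
      using x by (intro tendsto_cnj) auto
    then have "(disk_resolvent m n \<longlongrightarrow> cnj (green (cnj x) (m - n))) ?F"
      by (rule Lim_transform_eventually) (use ev in \<open>eventually_elim, auto simp: disk_resolvent_def resolvent_entry_lower\<close>)
    then show ?thesis by blast
  next
    case False
    then have neg: "sin t < 0" using t by simp
    have ev: "\<forall>\<^sub>F z in ?F. Im (?J z) > 0 \<and> z \<noteq> 0"
      using order_tendstoD(2)[OF Im neg] in_ball nz
    proof eventually_elim
      case (elim z)
      then show ?case using sq[of z] d by (simp add: Im_joukowski mult_neg_neg)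
    qed
    have "filterlim ?J (at x within {l. 0 < Im l}) ?F"
      unfolding filterlim_at using ev x by (intro conjI J) (auto elim!: eventually_mono)
    from filterlim_compose[OF green_tendsto_boundary[OF d x] this, of "m - n"]
    have "((\<lambda>z. green (?J z) (m - n)) \<longlongrightarrow> green x (m - n)) ?F" .
    then have "(disk_resolvent m n \<longlongrightarrow> green x (m - n)) ?F"
      by (rule Lim_transform_eventually) (use ev in \<open>eventually_elim, auto simp: disk_resolvent_def resolvent_entry_upper\<close>)
    then show ?thesis by blast
  qed
qed
section \<open>Regularized determinants of finite matrices\<close>

lemma principal_minor_cong:
  assumes "\<And>i j. i \<in> F \<Longrightarrow> j \<in> F \<Longrightarrow> A i j = B i j"
  shows "principal_minor A F = principal_minor B F"
  unfolding principal_minor_def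
  using assms by (intro sum.cong refl arg_cong2[where f = times] prod.cong) (auto dest: permutes_in_image)

lemma principal_minor_repeated_row:
  assumes F: "finite F" and ab: "a \<in> F" "b \<in> F" "a \<noteq> b" and eq: "\<And>j. B a j = B b j"
  shows "principal_minor B F = 0"
proof -
  let ?t = "Transposition.transpose a b"
  let ?f = "\<lambda>\<pi>. of_int (sign \<pi>) * (\<Prod>i\<in>F. B i (\<pi> i)) :: complex"
  have t: "?t permutes F" using ab by (simp add: permutes_swap_id)
  have "principal_minor B F = (\<Sum>\<pi> | \<pi> permutes F. ?f (\<pi> \<circ> ?t))"
    unfolding principal_minor_def by (rule sum_permutations_compose_right[OF t])
  also have "\<dots> = (\<Sum>\<pi> | \<pi> permutes F. - ?f \<pi>)"
  proof (intro sum.cong refl)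
    fix \<pi> assume "\<pi> \<in> {\<pi>. \<pi> permutes F}"
    then have \<pi>: "\<pi> permutes F" by simp
    have "sign (\<pi> \<circ> ?t) = - sign \<pi>"
      using sign_compose[of \<pi> ?t] permutation_permutes F \<pi> t ab by (auto simp: sign_swap_id)
    moreover have "(\<Prod>i\<in>F. B i ((\<pi> \<circ> ?t) i)) = (\<Prod>i\<in>F. B i (\<pi> i))"
    proof -
      have "(\<Prod>i\<in>F. B i (\<pi> i)) = (\<Prod>i\<in>F. B (?t i) (\<pi> (?t i)))"
        using prod.permute[OF t, of "\<lambda>i. B i (\<pi> i)"] by (simp add: o_def)
      also have "\<dots> = (\<Prod>i\<in>F. B i ((\<pi> \<circ> ?t) i))"
        using eq by (intro prod.cong) (auto simp: Transposition.transpose_def)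
      finally show ?thesis by simp
    qed
    ultimately show "?f (\<pi> \<circ> ?t) = - ?f \<pi>" by simp
  qed
  also have "\<dots> = - principal_minor B F" by (simp add: principal_minor_def sum_negf)
  finally show ?thesis by simp
qed

lemma principal_minor_permute_rows:
  assumes F: "finite F" and \<tau>: "\<tau> permutes F"
  shows "principal_minor (\<lambda>i. B (\<tau> i)) F = of_int (sign \<tau>) * principal_minor B F"
proof -
  have "principal_minor (\<lambda>i. B (\<tau> i)) F = (\<Sum>\<pi> | \<pi> permutes F. of_int (sign (\<pi> \<circ> \<tau>)) * (\<Prod>i\<in>F. B (\<tau> i) ((\<pi> \<circ> \<tau>) i)))"
    unfolding principal_minor_def by (rule sum_permutations_compose_right[OF \<tau>])
  also have "\<dots> = (\<Sum>\<pi> | \<pi> permutes F. of_int (sign \<tau>) * (of_int (sign \<pi>) * (\<Prod>i\<in>F. B i (\<pi> i))))"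
  proof (intro sum.cong refl)
    fix \<pi> assume "\<pi> \<in> {\<pi>. \<pi> permutes F}"
    then have \<pi>: "\<pi> permutes F" by simp
    have "sign (\<pi> \<circ> \<tau>) = sign \<pi> * sign \<tau>"
      using sign_compose[of \<pi> \<tau>] permutation_permutes F \<pi> \<tau> by auto
    moreover have "(\<Prod>i\<in>F. B (\<tau> i) ((\<pi> \<circ> \<tau>) i)) = (\<Prod>i\<in>F. B i (\<pi> i))"
      using prod.permute[OF \<tau>, of "\<lambda>i. B i (\<pi> i)"] by (simp add: o_def)
    ultimately show "of_int (sign (\<pi> \<circ> \<tau>)) * (\<Prod>i\<in>F. B (\<tau> i) ((\<pi> \<circ> \<tau>) i)) =
      of_int (sign \<tau>) * (of_int (sign \<pi>) * (\<Prod>i\<in>F. B i (\<pi> i)))" by simp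
  qed
  finally show ?thesis by (simp add: principal_minor_def sum_distrib_left)
qed

text \<open>Expanding the product of the row sums gives a sum over all maps of F to itself. A map
  that is not injective contributes a minor with two equal rows, hence 0; the others are
  permutations of the rows of B.\<close>

lemma principal_minor_mult:
  assumes F: "finite F"
  shows "principal_minor (\<lambda>i j. \<Sum>k\<in>F. A i k * B k j) F = principal_minor A F * principal_minor B F"
proof -
  let ?P = "PiE F (\<lambda>_. F)" and ?Q = "{\<tau>. \<tau> permutes F}"
  let ?g = "\<lambda>f. (\<Prod>i\<in>F. A i (f i)) * principal_minor (\<lambda>i. B (f i)) F"
  have fin: "finite ?P" using F by (simp add: finite_PiE)
  have "principal_minor (\<lambda>i j. \<Sum>k\<in>F. A i k * B k j) F
      = (\<Sum>\<pi>\<in>?Q. \<Sum>f\<in>?P. of_int (sign \<pi>) * ((\<Prod>i\<in>F. A i (f i)) * (\<Prod>i\<in>F. B (f i) (\<pi> i))))"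
    unfolding principal_minor_def using F
    by (intro sum.cong refl) (simp add: prod_sum_PiE sum_distrib_left prod.distrib)
  also have "\<dots> = (\<Sum>f\<in>?P. ?g f)"
    unfolding principal_minor_def by (subst sum.swap) (simp add: sum_distrib_left mult_ac)
  also have "\<dots> = (\<Sum>f\<in>{f\<in>?P. inj_on f F}. ?g f)"
  proof (rule sum.mono_neutral_right[OF fin])
    show "\<forall>f\<in>?P - {f \<in> ?P. inj_on f F}. ?g f = 0"
    proof
      fix f assume "f \<in> ?P - {f \<in> ?P. inj_on f F}"
      then obtain a b where "a \<in> F" "b \<in> F" "a \<noteq> b" "f a = f b" by (auto simp: inj_on_def)
      then have "principal_minor (\<lambda>i. B (f i)) F = 0" using F by (intro principal_minor_repeated_row[of F a b]) auto
      then show "?g f = 0" by simp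
    qed
  qed auto
  also have "\<dots> = (\<Sum>\<tau>\<in>?Q. ?g (restrict \<tau> F))"
  proof (rule sum.reindex_bij_witness[where i = "\<lambda>\<tau>. restrict \<tau> F" and j = "\<lambda>f x. if x \<in> F then f x else x"])
    fix f assume f: "f \<in> {f \<in> ?P. inj_on f F}"
    show "restrict (\<lambda>x. if x \<in> F then f x else x) F = f" using f by (auto simp: PiE_def extensional_def fun_eq_iff)
    then show "?g (restrict (\<lambda>x. if x \<in> F then f x else x) F) = ?g f" by simp
    show "(\<lambda>x. if x \<in> F then f x else x) \<in> ?Q" using f F
      by (auto intro!: inj_imp_permutes simp: PiE_def Pi_def inj_on_def)
  next
    fix \<tau> assume \<tau>: "\<tau> \<in> ?Q"
    show "(\<lambda>x. if x \<in> F then restrict \<tau> F x else x) = \<tau>" using \<tau> by (auto simp: permutes_def fun_eq_iff)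
    show "restrict \<tau> F \<in> {f \<in> ?P. inj_on f F}" using \<tau> permutes_inj_on[of \<tau> F F]
      by (auto simp: permutes_in_image inj_on_def)
  qed
  also have "\<dots> = (\<Sum>\<tau>\<in>?Q. (of_int (sign \<tau>) * (\<Prod>i\<in>F. A i (\<tau> i))) * principal_minor B F)"
  proof (intro sum.cong refl)
    fix \<tau> assume \<tau>: "\<tau> \<in> ?Q"
    have "principal_minor (\<lambda>i. B (restrict \<tau> F i)) F = principal_minor (\<lambda>i. B (\<tau> i)) F"
      by (rule principal_minor_cong) simp
    also have "\<dots> = of_int (sign \<tau>) * principal_minor B F" using F \<tau> by (simp add: principal_minor_permute_rows)
    finally show "?g (restrict \<tau> F) = (of_int (sign \<tau>) * (\<Prod>i\<in>F. A i (\<tau> i))) * principal_minor B F" by simp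
  qed
  finally show ?thesis by (simp add: principal_minor_def sum_distrib_right)
qed

lemma principal_minor_single_entry_row:
  assumes F: "finite F" "a \<notin> F" and z: "\<And>j. j \<in> F \<Longrightarrow> K a j = 0"
  shows "principal_minor K (insert a F) = K a a * principal_minor K F"
proof -
  have fin: "finite {\<pi>. \<pi> permutes insert a F}" using F by (simp add: finite_permutations)
  have "principal_minor K (insert a F) = (\<Sum>\<pi> | \<pi> permutes F. of_int (sign \<pi>) * (\<Prod>i\<in>insert a F. K i (\<pi> i)))"
    unfolding principal_minor_def
  proof (rule sum.mono_neutral_right[OF fin])
    show "\<forall>\<pi>\<in>{\<pi>. \<pi> permutes insert a F} - {\<pi>. \<pi> permutes F}. of_int (sign \<pi>) * (\<Prod>i\<in>insert a F. K i (\<pi> i)) = 0"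
    proof
      fix \<pi> assume \<pi>: "\<pi> \<in> {\<pi>. \<pi> permutes insert a F} - {\<pi>. \<pi> permutes F}"
      then have "\<pi> a \<noteq> a" using permutes_superset[of \<pi> "insert a F" F] by auto
      moreover have "\<pi> a \<in> insert a F" using \<pi> permutes_in_image[of \<pi> "insert a F" a] by simp
      ultimately have "K a (\<pi> a) = 0" using z by auto
      then show "of_int (sign \<pi>) * (\<Prod>i\<in>insert a F. K i (\<pi> i)) = 0" using F by simp
    qed
  qed (auto intro: permutes_subset)
  also have "\<dots> = (\<Sum>\<pi> | \<pi> permutes F. K a a * (of_int (sign \<pi>) * (\<Prod>i\<in>F. K i (\<pi> i))))"
    using F by (intro sum.cong refl) (auto simp: permutes_not_in)
  finally show ?thesis by (simp add: principal_minor_def sum_distrib_left)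
qed

lemma principal_minor_identity:
  assumes "finite F" "\<And>i j. i \<in> F \<Longrightarrow> j \<in> F \<Longrightarrow> K i j = (if i = j then 1 else 0)"
  shows "principal_minor K F = 1"
  using assms
proof (induction F)
  case empty
  then show ?case by (simp add: principal_minor_def permutes_empty)
next
  case (insert a F)
  then show ?case by (subst principal_minor_single_entry_row) auto
qed

text \<open>The Householder reflection I - (2/W) w w^H, self-inverse and isometric, that takes the
  row r to a multiple of a unit row. The phase of alpha is opposite to that of \<open>r a\<close>,
  so nothing cancels and W = |w|^2 is positive.\<close>

lemma householder_row:
  fixes r :: "'i \<Rightarrow> complex"
  assumes F: "finite F" and a: "a \<in> F" and r: "(\<Sum>j\<in>F. (cmod (r j))\<^sup>2) \<noteq> 0"
  shows "\<exists>U. (\<forall>j\<in>F. \<forall>l\<in>F. (\<Sum>k\<in>F. U j k * U k l) = (if j = l then 1 else 0)) \<and>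
    (\<forall>x. (\<Sum>k\<in>F. (cmod (\<Sum>j\<in>F. x j * U j k))\<^sup>2) = (\<Sum>k\<in>F. (cmod (x k))\<^sup>2)) \<and>
    (\<forall>k\<in>F - {a}. (\<Sum>j\<in>F. r j * U j k) = 0)"
proof -
  define N where "N = (\<Sum>j\<in>F. (cmod (r j))\<^sup>2)"
  have N: "N > 0" using r by (auto simp: N_def less_le sum_nonneg)
  define u where "u = (if r a = 0 then 1 else r a / of_real (cmod (r a)))"
  have u: "cmod u = 1" "u * of_real (cmod (r a)) = r a" by (auto simp: u_def norm_divide)
  have uu: "u * cnj u = 1" using u by (simp add: complex_mult_cnj cmod_power2[symmetric])
  define \<alpha> where "\<alpha> = - of_real (sqrt N) * u"
  have \<alpha>: "\<alpha> * cnj \<alpha> = of_real N" "cnj \<alpha> * r a = - of_real (sqrt N * cmod (r a))"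
  proof -
    have "\<alpha> * cnj \<alpha> = (of_real (sqrt N) * of_real (sqrt N)) * (u * cnj u)" by (simp add: \<alpha>_def)
    also have "of_real (sqrt N) * of_real (sqrt N) = complex_of_real N" using N by (simp flip: of_real_mult)
    finally show "\<alpha> * cnj \<alpha> = of_real N" using uu by simp
    have "cnj \<alpha> * r a = - of_real (sqrt N) * (u * cnj u) * of_real (cmod (r a))"
      by (subst u(2)[symmetric]) (simp add: \<alpha>_def)
    then show "cnj \<alpha> * r a = - of_real (sqrt N * cmod (r a))" using uu by simp
  qed
  define w where "w = (\<lambda>k. cnj (r k) - (if k = a then cnj \<alpha> else 0))"
  define W where "W = 2 * (N + sqrt N * cmod (r a))"
  have W: "W > 0" using N by (simp add: W_def add_pos_nonneg)
  have rr: "(\<Sum>k\<in>F. r k * cnj (r k)) = of_real N"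
    by (simp only: N_def of_real_sum complex_norm_square)
  have rw: "(\<Sum>j\<in>F. r j * w j) = of_real (W / 2)"
  proof -
    have "(\<Sum>j\<in>F. r j * w j) = (\<Sum>j\<in>F. r j * cnj (r j)) - (\<Sum>j\<in>F. if j = a then cnj \<alpha> * r a else 0)"
      unfolding sum_subtractf[symmetric] by (intro sum.cong) (auto simp: w_def algebra_simps)
    also have "\<dots> = of_real N + of_real (sqrt N * cmod (r a))" using F a rr \<alpha> by simp
    finally show ?thesis by (simp add: W_def)
  qed
  have ww: "(\<Sum>k\<in>F. w k * cnj (w k)) = of_real W"
  proof -
    have "(\<Sum>k\<in>F. w k * cnj (w k)) = (\<Sum>k\<in>F. r k * w k) - (\<Sum>k\<in>F. if k = a then \<alpha> * w a else 0)"
      unfolding sum_subtractf[symmetric] by (intro sum.cong) (auto simp: w_def algebra_simps)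
    also have "\<dots> = of_real (W / 2) - \<alpha> * w a" using F a rw by simp
    also have "\<alpha> * w a = cnj (cnj \<alpha> * r a) - \<alpha> * cnj \<alpha>" by (simp add: w_def algebra_simps)
    also have "\<dots> = - of_real (W / 2)" unfolding \<alpha> by (simp add: W_def algebra_simps add_divide_distrib)
    finally show ?thesis by simp
  qed
  define U where "U = (\<lambda>j k. (if j = k then 1 else 0) - of_real (2 / W) * w j * cnj (w k))"
  have xU: "(\<Sum>j\<in>F. x j * U j k) = x k - of_real (2 / W) * (\<Sum>j\<in>F. x j * w j) * cnj (w k)" if "k \<in> F" for x k
  proof -
    have "(\<Sum>j\<in>F. x j * U j k) = (\<Sum>j\<in>F. if j = k then x k else 0) - (\<Sum>j\<in>F. of_real (2 / W) * (x j * w j) * cnj (w k))"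
      unfolding sum_subtractf[symmetric] by (intro sum.cong) (auto simp: U_def algebra_simps)
    then show ?thesis using F that by (simp add: sum_distrib_left sum_distrib_right mult_ac)
  qed
  show ?thesis
  proof (intro exI[of _ U] conjI ballI allI)
    fix j l assume jl: "j \<in> F" "l \<in> F"
    have "(\<Sum>k\<in>F. U j k * w k) = (\<Sum>k\<in>F. if k = j then w j else 0) - of_real (2 / W) * w j * (\<Sum>k\<in>F. w k * cnj (w k))"
      unfolding sum_distrib_left sum_subtractf[symmetric] by (intro sum.cong) (auto simp: U_def algebra_simps)
    also have "\<dots> = - w j" unfolding ww using F jl W by simp
    finally have "(\<Sum>k\<in>F. U j k * U k l) = U j l + of_real (2 / W) * w j * cnj (w l)"
      using xU[OF jl(2), of "U j"] by simp
    then show "(\<Sum>k\<in>F. U j k * U k l) = (if j = l then 1 else 0)" by (simp add: U_def)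
  next
    fix k assume k: "k \<in> F - {a}"
    show "(\<Sum>j\<in>F. r j * U j k) = 0" using W k by (simp add: xU rw) (simp add: w_def)
  next
    fix x :: "'i \<Rightarrow> complex"
    define c where "c = of_real (2 / W) * (\<Sum>j\<in>F. x j * w j)"
    have xw: "(\<Sum>j\<in>F. x j * w j) = of_real (W / 2) * c" using W by (simp add: c_def)
    have "complex_of_real (\<Sum>k\<in>F. (cmod (\<Sum>j\<in>F. x j * U j k))\<^sup>2) = (\<Sum>k\<in>F. (x k - c * cnj (w k)) * cnj (x k - c * cnj (w k)))"
      by (simp add: xU c_def of_real_sum complex_norm_square del: of_real_power)
    also have "\<dots> = (\<Sum>k\<in>F. x k * cnj (x k)) - cnj c * (\<Sum>k\<in>F. x k * w k) - c * cnj (\<Sum>k\<in>F. x k * w k) + c * cnj c * (\<Sum>k\<in>F. w k * cnj (w k))"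
      by (simp add: sum_distrib_left sum.distrib sum_subtractf algebra_simps)
    also have "\<dots> = (\<Sum>k\<in>F. x k * cnj (x k))" unfolding xw ww by (simp add: algebra_simps)
    also have "\<dots> = complex_of_real (\<Sum>k\<in>F. (cmod (x k))\<^sup>2)" by (simp only: of_real_sum complex_norm_square)
    finally show "(\<Sum>k\<in>F. (cmod (\<Sum>j\<in>F. x j * U j k))\<^sup>2) = (\<Sum>k\<in>F. (cmod (x k))\<^sup>2)" by (simp only: of_real_eq_iff)
  qed
qed

text \<open>Induction on the index set: the reflection preserves all row norms and, being its own
  inverse, the modulus of the determinant. It leaves row a with a single entry, along which the
  determinant is expanded.\<close>

lemma hadamard_inequality:
  assumes "finite F"
  shows "(cmod (principal_minor K F))\<^sup>2 \<le> (\<Prod>i\<in>F. \<Sum>j\<in>F. (cmod (K i j))\<^sup>2)"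
  using assms
proof (induction F arbitrary: K)
  case empty
  then show ?case by (simp add: principal_minor_def permutes_empty)
next
  case (insert a F')
  let ?F = "insert a F'"
  have F: "finite ?F" using insert by simp
  show ?case
  proof (cases "(\<Sum>j\<in>?F. (cmod (K a j))\<^sup>2) = 0")
    case True
    then have "K a j = 0" if "j \<in> ?F" for j using F that by (subst (asm) sum_nonneg_eq_0_iff) auto
    then have "principal_minor K ?F = 0" using insert by (subst principal_minor_single_entry_row) auto
    then show ?thesis by (simp add: prod_nonneg sum_nonneg)
  next
    case False
    obtain U where U: "\<And>j l. j \<in> ?F \<Longrightarrow> l \<in> ?F \<Longrightarrow> (\<Sum>k\<in>?F. U j k * U k l) = (if j = l then 1 else 0)"
      "\<And>x. (\<Sum>k\<in>?F. (cmod (\<Sum>j\<in>?F. x j * U j k))\<^sup>2) = (\<Sum>k\<in>?F. (cmod (x k))\<^sup>2)"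
      "\<And>k. k \<in> ?F \<Longrightarrow> k \<noteq> a \<Longrightarrow> (\<Sum>j\<in>?F. K a j * U j k) = 0"
      using householder_row[OF F insertI1[of a F'] False] by blast
    define M where "M = (\<lambda>i k. \<Sum>j\<in>?F. K i j * U j k)"
    have "principal_minor U ?F * principal_minor U ?F = 1"
      unfolding principal_minor_mult[OF F, symmetric] by (rule principal_minor_identity[OF F]) (use U in auto)
    then have "cmod (principal_minor U ?F) * cmod (principal_minor U ?F) = 1" by (metis norm_mult norm_one)
    then have detU: "(cmod (principal_minor U ?F))\<^sup>2 = 1" by (simp add: power2_eq_square)
    have Mz: "M a j = 0" if "j \<in> F'" for j using U(3)[of j] that insert by (auto simp: M_def)
    have rowM: "(\<Sum>k\<in>?F. (cmod (M i k))\<^sup>2) = (\<Sum>k\<in>?F. (cmod (K i k))\<^sup>2)" for i unfolding M_def by (rule U(2))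
    have "(cmod (principal_minor K ?F))\<^sup>2 = (cmod (principal_minor K ?F * principal_minor U ?F))\<^sup>2"
      by (simp add: norm_mult power_mult_distrib detU)
    also have "principal_minor K ?F * principal_minor U ?F = principal_minor M ?F"
      unfolding M_def by (rule principal_minor_mult[OF F, symmetric])
    also have "\<dots> = M a a * principal_minor M F'"
      using insert Mz by (intro principal_minor_single_entry_row) auto
    also have "(cmod (M a a * principal_minor M F'))\<^sup>2 = (cmod (M a a))\<^sup>2 * (cmod (principal_minor M F'))\<^sup>2"
      by (simp add: norm_mult power_mult_distrib)
    also have "\<dots> \<le> (\<Sum>k\<in>?F. (cmod (M a k))\<^sup>2) * (\<Prod>i\<in>F'. \<Sum>j\<in>?F. (cmod (M i j))\<^sup>2)"
    proof (intro mult_mono)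
      show "(cmod (M a a))\<^sup>2 \<le> (\<Sum>k\<in>?F. (cmod (M a k))\<^sup>2)" using F by (intro member_le_sum) auto
      have "(cmod (principal_minor M F'))\<^sup>2 \<le> (\<Prod>i\<in>F'. \<Sum>j\<in>F'. (cmod (M i j))\<^sup>2)" by (rule insert.IH)
      also have "\<dots> \<le> (\<Prod>i\<in>F'. \<Sum>j\<in>?F. (cmod (M i j))\<^sup>2)"
        using F by (intro prod_mono conjI sum_nonneg sum_mono2) auto
      finally show "(cmod (principal_minor M F'))\<^sup>2 \<le> (\<Prod>i\<in>F'. \<Sum>j\<in>?F. (cmod (M i j))\<^sup>2)" .
    qed (auto intro: sum_nonneg)
    also have "\<dots> = (\<Prod>i\<in>?F. \<Sum>j\<in>?F. (cmod (K i j))\<^sup>2)" unfolding rowM using insert by (subst prod.insert) auto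
    finally show ?thesis .
  qed
qed

lemma prod_add_expand:
  fixes f g :: "'a \<Rightarrow> 'b::comm_semiring_1"
  assumes "finite F"
  shows "(\<Prod>i\<in>F. f i + g i) = (\<Sum>S\<in>Pow F. (\<Prod>i\<in>S. f i) * (\<Prod>i\<in>F - S. g i))"
  using assms
proof (induction F)
  case (insert a F)
  have d: "Pow F \<inter> insert a ` Pow F = {}" using insert by auto
  have inj: "inj_on (insert a) (Pow F)" using insert by (auto simp: inj_on_def)
  have "(\<Sum>S\<in>Pow (insert a F). (\<Prod>i\<in>S. f i) * (\<Prod>i\<in>insert a F - S. g i))
    = (\<Sum>S\<in>Pow F. (\<Prod>i\<in>S. f i) * (\<Prod>i\<in>insert a F - S. g i)) + (\<Sum>S\<in>Pow F. (\<Prod>i\<in>insert a S. f i) * (\<Prod>i\<in>insert a F - insert a S. g i))"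
    using insert d inj by (simp add: Pow_insert sum.union_disjoint sum.reindex)
  also have "(\<Sum>S\<in>Pow F. (\<Prod>i\<in>S. f i) * (\<Prod>i\<in>insert a F - S. g i)) = g a * (\<Sum>S\<in>Pow F. (\<Prod>i\<in>S. f i) * (\<Prod>i\<in>F - S. g i))"
    unfolding sum_distrib_left
  proof (intro sum.cong refl)
    fix S assume S: "S \<in> Pow F"
    then have "insert a F - S = insert a (F - S)" using insert by auto
    then show "(\<Prod>i\<in>S. f i) * (\<Prod>i\<in>insert a F - S. g i) = g a * ((\<Prod>i\<in>S. f i) * (\<Prod>i\<in>F - S. g i))"
      using insert by (simp add: mult_ac)
  qed
  also have "(\<Sum>S\<in>Pow F. (\<Prod>i\<in>insert a S. f i) * (\<Prod>i\<in>insert a F - insert a S. g i)) = f a * (\<Sum>S\<in>Pow F. (\<Prod>i\<in>S. f i) * (\<Prod>i\<in>F - S. g i))"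
    unfolding sum_distrib_left
  proof (intro sum.cong refl)
    fix S assume S: "S \<in> Pow F"
    then have "insert a F - insert a S = F - S" "a \<notin> S" "finite S" using insert finite_subset by auto
    then show "(\<Prod>i\<in>insert a S. f i) * (\<Prod>i\<in>insert a F - insert a S. g i) = f a * ((\<Prod>i\<in>S. f i) * (\<Prod>i\<in>F - S. g i))"
      by (simp add: mult_ac)
  qed
  finally show ?case using insert by (simp add: algebra_simps)
qed simp

text \<open>The expansion of det (1 + K), which is the finite case of \<open>fredholm_det\<close>.
  Choosing the entry of the identity at the indices outside S forces the permutation to fix
  them.\<close>

lemma sum_principal_minors:
  assumes F: "finite F"
  shows "(\<Sum>S\<in>Pow F. principal_minor K S) = principal_minor (\<lambda>i j. (if i = j then 1 else 0) + K i j) F"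
proof -
  let ?Q = "\<lambda>S. {\<pi>. \<pi> permutes S}"
  have fin: "finite (?Q F)" using F by (simp add: finite_permutations)
  have "principal_minor (\<lambda>i j. (if i = j then 1 else 0) + K i j) F
    = (\<Sum>\<pi>\<in>?Q F. \<Sum>S\<in>Pow F. of_int (sign \<pi>) * ((\<Prod>i\<in>S. K i (\<pi> i)) * (\<Prod>i\<in>F - S. if i = \<pi> i then 1 else 0)))"
    unfolding principal_minor_def using F
    by (intro sum.cong refl) (subst add.commute, simp add: prod_add_expand sum_distrib_left)
  also have "\<dots> = (\<Sum>S\<in>Pow F. \<Sum>\<pi>\<in>?Q F. of_int (sign \<pi>) * ((\<Prod>i\<in>S. K i (\<pi> i)) * (\<Prod>i\<in>F - S. if i = \<pi> i then 1 else 0)))"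
    by (rule sum.swap)
  also have "\<dots> = (\<Sum>S\<in>Pow F. principal_minor K S)"
  proof (intro sum.cong refl)
    fix S assume S: "S \<in> Pow F"
    let ?f = "\<lambda>\<pi>. of_int (sign \<pi>) * ((\<Prod>i\<in>S. K i (\<pi> i)) * (\<Prod>i\<in>F - S. if i = \<pi> i then 1 else 0))"
    have "(\<Sum>\<pi>\<in>?Q F. ?f \<pi>) = (\<Sum>\<pi>\<in>?Q S. ?f \<pi>)"
    proof (rule sum.mono_neutral_right[OF fin])
      show "?Q S \<subseteq> ?Q F" using S by (auto intro: permutes_subset)
      show "\<forall>\<pi>\<in>?Q F - ?Q S. ?f \<pi> = 0"
      proof
        fix \<pi> assume \<pi>: "\<pi> \<in> ?Q F - ?Q S"
        then obtain i where "i \<in> F - S" "\<pi> i \<noteq> i" using permutes_superset[of \<pi> F S] by auto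
        then have "(\<Prod>i\<in>F - S. if i = \<pi> i then 1 else 0) = (0::complex)"
          using F by (intro prod_zero) (auto intro!: bexI[of _ i])
        then show "?f \<pi> = 0" by simp
      qed
    qed
    also have "\<dots> = principal_minor K S"
      unfolding principal_minor_def
      by (intro sum.cong refl) (auto simp: permutes_not_in intro!: prod.neutral)
    finally show "(\<Sum>\<pi>\<in>?Q F. ?f \<pi>) = principal_minor K S" .
  qed
  finally show ?thesis by simp
qed

text \<open>Jacobi's formula at the identity matrix: a permutation other than the identity moves at
  least two indices, so after one factor is differentiated another zero factor remains.\<close>

lemma principal_minor_has_derivative_at_identity:
  fixes K :: "'a::real_normed_vector \<Rightarrow> 'i \<Rightarrow> 'i \<Rightarrow> complex"
  assumes F: "finite F"
    and K: "\<And>i j. i \<in> F \<Longrightarrow> j \<in> F \<Longrightarrow> ((\<lambda>s. K s i j) has_derivative K' i j) (at s)"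
    and id: "\<And>i j. i \<in> F \<Longrightarrow> j \<in> F \<Longrightarrow> K s i j = (if i = j then 1 else 0)"
  shows "((\<lambda>s. principal_minor (K s) F) has_derivative (\<lambda>h. \<Sum>i\<in>F. K' i i h)) (at s)"
proof -
  let ?Q = "{\<pi>. \<pi> permutes F}"
  let ?D = "\<lambda>\<pi> h. of_int (sign \<pi>) * (\<Sum>i\<in>F. K' i (\<pi> i) h * (\<Prod>j\<in>F - {i}. K s j (\<pi> j)))"
  have fin: "finite ?Q" using F by (simp add: finite_permutations)
  have "((\<lambda>s. principal_minor (K s) F) has_derivative (\<lambda>h. \<Sum>\<pi>\<in>?Q. ?D \<pi> h)) (at s)"
    unfolding principal_minor_def
    by (intro has_derivative_sum has_derivative_mult_right has_derivative_prod K)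
      (auto simp: permutes_in_image)
  moreover have "(\<Sum>\<pi>\<in>?Q. ?D \<pi> h) = (\<Sum>\<pi>\<in>{id}. ?D \<pi> h)" for h
  proof (rule sum.mono_neutral_right[OF fin])
    show "\<forall>\<pi>\<in>?Q - {id}. ?D \<pi> h = 0"
    proof
      fix \<pi> assume \<pi>: "\<pi> \<in> ?Q - {id}"
      have "(\<Prod>j\<in>F - {i}. K s j (\<pi> j)) = 0" if "i \<in> F" for i
      proof -
        have "\<exists>j\<in>F - {i}. \<pi> j \<noteq> j"
        proof (rule ccontr)
          assume "\<not> (\<exists>j\<in>F - {i}. \<pi> j \<noteq> j)"
          then have "\<pi> permutes {i}" using \<pi> permutes_superset[of \<pi> F "{i}"] by auto
          then show False using \<pi> by (simp add: permutes_sing)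
        qed
        then obtain j where j: "j \<in> F - {i}" "\<pi> j \<noteq> j" by blast
        moreover have "\<pi> j \<in> F" using \<pi> j permutes_in_image[of \<pi> F j] by simp
        ultimately show ?thesis using F id by (intro prod_zero) (auto intro!: bexI[of _ j])
      qed
      then show "?D \<pi> h = 0" by simp
    qed
  qed (auto simp: permutes_id)
  moreover have "?D id h = (\<Sum>i\<in>F. K' i i h)" for h using id by simp
  ultimately show ?thesis by simp
qed

text \<open>The determinant of (1 + A) exp (-A) for the block on F, with exp (-tr A) already put for
  the determinant of exp (-A). \<open>fredholm_det_finite_rows_det2\<close> justifies this.\<close>

definition det2 :: "'i set \<Rightarrow> ('i \<Rightarrow> 'i \<Rightarrow> complex) \<Rightarrow> complex"
  where "det2 F A = principal_minor (\<lambda>i j. (if i = j then 1 else 0) + A i j) F * exp (- (\<Sum>i\<in>F. A i i))"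

definition hs_norm :: "'i set \<Rightarrow> ('i \<Rightarrow> 'i \<Rightarrow> complex) \<Rightarrow> real"
  where "hs_norm F A = L2_set (\<lambda>(i, j). cmod (A i j)) (F \<times> F)"

lemma hs_norm_sq: "(hs_norm F A)\<^sup>2 = (\<Sum>i\<in>F. \<Sum>j\<in>F. (cmod (A i j))\<^sup>2)"
  unfolding hs_norm_def L2_set_def by (simp add: sum_nonneg sum.cartesian_product case_prod_unfold)

lemma hs_norm_nonneg [simp]: "0 \<le> hs_norm F A"
  by (simp add: hs_norm_def L2_set_nonneg)

lemma hs_norm_add_le: "hs_norm F (\<lambda>i j. A i j + c * B i j) \<le> hs_norm F A + cmod c * hs_norm F B"
proof -
  have "hs_norm F (\<lambda>i j. A i j + c * B i j) \<le> L2_set (\<lambda>x. cmod (A (fst x) (snd x)) + cmod c * cmod (B (fst x) (snd x))) (F \<times> F)"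
    unfolding hs_norm_def by (intro L2_set_mono) (auto simp: case_prod_unfold intro!: norm_triangle_mono norm_mult_ineq)
  also have "\<dots> \<le> L2_set (\<lambda>x. cmod (A (fst x) (snd x))) (F \<times> F) + L2_set (\<lambda>x. cmod c * cmod (B (fst x) (snd x))) (F \<times> F)"
    by (rule L2_set_triangle_ineq)
  also have "L2_set (\<lambda>x. cmod c * cmod (B (fst x) (snd x))) (F \<times> F) = cmod c * L2_set (\<lambda>x. cmod (B (fst x) (snd x))) (F \<times> F)"
    by (simp add: L2_set_right_distrib)
  finally show ?thesis by (simp add: hs_norm_def case_prod_unfold)
qed

text \<open>The squared row norms of 1 + A are 1 + 2 Re A_ii + sum_j |A_ij|^2, each at most the
  exponential of its excess over 1. The factor exp (-tr A) cancels the linear terms and only the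
  Hilbert-Schmidt norm is left.\<close>

lemma det2_bound:
  assumes F: "finite F"
  shows "cmod (det2 F A) \<le> exp ((hs_norm F A)\<^sup>2 / 2)"
proof -
  let ?I = "\<lambda>i j. (if i = j then 1 else 0) + A i j"
  have row: "(\<Sum>j\<in>F. (cmod (?I i j))\<^sup>2) = 1 + (2 * Re (A i i) + (\<Sum>j\<in>F. (cmod (A i j))\<^sup>2))" if "i \<in> F" for i
  proof -
    have one: "(cmod (1 + w))\<^sup>2 = (cmod w)\<^sup>2 + (1 + 2 * Re w)" for w
      unfolding cmod_power2 by (simp add: power2_sum)
    have "(\<Sum>j\<in>F. (cmod (?I i j))\<^sup>2) = (\<Sum>j\<in>F. (cmod (A i j))\<^sup>2 + (if j = i then 1 + 2 * Re (A i i) else 0))"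
      by (intro sum.cong) (auto simp: one)
    then show ?thesis using F that by (simp add: sum.distrib)
  qed
  have "(cmod (principal_minor ?I F))\<^sup>2 \<le> (\<Prod>i\<in>F. \<Sum>j\<in>F. (cmod (?I i j))\<^sup>2)" by (rule hadamard_inequality[OF F])
  also have "\<dots> \<le> (\<Prod>i\<in>F. exp (2 * Re (A i i) + (\<Sum>j\<in>F. (cmod (A i j))\<^sup>2)))"
  proof (intro prod_mono conjI sum_nonneg)
    fix i assume "i \<in> F"
    show "(\<Sum>j\<in>F. (cmod (?I i j))\<^sup>2) \<le> exp (2 * Re (A i i) + (\<Sum>j\<in>F. (cmod (A i j))\<^sup>2))"
      unfolding row[OF \<open>i \<in> F\<close>] by (rule exp_ge_add_one_self)
  qed auto
  also have "\<dots> = exp (2 * Re (\<Sum>i\<in>F. A i i) + (hs_norm F A)\<^sup>2)"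
    unfolding exp_sum[OF F, symmetric] by (simp add: sum.distrib hs_norm_sq sum_distrib_left)
  finally have 1: "(cmod (principal_minor ?I F))\<^sup>2 \<le> exp (2 * Re (\<Sum>i\<in>F. A i i) + (hs_norm F A)\<^sup>2)" .
  have "(cmod (det2 F A))\<^sup>2 = (cmod (principal_minor ?I F))\<^sup>2 * exp (- 2 * Re (\<Sum>i\<in>F. A i i))"
  proof -
    have "(exp (- Re (\<Sum>i\<in>F. A i i)))\<^sup>2 = exp (- 2 * Re (\<Sum>i\<in>F. A i i))"
      unfolding exp_double[symmetric] by (rule arg_cong[of _ _ exp]) simp
    then show ?thesis
      unfolding det2_def norm_mult power_mult_distrib norm_exp_eq_Re uminus_complex.simps by (rule arg_cong)
  qed
  also have "\<dots> \<le> exp (2 * Re (\<Sum>i\<in>F. A i i) + (hs_norm F A)\<^sup>2) * exp (- 2 * Re (\<Sum>i\<in>F. A i i))"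
    using 1 by (rule mult_right_mono) simp
  also have "\<dots> = (exp ((hs_norm F A)\<^sup>2 / 2))\<^sup>2"
    unfolding exp_double[symmetric] exp_add[symmetric] by (rule arg_cong[of _ _ exp]) simp
  finally show ?thesis by (rule power2_le_imp_le) simp
qed

text \<open>Cauchy's estimate for the entire function \<open>s \<mapsto> det2 (X + s (Y - X))\<close> on a disk of radius \<open>1 / e\<close>.\<close>

lemma det2_diff_le:
  assumes F: "finite F" and X: "hs_norm F X \<le> k" and d: "hs_norm F (\<lambda>i j. Y i j - X i j) \<le> e" "0 < e"
  shows "cmod (det2 F Y - det2 F X) \<le> e * exp ((k + e + 1)\<^sup>2 / 2)"
proof -
  define f where "f = (\<lambda>s. det2 F (\<lambda>i j. X i j + s * (Y i j - X i j)))"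
  define B where "B = exp ((k + e + 1)\<^sup>2 / 2)"
  have hol: "f holomorphic_on UNIV"
    unfolding f_def det2_def principal_minor_def by (intro holomorphic_intros)
  have bound: "cmod (f s) \<le> B" if "cmod s \<le> 1 + 1 / e" for s
  proof -
    have "hs_norm F (\<lambda>i j. X i j + s * (Y i j - X i j)) \<le> hs_norm F X + cmod s * hs_norm F (\<lambda>i j. Y i j - X i j)"
      by (rule hs_norm_add_le)
    also have "\<dots> \<le> k + (1 + 1 / e) * e" using that X d by (intro add_mono mult_mono) auto
    also have "\<dots> = k + e + 1" using d by (simp add: field_simps)
    finally have "(hs_norm F (\<lambda>i j. X i j + s * (Y i j - X i j)))\<^sup>2 \<le> (k + e + 1)\<^sup>2" by (intro power_mono) auto
    then show ?thesis using det2_bound[OF F, of "\<lambda>i j. X i j + s * (Y i j - X i j)"]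
      unfolding f_def B_def by (meson divide_right_mono exp_le_cancel_iff order_trans zero_le_numeral)
  qed
  have "norm (f 1 - f 0) \<le> (B * e) * norm (1 - 0 :: complex)"
  proof (rule field_differentiable_bound[where S = "cball 0 1" and f' = "deriv f"])
    fix s :: complex assume s: "s \<in> cball 0 1"
    show "(f has_field_derivative deriv f s) (at s within cball 0 1)"
      using holomorphic_derivI[OF hol open_UNIV UNIV_I] by (rule has_field_derivative_at_within)
    have "norm ((deriv ^^ 1) f s) \<le> fact 1 * B / (1 / e) ^ 1"
    proof (rule Cauchy_inequality)
      show "f holomorphic_on ball s (1 / e)" "continuous_on (cball s (1 / e)) f"
        using hol by (auto intro: holomorphic_on_subset holomorphic_on_imp_continuous_on)
      fix w assume w: "norm (s - w) = 1 / e"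
      have "cmod w \<le> cmod s + cmod (s - w)" by (metis norm_minus_commute norm_triangle_sub)
      then show "norm (f w) \<le> B" using w s by (intro bound) auto
    qed (use d in auto)
    then show "norm (deriv f s) \<le> B * e" by simp
  qed auto
  then show ?thesis by (simp add: f_def B_def mult.commute)
qed
section \<open>The Banach algebra of operators\<close>

text \<open>A copy of the operators whose multiplication is composition; as a Banach algebra it
  makes \<open>op_exp\<close> an instance of the general exponential.\<close>

typedef 'i opalg = "UNIV :: 'i ell2_op set" morphisms op_of alg_of by simp

setup_lifting type_definition_opalg

lemma norm_id_op: "norm (id_blinfun :: 'i ell2_op) = 1"
proof (rule antisym)
  show "norm (id_blinfun :: 'i ell2_op) \<le> 1" by (rule norm_blinfun_bound) auto
  show "1 \<le> norm (id_blinfun :: 'i ell2_op)"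
    using norm_blinfun[of "id_blinfun :: 'i ell2_op" "ell2_delta undefined"] by simp
qed

instantiation opalg :: (type) real_vector
begin
lift_definition zero_opalg :: "'a opalg" is 0 .
lift_definition plus_opalg :: "'a opalg \<Rightarrow> 'a opalg \<Rightarrow> 'a opalg" is "(+)" .
lift_definition minus_opalg :: "'a opalg \<Rightarrow> 'a opalg \<Rightarrow> 'a opalg" is "(-)" .
lift_definition uminus_opalg :: "'a opalg \<Rightarrow> 'a opalg" is uminus .
lift_definition scaleR_opalg :: "real \<Rightarrow> 'a opalg \<Rightarrow> 'a opalg" is scaleR .
instance by standard (transfer; simp add: algebra_simps)+
end

instantiation opalg :: (type) real_normed_vector
begin
lift_definition norm_opalg :: "'a opalg \<Rightarrow> real" is norm .
lift_definition dist_opalg :: "'a opalg \<Rightarrow> 'a opalg \<Rightarrow> real" is dist .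
definition sgn_opalg :: "'a opalg \<Rightarrow> 'a opalg" where "sgn_opalg x = x /\<^sub>R norm x"
definition uniformity_opalg :: "('a opalg \<times> 'a opalg) filter"
  where "uniformity_opalg = (INF e\<in>{0<..}. principal {(f, g). dist f g < e})"
definition open_opalg :: "'a opalg set \<Rightarrow> bool"
  where "open_opalg U = (\<forall>x\<in>U. eventually (\<lambda>(x', y). x' = x \<longrightarrow> y \<in> U) uniformity)"
instance
proof
  fix x y :: "'a opalg" and r :: real
  show "dist x y = norm (x - y)" by transfer (rule dist_norm)
  show "norm x = 0 \<longleftrightarrow> x = 0" by transfer simp
  show "norm (x + y) \<le> norm x + norm y" by transfer (rule norm_triangle_ineq)
  show "norm (r *\<^sub>R x) = \<bar>r\<bar> * norm x" by transfer simp
qed (simp_all add: sgn_opalg_def uniformity_opalg_def open_opalg_def)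
end

instantiation opalg :: (type) real_normed_algebra_1
begin
lift_definition one_opalg :: "'a opalg" is id_blinfun .
lift_definition times_opalg :: "'a opalg \<Rightarrow> 'a opalg \<Rightarrow> 'a opalg" is "(o\<^sub>L)" .
instance
proof
  show "(0 :: 'a opalg) \<noteq> 1" by transfer (metis norm_id_op norm_zero zero_neq_one)
qed (transfer, auto simp: norm_id_op norm_blinfun_compose
      blinfun.add_left blinfun.add_right blinfun.scaleR_left blinfun.scaleR_right intro!: blinfun_eqI)+
end

instance opalg :: (type) banach
proof
  fix X :: "nat \<Rightarrow> 'a opalg"
  assume "Cauchy X"
  then have "Cauchy (\<lambda>n. op_of (X n))" by (simp add: Cauchy_def dist_opalg.rep_eq)
  then obtain L where "(\<lambda>n. op_of (X n)) \<longlonglongrightarrow> L" by (meson Cauchy_convergent convergent_def)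
  then have "(\<lambda>n. dist (op_of (X n)) L) \<longlonglongrightarrow> 0" by (subst (asm) tendsto_dist_iff)
  then have "X \<longlonglongrightarrow> alg_of L" by (subst tendsto_dist_iff) (simp add: dist_opalg.rep_eq alg_of_inverse)
  then show "convergent X" by (auto simp: convergent_def)
qed

lemma bounded_linear_op_of: "bounded_linear op_of"
  by (rule bounded_linear_intro[where K = 1]) (simp_all add: plus_opalg.rep_eq scaleR_opalg.rep_eq norm_opalg.rep_eq)

lemma op_exp_eq: "op_exp A = op_of (exp (alg_of A))"
proof -
  have "op_of (alg_of A ^ k) = ((\<lambda>B. A o\<^sub>L B) ^^ k) id_blinfun" for k
    by (induction k) (simp_all add: one_opalg.rep_eq times_opalg.rep_eq alg_of_inverse)
  then have "op_of (alg_of A ^ k /\<^sub>R fact k) = (1 / fact k) *\<^sub>R (((\<lambda>B. A o\<^sub>L B) ^^ k) id_blinfun)" for k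
    by (simp add: scaleR_opalg.rep_eq divide_inverse)
  then show ?thesis
    unfolding op_exp_def exp_def bounded_linear.suminf[OF bounded_linear_op_of summable_exp_generic] by simp
qed

text \<open>Termwise convergence of the exponential series, dominated by the series of a common
  bound K for the norms.\<close>

lemma tendsto_exp_algebra:
  fixes f :: "nat \<Rightarrow> 'a::{real_normed_algebra_1, banach}"
  assumes "f \<longlonglongrightarrow> a"
  shows "(\<lambda>n. exp (f n)) \<longlonglongrightarrow> exp a"
proof -
  obtain K where K: "\<And>n. norm (f n) \<le> K" using convergent_imp_Bseq[of f] assms by (auto simp: Bseq_def convergent_def)
  have "eventually (\<lambda>n. summable (\<lambda>k. norm (f n ^ k /\<^sub>R fact k))) sequentially \<and> summable (\<lambda>k. norm (a ^ k /\<^sub>R fact k)) \<and>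
    (\<lambda>n. \<Sum>k. f n ^ k /\<^sub>R fact k) \<longlonglongrightarrow> (\<Sum>k. a ^ k /\<^sub>R fact k)"
  proof (rule tannerys_theorem[where M = "\<lambda>k. K ^ k /\<^sub>R fact k"])
    show "(\<lambda>n. f n ^ k /\<^sub>R fact k) \<longlonglongrightarrow> a ^ k /\<^sub>R fact k" for k by (intro tendsto_intros assms)
    show "summable (\<lambda>k. K ^ k /\<^sub>R fact k)" by (rule summable_exp_generic)
    show "\<forall>\<^sub>F (k, n) in at_top \<times>\<^sub>F sequentially. norm (f n ^ k /\<^sub>R fact k) \<le> K ^ k /\<^sub>R fact k"
    proof (rule always_eventually, clarify)
      fix k n
      have "norm (f n ^ k) \<le> K ^ k" using norm_power_ineq[of "f n" k] power_mono[OF K[of n], of k] by simp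
      then show "norm (f n ^ k /\<^sub>R fact k) \<le> K ^ k /\<^sub>R fact k" by (simp add: mult_left_mono)
    qed
  qed simp
  then show ?thesis unfolding exp_def by blast
qed

text \<open>The factor x^2 is kept explicit because (1 + A) exp (-A) - 1 has no terms of order below
  two; two factors A are what makes its rows summable later.\<close>

lemma exp_second_order:
  fixes x :: "'a::{real_normed_algebra_1, banach}"
  obtains h where "exp x = 1 + x + x * x * h" "norm h \<le> exp (norm x)" "h * x = x * h"
proof -
  define c where "c = (\<lambda>k. x ^ k /\<^sub>R fact (k + 2))"
  define h where "h = (\<Sum>k. c k)"
  have le: "norm (c k) \<le> norm x ^ k /\<^sub>R fact k" for k
  proof -
    have "norm (c k) = norm (x ^ k) / fact (k + 2)" by (simp add: c_def divide_inverse mult.commute)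
    also have "\<dots> \<le> norm x ^ k / fact k"
      by (intro frac_le norm_power_ineq fact_mono) auto
    finally show ?thesis by (simp add: divide_inverse mult.commute)
  qed
  have sn: "summable (\<lambda>k. norm (c k))"
    by (rule summable_comparison_test'[OF summable_exp_generic[of "norm x"], of 0]) (use le in auto)
  then have s: "summable c" by (rule summable_norm_cancel)
  have "exp x = (\<Sum>k. x ^ (k + 2) /\<^sub>R fact (k + 2)) + (\<Sum>k<2. x ^ k /\<^sub>R fact k)"
    unfolding exp_def by (rule suminf_split_initial_segment[OF summable_exp_generic])
  also have "(\<lambda>k. x ^ (k + 2) /\<^sub>R fact (k + 2)) = (\<lambda>k. x * x * c k)"
    by (auto simp: c_def fun_eq_iff numeral_2_eq_2 mult.assoc)
  also have "(\<Sum>k. x * x * c k) = x * x * h" unfolding h_def by (rule suminf_mult[OF s])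
  finally have 1: "exp x = 1 + x + x * x * h" by (simp add: numeral_2_eq_2 add_ac)
  have "norm h \<le> (\<Sum>k. norm (c k))" unfolding h_def by (rule summable_norm[OF sn])
  also have "\<dots> \<le> exp (norm x)" unfolding exp_def by (intro suminf_le le sn summable_exp_generic)
  finally have 2: "norm h \<le> exp (norm x)" .
  have "h * x = (\<Sum>k. c k * x)" unfolding h_def by (rule suminf_mult2[OF s])
  also have "(\<lambda>k. c k * x) = (\<lambda>k. x * c k)" by (simp add: c_def fun_eq_iff power_commutes)
  also have "(\<Sum>k. x * c k) = x * h" unfolding h_def by (rule suminf_mult[OF s])
  finally show thesis using that 1 2 by blast
qed
section \<open>Fredholm determinants\<close>

text \<open>Dominated convergence for unordered sums, obtained from the counting measure.\<close>

lemma infsum_dominated_tendsto: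
  fixes f :: "nat \<Rightarrow> 'a \<Rightarrow> complex"
  assumes lim: "\<And>x. x \<in> A \<Longrightarrow> (\<lambda>k. f k x) \<longlonglongrightarrow> g x"
    and dom: "\<And>k x. x \<in> A \<Longrightarrow> cmod (f k x) \<le> b x" and b: "b summable_on A"
  shows "(\<lambda>k. infsum (f k) A) \<longlonglongrightarrow> infsum g A"
proof -
  have b0: "0 \<le> b x" if "x \<in> A" for x using dom[OF that, of 0] norm_ge_zero order_trans by blast
  have ba: "(\<lambda>x. norm (b x)) summable_on A" using b b0 by (subst summable_on_cong[where g = b]) auto
  have gb: "cmod (g x) \<le> b x" if "x \<in> A" for x
    by (rule LIMSEQ_le_const2[OF tendsto_norm[OF lim[OF that]]]) (use dom that in auto)
  have fa: "(\<lambda>x. norm (f k x)) summable_on A" for k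
    by (rule Infinite_Sum.abs_summable_on_comparison_test[OF ba]) (use dom b0 in fastforce)
  have ga: "(\<lambda>x. norm (g x)) summable_on A"
    by (rule Infinite_Sum.abs_summable_on_comparison_test[OF ba]) (use gb b0 in fastforce)
  have "(\<lambda>k. integral\<^sup>L (count_space A) (f k)) \<longlonglongrightarrow> integral\<^sup>L (count_space A) g"
  proof (rule integral_dominated_convergence[where w = b])
    show "integrable (count_space A) b"
      using ba[unfolded abs_summable_equivalent] by (simp only: Infinite_Set_Sum.abs_summable_on_def)
  qed (use lim dom in \<open>auto intro!: AE_I2\<close>)
  then show ?thesis
    using infsetsum_infsum[OF fa[unfolded abs_summable_equivalent]] infsetsum_infsum[OF ga[unfolded abs_summable_equivalent]]
    by (simp add: infsetsum_def)
qed

lemma principal_minor_zero_row: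
  assumes "finite S" "a \<in> S" "\<And>j. j \<in> S \<Longrightarrow> K a j = 0"
  shows "principal_minor K S = 0"
proof -
  have "principal_minor K (insert a (S - {a})) = 0" using assms by (subst principal_minor_single_entry_row) auto
  then show ?thesis using assms(2) by (simp add: insert_absorb)
qed

lemma matrix_entry_id: "matrix_entry id_blinfun m n = (if m = n then 1 else 0)"
  by (simp add: matrix_entry_def ell2_delta.rep_eq)

text \<open>A minor whose index set leaves F has a zero row, so the infinite sum reduces to the
  subsets of F and \<open>sum_principal_minors\<close> applies.\<close>

lemma fredholm_det_finite_rows:
  assumes F: "finite F" and z: "\<And>m n. m \<notin> F \<Longrightarrow> matrix_entry (X - id_blinfun) m n = 0"
  shows "fredholm_det X = principal_minor (matrix_entry X) F"
proof -
  let ?K = "matrix_entry (X - id_blinfun)"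
  have "fredholm_det X = infsum (principal_minor ?K) (Pow F)"
    unfolding fredholm_det_def
  proof (rule infsum_cong_neutral)
    fix S assume "S \<in> {S. finite S} - Pow F"
    then obtain a where "finite S" "a \<in> S" "a \<notin> F" by auto
    then show "principal_minor ?K S = 0" using z by (intro principal_minor_zero_row[of S a]) auto
  qed (use F finite_subset in auto)
  also have "\<dots> = (\<Sum>S\<in>Pow F. principal_minor ?K S)" using F by (intro infsum_finite) simp
  also have "\<dots> = principal_minor (\<lambda>i j. (if i = j then 1 else 0) + ?K i j) F" by (rule sum_principal_minors[OF F])
  also have "\<dots> = principal_minor (matrix_entry X) F"
    by (rule principal_minor_cong) (simp add: matrix_entry_diff matrix_entry_id)
  finally show ?thesis .
qed

lemma ell2_fun_sum: "ell2_fun (\<Sum>k\<in>F. f k) n = (\<Sum>k\<in>F. ell2_fun (f k) n)"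
  by (induction F rule: infinite_finite_induct) (simp_all add: zero_ell2.rep_eq plus_ell2.rep_eq)

lemma complex_linear_op_sum_delta:
  fixes X :: "'i ell2_op"
  assumes "complex_linear_op X"
  shows "ell2_fun (X (\<Sum>k\<in>F. scalar_op (c k) (ell2_delta k))) i = (\<Sum>k\<in>F. c k * matrix_entry X i k)"
  by (simp add: blinfun.sum_right ell2_fun_sum complex_linear_op_apply[OF assms] matrix_entry_def)

lemma ell2_eq_sum_delta:
  assumes "finite F" "\<And>k. k \<notin> F \<Longrightarrow> ell2_fun f k = 0"
  shows "f = (\<Sum>k\<in>F. scalar_op (ell2_fun f k) (ell2_delta k))"
proof (rule ell2_eqI)
  fix n
  have "(\<Sum>k\<in>F. ell2_fun f k * (if n = k then 1 else 0)) = (if n \<in> F then ell2_fun f n else 0)"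
    using assms(1) by (simp add: if_distrib[of "\<lambda>x. _ * x"] cong: if_cong)
  then show "ell2_fun f n = ell2_fun (\<Sum>k\<in>F. scalar_op (ell2_fun f k) (ell2_delta k)) n"
    using assms(2)[of n] by (auto simp: ell2_fun_sum ell2_delta.rep_eq)
qed

lemma matrix_entry_compose:
  assumes X: "complex_linear_op X" and F: "finite F" and Y: "\<And>k. k \<notin> F \<Longrightarrow> matrix_entry Y k j = 0"
  shows "matrix_entry (X o\<^sub>L Y) i j = (\<Sum>k\<in>F. matrix_entry X i k * matrix_entry Y k j)"
proof -
  have "Y (ell2_delta j) = (\<Sum>k\<in>F. scalar_op (matrix_entry Y k j) (ell2_delta k))"
    using Y unfolding matrix_entry_def by (intro ell2_eq_sum_delta F) auto
  then show ?thesis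
    by (simp add: matrix_entry_def[of "X o\<^sub>L Y"] complex_linear_op_sum_delta[OF X] mult.commute)
qed

lemma bounded_linear_matrix_entry: "bounded_linear (\<lambda>X. matrix_entry X i j)"
proof (rule bounded_linear_intro[where K = 1])
  show "matrix_entry (r *\<^sub>R X) i j = r *\<^sub>R matrix_entry X i j" for r X
    by (simp add: matrix_entry_def scaleR_blinfun.rep_eq scaleR_ell2.rep_eq)
qed (simp_all add: matrix_entry_add norm_matrix_entry_le)

lemma exp_commute_algebra:
  fixes x y :: "'a::{real_normed_algebra_1, banach}"
  assumes "x * y = y * x"
  shows "exp x * y = y * exp x"
  using assms by (simp add: exp_def suminf_mult[symmetric] summable_exp_generic power_commuting_commutes suminf_mult2)

lemma complex_linear_op_exp:
  assumes "complex_linear_op (op_of a)"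
  shows "complex_linear_op (op_of (exp a))"
  unfolding complex_linear_op_def
proof
  fix c
  have "a * alg_of (scalar_op c) = alg_of (scalar_op c) * a"
    using assms unfolding complex_linear_op_def
    by (metis alg_of_inverse UNIV_I op_of_inject times_opalg.rep_eq)
  from exp_commute_algebra[OF this]
  show "op_of (exp a) o\<^sub>L scalar_op c = scalar_op c o\<^sub>L op_of (exp a)"
    by (metis alg_of_inverse UNIV_I times_opalg.rep_eq)
qed

text \<open>exp a - 1 has a left factor a, so it cannot change a row in which a is zero.\<close>

lemma op_exp_rows:
  assumes "\<And>f. ell2_fun (op_of a f) k = 0"
  shows "ell2_fun (op_of (exp a) f) k = ell2_fun f k"
proof -
  obtain h where h: "exp a = 1 + a + a * a * h" by (rule exp_second_order)
  have "op_of (exp a) f = f + op_of a f + op_of a (op_of a (op_of h f))"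
    unfolding h by (simp add: plus_opalg.rep_eq one_opalg.rep_eq times_opalg.rep_eq blinfun.add_left)
  then show ?thesis using assms by (simp add: plus_ell2.rep_eq)
qed

text \<open>The determinant of \<open>exp (s A)\<close> is a one-parameter group with derivative \<open>tr A\<close> at \<open>0\<close>.\<close>

lemma principal_minor_op_exp:
  fixes A :: "'i ell2_op"
  assumes F: "finite F" and A: "complex_linear_op A" and rows: "\<And>m f. m \<notin> F \<Longrightarrow> ell2_fun (A f) m = 0"
  shows "principal_minor (matrix_entry (op_exp (- A))) F = exp (- (\<Sum>i\<in>F. matrix_entry A i i))"
proof -
  define a where "a = alg_of A"
  have opa: "op_of a = A" by (simp add: a_def alg_of_inverse)
  define E where "E = (\<lambda>s::real. op_of (exp (s *\<^sub>R a)))"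
  define \<tau> where "\<tau> = (\<Sum>i\<in>F. matrix_entry A i i)"
  define \<psi> where "\<psi> = (\<lambda>s. principal_minor (matrix_entry (E s)) F)"
  have clE: "complex_linear_op (E s)" for s
    unfolding E_def by (rule complex_linear_op_exp) (simp add: scaleR_opalg.rep_eq opa complex_linear_op_scaleR A)
  have rowE: "ell2_fun (E s f) k = ell2_fun f k" if "k \<notin> F" for s f k
    unfolding E_def by (rule op_exp_rows)
      (simp add: scaleR_opalg.rep_eq opa scaleR_blinfun.rep_eq scaleR_ell2.rep_eq rows[OF that])
  have zeroE: "matrix_entry (E s) k j = 0" if "k \<notin> F" "j \<in> F" for s k j
    using that by (auto simp: matrix_entry_def rowE ell2_delta.rep_eq)
  have mult: "\<psi> (s + t) = \<psi> s * \<psi> t" for s t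
  proof -
    have "E (s + t) = E s o\<^sub>L E t"
      unfolding E_def scaleR_add_left by (subst exp_add_commuting) (simp_all add: times_opalg.rep_eq)
    then have "\<psi> (s + t) = principal_minor (\<lambda>i j. \<Sum>k\<in>F. matrix_entry (E s) i k * matrix_entry (E t) k j) F"
      unfolding \<psi>_def
      by (auto intro!: principal_minor_cong matrix_entry_compose[OF clE F] simp: zeroE)
    then show ?thesis using F by (simp add: principal_minor_mult \<psi>_def)
  qed
  have E0: "E 0 = id_blinfun" by (simp add: E_def one_opalg.rep_eq)
  have "((\<lambda>s. op_of (exp (s *\<^sub>R a))) has_vector_derivative op_of (exp (0 *\<^sub>R a) * a)) (at 0)"
    by (rule bounded_linear.has_vector_derivative[OF bounded_linear_op_of exp_scaleR_has_vector_derivative_right])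
  then have dE: "(E has_vector_derivative A) (at 0)" by (simp add: E_def[abs_def] opa)
  have dm: "((\<lambda>s. matrix_entry (E s) i j) has_derivative (\<lambda>h. h *\<^sub>R matrix_entry A i j)) (at 0)" for i j
    using bounded_linear.has_vector_derivative[OF bounded_linear_matrix_entry dE, of i j]
    by (simp add: has_vector_derivative_def)
  have "(\<psi> has_derivative (\<lambda>h. \<Sum>i\<in>F. h *\<^sub>R matrix_entry A i i)) (at 0)"
    unfolding \<psi>_def using F dm
    by (rule principal_minor_has_derivative_at_identity) (simp add: E0 matrix_entry_id)
  then have d0: "(\<psi> has_vector_derivative \<tau>) (at 0)"
    by (simp add: has_vector_derivative_def \<tau>_def scaleR_sum_right)
  have d: "(\<psi> has_vector_derivative \<psi> t * \<tau>) (at t)" for t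
  proof -
    have "((\<lambda>s. \<psi> (s - t)) has_vector_derivative (1 *\<^sub>R \<tau>)) (at t)"
      by (rule vector_diff_chain_at[where f = "\<lambda>s. s - t" and g = \<psi>, unfolded o_def])
        (auto intro!: derivative_eq_intros d0)
    then have "((\<lambda>s. \<psi> t * \<psi> (s - t)) has_vector_derivative (\<psi> t * (1 *\<^sub>R \<tau>))) (at t)"
      by (intro derivative_eq_intros) auto
    then show ?thesis by (simp flip: mult)
  qed
  have "((\<lambda>s. \<psi> s * exp (- (of_real s * \<tau>))) has_vector_derivative 0) (at t within UNIV)" for t
  proof -
    have "((\<lambda>w. exp (- (w * \<tau>))) has_field_derivative - \<tau> * exp (- (of_real t * \<tau>))) (at (of_real t))"
      by (auto intro!: derivative_eq_intros)
    from has_vector_derivative_real_field[OF this]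
    have "((\<lambda>s. \<psi> s * exp (- (of_real s * \<tau>))) has_vector_derivative
      \<psi> t * (- \<tau> * exp (- (of_real t * \<tau>))) + \<psi> t * \<tau> * exp (- (of_real t * \<tau>))) (at t)"
      by (intro has_vector_derivative_mult d) simp
    then show ?thesis by simp
  qed
  then obtain c where c: "\<And>s. \<psi> s * exp (- (of_real s * \<tau>)) = c"
    using has_vector_derivative_zero_constant[of UNIV "\<lambda>s. \<psi> s * exp (- (of_real s * \<tau>))"] by auto
  have "\<psi> 0 = 1" unfolding \<psi>_def E0 by (rule principal_minor_identity[OF F]) (simp add: matrix_entry_id)
  then have "c = 1" using c[of 0] by simp
  then have "\<psi> (-1) * exp \<tau> = 1" using c[of "-1"] by simp
  then have "\<psi> (-1) = exp (- \<tau>)" by (simp add: exp_minus field_simps)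
  moreover have "op_exp (- A) = E (-1)"
    unfolding op_exp_eq E_def a_def by (rule arg_cong[where f = "\<lambda>x. op_of (exp x)"]) (simp add: uminus_opalg.abs_eq)
  ultimately show ?thesis by (simp add: \<psi>_def \<tau>_def)
qed

lemma fredholm_det_finite_rows_det2:
  fixes A :: "'i ell2_op"
  assumes F: "finite F" and A: "complex_linear_op A" and rows: "\<And>m f. m \<notin> F \<Longrightarrow> ell2_fun (A f) m = 0"
  shows "fredholm_det ((id_blinfun + A) o\<^sub>L op_exp (- A)) = det2 F (matrix_entry A)"
proof -
  define E where "E = op_exp (- A)"
  have rowE: "ell2_fun (E f) k = ell2_fun f k" if "k \<notin> F" for f k
    unfolding E_def op_exp_eq using rows[OF that]
    by (intro op_exp_rows) (simp add: alg_of_inverse uminus_blinfun.rep_eq uminus_ell2.rep_eq)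
  have "fredholm_det ((id_blinfun + A) o\<^sub>L E) = principal_minor (matrix_entry ((id_blinfun + A) o\<^sub>L E)) F"
    using F by (rule fredholm_det_finite_rows)
      (simp add: matrix_entry_def blinfun.diff_left blinfun.add_left minus_ell2.rep_eq plus_ell2.rep_eq rowE rows)
  also have "\<dots> = principal_minor (\<lambda>i j. \<Sum>k\<in>F. matrix_entry (id_blinfun + A) i k * matrix_entry E k j) F"
    using F A by (intro principal_minor_cong matrix_entry_compose complex_linear_op_add complex_linear_op_id)
      (auto simp: matrix_entry_def[of E] rowE ell2_delta.rep_eq)
  also have "\<dots> = det2 F (matrix_entry A)"
    unfolding principal_minor_mult[OF F] E_def det2_def
    by (subst principal_minor_op_exp[OF assms]) (simp_all add: matrix_entry_add[abs_def] matrix_entry_id)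
  finally show ?thesis by (simp add: E_def)
qed

text \<open>The conjugated row, cut off to S, is the test vector: it is mapped to the squared norm q
  of the row piece, while its own norm is the root of q.\<close>

lemma matrix_entry_row_bound:
  fixes X :: "'i ell2_op"
  assumes X: "complex_linear_op X" and S: "finite S" and row: "\<And>f. cmod (ell2_fun (X f) m) \<le> \<rho> * norm f"
  shows "(\<Sum>n\<in>S. (cmod (matrix_entry X m n))\<^sup>2) \<le> \<rho>\<^sup>2"
proof -
  define x where "x = matrix_entry X m"
  define q where "q = (\<Sum>n\<in>S. (cmod (x n))\<^sup>2)"
  define f where "f = (\<Sum>n\<in>S. scalar_op (cnj (x n)) (ell2_delta n))"
  have q0: "0 \<le> q" by (simp add: q_def sum_nonneg)
  have "ell2_fun (X f) m = (\<Sum>n\<in>S. cnj (x n) * x n)"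
    unfolding f_def x_def by (rule complex_linear_op_sum_delta[OF X])
  also have "\<dots> = of_real q" by (simp add: q_def complex_norm_square mult.commute del: of_real_power)
  finally have Xf: "cmod (ell2_fun (X f) m) = q" using q0 by simp
  have ff: "ell2_fun f k = (if k \<in> S then cnj (x k) else 0)" for k
    unfolding f_def ell2_fun_sum using S by (simp add: ell2_delta.rep_eq if_distrib[of "\<lambda>x. _ * x"] cong: if_cong)
  have "(\<Sum>\<^sub>\<infinity>k. (cmod (ell2_fun f k))\<^sup>2) = (\<Sum>\<^sub>\<infinity>k\<in>S. (cmod (x k))\<^sup>2)"
    by (rule infsum_cong_neutral) (auto simp: ff)
  then have nf: "norm f = sqrt q" using S by (simp add: norm_ell2_def q_def)
  have "q \<le> \<rho> * sqrt q" using row[of f] Xf nf by simp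
  then have "sqrt q * sqrt q \<le> \<rho> * sqrt q" using q0 by simp
  then have "sqrt q \<le> \<rho> \<or> q = 0" using q0 by (auto simp: mult_le_cancel_right simp del: real_sqrt_mult_self)
  then have "q \<le> \<rho>\<^sup>2"
  proof
    assume "sqrt q \<le> \<rho>"
    then have "(sqrt q)\<^sup>2 \<le> \<rho>\<^sup>2" using q0 by (intro power_mono) auto
    then show ?thesis using q0 by simp
  qed simp
  then show ?thesis by (simp add: q_def x_def)
qed

lemma norm_principal_minor_le_prod:
  fixes X :: "'i ell2_op"
  assumes X: "complex_linear_op X" and S: "finite S"
    and row: "\<And>m f. m \<in> S \<Longrightarrow> cmod (ell2_fun (X f) m) \<le> \<rho> m * norm f" and \<rho>: "\<And>m. 0 \<le> \<rho> m"
  shows "cmod (principal_minor (matrix_entry X) S) \<le> (\<Prod>m\<in>S. \<rho> m)"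
proof -
  have "(cmod (principal_minor (matrix_entry X) S))\<^sup>2 \<le> (\<Prod>i\<in>S. \<Sum>j\<in>S. (cmod (matrix_entry X i j))\<^sup>2)"
    by (rule hadamard_inequality[OF S])
  also have "\<dots> \<le> (\<Prod>i\<in>S. (\<rho> i)\<^sup>2)"
    using row by (intro prod_mono conjI sum_nonneg matrix_entry_row_bound[OF X S]) auto
  also have "\<dots> = (\<Prod>i\<in>S. \<rho> i)\<^sup>2" by (simp add: prod_power_distrib)
  finally show ?thesis by (rule power2_le_imp_le) (simp add: prod_nonneg \<rho>)
qed

text \<open>Over the subsets of a finite set the products sum to the product of 1 +
  \<open>\<rho> m\<close>, which is at most the exponential of the sum of \<open>\<rho>\<close>. By
  Hadamard such products dominate principal minors.\<close>

lemma summable_on_prod_finite_sets: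
  fixes \<rho> :: "'i \<Rightarrow> real"
  assumes \<rho>: "\<And>m. 0 \<le> \<rho> m" and s: "\<rho> summable_on UNIV"
  shows "(\<lambda>S. \<Prod>m\<in>S. \<rho> m) summable_on {S. finite S}"
proof (rule nonneg_bdd_above_summable_on)
  show "bdd_above (sum (\<lambda>S. \<Prod>m\<in>S. \<rho> m) ` {F. F \<subseteq> {S. finite S} \<and> finite F})"
  proof (rule bdd_aboveI2)
    fix \<F> :: "'i set set" assume "\<F> \<in> {F. F \<subseteq> {S. finite S} \<and> finite F}"
    then have U: "finite (\<Union>\<F>)" "\<F> \<subseteq> Pow (\<Union>\<F>)" by auto
    have "(\<Sum>S\<in>\<F>. \<Prod>m\<in>S. \<rho> m) \<le> (\<Sum>S\<in>Pow (\<Union>\<F>). \<Prod>m\<in>S. \<rho> m)"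
      using U \<rho> by (intro sum_mono2) (auto intro: prod_nonneg)
    also have "\<dots> = (\<Prod>m\<in>\<Union>\<F>. \<rho> m + 1)" using prod_add_expand[OF U(1), of \<rho> "\<lambda>_. 1"] by simp
    also have "\<dots> \<le> (\<Prod>m\<in>\<Union>\<F>. exp (\<rho> m))"
      using \<rho> by (intro prod_mono) (auto simp: add.commute[of _ 1] add_nonneg_nonneg)
    also have "\<dots> = exp (\<Sum>m\<in>\<Union>\<F>. \<rho> m)" using U(1) by (simp add: exp_sum)
    also have "\<dots> \<le> exp (\<Sum>\<^sub>\<infinity>m. \<rho> m)" using finite_sum_le_infsum[OF s U(1)] \<rho> by simp
    finally show "(\<Sum>S\<in>\<F>. \<Prod>m\<in>S. \<rho> m) \<le> exp (\<Sum>\<^sub>\<infinity>m. \<rho> m)" .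
  qed
qed (auto intro: prod_nonneg \<rho>)

section \<open>Hilbert-Schmidt perturbations and their finite sections\<close>

definition truncate :: "'i set \<Rightarrow> ('i \<Rightarrow> complex) \<Rightarrow> 'i \<Rightarrow> complex"
  where "truncate F V = (\<lambda>n. if n \<in> F then V n else 0)"

lemma norm_mult_op_le:
  assumes V: "\<And>n. cmod (V n) \<le> C"
  shows "norm (mult_op V) \<le> C"
proof -
  have C: "0 \<le> C" using V[of undefined] norm_ge_zero order_trans by blast
  have b: "bounded (range V)" using V by (auto simp: bounded_iff)
  show ?thesis
  proof (rule norm_blinfun_bound[OF C])
    fix f :: "'a ell2"
    have "norm (Abs_ell2 (ell2_fun (mult_op V f))) \<le> C * norm f"
    proof (rule ell2_bdd_sums(2))
      fix F :: "'a set" assume F: "finite F"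
      have "(\<Sum>x\<in>F. (cmod (ell2_fun (mult_op V f) x))\<^sup>2) \<le> (\<Sum>x\<in>F. C\<^sup>2 * (cmod (ell2_fun f x))\<^sup>2)"
        using V by (intro sum_mono) (simp add: mult_op_apply[OF b] norm_mult power_mult_distrib mult_right_mono power_mono)
      also have "\<dots> \<le> C\<^sup>2 * (norm f)\<^sup>2"
        unfolding sum_distrib_left[symmetric] by (intro mult_left_mono ell2_sum_le_norm F) simp
      finally show "(\<Sum>x\<in>F. (cmod (ell2_fun (mult_op V f) x))\<^sup>2) \<le> (C * norm f)\<^sup>2" by (simp add: power_mult_distrib)
    qed (simp add: C)
    then show "norm (mult_op V f) \<le> C * norm f" by (simp add: ell2_fun_inverse)
  qed
qed

lemma sum_summable_on:
  fixes f :: "'b \<Rightarrow> 'a \<Rightarrow> real"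
  assumes "\<And>m. f m summable_on A"
  shows "(\<lambda>n. \<Sum>m\<in>S. f m n) summable_on A"
  by (induction S rule: infinite_finite_induct) (simp_all add: summable_on_add assms)

lemma sum_matrix_entry_col_le: "finite S \<Longrightarrow> (\<Sum>m\<in>S. (cmod (matrix_entry R m n))\<^sup>2) \<le> (norm R)\<^sup>2"
  using order_trans[OF ell2_sum_le_norm[of S "R (ell2_delta n)"] power_mono[OF norm_blinfun[of R "ell2_delta n"], of 2]]
  by (simp add: matrix_entry_def)

text \<open>The situation at one fixed lambda, with R in the role of the free resolvent: V in l^2
  makes V R Hilbert-Schmidt. The bounds here depend on \<open>norm R\<close> and serve convergence
  only, not uniformity in lambda.\<close>

locale square_summable_perturbation =
  fixes V :: "'i \<Rightarrow> complex" and R :: "'i ell2_op"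
  assumes V2: "(\<lambda>n. (cmod (V n))\<^sup>2) summable_on UNIV" and R: "complex_linear_op R"
begin

definition nV :: real where "nV = sqrt (\<Sum>\<^sub>\<infinity>n. (cmod (V n))\<^sup>2)"
definition row :: "'i \<Rightarrow> real" where "row m = sqrt (\<Sum>\<^sub>\<infinity>n. (cmod (matrix_entry R m n * V n))\<^sup>2)"

lemma nV_sq: "nV\<^sup>2 = (\<Sum>\<^sub>\<infinity>n. (cmod (V n))\<^sup>2)" and nV_nonneg: "0 \<le> nV"
  by (simp_all add: nV_def infsum_nonneg)

lemma row_sq: "(row m)\<^sup>2 = (\<Sum>\<^sub>\<infinity>n. (cmod (matrix_entry R m n * V n))\<^sup>2)" and row_nonneg: "0 \<le> row m"
  by (simp_all add: row_def infsum_nonneg)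

lemma row_summable: "(\<lambda>n. (cmod (matrix_entry R m n * V n))\<^sup>2) summable_on UNIV"
  by (rule ell2_mult_summable[OF V2 norm_matrix_entry_le])

lemma sum_row_summable: "(\<lambda>n. \<Sum>m\<in>S. (cmod (matrix_entry R m n * V n))\<^sup>2) summable_on UNIV"
  by (rule sum_summable_on) (rule row_summable)

lemma V_bound: "cmod (V n) \<le> nV"
  by (rule power2_le_imp_le) (use finite_sum_le_infsum[OF V2, of "{n}"] nV_nonneg in \<open>simp_all add: nV_sq\<close>)

text \<open>The left side is part of the squared Hilbert-Schmidt norm of R V. Exchanging the sums
  bounds it by columns, and no column of R is longer than the norm of R.\<close>

lemma sum_row_sq_le: assumes S: "finite S" shows "(\<Sum>m\<in>S. (row m)\<^sup>2) \<le> (norm R)\<^sup>2 * nV\<^sup>2"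
proof -
  have "(\<Sum>m\<in>S. (row m)\<^sup>2) = (\<Sum>\<^sub>\<infinity>n. \<Sum>m\<in>S. (cmod (matrix_entry R m n * V n))\<^sup>2)"
    unfolding row_sq using S
  proof (induction S)
    case (insert a S)
    then show ?case using infsum_add[OF row_summable[of a] sum_row_summable[of S]] by simp
  qed simp
  also have "\<dots> \<le> (\<Sum>\<^sub>\<infinity>n. (norm R)\<^sup>2 * (cmod (V n))\<^sup>2)"
  proof (rule infsum_mono)
    show "(\<lambda>n. \<Sum>m\<in>S. (cmod (matrix_entry R m n * V n))\<^sup>2) summable_on UNIV"
      by (rule sum_row_summable)
    show "(\<lambda>n. (norm R)\<^sup>2 * (cmod (V n))\<^sup>2) summable_on UNIV" by (intro summable_on_cmult_right V2)
    show "(\<Sum>m\<in>S. (cmod (matrix_entry R m n * V n))\<^sup>2) \<le> (norm R)\<^sup>2 * (cmod (V n))\<^sup>2" for n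
      using mult_right_mono[OF sum_matrix_entry_col_le[OF S, of R n] zero_le_power2[of "cmod (V n)"]]
      by (simp add: norm_mult power_mult_distrib sum_distrib_right)
  qed
  also have "\<dots> = (norm R)\<^sup>2 * nV\<^sup>2" unfolding nV_sq by (rule infsum_cmult_right')
  finally show ?thesis .
qed

lemma weight_summable: "(\<lambda>m. cmod (V m) * row m) summable_on UNIV"
proof (rule summable_on_comparison_test)
  have "(\<lambda>m. (row m)\<^sup>2) summable_on UNIV"
    by (rule nonneg_bdd_above_summable_on, simp, rule bdd_aboveI2, rule sum_row_sq_le) simp
  then show "(\<lambda>m. (cmod (V m))\<^sup>2 + (row m)\<^sup>2) summable_on UNIV" by (intro summable_on_add V2)
  show "cmod (V m) * row m \<le> (cmod (V m))\<^sup>2 + (row m)\<^sup>2" for m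
    using sum_squares_bound[of "cmod (V m)" "row m"] mult_nonneg_nonneg[OF norm_ge_zero row_nonneg, of "V m" m] by linarith
qed (simp add: row_nonneg)

lemma truncate_bound: "cmod (truncate F V n) \<le> nV"
  using V_bound[of n] nV_nonneg by (simp add: truncate_def)

lemma bounded_truncate: "bounded (range (truncate F V))"
  using truncate_bound[of F] by (auto simp: bounded_iff)

lemma bounded_V: "bounded (range V)"
  using V_bound by (auto simp: bounded_iff)

lemma row_mult_op_le:
  assumes F: "finite F"
  shows "cmod (ell2_fun (R (mult_op (truncate F V) u)) m) \<le> row m * norm u"
proof -
  let ?r = "\<lambda>n. cmod (matrix_entry R m n * V n)" and ?u = "\<lambda>n. cmod (ell2_fun u n)"
  have "mult_op (truncate F V) u = (\<Sum>n\<in>F. scalar_op (ell2_fun (mult_op (truncate F V) u) n) (ell2_delta n))"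
    by (rule ell2_eq_sum_delta[OF F]) (simp only: mult_op_apply[OF bounded_truncate], simp add: truncate_def)
  from arg_cong[OF this, of "\<lambda>f. ell2_fun (R f) m"]
  have "ell2_fun (R (mult_op (truncate F V) u)) m = (\<Sum>n\<in>F. ell2_fun (mult_op (truncate F V) u) n * matrix_entry R m n)"
    using complex_linear_op_sum_delta[OF R, of "ell2_fun (mult_op (truncate F V) u)" F m] by simp
  also have "\<dots> = (\<Sum>n\<in>F. (matrix_entry R m n * V n) * ell2_fun u n)"
    by (intro sum.cong refl) (simp only: mult_op_apply[OF bounded_truncate], simp add: truncate_def)
  also have "cmod \<dots> \<le> (\<Sum>n\<in>F. \<bar>?r n\<bar> * \<bar>?u n\<bar>)"
    by (rule order_trans[OF norm_sum]) (simp add: norm_mult)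
  also have "\<dots> \<le> L2_set ?r F * L2_set ?u F" by (rule L2_set_mult_ineq)
  also have "\<dots> \<le> row m * norm u"
  proof (intro mult_mono)
    show "L2_set ?r F \<le> row m"
      unfolding L2_set_def row_def by (intro real_sqrt_le_mono finite_sum_le_infsum row_summable F) auto
    show "L2_set ?u F \<le> norm u"
      unfolding L2_set_def using ell2_sum_le_norm[OF F, of u] by (intro real_le_lsqrt) (auto simp: sum_nonneg)
  qed (auto simp: L2_set_nonneg row_nonneg)
  finally show ?thesis .
qed

definition K :: real where "K = nV * norm R"
definition G :: real where "G = 1 + (1 + K) * exp K"

lemma K_nonneg: "0 \<le> K" by (simp add: K_def nV_nonneg)
lemma G_nonneg: "0 \<le> G" unfolding G_def by (intro add_nonneg_nonneg mult_nonneg_nonneg K_nonneg) auto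

text \<open>\<open>(1 + A) exp (-A) - 1 = A\<^sup>2 g\<close> with bounded \<open>g\<close>; the second factor \<open>V\<close> in \<open>A\<^sup>2 = V R V R\<close> is what
  makes the row norms of this operator summable although those of \<open>A = V R\<close> need not be.\<close>

definition rho :: "'i \<Rightarrow> real" where "rho m = cmod (V m) * row m * (norm R * G)"

lemma rho_nonneg: "0 \<le> rho m" by (simp add: rho_def row_nonneg G_nonneg)

lemma rho_summable: "rho summable_on UNIV"
  unfolding rho_def by (intro summable_on_cmult_left weight_summable)

definition AF :: "'i set \<Rightarrow> 'i ell2_op" where "AF F = mult_op (truncate F V) o\<^sub>L R"
definition TF :: "'i set \<Rightarrow> 'i ell2_op" where "TF F = ((id_blinfun + AF F) o\<^sub>L op_exp (- AF F)) - id_blinfun"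

lemma norm_AF: "norm (AF F) \<le> K"
  unfolding AF_def K_def
  by (rule order_trans[OF norm_blinfun_compose]) (intro mult_right_mono norm_mult_op_le truncate_bound norm_ge_zero)

lemma complex_linear_AF: "complex_linear_op (AF F)"
  unfolding AF_def by (intro complex_linear_op_compose complex_linear_op_mult_op bounded_truncate R)

lemma op_exp_complex_linear: "complex_linear_op A \<Longrightarrow> complex_linear_op (op_exp A)"
  unfolding op_exp_eq by (rule complex_linear_op_exp) (simp add: alg_of_inverse)

lemma complex_linear_TF: "complex_linear_op (TF F)"
  unfolding TF_def
  by (intro complex_linear_op_diff complex_linear_op_compose complex_linear_op_add complex_linear_op_id
      complex_linear_AF op_exp_complex_linear complex_linear_op_uminus)

lemma TF_eq: "TF F = op_of ((1 + alg_of (AF F)) * exp (- alg_of (AF F)) - 1)"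
  unfolding TF_def op_exp_eq
  by (simp add: minus_opalg.rep_eq plus_opalg.rep_eq times_opalg.rep_eq one_opalg.rep_eq alg_of_inverse uminus_opalg.abs_eq)

lemma TF_row:
  assumes F: "finite F"
  shows "cmod (ell2_fun (TF F f) m) \<le> rho m * norm f"
proof -
  define a where "a = alg_of (AF F)"
  have opa: "op_of a = AF F" by (simp add: a_def alg_of_inverse)
  have na: "norm a \<le> K" using norm_AF[of F] by (simp add: norm_opalg.rep_eq opa)
  obtain h where h: "exp (- a) = 1 + (- a) + (- a) * (- a) * h" "norm h \<le> exp (norm (- a))" by (rule exp_second_order)
  \<comment> \<open>With exp (-a) = 1 - a + a^2 h, expanding (1 + a) exp (-a) - 1 leaves a^2 times
    this g.\<close>
  define g where "g = h - 1 + a * h"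
  have "(1 + a) * exp (- a) - 1 = a * (a * g)"
    unfolding h(1) g_def by (simp add: algebra_simps)
  then have T: "TF F f = AF F (AF F (op_of g f))" by (simp add: TF_eq flip: a_def) (simp add: times_opalg.rep_eq opa)
  have nh: "norm h \<le> exp K" using order_trans[OF h(2), of "exp K"] na by simp
  have "norm g \<le> norm h + 1 + norm a * norm h"
    using norm_triangle_ineq[of "h - 1" "a * h"] norm_triangle_ineq4[of h 1] norm_mult_ineq[of a h] by (simp add: g_def)
  also have "\<dots> \<le> exp K + 1 + K * exp K" using nh na K_nonneg by (intro add_mono mult_mono) auto
  finally have ng: "norm g \<le> G" by (simp add: G_def algebra_simps)
  define u where "u = R (op_of g f)"
  have "norm u \<le> norm R * norm (op_of g f)" unfolding u_def by (rule norm_blinfun)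
  also have "\<dots> \<le> norm R * (G * norm f)"
    using norm_blinfun[of "op_of g" f] mult_right_mono[OF ng norm_ge_zero, of f]
    by (intro mult_left_mono) (auto simp: norm_opalg.rep_eq)
  finally have nu: "norm u \<le> norm R * (G * norm f)" .
  have "ell2_fun (TF F f) m = truncate F V m * ell2_fun (R (mult_op (truncate F V) u)) m"
    unfolding T AF_def u_def by (simp add: mult_op_apply[OF bounded_truncate])
  also have "cmod \<dots> \<le> cmod (V m) * (row m * norm u)"
    unfolding norm_mult by (intro mult_mono row_mult_op_le F) (auto simp: truncate_def)
  also have "\<dots> \<le> cmod (V m) * (row m * (norm R * (G * norm f)))"
    by (intro mult_left_mono nu row_nonneg) auto
  finally show ?thesis by (simp add: rho_def mult_ac)
qed

text \<open>The truncated potentials converge in sup norm, so \<open>AF\<close> converges in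
  operator norm and \<open>TF\<close> entrywise. The row bounds \<open>rho\<close> do not depend on
  the truncation, so products of them dominate the sum over index sets.\<close>

lemma det2_truncation_tendsto:
  assumes F: "\<And>k. finite (F k)" and Flim: "filterlim F (finite_subsets_at_top UNIV) sequentially"
  shows "(\<lambda>k::nat. det2 (F k) (\<lambda>i j. V i * matrix_entry R i j))
    \<longlonglongrightarrow> fredholm_det ((id_blinfun + (mult_op V o\<^sub>L R)) o\<^sub>L op_exp (- (mult_op V o\<^sub>L R)))"
proof -
  define A where "A = mult_op V o\<^sub>L R"
  \<comment> \<open>The full operator is the truncation to \<open>UNIV\<close>, so
    \<open>TF_eq\<close> also describes the limit.\<close>
  have A: "A = AF UNIV" by (simp add: A_def AF_def truncate_def)
  have sV: "(\<lambda>k. \<Sum>n\<in>F k. (cmod (V n))\<^sup>2) \<longlonglongrightarrow> nV\<^sup>2"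
    using filterlim_compose[OF infsum_tendsto[OF V2] Flim] by (simp add: nV_sq)
  have tail: "cmod (V n - truncate (F k) V n) \<le> sqrt (nV\<^sup>2 - (\<Sum>n\<in>F k. (cmod (V n))\<^sup>2))" for n k
  proof (cases "n \<in> F k")
    case True
    then show ?thesis using finite_sum_le_infsum[OF V2 F[of k]] by (simp add: truncate_def nV_sq)
  next
    case False
    have "(\<Sum>m\<in>insert n (F k). (cmod (V m))\<^sup>2) \<le> nV\<^sup>2" unfolding nV_sq using F by (intro finite_sum_le_infsum[OF V2]) auto
    then have "(cmod (V n))\<^sup>2 \<le> nV\<^sup>2 - (\<Sum>n\<in>F k. (cmod (V n))\<^sup>2)" using False F by simp
    then show ?thesis using False by (simp add: truncate_def real_le_rsqrt)
  qed
  have "(\<lambda>k. sqrt (nV\<^sup>2 - (\<Sum>n\<in>F k. (cmod (V n))\<^sup>2)) * norm R) \<longlonglongrightarrow> sqrt (nV\<^sup>2 - nV\<^sup>2) * norm R"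
    by (intro tendsto_intros sV)
  moreover have "norm (AF (F k) - A) \<le> sqrt (nV\<^sup>2 - (\<Sum>n\<in>F k. (cmod (V n))\<^sup>2)) * norm R" for k
  proof -
    have "A - AF (F k) = mult_op (\<lambda>n. V n - truncate (F k) V n) o\<^sub>L R"
    proof (intro blinfun_eqI ell2_eqI)
      fix f n
      have "bounded (range (\<lambda>n. V n - truncate (F k) V n))"
        using tail[of _ k] by (auto simp: bounded_iff)
      then show "ell2_fun ((A - AF (F k)) f) n = ell2_fun ((mult_op (\<lambda>n. V n - truncate (F k) V n) o\<^sub>L R) f) n"
        by (simp add: A_def AF_def minus_blinfun.rep_eq minus_ell2.rep_eq mult_op_apply bounded_V bounded_truncate algebra_simps)
    qed
    then show ?thesis
      by (subst norm_minus_commute) (simp, rule order_trans[OF norm_blinfun_compose], intro mult_right_mono norm_mult_op_le tail norm_ge_zero)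
  qed
  ultimately have "(\<lambda>k. AF (F k) - A) \<longlonglongrightarrow> 0"
    by (intro Lim_null_comparison[of "\<lambda>k. AF (F k) - A"]) auto
  then have "(\<lambda>k. alg_of (AF (F k)) - alg_of A) \<longlonglongrightarrow> 0"
    unfolding tendsto_iff by (simp add: dist_norm norm_opalg.rep_eq minus_opalg.rep_eq alg_of_inverse)
  then have lim: "(\<lambda>k. alg_of (AF (F k))) \<longlonglongrightarrow> alg_of A" by (rule LIM_zero_cancel)
  have limT: "(\<lambda>k. matrix_entry (TF (F k)) i j) \<longlonglongrightarrow> matrix_entry (TF UNIV) i j" for i j
    unfolding TF_eq A[symmetric]
    by (intro bounded_linear.tendsto[OF bounded_linear_compose[OF bounded_linear_matrix_entry bounded_linear_op_of]]
        tendsto_intros tendsto_exp_algebra lim)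
  have "(\<lambda>k. infsum (principal_minor (matrix_entry (TF (F k)))) {S. finite S})
    \<longlonglongrightarrow> infsum (principal_minor (matrix_entry (TF UNIV))) {S. finite S}"
  proof (rule infsum_dominated_tendsto[where b = "\<lambda>S. \<Prod>m\<in>S. rho m"])
    show "(\<lambda>k. principal_minor (matrix_entry (TF (F k))) S) \<longlonglongrightarrow> principal_minor (matrix_entry (TF UNIV)) S" for S
      unfolding principal_minor_def by (intro tendsto_intros limT)
    show "cmod (principal_minor (matrix_entry (TF (F k))) S) \<le> (\<Prod>m\<in>S. rho m)" if "S \<in> {S. finite S}" for k S
      using that by (intro norm_principal_minor_le_prod complex_linear_TF TF_row F rho_nonneg) auto
    show "(\<lambda>S. \<Prod>m\<in>S. rho m) summable_on {S. finite S}" by (intro summable_on_prod_finite_sets rho_nonneg rho_summable)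
  qed
  moreover have "infsum (principal_minor (matrix_entry (TF (F k)))) {S. finite S} = det2 (F k) (\<lambda>i j. V i * matrix_entry R i j)" for k
  proof -
    have "infsum (principal_minor (matrix_entry (TF (F k)))) {S. finite S} = det2 (F k) (matrix_entry (AF (F k)))"
      unfolding TF_def fredholm_det_def[symmetric]
      by (rule fredholm_det_finite_rows_det2[OF F complex_linear_AF])
        (simp add: AF_def mult_op_apply[OF bounded_truncate], simp add: truncate_def)
    also have "\<dots> = det2 (F k) (\<lambda>i j. V i * matrix_entry R i j)"
    proof -
      have "matrix_entry (AF (F k)) i j = V i * matrix_entry R i j" if "i \<in> F k" for i j
        using that by (simp add: matrix_entry_def AF_def mult_op_apply[OF bounded_truncate]) (simp add: truncate_def)
      then show ?thesis unfolding det2_def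
        by (intro arg_cong2[where f = times] principal_minor_cong arg_cong[where f = exp] arg_cong[where f = uminus] sum.cong) auto
    qed
    finally show ?thesis .
  qed
  ultimately show ?thesis by (simp add: TF_def fredholm_det_def[symmetric] A_def[symmetric] flip: A)
qed

end
section \<open>Hilbert--Schmidt bounds\<close>

text \<open>The weighted arithmetic-geometric mean with weights 1 - 2/q and 2/q, followed by the
  mean of A and B. The three coefficients add up to 1, and in \<open>young_sum\<close> each of the
  three double sums is at most 1.\<close>

lemma young_pointwise:
  fixes A B G q :: real
  assumes "2 \<le> q" "0 < A" "0 < B" "0 < G"
  shows "(A * B) powr (1 - 1 / q) * G powr (2 / q) \<le> (1 - 2 / q) * (A * B) + (A * G + B * G) / q"
proof -
  define W where "W = G * sqrt (A * B)"
  have W: "0 < W" using assms by (simp add: W_def)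
  have "W powr (2 / q) = G powr (2 / q) * (A * B) powr (1 / q)"
    using assms by (simp add: W_def powr_mult powr_half_sqrt[symmetric] powr_powr)
  then have "(A * B) powr (1 - 1 / q) * G powr (2 / q) = (A * B) powr (1 - 2 / q) * W powr (2 / q)"
    by (simp add: mult_ac flip: powr_add)
  also have "\<dots> \<le> (1 - 2 / q) * (A * B) + (2 / q) * W"
    using assms W by (intro Youngs_inequality_0) auto
  also have "(2 / q) * W \<le> (2 / q) * ((A * G + B * G) / 2)"
  proof (intro mult_left_mono)
    have "W \<le> G * ((A + B) / 2)" unfolding W_def using arith_geo_mean_sqrt[of A B] assms by (intro mult_left_mono) auto
    then show "W \<le> (A * G + B * G) / 2" by (simp add: algebra_simps)
  qed (use assms in auto)
  also have "(2 / q) * ((A * G + B * G) / 2) = (A * G + B * G) / q" by (simp only: times_divide_times_eq mult.commute[of q] mult_divide_mult_cancel_left_if) simp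
  finally show ?thesis by simp
qed

text \<open>Young's inequality for the kernel g^2 with exponents p, p and q/2, where q = p / (p - 1)
  and 2/p + 2/q = 2. After normalization to (a/alpha)^p, (b/beta)^p and (g/C)^q the exponents are
  those of \<open>young_pointwise\<close>.\<close>

lemma young_sum:
  fixes a b :: "'i \<Rightarrow> real" and g :: "'i \<Rightarrow> 'i \<Rightarrow> real"
  assumes F: "finite F" and p: "1 < p" "p \<le> 2" and pos: "0 < \<alpha>" "0 < \<beta>" "0 < C"
    and nn: "\<And>i. 0 \<le> a i" "\<And>i. 0 \<le> b i" "\<And>i j. 0 \<le> g i j"
    and a: "(\<Sum>i\<in>F. a i powr p) \<le> \<alpha> powr p" and b: "(\<Sum>i\<in>F. b i powr p) \<le> \<beta> powr p"
    and row: "\<And>i. (\<Sum>j\<in>F. g i j powr (p / (p - 1))) \<le> C powr (p / (p - 1))"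
    and col: "\<And>j. (\<Sum>i\<in>F. g i j powr (p / (p - 1))) \<le> C powr (p / (p - 1))"
  shows "(\<Sum>i\<in>F. \<Sum>j\<in>F. a i * b j * (g i j)\<^sup>2) \<le> \<alpha> * \<beta> * C\<^sup>2"
proof -
  define q where "q = p / (p - 1)"
  have q: "2 \<le> q" using p by (simp add: q_def field_simps)
  have pq: "p * (1 - 1 / q) = 1" using p by (simp add: q_def field_simps)
  define A where "A = (\<lambda>i. (a i / \<alpha>) powr p)"
  define B where "B = (\<lambda>i. (b i / \<beta>) powr p)"
  define H where "H = (\<lambda>i j. (g i j / C) powr q)"
  have nn': "0 \<le> A i" "0 \<le> B i" "0 \<le> H i j" for i j by (simp_all add: A_def B_def H_def)
  have sA: "(\<Sum>i\<in>F. A i) \<le> 1" "(\<Sum>i\<in>F. B i) \<le> 1" "(\<Sum>j\<in>F. H i j) \<le> 1" "(\<Sum>i\<in>F. H i j) \<le> 1" for i j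
    using a b row[of i] col[of j] pos nn
    by (simp_all add: A_def B_def H_def powr_divide less_imp_le q_def[symmetric] flip: sum_divide_distrib)
  have pt: "a i * b j * (g i j)\<^sup>2 \<le> (\<alpha> * \<beta> * C\<^sup>2) * ((1 - 2 / q) * (A i * B j) + (A i * H i j + B j * H i j) / q)" for i j
  proof (cases "a i = 0 \<or> b j = 0 \<or> g i j = 0")
    case True
    then have "a i * b j * (g i j)\<^sup>2 = 0" by auto
    then show ?thesis using q pos nn' by (auto intro!: mult_nonneg_nonneg add_nonneg_nonneg divide_nonneg_nonneg)
  next
    case False
    then have g0: "0 < a i" "0 < b j" "0 < g i j" using nn by (auto simp: less_le)
    have "(A i * B j) powr (1 - 1 / q) * H i j powr (2 / q) = (a i / \<alpha>) * (b j / \<beta>) * (g i j / C)\<^sup>2"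
      using g0 pos pq q by (simp add: A_def B_def H_def powr_mult powr_powr powr_numeral)
    then have "a i * b j * (g i j)\<^sup>2 = (\<alpha> * \<beta> * C\<^sup>2) * ((A i * B j) powr (1 - 1 / q) * H i j powr (2 / q))"
      using pos by (simp add: power_divide)
    also have "\<dots> \<le> (\<alpha> * \<beta> * C\<^sup>2) * ((1 - 2 / q) * (A i * B j) + (A i * H i j + B j * H i j) / q)"
      using g0 pos by (intro mult_left_mono young_pointwise q) (auto simp: A_def B_def H_def)
    finally show ?thesis .
  qed
  have AH: "(\<Sum>i\<in>F. \<Sum>j\<in>F. A i * H i j) \<le> 1"
  proof -
    have "(\<Sum>i\<in>F. \<Sum>j\<in>F. A i * H i j) \<le> (\<Sum>i\<in>F. A i * 1)"
      unfolding sum_distrib_left[symmetric] by (intro sum_mono mult_left_mono sA nn')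
    then show ?thesis using sA by simp
  qed
  have BH: "(\<Sum>i\<in>F. \<Sum>j\<in>F. B j * H i j) \<le> 1"
  proof -
    have "(\<Sum>j\<in>F. \<Sum>i\<in>F. B j * H i j) \<le> (\<Sum>j\<in>F. B j * 1)"
      unfolding sum_distrib_left[symmetric] by (intro sum_mono mult_left_mono sA nn')
    then show ?thesis using sA by (subst sum.swap) simp
  qed
  have AB: "(\<Sum>i\<in>F. \<Sum>j\<in>F. A i * B j) \<le> 1"
    unfolding sum_product[symmetric] using mult_mono[OF sA(1,2)] nn' by (simp add: sum_nonneg)
  have "(\<Sum>i\<in>F. \<Sum>j\<in>F. a i * b j * (g i j)\<^sup>2)
    \<le> (\<Sum>i\<in>F. \<Sum>j\<in>F. (\<alpha> * \<beta> * C\<^sup>2) * ((1 - 2 / q) * (A i * B j) + (A i * H i j + B j * H i j) / q))"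
    by (intro sum_mono pt)
  also have "\<dots> = (\<alpha> * \<beta> * C\<^sup>2) * ((1 - 2 / q) * (\<Sum>i\<in>F. \<Sum>j\<in>F. A i * B j)
      + ((\<Sum>i\<in>F. \<Sum>j\<in>F. A i * H i j) + (\<Sum>i\<in>F. \<Sum>j\<in>F. B j * H i j)) / q)"
    by (simp add: sum_distrib_left[symmetric] sum.distrib sum_divide_distrib[symmetric])
  also have "\<dots> \<le> (\<alpha> * \<beta> * C\<^sup>2) * ((1 - 2 / q) * 1 + (1 + 1) / q)"
    using pos q AB AH BH by (intro mult_left_mono add_mono divide_right_mono) auto
  also have "\<dots> = \<alpha> * \<beta> * C\<^sup>2" by simp
  finally show ?thesis .
qed

lemma C_star_pos:
  assumes "3 \<le> d" "1 \<le> p" "d = 3 \<Longrightarrow> p < 6 / 5" "4 \<le> d \<Longrightarrow> p < 4 / 3"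
  shows "0 < C_star p d"
proof -
  have "1 \<le> const_C p d" "1 \<le> const_Gamma p d" "0 < const_C0 d"
    using assms by (auto intro: const_C_ge_1 const_Gamma_ge_1 const_C0_pos)
  then show ?thesis unfolding C_star_def by (intro add_pos_nonneg mult_nonneg_nonneg) auto
qed

text \<open>Two weights with separate bounds, because one of them may be a tail of V. Vanishing
  bounds are treated apart since \<open>young_sum\<close> divides by them, and p = 1 uses the sup
  norm of the kernel.\<close>

lemma kernel_bound_young:
  fixes a b :: "int ^ 'd::finite \<Rightarrow> real"
  assumes d: "3 \<le> CARD('d)" and p: "1 \<le> p" and p3: "CARD('d) = 3 \<Longrightarrow> p < 6 / 5"
    and p4: "4 \<le> CARD('d) \<Longrightarrow> p < 4 / 3" and F: "finite F"
    and nn: "\<And>i. 0 \<le> a i" "\<And>i. 0 \<le> b i" "0 \<le> \<alpha>" "0 \<le> \<beta>"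
    and a: "(\<Sum>i\<in>F. a i powr p) \<le> \<alpha> powr p" and b: "(\<Sum>i\<in>F. b i powr p) \<le> \<beta> powr p"
  shows "(\<Sum>i\<in>F. \<Sum>j\<in>F. a i * b j * (enn2real (kernel_bound (i - j)))\<^sup>2) \<le> \<alpha> * \<beta> * (C_star p CARD('d))\<^sup>2"
proof -
  let ?C = "C_star p CARD('d)" and ?g = "\<lambda>(i :: int ^ 'd) j. enn2real (kernel_bound (i - j))"
  have C: "0 < ?C" using C_star_pos d p p3 p4 by blast
  have zero: "x i = 0" if "(\<Sum>i\<in>F. x i powr p) \<le> 0 powr p" "i \<in> F" for x :: "int ^ 'd \<Rightarrow> real" and i
  proof -
    have "x i powr p \<le> (\<Sum>i\<in>F. x i powr p)" using F that by (intro member_le_sum) auto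
    then have "x i powr p = 0"
      using that(1) p powr_ge_zero[of "x i" p] unfolding powr_0 by linarith
    then show ?thesis by simp
  qed
  consider "\<alpha> = 0" | "\<beta> = 0" | "0 < \<alpha>" "0 < \<beta>" "p = 1" | "0 < \<alpha>" "0 < \<beta>" "1 < p" using nn p by fastforce
  then show ?thesis
  proof cases
    case 1
    then have "(\<Sum>i\<in>F. \<Sum>j\<in>F. a i * b j * (?g i j)\<^sup>2) = 0" using zero[of a] a by (intro sum.neutral) auto
    then show ?thesis using 1 by simp
  next
    case 2
    then have "(\<Sum>i\<in>F. \<Sum>j\<in>F. a i * b j * (?g i j)\<^sup>2) = 0" using zero[of b] b by (intro sum.neutral ballI) auto
    then show ?thesis using 2 by simp
  next
    case 3
    have "(\<Sum>i\<in>F. \<Sum>j\<in>F. a i * b j * (?g i j)\<^sup>2) \<le> (\<Sum>i\<in>F. \<Sum>j\<in>F. a i * b j * ?C\<^sup>2)"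
    proof (intro sum_mono mult_left_mono power_mono mult_nonneg_nonneg nn)
      show "?g i j \<le> ?C" for i j
        using enn2real_mono[OF kernel_bound_le_C_star_1[OF d, of "i - j"]] C 3 by simp
    qed auto
    also have "\<dots> = (\<Sum>i\<in>F. a i) * (\<Sum>j\<in>F. b j) * ?C\<^sup>2" unfolding sum_product unfolding sum_distrib_right by (rule refl)
    also have "\<dots> \<le> \<alpha> * \<beta> * ?C\<^sup>2"
      using a b 3 nn by (intro mult_right_mono mult_mono) (auto simp: sum_nonneg)
    finally show ?thesis .
  next
    case 4
    have p2: "p \<le> 2" using d p3 p4 by (cases "CARD('d) = 3") auto
    show ?thesis
    proof (rule young_sum[OF F 4(3) p2 4(1,2) C nn(1,2) _ a b])
      show "(\<Sum>j\<in>F. ?g i j powr (p / (p - 1))) \<le> ?C powr (p / (p - 1))" for i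
        using kernel_bound_sum_le_C_star[OF d 4(3) p3 p4 finite_imageI[OF F, of "\<lambda>j. i - j"]]
        by (simp add: sum.reindex inj_on_def)
      show "(\<Sum>i\<in>F. ?g i j powr (p / (p - 1))) \<le> ?C powr (p / (p - 1))" for j
        using kernel_bound_sum_le_C_star[OF d 4(3) p3 p4 finite_imageI[OF F, of "\<lambda>i. i - j"]]
        by (simp add: sum.reindex inj_on_def)
    qed auto
  qed
qed

lemma principal_minor_conjugate:
  assumes "finite F"
  shows "principal_minor (\<lambda>i j. v i * K i j * v j) F = principal_minor (\<lambda>i j. (v i)\<^sup>2 * K i j) F"
proof -
  have "(\<Prod>i\<in>F. v i * K i (\<pi> i) * v (\<pi> i)) = (\<Prod>i\<in>F. (v i)\<^sup>2 * K i (\<pi> i))" if "\<pi> permutes F" for \<pi>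
  proof -
    have "(\<Prod>i\<in>F. v (\<pi> i)) = (\<Prod>i\<in>F. v i)" using prod.permute[OF that, of v] by (simp add: o_def)
    then show ?thesis by (simp add: prod.distrib power2_eq_square)
  qed
  then show ?thesis unfolding principal_minor_def by (intro sum.cong) auto
qed

text \<open>Applied with \<open>v = \<surd>V\<close>: the Hilbert--Schmidt norm of \<open>\<surd>V R \<surd>V\<close>, unlike that of \<open>V R\<close>, is
  controlled by the \<open>\<ell>\<^sup>p\<close> norm of \<open>V\<close> through Young's inequality.\<close>

lemma det2_conjugate:
  assumes F: "finite F"
  shows "det2 F (\<lambda>i j. v i * K i j * v j) = det2 F (\<lambda>i j. (v i)\<^sup>2 * K i j)"
proof -
  have "(\<Sum>S\<in>Pow F. principal_minor (\<lambda>i j. v i * K i j * v j) S) = (\<Sum>S\<in>Pow F. principal_minor (\<lambda>i j. (v i)\<^sup>2 * K i j) S)"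
    using F finite_subset by (intro sum.cong refl principal_minor_conjugate) auto
  then show ?thesis unfolding det2_def sum_principal_minors[OF F, symmetric] by (simp add: power2_eq_square mult_ac)
qed

text \<open>Padding by zeros brings finite sections of different size to a common index set, where
  \<open>det2_diff_le\<close> can compare them.\<close>

lemma det2_extend:
  assumes F: "finite F'" and sub: "F \<subseteq> F'"
  shows "det2 F' (\<lambda>i j. if i \<in> F \<and> j \<in> F then A i j else 0) = det2 F A"
proof -
  let ?A = "\<lambda>i j. if i \<in> F \<and> j \<in> F then A i j else 0"
  have fF: "finite F" using assms finite_subset by blast
  have "(\<Sum>S\<in>Pow F'. principal_minor ?A S) = (\<Sum>S\<in>Pow F. principal_minor ?A S)"
  proof (rule sum.mono_neutral_right)
    show "\<forall>S\<in>Pow F' - Pow F. principal_minor ?A S = 0"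
    proof
      fix S assume "S \<in> Pow F' - Pow F"
      then obtain a where "finite S" "a \<in> S" "a \<notin> F" using F finite_subset by auto
      then show "principal_minor ?A S = 0" by (intro principal_minor_zero_row[of S a]) auto
    qed
  qed (use F sub in auto)
  also have "\<dots> = (\<Sum>S\<in>Pow F. principal_minor A S)"
    by (intro sum.cong refl principal_minor_cong) auto
  finally have 1: "(\<Sum>S\<in>Pow F'. principal_minor ?A S) = (\<Sum>S\<in>Pow F. principal_minor A S)" .
  have "(\<Sum>i\<in>F'. ?A i i) = (\<Sum>i\<in>F. A i i)"
    using F sub by (intro sum.mono_neutral_cong_right) auto
  then show ?thesis
    unfolding det2_def sum_principal_minors[OF F, symmetric] sum_principal_minors[OF fF, symmetric] 1 by simp
qed

lemma hs_norm_le: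
  assumes "(\<Sum>i\<in>F. \<Sum>j\<in>F. (cmod (A i j))\<^sup>2) \<le> c\<^sup>2" "0 \<le> c"
  shows "hs_norm F A \<le> c"
  using assms hs_norm_sq[of F A] by (auto intro: power2_le_imp_le)
section \<open>The function D\<close>

locale lp_potential =
  fixes V :: "int ^ 'd::finite \<Rightarrow> complex" and p :: real
  assumes dim: "3 \<le> CARD('d)" and p1: "1 \<le> p" and p3: "CARD('d) = 3 \<Longrightarrow> p < 6 / 5"
    and p4: "4 \<le> CARD('d) \<Longrightarrow> p < 4 / 3" and Vp: "in_lp p V"
begin

definition CV :: real where "CV = C_star p CARD('d)"
definition LV :: real where "LV = lp_norm p V"
definition MV :: real where "MV = CV\<^sup>2 * LV\<^sup>2"

definition Sp :: real where "Sp = (\<Sum>\<^sub>\<infinity>n. cmod (V n) powr p)"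

lemma p2: "p < 2"
  using dim p3 p4 by (cases "CARD('d) = 3") auto

lemma C_pos: "0 < CV"
  unfolding CV_def using C_star_pos dim p1 p3 p4 by blast

lemma Sp_summable: "(\<lambda>n. cmod (V n) powr p) summable_on UNIV"
  using Vp by (simp add: in_lp_def)

lemma Sp_nonneg: "0 \<le> Sp" unfolding Sp_def by (intro infsum_nonneg) simp

lemma L_nonneg: "0 \<le> LV" by (simp add: LV_def lp_norm_def)

lemma L_powr: "LV powr p = Sp"
  using p1 Sp_nonneg by (simp add: LV_def lp_norm_def Sp_def[symmetric] powr_powr)

lemma sum_le_Sp: "finite F \<Longrightarrow> (\<Sum>n\<in>F. cmod (V n) powr p) \<le> Sp"
  unfolding Sp_def by (rule finite_sum_le_infsum[OF Sp_summable]) auto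

lemma V_le_L: "cmod (V n) \<le> LV"
proof -
  have "cmod (V n) powr p \<le> LV powr p" using sum_le_Sp[of "{n}"] L_powr by simp
  then show ?thesis using p1 L_nonneg powr_less_mono2[of p LV "cmod (V n)"] by (cases "LV < cmod (V n)") auto
qed

lemma V_square_summable: "(\<lambda>n. (cmod (V n))\<^sup>2) summable_on UNIV"
proof (rule summable_on_comparison_test)
  show "(\<lambda>n. LV powr (2 - p) * cmod (V n) powr p) summable_on UNIV" by (intro summable_on_cmult_right Sp_summable)
  fix n
  have "(cmod (V n))\<^sup>2 = cmod (V n) powr (2 - p) * cmod (V n) powr p"
    by (cases "V n = 0") (simp_all add: powr_numeral flip: powr_add)
  also have "\<dots> \<le> LV powr (2 - p) * cmod (V n) powr p"
    using p2 by (intro mult_right_mono powr_mono2 V_le_L) auto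
  finally show "(cmod (V n))\<^sup>2 \<le> LV powr (2 - p) * cmod (V n) powr p" .
qed auto

text \<open>An increasing exhaustion of the lattice by finite sets, ordered by the countability
  encoding.\<close>

definition Fk :: "nat \<Rightarrow> (int ^ 'd) set" where "Fk k = {n. to_nat n < k}"

lemma finite_Fk: "finite (Fk k)"
  unfolding Fk_def using finite_vimageI[OF finite_lessThan[of k] inj_to_nat, where 'a1 = "int ^ 'd"]
  by (simp add: vimage_def)

lemma Fk_mono: "k \<le> l \<Longrightarrow> Fk k \<subseteq> Fk l"
  by (auto simp: Fk_def)

lemma Fk_lim: "filterlim Fk (finite_subsets_at_top UNIV) sequentially"
  unfolding filterlim_finite_subsets_at_top
proof (intro allI impI)
  fix X :: "(int ^ 'd) set" assume X: "finite X \<and> X \<subseteq> UNIV"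
  have sub: "X \<subseteq> Fk k" if "Max (insert 0 (to_nat ` X)) < k" for k
    using X that by (auto simp: Fk_def)
  show "\<forall>\<^sub>F k in sequentially. finite (Fk k) \<and> X \<subseteq> Fk k \<and> Fk k \<subseteq> UNIV"
    using eventually_gt_at_top[of "Max (insert 0 (to_nat ` X))"] by eventually_elim (simp add: finite_Fk sub)
qed

text \<open>The l^p norm of V outside \<open>Fk k\<close>.\<close>

definition tail :: "nat \<Rightarrow> real" where "tail k = (Sp - (\<Sum>n\<in>Fk k. cmod (V n) powr p)) powr (1 / p)"

lemma tail_nonneg: "0 \<le> tail k" by (simp add: tail_def)

lemma tail_tendsto: "tail \<longlonglongrightarrow> 0"
proof -
  have "(\<lambda>k. \<Sum>n\<in>Fk k. cmod (V n) powr p) \<longlonglongrightarrow> Sp"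
    using filterlim_compose[OF infsum_tendsto[OF Sp_summable] Fk_lim] by (simp add: Sp_def)
  from tendsto_diff[OF tendsto_const this, of Sp]
  have "(\<lambda>k. Sp - (\<Sum>n\<in>Fk k. cmod (V n) powr p)) \<longlonglongrightarrow> 0" by simp
  then have "tail \<longlonglongrightarrow> 0 powr (1 / p)"
    unfolding tail_def using p1 sum_le_Sp[OF finite_Fk]
    by (intro tendsto_powr2[OF _ tendsto_const]) (auto intro!: always_eventually)
  then show ?thesis by simp
qed

lemma sum_tail_le:
  assumes F: "finite F"
  shows "(\<Sum>n\<in>F. (if n \<in> Fk k then 0 else cmod (V n)) powr p) \<le> tail k powr p"
proof -
  have "(\<Sum>n\<in>F. (if n \<in> Fk k then 0 else cmod (V n)) powr p) = (\<Sum>n\<in>F - Fk k. cmod (V n) powr p)"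
    using F by (intro sum.mono_neutral_cong_right) auto
  also have "\<dots> = (\<Sum>n\<in>(F - Fk k) \<union> Fk k. cmod (V n) powr p) - (\<Sum>n\<in>Fk k. cmod (V n) powr p)"
    using F finite_Fk by (subst sum.union_disjoint) auto
  also have "\<dots> \<le> Sp - (\<Sum>n\<in>Fk k. cmod (V n) powr p)" using F finite_Fk by (intro diff_right_mono sum_le_Sp) auto
  also have "\<dots> = tail k powr p" using p1 sum_le_Sp[OF finite_Fk] by (simp add: tail_def powr_powr)
  finally show ?thesis .
qed

text \<open>Both outer factors are complex square roots, rather than one root of the modulus and one
  phase factor, so that \<open>det2_conjugate\<close> leads back to V R.\<close>

definition B :: "complex \<Rightarrow> int ^ 'd \<Rightarrow> int ^ 'd \<Rightarrow> complex"
  where "B z i j = csqrt (V i) * disk_resolvent i j z * csqrt (V j)"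

definition Dk :: "nat \<Rightarrow> complex \<Rightarrow> complex" where "Dk k z = det2 (Fk k) (B z)"

lemma norm_B_sq_le:
  assumes "z \<in> ball 0 1"
  shows "(cmod (B z i j))\<^sup>2 \<le> cmod (V i) * cmod (V j) * (enn2real (kernel_bound (i - j)))\<^sup>2"
proof -
  have s: "(cmod (csqrt w))\<^sup>2 = cmod w" for w by (simp flip: norm_power)
  have "(cmod (B z i j))\<^sup>2 = cmod (V i) * cmod (V j) * (cmod (disk_resolvent i j z))\<^sup>2"
    by (simp add: B_def norm_mult power_mult_distrib s)
  also have "\<dots> \<le> cmod (V i) * cmod (V j) * (enn2real (kernel_bound (i - j)))\<^sup>2"
    by (intro mult_left_mono power_mono norm_disk_resolvent_le dim assms mult_nonneg_nonneg) auto
  finally show ?thesis .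
qed

lemma hs_B_le:
  assumes z: "z \<in> ball 0 1" and F: "finite F"
  shows "hs_norm F (B z) \<le> CV * LV"
proof (rule hs_norm_le)
  have "(\<Sum>i\<in>F. \<Sum>j\<in>F. (cmod (B z i j))\<^sup>2) \<le> (\<Sum>i\<in>F. \<Sum>j\<in>F. cmod (V i) * cmod (V j) * (enn2real (kernel_bound (i - j)))\<^sup>2)"
    by (intro sum_mono norm_B_sq_le z)
  also have "\<dots> \<le> LV * LV * CV\<^sup>2"
    using kernel_bound_young[OF dim p1 p3 p4 F, folded CV_def, of "\<lambda>i. cmod (V i)" "\<lambda>i. cmod (V i)" LV LV] L_nonneg sum_le_Sp[OF F] L_powr by simp
  finally show "(\<Sum>i\<in>F. \<Sum>j\<in>F. (cmod (B z i j))\<^sup>2) \<le> (CV * LV)\<^sup>2" by (simp add: power2_eq_square mult_ac)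
qed (use C_pos L_nonneg in auto)

text \<open>An entry outside the block has at least one of its two potential factors in the tail of
  V, so the difference is small uniformly in z and F.\<close>

lemma hs_B_diff_le:
  assumes z: "z \<in> ball 0 1" and F: "finite F"
  shows "hs_norm F (\<lambda>i j. B z i j - (if i \<in> Fk k \<and> j \<in> Fk k then B z i j else 0)) \<le> sqrt (2 * tail k * LV) * CV"
proof (rule hs_norm_le)
  let ?a = "\<lambda>i. cmod (V i)" and ?t = "\<lambda>i. if i \<in> Fk k then 0 else cmod (V i)"
  let ?g = "\<lambda>i (j :: int ^ 'd). (enn2real (kernel_bound (i - j)))\<^sup>2"
  have pt: "(cmod (B z i j - (if i \<in> Fk k \<and> j \<in> Fk k then B z i j else 0)))\<^sup>2 \<le> ?t i * ?a j * ?g i j + ?a i * ?t j * ?g i j" for i j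
    using norm_B_sq_le[OF z, of i j] by (auto intro!: order_trans[OF norm_B_sq_le[OF z]])
  have 1: "(\<Sum>i\<in>F. \<Sum>j\<in>F. ?t i * ?a j * ?g i j) \<le> tail k * LV * CV\<^sup>2"
    using kernel_bound_young[OF dim p1 p3 p4 F, folded CV_def, of ?t ?a "tail k" LV] L_nonneg tail_nonneg sum_le_Sp[OF F] sum_tail_le[OF F] L_powr by simp
  have 2: "(\<Sum>i\<in>F. \<Sum>j\<in>F. ?a i * ?t j * ?g i j) \<le> LV * tail k * CV\<^sup>2"
    using kernel_bound_young[OF dim p1 p3 p4 F, folded CV_def, of ?a ?t LV "tail k"] L_nonneg tail_nonneg sum_le_Sp[OF F] sum_tail_le[OF F] L_powr by simp
  have "(\<Sum>i\<in>F. \<Sum>j\<in>F. (cmod (B z i j - (if i \<in> Fk k \<and> j \<in> Fk k then B z i j else 0)))\<^sup>2)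
    \<le> (\<Sum>i\<in>F. \<Sum>j\<in>F. ?t i * ?a j * ?g i j + ?a i * ?t j * ?g i j)" by (intro sum_mono pt)
  also have "\<dots> = (\<Sum>i\<in>F. \<Sum>j\<in>F. ?t i * ?a j * ?g i j) + (\<Sum>i\<in>F. \<Sum>j\<in>F. ?a i * ?t j * ?g i j)"
    by (simp only: sum.distrib)
  also have "\<dots> \<le> tail k * LV * CV\<^sup>2 + LV * tail k * CV\<^sup>2" by (intro add_mono 1 2)
  also have "\<dots> = (sqrt (2 * tail k * LV) * CV)\<^sup>2"
    using tail_nonneg[of k] L_nonneg by (simp add: power_mult_distrib algebra_simps)
  finally show "(\<Sum>i\<in>F. \<Sum>j\<in>F. (cmod (B z i j - (if i \<in> Fk k \<and> j \<in> Fk k then B z i j else 0)))\<^sup>2) \<le> (sqrt (2 * tail k * LV) * CV)\<^sup>2" .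
qed (use C_pos L_nonneg tail_nonneg in auto)

lemma norm_Dk_le: "z \<in> ball 0 1 \<Longrightarrow> cmod (Dk k z) \<le> exp (MV / 2)"
proof -
  assume z: "z \<in> ball 0 1"
  have "(hs_norm (Fk k) (B z))\<^sup>2 \<le> (CV * LV)\<^sup>2" by (intro power_mono hs_B_le z finite_Fk) simp
  then have "exp ((hs_norm (Fk k) (B z))\<^sup>2 / 2) \<le> exp (MV / 2)" by (simp add: MV_def power_mult_distrib)
  then show ?thesis unfolding Dk_def using det2_bound[OF finite_Fk, of k "B z"] by linarith
qed

text \<open>The bound of \<open>det2_diff_le\<close>. The summand 1 / Suc k keeps its parameter
  positive even when the tail is 0.\<close>

definition err :: "nat \<Rightarrow> real"
  where "err k = (sqrt (2 * tail k * LV) * CV + 1 / Suc k) * exp ((CV * LV + (sqrt (2 * tail k * LV) * CV + 1 / Suc k) + 1)\<^sup>2 / 2)"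

lemma err_tendsto: "err \<longlonglongrightarrow> 0"
proof -
  have "(\<lambda>k. 1 / real (Suc k)) \<longlonglongrightarrow> 0" using LIMSEQ_inverse_real_of_nat by (simp add: inverse_eq_divide)
  then have "err \<longlonglongrightarrow> (sqrt (2 * 0 * LV) * CV + 0) * exp ((CV * LV + (sqrt (2 * 0 * LV) * CV + 0) + 1)\<^sup>2 / 2)"
    unfolding err_def[abs_def] by (intro tendsto_intros tail_tendsto) auto
  then show ?thesis by simp
qed

lemma Dk_diff_le:
  assumes z: "z \<in> ball 0 1" and kl: "k \<le> l"
  shows "cmod (Dk l z - Dk k z) \<le> err k"
proof -
  let ?X = "\<lambda>i j. if i \<in> Fk k \<and> j \<in> Fk k then B z i j else 0"
  have Dk: "Dk k z = det2 (Fk l) ?X" unfolding Dk_def by (rule det2_extend[OF finite_Fk Fk_mono[OF kl], symmetric])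
  have "(hs_norm (Fk l) ?X)\<^sup>2 \<le> (hs_norm (Fk l) (B z))\<^sup>2" unfolding hs_norm_sq by (intro sum_mono) auto
  then have X: "hs_norm (Fk l) ?X \<le> CV * LV"
    using hs_B_le[OF z finite_Fk[of l]] power2_le_imp_le[OF _ hs_norm_nonneg] by (meson order_trans)
  have "hs_norm (Fk l) (\<lambda>i j. B z i j - ?X i j) \<le> sqrt (2 * tail k * LV) * CV + 1 / Suc k"
    using hs_B_diff_le[OF z finite_Fk[of l], of k] by (simp add: add_increasing2)
  moreover have "0 < sqrt (2 * tail k * LV) * CV + 1 / real (Suc k)"
    using C_pos tail_nonneg L_nonneg by (intro add_nonneg_pos mult_nonneg_nonneg) auto
  ultimately show ?thesis
    unfolding Dk Dk_def[of l] err_def by (rule det2_diff_le[OF finite_Fk X])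
qed

lemma Dk_at_0: "Dk k 0 = 1"
  unfolding Dk_def det2_def by (simp add: B_def disk_resolvent_def principal_minor_identity[OF finite_Fk])

text \<open>Here the two forms meet: conjugation turns the section of the symmetrized operator into
  that of V R, for which the theory at fixed lambda gives the limit.\<close>

lemma Dk_tendsto:
  assumes z: "z \<in> ball 0 1"
  shows "(\<lambda>k. Dk k z) \<longlonglongrightarrow> D_fun V z"
proof (cases "z = 0")
  case True
  then show ?thesis by (simp add: Dk_at_0 D_fun_def)
next
  case False
  define l where "l = joukowski CARD('d) z"
  have l: "l \<in> Lambda_dom CARD('d)" unfolding l_def using joukowski_in_Lambda_dom[of "CARD('d)" z] dim False z by simp
  interpret square_summable_perturbation V "free_resolvent l"
    by unfold_locales (rule V_square_summable, rule complex_linear_free_resolvent[OF l])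
  have "Dk k z = det2 (Fk k) (\<lambda>i j. V i * matrix_entry (free_resolvent l) i j)" for k
    unfolding Dk_def B_def det2_conjugate[OF finite_Fk] using False by (simp add: disk_resolvent_def l_def)
  then show ?thesis
    using det2_truncation_tendsto[OF finite_Fk Fk_lim] False by (simp add: D_fun_def perturbation_det_def l_def Let_def)
qed

lemma D_diff_le:
  assumes z: "z \<in> ball 0 1"
  shows "cmod (D_fun V z - Dk k z) \<le> err k"
proof (rule LIMSEQ_le_const2)
  show "(\<lambda>l. cmod (Dk l z - Dk k z)) \<longlonglongrightarrow> cmod (D_fun V z - Dk k z)" by (intro tendsto_intros Dk_tendsto z)
qed (use Dk_diff_le[OF z] in blast)

text \<open>Uniformity on the whole open disk, not merely on compact subsets, is what permits
  exchanging this limit with boundary limits.\<close>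

lemma D_uniform_limit: "uniform_limit (ball 0 1) Dk (D_fun V) sequentially"
proof (rule uniform_limitI)
  fix e :: real assume "0 < e"
  then have "\<forall>\<^sub>F k in sequentially. err k < e" using err_tendsto by (simp add: order_tendsto_iff)
  then show "\<forall>\<^sub>F k in sequentially. \<forall>z\<in>ball 0 1. dist (Dk k z) (D_fun V z) < e"
    by eventually_elim (auto simp: dist_norm norm_minus_commute[of "Dk _ _"] intro!: le_less_trans[OF D_diff_le])
qed

lemma Dk_holomorphic: "Dk k holomorphic_on ball 0 1"
  unfolding Dk_def[abs_def] det2_def principal_minor_def B_def
  by (intro holomorphic_intros holomorphic_disk_resolvent)

lemma D_holomorphic: "D_fun V holomorphic_on ball 0 1"
proof (rule holomorphic_uniform_sequence[OF open_ball, where f = Dk], rule Dk_holomorphic)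
  fix x :: complex assume "x \<in> ball 0 1"
  then obtain d where "0 < d" "cball x d \<subseteq> ball 0 1" using open_contains_cball[of "ball (0::complex) 1"] by blast
  then show "\<exists>d>0. cball x d \<subseteq> ball 0 1 \<and> uniform_limit (cball x d) Dk (D_fun V) sequentially"
    using uniform_limit_on_subset[OF D_uniform_limit] by blast
qed

lemma D_at_0: "D_fun V 0 = 1" by (simp add: D_fun_def)

lemma norm_D_le: "z \<in> ball 0 1 \<Longrightarrow> cmod (D_fun V z) \<le> exp (MV / 2)"
  by (rule LIMSEQ_le_const2[OF tendsto_norm[OF Dk_tendsto]]) (use norm_Dk_le in auto)

text \<open>The minor has derivative tr B'(0) at the origin, and the exponential factor has the
  opposite one.\<close>

lemma Dk_deriv_0: "(Dk k has_field_derivative 0) (at 0)"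
proof -
  define B' where "B' = (\<lambda>i j. deriv (\<lambda>z. B z i j) 0)"
  have dB: "((\<lambda>z. B z i j) has_field_derivative B' i j) (at 0)" for i j
    unfolding B'_def
  proof (rule holomorphic_derivI[OF _ open_ball])
    show "(\<lambda>z. B z i j) holomorphic_on ball 0 1" unfolding B_def by (intro holomorphic_intros holomorphic_disk_resolvent)
  qed simp
  have B0: "B 0 i j = 0" for i j by (simp add: B_def disk_resolvent_def)
  have "((\<lambda>z. principal_minor (\<lambda>i j. (if i = j then 1 else 0) + B z i j) (Fk k)) has_derivative (\<lambda>h. \<Sum>i\<in>Fk k. B' i i * h)) (at 0)"
  proof (rule principal_minor_has_derivative_at_identity[OF finite_Fk, where K' = "\<lambda>i j h. B' i j * h"])
    show "((\<lambda>z. (if i = j then 1 else 0) + B z i j) has_derivative (\<lambda>h. B' i j * h)) (at 0)" for i j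
      using has_derivative_add[OF has_derivative_const dB[of i j, unfolded has_field_derivative_def]] by simp
  qed (simp add: B0)
  then have 1: "((\<lambda>z. principal_minor (\<lambda>i j. (if i = j then 1 else 0) + B z i j) (Fk k)) has_field_derivative (\<Sum>i\<in>Fk k. B' i i)) (at 0)"
    unfolding has_field_derivative_def by (rule has_derivative_eq_rhs) (simp add: fun_eq_iff sum_distrib_right)
  have pm: "principal_minor (\<lambda>i j. (if i = j then 1 else 0) + B 0 i j) (Fk k) = 1"
    by (rule principal_minor_identity[OF finite_Fk]) (simp add: B0)
  show ?thesis unfolding Dk_def[abs_def] det2_def
    by (rule derivative_eq_intros 1 dB refl)+ (subst pm, simp add: B0)
qed

lemma D_deriv_0: "deriv (D_fun V) 0 = 0"
proof -
  have "(\<lambda>k. deriv (Dk k) 0) \<longlonglongrightarrow> deriv (D_fun V) 0"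
    by (rule deriv_complex_uniform_limit[OF D_uniform_limit]) (simp_all add: Dk_holomorphic)
  moreover have "deriv (Dk k) 0 = 0" for k by (rule DERIV_imp_deriv[OF Dk_deriv_0])
  ultimately show ?thesis using LIMSEQ_unique[of "\<lambda>_. 0" "deriv (D_fun V) 0" 0] by simp
qed

text \<open>Each section has a boundary limit because its finitely many entries do. The estimate
  \<open>err\<close> survives this limit, so the boundary values of the sections form a Cauchy
  sequence, whose limit is attained by D through uniform convergence.\<close>

lemma D_boundary_limit:
  assumes t: "sin t \<noteq> 0"
  obtains l where "(D_fun V \<longlongrightarrow> l) (at (cis t) within ball 0 1)" "cmod l \<le> exp (MV / 2)"
proof -
  let ?F = "at (cis t) within ball 0 1"
  have "cis t islimpt ball 0 1" by (simp add: islimpt_ball)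
  then have nt: "\<not> trivial_limit ?F" by (simp add: trivial_limit_within)
  have ev: "\<forall>\<^sub>F z in ?F. z \<in> ball 0 1" by (simp add: eventually_at_filter)
  define r where "r = (\<lambda>i j :: int ^ 'd. SOME l. (disk_resolvent i j \<longlongrightarrow> l) ?F)"
  have r: "(disk_resolvent i j \<longlongrightarrow> r i j) ?F" for i j
    unfolding r_def by (rule someI_ex[OF disk_resolvent_boundary[OF dim t]])
  define g where "g = (\<lambda>k. det2 (Fk k) (\<lambda>i j. csqrt (V i) * r i j * csqrt (V j)))"
  have g: "(Dk k \<longlongrightarrow> g k) ?F" for k
    unfolding g_def Dk_def[abs_def] det2_def principal_minor_def B_def by (intro tendsto_intros r)
  have gd: "cmod (g l - g k) \<le> err k" if "k \<le> l" for k l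
  proof (rule tendsto_upperbound[OF _ _ nt])
    show "((\<lambda>z. cmod (Dk l z - Dk k z)) \<longlongrightarrow> cmod (g l - g k)) ?F" by (intro tendsto_intros g)
    show "\<forall>\<^sub>F z in ?F. cmod (Dk l z - Dk k z) \<le> err k"
      using ev by eventually_elim (rule Dk_diff_le[OF _ that])
  qed
  have "Cauchy g"
  proof (rule CauchyI')
    fix e :: real assume "0 < e"
    then have "\<forall>\<^sub>F k in sequentially. err k < e" using err_tendsto by (simp add: order_tendsto_iff)
    then obtain N where N: "\<And>k. N \<le> k \<Longrightarrow> err k < e" by (auto simp: eventually_sequentially)
    show "\<exists>N. \<forall>m\<ge>N. \<forall>n>m. dist (g m) (g n) < e"
    proof (intro exI[of _ N] allI impI)
      fix m n assume "N \<le> m" "m < n"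
      then show "dist (g m) (g n) < e" using gd[of m n] N[of m] by (simp add: dist_norm norm_minus_commute)
    qed
  qed
  then obtain l where l: "g \<longlonglongrightarrow> l" by (auto simp: Cauchy_convergent_iff convergent_def)
  have lim: "(D_fun V \<longlongrightarrow> l) ?F"
    by (rule swap_uniform_limit[OF _ l D_uniform_limit]) (simp_all add: g)
  moreover have "cmod l \<le> exp (MV / 2)"
    by (rule tendsto_upperbound[OF tendsto_norm[OF lim] eventually_mono[OF ev norm_D_le] nt])
  ultimately show thesis by (rule that)
qed

lemma norm_boundary_value_le:
  assumes "sin t \<noteq> 0"
  shows "cmod (boundary_value (D_fun V) (cis t)) \<le> exp (MV / 2)"
proof -
  obtain l where l: "(D_fun V \<longlongrightarrow> l) (at (cis t) within ball 0 1)" "cmod l \<le> exp (MV / 2)"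
    by (rule D_boundary_limit[OF assms])
  have "cis t islimpt ball 0 1" by (simp add: islimpt_ball)
  then have "\<not> trivial_limit (at (cis t) within ball 0 1)" by (simp add: trivial_limit_within)
  from tendsto_Lim[OF this l(1)] show ?thesis using l(2) by (simp add: boundary_value_def)
qed

end
section \<open>Blaschke products\<close>

lemma one_minus_cnj_mult_nonzero:
  assumes "cmod a < 1" "cmod w < 1"
  shows "1 - cnj a * w \<noteq> 0"
proof
  assume "1 - cnj a * w = 0"
  then have "cmod a * cmod w = 1" by (metis complex_mod_cnj eq_iff_diff_eq_0 norm_mult norm_one)
  moreover have "cmod a * cmod w < 1 * 1" using assms by (intro mult_strict_mono') auto
  ultimately show False by simp
qed

text \<open>Dividing by a Blaschke factor does not raise the supremum: a Moebius map moves the zero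
  to the origin, where this is the Schwarz lemma.\<close>

lemma blaschke_factor_quotient:
  assumes h: "h holomorphic_on ball 0 1" "\<And>w. w \<in> ball 0 1 \<Longrightarrow> cmod (h w) \<le> K" and a: "cmod a < 1" "h a = 0"
  obtains h1 where "h1 holomorphic_on ball 0 1" "\<And>w. w \<in> ball 0 1 \<Longrightarrow> cmod (h1 w) \<le> K"
    "\<And>w. w \<in> ball 0 1 \<Longrightarrow> h w = (a - w) / (1 - cnj a * w) * h1 w"
proof -
  define g where "g = h \<circ> Moebius_function 0 (- a)"
  have K0: "0 \<le> K" using h(2)[of 0] norm_ge_zero[of "h 0"] by (simp del: norm_ge_zero)
  have maps: "Moebius_function 0 b ` ball 0 1 \<subseteq> ball 0 1" if "cmod b < 1" for b
    using Moebius_function_norm_lt_1[OF that] by auto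
  have g: "g holomorphic_on ball 0 1"
    unfolding g_def using a maps[of "- a"]
    by (intro holomorphic_on_compose_gen[OF _ h(1)] Moebius_function_holomorphic) auto
  have g0: "g 0 = 0" using a by (simp add: g_def Moebius_function_of_zero)
  have gK: "cmod (g w) \<le> K" if "w \<in> ball 0 1" for w
    using that h(2)[of "Moebius_function 0 (- a) w"] Moebius_function_norm_lt_1[of "- a" w 0] a by (auto simp: g_def)
  obtain g1 where g1: "g1 holomorphic_on ball 0 1" "\<And>w. cmod w < 1 \<Longrightarrow> g w = w * g1 w" "deriv g 0 = g1 0"
    using Schwarz3[OF g g0] by blast
  have g1K: "cmod (g1 w) \<le> K" if w: "cmod w < 1" for w
  proof (rule field_le_epsilon)
    fix e :: real assume e: "0 < e"
    \<comment> \<open>The Schwarz lemma asks for values strictly inside the unit disk, so g is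
      scaled by K + e with e arbitrary.\<close>
    define k where "k = (\<lambda>w. g w / of_real (K + e))"
    have K: "0 < K + e" using K0 e by simp
    have k: "k holomorphic_on ball 0 1" "k 0 = 0" using K unfolding k_def by (auto intro!: holomorphic_intros g simp: g0)
    have k1: "cmod (k u) < 1" if "cmod u < 1" for u
      using gK[of u] that K e by (simp add: k_def norm_divide del: of_real_add)
    have "cmod (g1 w) / (K + e) \<le> 1"
    proof (cases "w = 0")
      case True
      have "(g has_field_derivative deriv g 0) (at 0)" by (rule holomorphic_derivI[OF g]) auto
      then have "(k has_field_derivative deriv g 0 / of_real (K + e)) (at 0)" unfolding k_def by (rule DERIV_cdivide)
      then have "deriv k 0 = g1 0 / of_real (K + e)" using g1(3) by (simp add: DERIV_imp_deriv)
      then show ?thesis using Schwarz_Lemma(2)[OF k k1, of 0] True K by (simp add: norm_divide del: of_real_add)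
    next
      case False
      have "cmod (k w) \<le> cmod w" using Schwarz_Lemma(1)[OF k k1 w] .
      moreover have "cmod (k w) = cmod w * (cmod (g1 w) / (K + e))" using g1(2)[OF w] K by (simp add: k_def norm_divide norm_mult del: of_real_add)
      ultimately have "cmod w * (cmod (g1 w) / (K + e)) \<le> cmod w * 1" by linarith
      then show ?thesis using False by (subst (asm) mult_le_cancel_left_pos) auto
    qed
    then show "cmod (g1 w) \<le> K + e" using K by (simp add: field_simps)
  qed
  define h1 where "h1 = (\<lambda>w. - (g1 \<circ> Moebius_function 0 a) w)"
  show thesis
  proof (rule that[of h1])
    show "h1 holomorphic_on ball 0 1"
      unfolding h1_def using a maps[of a]
      by (intro holomorphic_on_minus holomorphic_on_compose_gen[OF _ g1(1)] Moebius_function_holomorphic) auto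
    show "cmod (h1 w) \<le> K" if "w \<in> ball 0 1" for w
      using that Moebius_function_norm_lt_1[OF a(1), of w] by (auto simp: h1_def intro!: g1K)
    show "h w = (a - w) / (1 - cnj a * w) * h1 w" if "w \<in> ball 0 1" for w
    proof -
      have "h w = g (Moebius_function 0 a w)" using Moebius_function_compose[of "- a" a w] a that by (simp add: g_def)
      also have "\<dots> = Moebius_function 0 a w * g1 (Moebius_function 0 a w)"
        using that Moebius_function_norm_lt_1[OF a(1), of w] by (intro g1(2)) auto
      also have "\<dots> = (a - w) / (1 - cnj a * w) * h1 w"
      proof -
        have "(w - a) / c * v = (a - w) / c * - v" for c v by (simp add: diff_divide_distrib algebra_simps)
        then show ?thesis unfolding h1_def o_def Moebius_function_simple .
      qed
      finally show ?thesis .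
    qed
  qed
qed

lemma finite_blaschke_quotient:
  assumes f: "f holomorphic_on ball 0 1" "\<And>w. w \<in> ball 0 1 \<Longrightarrow> cmod (f w) \<le> K" and zs: "zero_enumeration f N z"
  shows "\<exists>h. h holomorphic_on ball 0 1 \<and> (\<forall>w\<in>ball 0 1. cmod (h w) \<le> K \<and>
    f w = (\<Prod>j | j < n \<and> enat j < N. (z j - w) / (1 - cnj (z j) * w)) * h w)"
proof (induction n)
  case 0
  show ?case using f by (intro exI[of _ f]) auto
next
  case (Suc n)
  define \<phi> where "\<phi> = (\<lambda>j w. (z j - w) / (1 - cnj (z j) * w))"
  let ?S = "{j. j < n \<and> enat j < N}"
  obtain h where h: "h holomorphic_on ball 0 1" "\<And>w. w \<in> ball 0 1 \<Longrightarrow> cmod (h w) \<le> K"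
    "\<And>w. w \<in> ball 0 1 \<Longrightarrow> f w = (\<Prod>j\<in>?S. \<phi> j w) * h w" using Suc unfolding \<phi>_def by blast
  show ?case
  proof (cases "enat n < N")
    case False
    then have "{j. j < Suc n \<and> enat j < N} = ?S" using less_Suc_eq by auto
    then show ?thesis using h unfolding \<phi>_def by auto
  next
    case True
    define a where "a = z n"
    have zb: "cmod (z j) < 1" "f (z j) = 0" if "enat j < N" for j using zs that by (auto simp: zero_enumeration_def)
    have a: "cmod a < 1" "f a = 0" using zb[OF True] by (auto simp: a_def)
    let ?J = "{j. enat j < N \<and> z j = a}"
    have J: "finite ?J" "zorder f a = int (card ?J)" using zs a by (auto simp: zero_enumeration_def)
    \<comment> \<open>Otherwise the order of f at a would be the number of indices below n with
      \<open>z j = a\<close>, while the enumeration lists a once more at n.\<close>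
    have "h a = 0"
    proof (rule ccontr)
      assume ha: "h a \<noteq> 0"
      define Sa where "Sa = {j\<in>?S. z j = a}"
      define G where "G = (\<lambda>w. (\<Prod>j\<in>Sa. - 1 / (1 - cnj a * w)) * (\<Prod>j\<in>?S - Sa. \<phi> j w) * h w)"
      have fin: "finite ?S" "Sa \<subseteq> ?S" by (auto simp: Sa_def)
      have nz: "1 - cnj (z j) * w \<noteq> 0" if "j \<in> ?S" "w \<in> ball 0 1" for j w
        using that by (intro one_minus_cnj_mult_nonzero zb) auto
      have nza: "1 - cnj a * w \<noteq> 0" if "w \<in> ball 0 1" for w using that a by (intro one_minus_cnj_mult_nonzero) auto
      have "zorder f a = int (card Sa)"
      proof (rule zorder_eqI[where g = G and S = "ball 0 1"])
        show "G holomorphic_on ball 0 1" unfolding G_def \<phi>_def by (intro holomorphic_intros h(1)) (use nz nza in auto)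
        have "\<phi> j a \<noteq> 0" if "j \<in> ?S - Sa" for j using that nz[of j a] a by (auto simp: \<phi>_def Sa_def)
        then show "G a \<noteq> 0" using ha nza[of a] a fin by (auto simp: G_def)
        fix w assume w: "w \<in> ball (0::complex) 1" "w \<noteq> a"
        have "f w = (\<Prod>j\<in>Sa. \<phi> j w) * (\<Prod>j\<in>?S - Sa. \<phi> j w) * h w"
          unfolding h(3)[OF w(1)] using prod.subset_diff[OF fin(2,1), of "\<lambda>j. \<phi> j w"] by (simp add: mult_ac)
        also have "(\<Prod>j\<in>Sa. \<phi> j w) = (\<Prod>j\<in>Sa. - 1 / (1 - cnj a * w)) * (w - a) ^ card Sa"
        proof -
          have alg: "(x - w) / c = - 1 / c * (w - x)" for x c by (cases "c = 0") (simp_all add: field_simps)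
          have "(\<Prod>j\<in>Sa. \<phi> j w) = (\<Prod>j\<in>Sa. - 1 / (1 - cnj a * w) * (w - a))"
            by (intro prod.cong) (auto simp: Sa_def \<phi>_def alg)
          then show ?thesis by (simp only: prod.distrib prod_constant)
        qed
        finally show "f w = G w * (w - a) powi int (card Sa)" by (simp add: G_def mult_ac)
      qed (use a in auto)
      moreover have "card Sa < card ?J"
        using J(1) True by (intro psubset_card_mono) (auto simp: Sa_def a_def)
      ultimately show False using J by simp
    qed
    from blaschke_factor_quotient[OF h(1,2) a(1) this] obtain h1 where h1: "h1 holomorphic_on ball 0 1"
      "\<And>w. w \<in> ball 0 1 \<Longrightarrow> cmod (h1 w) \<le> K" "\<And>w. w \<in> ball 0 1 \<Longrightarrow> h w = \<phi> n w * h1 w"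
      unfolding \<phi>_def a_def by blast
    have S: "{j. j < Suc n \<and> enat j < N} = insert n ?S" using True less_Suc_eq by auto
    have "f w = (\<Prod>j | j < Suc n \<and> enat j < N. \<phi> j w) * h1 w" if "w \<in> ball 0 1" for w
      unfolding S using h(3)[OF that] h1(3)[OF that] by simp
    then show ?thesis using h1 unfolding \<phi>_def by auto
  qed
qed

text \<open>The finite quotient is evaluated at the origin, where f is 1 and the quotient is at most
  K. This does the work of Jensen's inequality.\<close>

lemma prod_zeros_ge:
  assumes f: "f holomorphic_on ball 0 1" "\<And>w. w \<in> ball 0 1 \<Longrightarrow> cmod (f w) \<le> K" and zs: "zero_enumeration f N z"
    and f0: "f 0 = 1"
  shows "1 \<le> (\<Prod>j<n. if enat j < N then cmod (z j) else 1) * K"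
proof -
  obtain h where h: "cmod (h 0) \<le> K" "f 0 = (\<Prod>j | j < n \<and> enat j < N. z j) * h 0"
    using finite_blaschke_quotient[OF assms(1-3), of n] by force
  have "(\<Prod>j<n. if enat j < N then cmod (z j) else 1) = (\<Prod>j | j < n \<and> enat j < N. cmod (z j))"
    by (intro prod.mono_neutral_cong_right) auto
  then have "(\<Prod>j<n. if enat j < N then cmod (z j) else 1) = cmod (\<Prod>j | j < n \<and> enat j < N. z j)" by (simp add: prod_norm)
  moreover have "1 = cmod (\<Prod>j | j < n \<and> enat j < N. z j) * cmod (h 0)" using h(2) f0 by (metis norm_mult norm_one)
  ultimately show ?thesis using mult_left_mono[OF h(1) norm_ge_zero, of "\<Prod>j | j < n \<and> enat j < N. z j"] by simp
qed

text \<open>For |w| <= 1/2 the difference is 1 - |a| times a quotient with numerator at most 3 |a| /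
  2 and denominator at least |a| / 2, whence the factor 3.\<close>

lemma blaschke_factor_minus_1:
  assumes a: "a \<noteq> 0" "cmod a < 1" and w: "cmod w \<le> 1 / 2"
  shows "cmod (of_real (cmod a) / a * ((a - w) / (1 - cnj a * w)) - 1) \<le> 3 * (1 - cmod a)"
proof -
  have nz: "1 - cnj a * w \<noteq> 0" using a w by (intro one_minus_cnj_mult_nonzero) auto
  have sq: "a * cnj a = of_real (cmod a) * of_real (cmod a)"
    using complex_norm_square[of a] by (simp add: power2_eq_square)
  have e: "of_real (cmod a) / a * ((a - w) / (1 - cnj a * w)) - 1 = - of_real (1 - cmod a) * (a + of_real (cmod a) * w) / (a * (1 - cnj a * w))"
  proof -
    have "of_real (cmod a) * (a - w) - a * (1 - cnj a * w) = of_real (cmod a) * (a - w) - a + (a * cnj a) * w" by (simp add: algebra_simps)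
    also have "\<dots> = - of_real (1 - cmod a) * (a + of_real (cmod a) * w)" unfolding sq by (simp add: algebra_simps)
    finally show ?thesis using nz a by (simp add: divide_simps)
  qed
  have "cmod (a + of_real (cmod a) * w) \<le> cmod a + cmod a * cmod w"
    using norm_triangle_ineq[of a "of_real (cmod a) * w"] by (simp add: norm_mult)
  also have "\<dots> \<le> cmod a * (3 / 2)" using w a by (simp add: algebra_simps mult_left_mono)
  finally have num: "cmod (a + of_real (cmod a) * w) \<le> cmod a * (3 / 2)" .
  have "1 - cmod a * cmod w \<le> cmod (1 - cnj a * w)" using norm_triangle_ineq2[of 1 "cnj a * w"] by (simp add: norm_mult)
  moreover have "cmod a * cmod w \<le> 1 * (1 / 2)" using a w by (intro mult_mono) auto
  ultimately have den: "cmod a * (1 / 2) \<le> cmod (a * (1 - cnj a * w))" unfolding norm_mult by (intro mult_left_mono) auto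
  have "cmod (of_real (cmod a) / a * ((a - w) / (1 - cnj a * w)) - 1) = (1 - cmod a) * (cmod (a + of_real (cmod a) * w) / cmod (a * (1 - cnj a * w)))"
    unfolding e using a by (simp add: norm_mult norm_divide del: of_real_diff)
  also have "\<dots> \<le> (1 - cmod a) * ((cmod a * (3 / 2)) / (cmod a * (1 / 2)))"
    using num den a by (intro mult_left_mono frac_le) auto
  finally show ?thesis using a by simp
qed
section \<open>The canonical factorization and the trace formula\<close>

text \<open>Taylor expansion in w with a remainder bounded uniformly in t, which allows
  differentiation under the integral at the origin.\<close>

lemma herglotz_kernel_expand:
  assumes "cmod w \<le> 1 / 2"
  shows "(cis t + w) / (cis t - w) = 1 + 2 * w * cis (- t) + w\<^sup>2 * (2 * cis (- t) / (cis t - w))"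
    and "cmod (2 * cis (- t) / (cis t - w)) \<le> 4"
proof -
  have d: "1 / 2 \<le> cmod (cis t - w)" using norm_triangle_ineq2[of "cis t" w] assms by simp
  then have nz: "cis t - w \<noteq> 0" by auto
  have c: "cis t * cis (- t) = 1" by (simp add: cis_mult)
  have "(1 + 2 * w * cis (- t)) * (cis t - w) + w\<^sup>2 * (2 * cis (- t)) = cis t - w + 2 * w * (cis t * cis (- t))"
    by (simp add: algebra_simps power2_eq_square)
  then have "(1 + 2 * w * cis (- t)) * (cis t - w) + w\<^sup>2 * (2 * cis (- t)) = cis t + w" unfolding c by simp
  then have "(cis t + w) / (cis t - w) = ((1 + 2 * w * cis (- t)) * (cis t - w) + w\<^sup>2 * (2 * cis (- t))) / (cis t - w)" by simp
  also have "\<dots> = 1 + 2 * w * cis (- t) + w\<^sup>2 * (2 * cis (- t) / (cis t - w))"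
    unfolding add_divide_distrib using nz by simp
  finally show "(cis t + w) / (cis t - w) = 1 + 2 * w * cis (- t) + w\<^sup>2 * (2 * cis (- t) / (cis t - w))" .
  have "cmod (2 * cis (- t) / (cis t - w)) = 2 / cmod (cis t - w)" by (simp add: norm_divide norm_mult)
  also have "\<dots> \<le> 2 / (1 / 2)" using d by (intro divide_left_mono) auto
  finally show "cmod (2 * cis (- t) / (cis t - w)) \<le> 4" by simp
qed

text \<open>One statement for both parts of mu: the density on Lebesgue measure, and the constant 1
  on sigma.\<close>

lemma herglotz_integral_deriv:
  fixes l :: "real \<Rightarrow> complex"
  assumes l: "integrable M l" and cis: "cis \<in> borel_measurable M"
  shows "((\<lambda>w. LINT t|M. (cis t + w) / (cis t - w) * l t) has_field_derivative 2 * (LINT t|M. cis (- t) * l t)) (at 0)"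
proof -
  define I where "I = (\<lambda>w. LINT t|M. (cis t + w) / (cis t - w) * l t)"
  define c where "c = (LINT t|M. cis (- t) * l t)"
  define r where "r = (\<lambda>w. LINT t|M. 2 * cis (- t) / (cis t - w) * l t)"
  have cis': "(\<lambda>t. cis (- t)) \<in> borel_measurable M"
  proof -
    have "(\<lambda>t. cnj (cis t)) \<in> borel_measurable M" by (rule borel_measurable_continuous_on[OF _ cis, of cnj]) (intro continuous_intros)
    then show ?thesis by (simp add: cis_cnj)
  qed
  have lm: "l \<in> borel_measurable M" using l by simp
  have i1: "integrable M (\<lambda>t. cis (- t) * l t)"
    by (rule Bochner_Integration.integrable_bound[OF l]) (use cis' lm in \<open>auto simp: norm_mult\<close>)
  have i2: "integrable M (\<lambda>t. 2 * cis (- t) / (cis t - w) * l t)" if "cmod w \<le> 1 / 2" for w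
  proof (rule Bochner_Integration.integrable_bound[where f = "\<lambda>t. 4 * l t"])
    show "integrable M (\<lambda>t. 4 * l t)" using l by simp
    show "(\<lambda>t. 2 * cis (- t) / (cis t - w) * l t) \<in> borel_measurable M" using cis cis' lm by measurable
    show "AE t in M. norm (2 * cis (- t) / (cis t - w) * l t) \<le> norm (4 * l t)"
    proof (rule AE_I2)
      show "norm (2 * cis (- t) / (cis t - w) * l t) \<le> norm (4 * l t)" for t
        using mult_right_mono[OF herglotz_kernel_expand(2)[OF that, of t] norm_ge_zero[of "l t"]]
          by (simp only: norm_mult[of _ "l t"] norm_numeral)
    qed
  qed
  have lin: "(LINT t|M. f t + a * g t + b * h t) = (LINT t|M. f t) + a * (LINT t|M. g t) + b * (LINT t|M. h t)"
    if "integrable M f" "integrable M g" "integrable M h" for f g h :: "real \<Rightarrow> complex" and a b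
    using that by simp
  have I: "I w = (LINT t|M. l t) + 2 * w * c + w\<^sup>2 * r w" if w: "cmod w \<le> 1 / 2" for w
  proof -
    have "I w = (LINT t|M. l t + 2 * w * (cis (- t) * l t) + w\<^sup>2 * (2 * cis (- t) / (cis t - w) * l t))"
      unfolding I_def herglotz_kernel_expand(1)[OF w] by (intro Bochner_Integration.integral_cong refl) (simp add: algebra_simps)
    also have "\<dots> = (LINT t|M. l t) + 2 * w * c + w\<^sup>2 * r w"
      unfolding c_def r_def by (rule lin[OF l i1 i2[OF w]])
    finally show ?thesis .
  qed
  have rb: "cmod (r w) \<le> (LINT t|M. 4 * cmod (l t))" if w: "cmod w \<le> 1 / 2" for w
    unfolding r_def
  proof (rule order_trans[OF integral_norm_bound integral_mono])
    show "integrable M (\<lambda>t. norm (2 * cis (- t) / (cis t - w) * l t))" using i2[OF w] by (rule integrable_norm)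
    show "integrable M (\<lambda>t. 4 * cmod (l t))" using l by simp
    show "norm (2 * cis (- t) / (cis t - w) * l t) \<le> 4 * cmod (l t)" for t
      using mult_right_mono[OF herglotz_kernel_expand(2)[OF w, of t] norm_ge_zero[of "l t"]]
          by (simp only: norm_mult[of _ "l t"] norm_numeral)
  qed
  have "((\<lambda>h. (I (0 + h) - I 0) / h - 2 * c) \<longlongrightarrow> 0) (at 0)"
  proof (rule Lim_null_comparison)
    have "\<forall>\<^sub>F h in at (0::complex). h \<in> ball 0 (1 / 2) \<and> h \<noteq> 0"
      by (intro eventually_conj eventually_at_in_open') (auto simp: eventually_at_filter)
    then show "\<forall>\<^sub>F h in at 0. norm ((I (0 + h) - I 0) / h - 2 * c) \<le> cmod h * (LINT t|M. 4 * cmod (l t))"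
    proof eventually_elim
      case (elim h)
      have "(I (0 + h) - I 0) / h - 2 * c = h * r h" using elim by (simp add: I field_simps power2_eq_square)
      then show ?case using rb[of h] elim by (simp add: norm_mult mult_left_mono)
    qed
    show "((\<lambda>h. cmod h * (LINT t|M. 4 * cmod (l t))) \<longlongrightarrow> 0) (at (0::complex))"
      by (auto intro!: tendsto_eq_intros)
  qed
  then show ?thesis unfolding DERIV_def I_def[symmetric] c_def[symmetric] by (simp only: LIM_zero_iff)
qed

lemma integral_exp_int:
  assumes "n \<noteq> 0"
  shows "(LINT t|lborel. indicator {-pi..pi} t *\<^sub>R exp (- \<i> * of_int n * of_real t)) = 0"
proof -
  let ?F = "\<lambda>t::real. exp (- \<i> * of_int n * of_real t) / (- \<i> * of_int n)"
  have "(LINT t|lborel. indicator {-pi..pi} t *\<^sub>R exp (- \<i> * of_int n * of_real t)) = ?F pi - ?F (- pi)"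
  proof (rule integral_FTC_atLeastAtMost)
    fix x :: real
    have "((\<lambda>w. exp (- \<i> * of_int n * w) / (- \<i> * of_int n)) has_field_derivative exp (- \<i> * of_int n * of_real x)) (at (of_real x))"
      using assms by (auto intro!: derivative_eq_intros)
    from has_vector_derivative_real_field[OF this]
    show "(?F has_vector_derivative exp (- \<i> * of_int n * of_real x)) (at x within {-pi..pi})" by (rule has_vector_derivative_at_within)
  qed (auto intro!: continuous_intros)
  also have "exp (- \<i> * of_int n * of_real pi) = exp (- \<i> * of_int n * of_real (- pi))"
  proof -
    have "exp (- \<i> * of_int n * of_real pi) = exp (- \<i> * of_int n * of_real (- pi) + of_int (- n) * (2 * of_real pi * \<i>))"
      by (rule arg_cong[where f = exp]) (simp add: algebra_simps)
    also have "\<dots> = exp (- \<i> * of_int n * of_real (- pi))" by (subst exp_plus_2pin[symmetric, of _ "- n"]) (simp add: algebra_simps)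
    finally show ?thesis .
  qed
  finally show ?thesis by simp
qed

text \<open>1 - (d / lambda)^2 is the square of u = (1 - z^2) / (1 + z^2). As |z^2| < 1, u has
  positive real part, so it is the root that \<open>csqrt\<close> returns.\<close>

lemma varkappa_joukowski:
  assumes d: "0 < d" and z: "z \<noteq> 0" "cmod z < 1"
  shows "varkappa d (joukowski d z) = of_nat d / 2 * (1 / z - z)"
proof -
  have zz: "cmod (z\<^sup>2) < 1" using z by (simp add: norm_power power_less_one_iff)
  then have nz: "1 + z\<^sup>2 \<noteq> 0" by (metis add.inverse_unique add.commute norm_minus_cancel norm_one order.irrefl)
  define u where "u = (1 - z\<^sup>2) / (1 + z\<^sup>2)"
  have J: "joukowski d z = of_nat d / 2 * ((1 + z\<^sup>2) / z)" using z by (simp add: joukowski_def field_simps power2_eq_square)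
  have "of_nat d / joukowski d z = 2 * z / (1 + z\<^sup>2)"
  proof -
    define s where "s = 1 + z\<^sup>2"
    have "s \<noteq> 0" using nz by (simp add: s_def)
    then show ?thesis unfolding J s_def[symmetric] using d z by (simp add: field_simps)
  qed
  then have "1 - (of_nat d / joukowski d z)\<^sup>2 = ((1 + z\<^sup>2)\<^sup>2 - (2 * z)\<^sup>2) / (1 + z\<^sup>2)\<^sup>2"
    using nz by (simp add: power_divide diff_divide_distrib)
  also have "(1 + z\<^sup>2)\<^sup>2 - (2 * z)\<^sup>2 = (1 - z\<^sup>2)\<^sup>2" by (simp add: power2_eq_square algebra_simps)
  finally have sq: "1 - (of_nat d / joukowski d z)\<^sup>2 = u\<^sup>2" by (simp add: u_def power_divide)
  have "0 < Re u"
  proof -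
    have "Re u = (1 - (cmod (z\<^sup>2))\<^sup>2) / (cmod (1 + z\<^sup>2))\<^sup>2"
    proof -
      define v where "v = z\<^sup>2"
      have "Re ((1 - v) / (1 + v)) = (1 - (cmod v)\<^sup>2) / (cmod (1 + v))\<^sup>2"
        unfolding Re_divide cmod_power2 by (simp add: power2_eq_square algebra_simps)
      then show ?thesis by (simp add: u_def v_def)
    qed
    moreover have "(cmod (z\<^sup>2))\<^sup>2 < 1" using zz by (simp add: power_less_one_iff abs_square_less_1)
    ultimately show ?thesis using nz by simp
  qed
  then have "csqrt (u\<^sup>2) = u" by (intro csqrt_square) simp
  then have "varkappa d (joukowski d z) = joukowski d z * u" unfolding varkappa_def sq by simp
  also have "\<dots> = of_nat d / 2 * ((1 - z\<^sup>2) / z)" unfolding J u_def using nz by simp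
  also have "\<dots> = of_nat d / 2 * (1 / z - z)" using z by (simp add: field_simps power2_eq_square)
  finally show ?thesis .
qed

lemma Re_varkappa_Im_joukowski:
  assumes "0 < d" "z \<noteq> 0" "cmod z < 1"
  shows "of_real (Re (varkappa d (joukowski d z))) + \<i> * of_real (Im (joukowski d z)) = of_nat d / 2 * (1 / z - cnj z)"
  unfolding varkappa_joukowski[OF assms]
proof -
  define c where "c = real d / 2"
  have c: "(of_nat d / 2 :: complex) = of_real c" by (simp add: c_def)
  show "of_real (Re (of_nat d / 2 * (1 / z - z))) + \<i> * of_real (Im (joukowski d z)) = of_nat d / 2 * (1 / z - cnj z)"
    unfolding joukowski_def c by (simp add: complex_eq_iff algebra_simps)
qed

section \<open>Estimates for a bounded function with a canonical factorization\<close>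

locale disk_factorization =
  fixes f :: "complex \<Rightarrow> complex" and N :: enat and z :: "nat \<Rightarrow> complex" and \<sigma> :: "real measure" and m :: real
  assumes hol: "f holomorphic_on ball 0 1" and f0: "f 0 = 1" and df0: "deriv f 0 = 0"
    and bound: "\<And>w. w \<in> ball 0 1 \<Longrightarrow> cmod (f w) \<le> exp m"
    and boundary_bound: "\<And>t. sin t \<noteq> 0 \<Longrightarrow> cmod (boundary_value f (cis t)) \<le> exp m"
    and zeros: "zero_enumeration f N z" and canonical: "canonical_singular_measure f N z \<sigma>"
begin

text \<open>The value 1 beyond the enumeration treats finite and infinite N as one infinite
  product.\<close>

definition a :: "nat \<Rightarrow> real" where "a j = (if enat j < N then cmod (z j) else 1)"

lemma m_nonneg: "0 \<le> m" using bound[of 0] f0 by simp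

lemma zero_props: "enat j < N \<Longrightarrow> cmod (z j) < 1" "enat j < N \<Longrightarrow> z j \<noteq> 0"
  using zeros f0 by (auto simp: zero_enumeration_def)

lemma a_bounds: "0 < a j" "a j \<le> 1"
  using zero_props[of j] by (auto simp: a_def less_imp_le)

lemma prod_a_ge: "exp (- m) \<le> (\<Prod>j<n. a j)"
  using prod_zeros_ge[OF hol bound zeros f0, of n] by (simp add: a_def exp_minus field_simps)

lemma sum_le_ln_prod: "(\<Sum>j<n. 1 - a j) \<le> - ln (\<Prod>j<n. a j)"
proof -
  have "ln (\<Prod>j<n. a j) = (\<Sum>j<n. ln (a j))" by (rule ln_prod) (simp_all add: a_bounds less_imp_neq[OF a_bounds(1), symmetric])
  also have "\<dots> \<le> (\<Sum>j<n. a j - 1)" by (intro sum_mono ln_le_minus_one a_bounds)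
  finally show ?thesis by (simp add: sum_subtractf)
qed

text \<open>The partial products stay above exp (-m), and ln x <= x - 1 converts this into a bound
  for the partial sums.\<close>

lemma summable_1_minus_a: "summable (\<lambda>j. 1 - a j)"
proof (rule summableI_nonneg_bounded)
  fix n
  have "- ln (\<Prod>j<n. a j) \<le> m"
    using prod_a_ge[of n] a_bounds(1) by (simp add: ln_ge_iff prod_pos minus_le_iff)
  then show "(\<Sum>j<n. 1 - a j) \<le> m" using sum_le_ln_prod[of n] by linarith
qed (use a_bounds in auto)

definition \<beta> :: "nat \<Rightarrow> complex \<Rightarrow> complex"
  where "\<beta> j w = (if enat j < N then of_real (cmod (z j)) / z j * ((z j - w) / (1 - cnj (z j) * w)) else 1)"

lemma blaschke_eq: "blaschke N z w = (\<Prod>j. \<beta> j w)"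
  by (simp add: blaschke_def \<beta>_def)

lemma \<beta>_minus_1: "cmod w \<le> 1 / 2 \<Longrightarrow> cmod (\<beta> j w - 1) \<le> 3 * (1 - a j)"
  using blaschke_factor_minus_1[of "z j" w] zero_props[of j] by (simp add: \<beta>_def a_def)

lemma \<beta>_holomorphic: "\<beta> j holomorphic_on ball 0 1"
proof (cases "enat j < N")
  case True
  then have "\<beta> j = (\<lambda>w. of_real (cmod (z j)) / z j * ((z j - w) / (1 - cnj (z j) * w)))" by (simp add: \<beta>_def fun_eq_iff)
  then show ?thesis using one_minus_cnj_mult_nonzero[OF zero_props(1)[OF True]]
    by (auto intro!: holomorphic_intros simp: zero_props(2)[OF True])
next
  case False
  then have "\<beta> j = (\<lambda>w. 1)" by (simp add: \<beta>_def fun_eq_iff)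
  then show ?thesis by simp
qed

lemma convergent_\<beta>: "cmod w \<le> 1 / 2 \<Longrightarrow> convergent_prod (\<lambda>j. \<beta> j w)"
proof (intro abs_convergent_prod_imp_convergent_prod, unfold abs_convergent_prod_conv_summable)
  assume "cmod w \<le> 1 / 2"
  then show "summable (\<lambda>j. norm (\<beta> j w - 1))"
    by (intro summable_comparison_test'[OF summable_mult[OF summable_1_minus_a, of 3], of 0]) (simp only: real_norm_def abs_norm_cancel \<beta>_minus_1)
qed

text \<open>Uniform convergence on a disk around the origin is what justifies termwise logarithmic
  differentiation in \<open>trace_sums\<close>.\<close>

lemma blaschke_uniform_limit: "uniform_limit (ball 0 (1 / 2)) (\<lambda>n w. \<Prod>k<n. \<beta> k w) (blaschke N z) sequentially"
proof -
  have "uniformly_convergent_on (cball 0 (1 / 2)) (\<lambda>n w. \<Prod>k<n. \<beta> k w)"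
  proof (rule uniformly_convergent_on_prod')
    show "continuous_on (cball 0 (1 / 2)) (\<beta> n)" for n
      by (rule holomorphic_on_imp_continuous_on[OF holomorphic_on_subset[OF \<beta>_holomorphic]]) auto
    show "uniformly_convergent_on (cball 0 (1 / 2)) (\<lambda>n w. \<Sum>k<n. norm (\<beta> k w - 1))"
      by (rule Weierstrass_m_test'[OF _ summable_mult[OF summable_1_minus_a, of 3]]) (simp_all only: real_norm_def abs_norm_cancel mem_cball_0 \<beta>_minus_1)
  qed auto
  then obtain P where P: "uniform_limit (cball 0 (1 / 2)) (\<lambda>n w. \<Prod>k<n. \<beta> k w) P sequentially"
    by (auto simp: uniformly_convergent_on_def)
  have "P w = blaschke N z w" if "w \<in> cball 0 (1 / 2)" for w
  proof (rule LIMSEQ_unique[OF tendsto_uniform_limitI[OF P that]])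
    have "(\<lambda>j. \<beta> j w) has_prod blaschke N z w"
      unfolding blaschke_eq using that by (intro convergent_prod_has_prod convergent_\<beta>) auto
    then show "(\<lambda>n. \<Prod>k<n. \<beta> k w) \<longlonglongrightarrow> blaschke N z w" by (rule has_prod_imp_tendsto')
  qed
  then show ?thesis using uniform_limit_on_subset[OF P, of "ball 0 (1 / 2)"]
    by (subst uniform_limit_cong'[where g = "\<lambda>n w. \<Prod>k<n. \<beta> k w" and i = P]) auto
qed

definition Q :: real where "Q = (\<Prod>j. a j)"

lemma prod_a_tendsto: "(\<lambda>n. \<Prod>j<n. a j) \<longlonglongrightarrow> Q"
proof -
  have "summable (\<lambda>j. norm (a j - 1))" using summable_1_minus_a a_bounds by (simp add: abs_minus_commute)
  then have "convergent_prod a"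
    by (intro abs_convergent_prod_imp_convergent_prod) (simp add: abs_convergent_prod_conv_summable)
  then show ?thesis unfolding Q_def by (intro has_prod_imp_tendsto' convergent_prod_has_prod)
qed

lemma B_zero_eq: "B_zero N z = ln Q"
  by (simp add: B_zero_def Q_def a_def)

lemma Q_ge: "exp (- m) \<le> Q"
  by (rule LIMSEQ_le_const[OF prod_a_tendsto]) (use prod_a_ge in auto)

lemma Q_pos: "0 < Q" using Q_ge exp_gt_zero[of "- m"] by linarith

lemma Q_le_prod: "Q \<le> (\<Prod>j<n. a j)"
proof (rule LIMSEQ_le_const2[OF prod_a_tendsto], intro exI[of _ n] allI impI)
  fix k assume "n \<le> k"
  then have "(\<Prod>j<k. a j) = (\<Prod>j<n. a j) * (\<Prod>j\<in>{n..<k}. a j)"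
    by (simp add: prod.atLeastLessThan_concat[of 0 n k, symmetric] lessThan_atLeast0)
  also have "\<dots> \<le> (\<Prod>j<n. a j) * 1"
    using a_bounds by (intro mult_left_mono prod_le_1 prod_nonneg) (auto intro: less_imp_le)
  finally show "(\<Prod>j<k. a j) \<le> (\<Prod>j<n. a j)" by simp
qed

lemma sum_le_minus_B_zero: "(\<Sum>j<n. 1 - a j) \<le> - B_zero N z"
proof -
  have "ln Q \<le> ln (\<Prod>j<n. a j)" using Q_pos Q_le_prod[of n] by (intro ln_mono) auto
  then show ?thesis using sum_le_ln_prod[of n] unfolding B_zero_eq by linarith
qed

lemma finite_sum_zeros_le:
  assumes "finite S" "S \<subseteq> {j. enat j < N}"
  shows "(\<Sum>j\<in>S. 1 - cmod (z j)) \<le> - B_zero N z"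
proof -
  have "(\<Sum>j\<in>S. 1 - cmod (z j)) = (\<Sum>j\<in>S. 1 - a j)" using assms by (intro sum.cong) (auto simp: a_def)
  also have "\<dots> \<le> (\<Sum>j<Suc (Max (insert 0 S)). 1 - a j)"
    using assms a_bounds by (intro sum_mono2) (auto simp: less_Suc_eq_le)
  also have "\<dots> \<le> - B_zero N z" by (rule sum_le_minus_B_zero)
  finally show ?thesis .
qed

lemma zeros_summable: "(\<lambda>j. 1 - cmod (z j)) summable_on {j. enat j < N}"
proof (rule nonneg_bdd_above_summable_on)
  show "bdd_above (sum (\<lambda>j. 1 - cmod (z j)) ` {F. F \<subseteq> {j. enat j < N} \<and> finite F})"
    by (rule bdd_aboveI2) (auto intro: finite_sum_zeros_le)
qed (use zero_props(1) in \<open>auto intro: less_imp_le\<close>)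

lemma zeros_infsum_le: "(\<Sum>\<^sub>\<infinity>j\<in>{j. enat j < N}. 1 - cmod (z j)) \<le> - B_zero N z"
  by (rule infsum_le_finite_sums[OF zeros_summable finite_sum_zeros_le])

lemma blaschke_0: "blaschke N z 0 = of_real Q"
proof (rule LIMSEQ_unique)
  have \<beta>0: "\<beta> j 0 = of_real (a j)" for j using zero_props(2)[of j] by (simp add: \<beta>_def a_def)
  show "(\<lambda>n. \<Prod>j<n. \<beta> j 0) \<longlonglongrightarrow> blaschke N z 0"
    using convergent_prod_has_prod[OF convergent_\<beta>[of 0]] by (intro has_prod_imp_tendsto') (simp add: blaschke_eq)
  show "(\<lambda>n. \<Prod>j<n. \<beta> j 0) \<longlonglongrightarrow> of_real Q"
    unfolding \<beta>0 of_real_prod[symmetric] by (intro tendsto_of_real prod_a_tendsto)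
qed

lemma \<beta>_logderiv: "deriv (\<beta> j) 0 / \<beta> j 0 = (if enat j < N then cnj (z j) - 1 / z j else 0)"
proof (cases "enat j < N")
  case True
  note nz = zero_props(2)[OF True]
  have "\<beta> j = (\<lambda>w. of_real (cmod (z j)) / z j * ((z j - w) / (1 - cnj (z j) * w)))" using True by (simp add: \<beta>_def fun_eq_iff)
  moreover have "((\<lambda>w. of_real (cmod (z j)) / z j * ((z j - w) / (1 - cnj (z j) * w))) has_field_derivative
    of_real (cmod (z j)) / z j * (z j * cnj (z j) - 1)) (at 0)"
    by (rule DERIV_cmult) (auto intro!: derivative_eq_intros)
  ultimately have "deriv (\<beta> j) 0 = of_real (cmod (z j)) / z j * (z j * cnj (z j) - 1)" by (simp add: DERIV_imp_deriv)
  then show ?thesis using True nz by (simp add: \<beta>_def field_simps)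
next
  case False
  then have "\<beta> j = (\<lambda>w. 1)" by (simp add: \<beta>_def fun_eq_iff)
  then show ?thesis using False by simp
qed

definition W :: "real \<Rightarrow> real" where "W t = indicator {-pi..pi} t * ln (cmod (boundary_value f (cis t)))"

lemma W_integrable: "integrable lborel W"
  using canonical by (simp add: canonical_singular_measure_def set_integrable_def W_def[abs_def])

lemma W_measurable: "W \<in> borel_measurable lborel"
  using W_integrable by simp

lemma finite_\<sigma>: "finite_measure \<sigma>"
  using canonical by (simp add: canonical_singular_measure_def)

lemma cis_measurable: "cis \<in> borel_measurable borel" "cis \<in> borel_measurable \<sigma>"
proof -
  show c: "cis \<in> borel_measurable borel" by (intro borel_measurable_continuous_onI continuous_intros)
  have "sets \<sigma> = sets (restrict_space borel {-pi..pi})" using canonical by (simp add: canonical_singular_measure_def)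
  then show "cis \<in> borel_measurable \<sigma>" using measurable_restrict_space1[OF c] by (simp cong: measurable_cong_sets)
qed

lemma mu_eq: "mu_integral f \<sigma> g = (LINT t|lborel. g t * of_real (W t)) - (LINT t|\<sigma>. g t)"
proof -
  have "(LINT t:{-pi..pi}|lborel. g t * of_real (ln (cmod (boundary_value f (cis t))))) = (LINT t|lborel. g t * of_real (W t))"
    unfolding set_lebesgue_integral_def by (rule Bochner_Integration.integral_cong) (auto simp: W_def indicator_def)
  then show ?thesis by (simp add: mu_integral_def)
qed

text \<open>The Herglotz integral of mu. The factor 1 in the integral over sigma brings it into the
  form of \<open>herglotz_integral_deriv\<close>.\<close>

definition \<Phi> :: "complex \<Rightarrow> complex"
  where "\<Phi> w = (LINT t|lborel. (cis t + w) / (cis t - w) * of_real (W t)) - (LINT t|\<sigma>. (cis t + w) / (cis t - w) * 1)"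

lemma factorization: "w \<in> ball 0 1 \<Longrightarrow> f w = blaschke N z w * exp (\<Phi> w / (2 * of_real pi))"
proof -
  assume w: "w \<in> ball 0 1"
  have "(LINT t:{-pi..pi}|lborel. (cis t + w) / (cis t - w) * of_real (ln (cmod (boundary_value f (cis t)))))
    = (LINT t|lborel. (cis t + w) / (cis t - w) * of_real (W t))"
    unfolding set_lebesgue_integral_def by (rule Bochner_Integration.integral_cong) (auto simp: W_def indicator_def)
  moreover have "f w = blaschke N z w * exp (- 1 / (2 * of_real pi) * (LINT t|\<sigma>. (cis t + w) / (cis t - w))) *
      exp (1 / (2 * of_real pi) *
        (LINT t:{-pi..pi}|lborel. (cis t + w) / (cis t - w) * of_real (ln (cmod (boundary_value f (cis t))))))"
    using canonical unfolding canonical_singular_measure_def by (elim conjE) (rule bspec[OF _ w])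
  moreover have "exp (- 1 / c * s) * exp (1 / c * l) = exp ((l - s) / c)" for c s l :: complex
    unfolding exp_add[symmetric] by (rule arg_cong[where f = exp]) (simp add: diff_divide_distrib)
  ultimately show ?thesis
    unfolding \<Phi>_def by (simp only: mult.assoc mult_1_right)
qed

definition \<mu>0 :: real where "\<mu>0 = (LINT t|lborel. W t) - measure \<sigma> (space \<sigma>)"
definition \<mu>1 :: complex where "\<mu>1 = mu_integral f \<sigma> (\<lambda>t. cis (- t))"

lemma \<Phi>_0: "\<Phi> 0 = of_real \<mu>0"
  by (simp add: \<Phi>_def \<mu>0_def scaleR_conv_of_real)

lemma \<Phi>_deriv: "(\<Phi> has_field_derivative 2 * \<mu>1) (at 0)"
proof -
  have 1: "((\<lambda>w. LINT t|lborel. (cis t + w) / (cis t - w) * of_real (W t)) has_field_derivative 2 * (LINT t|lborel. cis (- t) * of_real (W t))) (at 0)"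
    by (rule herglotz_integral_deriv) (use W_integrable cis_measurable in auto)
  have 2: "((\<lambda>w. LINT t|\<sigma>. (cis t + w) / (cis t - w) * 1) has_field_derivative 2 * (LINT t|\<sigma>. cis (- t) * 1)) (at 0)"
    by (rule herglotz_integral_deriv) (use finite_measure.integrable_const[OF finite_\<sigma>] cis_measurable in auto)
  from DERIV_diff[OF 1 2] show ?thesis unfolding \<Phi>_def[abs_def] \<mu>1_def mu_eq by (simp add: algebra_simps)
qed

lemma minus_B_zero_eq: "- B_zero N z = \<mu>0 / (2 * pi)"
proof -
  have "1 = of_real Q * exp (of_real \<mu>0 / (2 * of_real pi) :: complex)"
    using factorization[of 0] by (simp add: f0 blaschke_0 \<Phi>_0)
  also have "of_real \<mu>0 / (2 * of_real pi) = complex_of_real (\<mu>0 / (2 * pi))" by simp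
  also have "of_real Q * exp (complex_of_real (\<mu>0 / (2 * pi))) = of_real (Q * exp (\<mu>0 / (2 * pi)))"
    unfolding exp_of_real of_real_mult ..
  finally have "Q * exp (\<mu>0 / (2 * pi)) = 1" by (metis of_real_eq_1_iff)
  then have "ln (Q * exp (\<mu>0 / (2 * pi))) = 0" by simp
  then show ?thesis using Q_pos by (simp add: ln_mult B_zero_eq)
qed

text \<open>The boundary bound is available off the countable zero set of sin. Where the boundary
  value is 0, \<open>ln 0 = 0\<close> and the bound rests on m >= 0.\<close>

lemma W_le: "AE t in lborel. W t \<le> indicator {-pi..pi} t * m"
proof -
  have "{t::real. sin t = 0} = range (\<lambda>i::int. of_int i * pi)" by (auto simp: sin_zero_iff_int2)
  then have "countable {t::real. sin t = 0}" by (simp only: countable_image countableI_type)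
  then have "{t::real. sin t = 0} \<in> null_sets lborel" by (rule countable_imp_null_set_lborel)
  then have "AE t in lborel. t \<notin> {t::real. sin t = 0}" by (rule AE_not_in)
  then show ?thesis
  proof eventually_elim
    case (elim t)
    have "ln (cmod (boundary_value f (cis t))) \<le> m"
    proof (cases "boundary_value f (cis t) = 0")
      case False
      then have "ln (cmod (boundary_value f (cis t))) \<le> ln (exp m)" using boundary_bound[of t] elim by (intro ln_mono) auto
      then show ?thesis by simp
    qed (simp add: m_nonneg)
    then show ?case unfolding W_def by (intro mult_left_mono) auto
  qed
qed

lemma m_integral: "integrable lborel (\<lambda>t. indicator {-pi..pi} t * m)" "(LINT t|lborel. indicator {-pi..pi} t * m) = 2 * pi * m"
  by simp_all

lemma W_integral_le: "(LINT t|lborel. W t) \<le> 2 * pi * m"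
  using integral_mono_AE[OF W_integrable m_integral(1) W_le] m_integral(2) by simp

lemma minus_B_zero_le: "- B_zero N z \<le> m - measure \<sigma> (space \<sigma>) / (2 * pi)"
proof -
  have "\<mu>0 / (2 * pi) \<le> (2 * pi * m - measure \<sigma> (space \<sigma>)) / (2 * pi)"
    using W_integral_le by (intro divide_right_mono) (auto simp: \<mu>0_def)
  also have "\<dots> = m - measure \<sigma> (space \<sigma>) / (2 * pi)" by (simp add: diff_divide_distrib)
  finally show ?thesis by (simp add: minus_B_zero_eq)
qed

text \<open>mu is a signed measure, so the sign comes from the zeros: the mass is 2 pi times -B_0,
  and all |z_j| are below 1.\<close>

lemma \<mu>0_nonneg: "0 \<le> \<mu>0"
proof -
  have "0 \<le> - B_zero N z" using sum_le_minus_B_zero[of 0] by simp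
  then have "0 \<le> \<mu>0 / (2 * pi) * (2 * pi)" unfolding minus_B_zero_eq by (intro mult_nonneg_nonneg) auto
  then show ?thesis by simp
qed

text \<open>Since \<open>m dt - d\<mu>\<close> is a positive measure and \<open>dt\<close> has no nonzero Fourier coefficients, all the
  nonzero coefficients of \<open>d\<mu>\<close> are bounded by its total mass \<open>2 \<pi> m - \<mu>0\<close>.\<close>

lemma fourier_bound: "1 / (2 * pi) * cmod (mu_integral f \<sigma> (\<lambda>t. exp (- \<i> * of_int n * of_real t))) \<le> m"
proof -
  let ?e = "\<lambda>t::real. exp (- \<i> * of_int n * of_real t)"
  let ?s = "measure \<sigma> (space \<sigma>)"
  have ne: "cmod (?e t) = 1" for t by (simp add: norm_exp_eq_Re)
  have s: "cmod (LINT t|\<sigma>. ?e t) \<le> ?s"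
    using integral_norm_bound[of \<sigma> ?e] by (simp only: ne) simp
  have "cmod (mu_integral f \<sigma> ?e) \<le> 2 * pi * m"
  proof (cases "n = 0")
    \<comment> \<open>The coefficient of order 0 is the total mass itself, which lies between 0 and
      2 pi m.\<close>
    case True
    have "mu_integral f \<sigma> ?e = of_real \<mu>0" unfolding mu_eq True by (simp add: \<mu>0_def scaleR_conv_of_real)
    then have "cmod (mu_integral f \<sigma> ?e) = \<mu>0" using \<mu>0_nonneg by simp
    moreover have "\<mu>0 \<le> 2 * pi * m"
      using W_integral_le measure_nonneg[of \<sigma> "space \<sigma>"] unfolding \<mu>0_def by linarith
    ultimately show ?thesis by linarith
  next
    case False
    let ?m = "\<lambda>t. indicator {-pi..pi} t * m"
    have em: "?e \<in> borel_measurable borel" by (intro borel_measurable_continuous_onI continuous_intros)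
    have i1: "integrable lborel (\<lambda>t. ?e t * of_real (W t))"
      by (rule Bochner_Integration.integrable_bound[OF W_integrable]) (use em W_measurable in \<open>auto simp: norm_mult ne\<close>)
    have i2: "integrable lborel (\<lambda>t. ?e t * of_real (?m t))"
      by (rule Bochner_Integration.integrable_bound[OF m_integral(1)]) (use em in \<open>auto simp: norm_mult ne\<close>)
    have "(LINT t|lborel. ?e t * of_real (?m t)) = (LINT t|lborel. of_real m * (indicator {-pi..pi} t *\<^sub>R ?e t))"
      by (intro Bochner_Integration.integral_cong refl) (simp add: indicator_def)
    also have "\<dots> = 0" unfolding integral_mult_right_zero integral_exp_int[OF False] by simp
    finally have "(LINT t|lborel. ?e t * of_real (W t)) = - (LINT t|lborel. ?e t * of_real (?m t) - ?e t * of_real (W t))"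
      using i1 i2 by simp
    also have "cmod \<dots> \<le> (LINT t|lborel. ?m t - W t)"
      unfolding norm_minus_cancel
    proof (rule order_trans[OF integral_norm_bound], rule integral_mono_AE)
      show "integrable lborel (\<lambda>t. norm (?e t * of_real (?m t) - ?e t * of_real (W t)))" using i1 i2 by (intro integrable_norm Bochner_Integration.integrable_diff)
      show "integrable lborel (\<lambda>t. ?m t - W t)" by (intro Bochner_Integration.integrable_diff W_integrable m_integral)
      show "AE t in lborel. norm (?e t * of_real (?m t) - ?e t * of_real (W t)) \<le> ?m t - W t"
        using W_le
      proof eventually_elim
        case (elim t)
        have "norm (?e t * of_real (?m t) - ?e t * of_real (W t)) = \<bar>?m t - W t\<bar>"
          unfolding right_diff_distrib[symmetric] of_real_diff[symmetric] norm_mult ne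
            by (simp only: mult_1 norm_of_real)
        then show ?case using elim by simp
      qed
    qed
    also have "(LINT t|lborel. ?m t - W t) = 2 * pi * m - (LINT t|lborel. W t)"
      using Bochner_Integration.integral_diff[OF m_integral(1) W_integrable] m_integral(2) by simp
    finally have "cmod (LINT t|lborel. ?e t * of_real (W t)) \<le> 2 * pi * m - (LINT t|lborel. W t)" .
    then have "cmod (mu_integral f \<sigma> ?e) \<le> 2 * pi * m - \<mu>0"
      unfolding mu_eq \<mu>0_def using s norm_triangle_ineq4[of "LINT t|lborel. ?e t * of_real (W t)" "LINT t|\<sigma>. ?e t"] by linarith
    then show ?thesis using \<mu>0_nonneg by linarith
  qed
  then show ?thesis by (simp add: field_simps)
qed

text \<open>f divided by the exponential factor is the Blaschke product near 0, so no logarithm of f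
  has to be chosen. As f'(0) = 0, its logarithmic derivative there is minus that of the exponential
  factor.\<close>

lemma trace_sums: "(\<lambda>j. if enat j < N then 1 / z j - cnj (z j) else 0) sums (\<mu>1 / of_real pi)"
proof -
  define E where "E = (\<lambda>w. exp (\<Phi> w / (2 * of_real pi)))"
  have dE: "(E has_field_derivative E 0 * (\<mu>1 / of_real pi)) (at 0)"
    using DERIV_fun_exp[OF DERIV_cdivide[OF \<Phi>_deriv, of "2 * of_real pi"]] by (simp add: E_def)
  have E0: "E w \<noteq> 0" for w by (simp add: E_def)
  have "(f has_field_derivative 0) (at 0)" using holomorphic_derivI[OF hol, of 0] df0 by simp
  from DERIV_divide[OF this dE E0]
  have "((\<lambda>w. f w / E w) has_field_derivative (0 * E 0 - f 0 * (E 0 * (\<mu>1 / of_real pi))) / (E 0 * E 0)) (at 0)" .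
  then have "((\<lambda>w. f w / E w) has_field_derivative - (\<mu>1 / of_real pi) / E 0) (at 0)" using E0[of 0] f0 by simp
  moreover have "\<forall>\<^sub>F w in nhds 0. f w / E w = blaschke N z w"
  proof -
    have "\<forall>\<^sub>F w in nhds 0. w \<in> ball (0::complex) 1" by (rule eventually_nhds_in_open) auto
    then show ?thesis by eventually_elim (simp add: factorization E_def)
  qed
  ultimately have "(blaschke N z has_field_derivative - (\<mu>1 / of_real pi) / E 0) (at 0)"
    using DERIV_cong_ev[OF refl _ refl, of "\<lambda>w. f w / E w" "blaschke N z" 0] by blast
  then have dB: "deriv (blaschke N z) 0 = - (\<mu>1 / of_real pi) / E 0" by (rule DERIV_imp_deriv)
  have B0: "blaschke N z 0 = 1 / E 0" using factorization[of 0] f0 E0[of 0] by (simp add: E_def field_simps)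
  have "(\<lambda>k. deriv (\<beta> k) 0 / \<beta> k 0) sums (deriv (blaschke N z) 0 / blaschke N z 0)"
  proof (rule logderiv_prodinf_complex_uniform_limit[OF blaschke_uniform_limit])
    show "\<beta> k holomorphic_on ball 0 (1 / 2)" for k by (rule holomorphic_on_subset[OF \<beta>_holomorphic]) auto
    show "blaschke N z 0 \<noteq> 0" using E0[of 0] by (simp add: B0)
  qed auto
  also have "deriv (blaschke N z) 0 / blaschke N z 0 = - (\<mu>1 / of_real pi)" unfolding dB B0 using E0[of 0] by simp
  finally have "(\<lambda>k. deriv (\<beta> k) 0 / \<beta> k 0) sums - (\<mu>1 / of_real pi)" .
  from sums_minus[OF this] have "(\<lambda>k. - (deriv (\<beta> k) 0 / \<beta> k 0)) sums (\<mu>1 / of_real pi)" by (simp only: minus_minus)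
  moreover have "- (deriv (\<beta> k) 0 / \<beta> k 0) = (if enat k < N then 1 / z k - cnj (z k) else 0)" for k
    unfolding \<beta>_logderiv by simp
  ultimately show ?thesis by (simp only:)
qed

text \<open>The modulus is (1 - |z_j|^2) / |z_j|. Each single |z_j| is at least the whole product Q,
  hence at least exp (-m), so the summable 1 - |z_j| dominates.\<close>

lemma norm_trace_summand_le:
  assumes "enat j < N"
  shows "cmod (1 / z j - cnj (z j)) \<le> 2 * exp m * (1 - cmod (z j))"
proof -
  let ?r = "cmod (z j)"
  have r: "0 < ?r" "?r < 1" using zero_props[OF assms] by auto
  have "Q \<le> (\<Prod>i<Suc j. a i)" by (rule Q_le_prod)
  also have "\<dots> \<le> 1 * a j" unfolding prod.lessThan_Suc
    using a_bounds by (intro mult_right_mono prod_le_1) (auto intro: less_imp_le)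
  finally have "exp (- m) \<le> ?r" using Q_ge assms by (simp add: a_def)
  then have e: "1 / ?r \<le> exp m" using r by (simp add: exp_minus field_simps)
  have "1 / z j - cnj (z j) = of_real (1 - ?r\<^sup>2) / z j"
    using r complex_norm_square[of "z j"] by (simp add: field_simps)
  then have "cmod (1 / z j - cnj (z j)) = \<bar>1 - ?r\<^sup>2\<bar> / ?r" by (simp add: norm_divide del: of_real_diff)
  also have "1 - ?r\<^sup>2 = (1 - ?r) * (1 + ?r)" by (simp add: power2_eq_square algebra_simps)
  also have "\<bar>(1 - ?r) * (1 + ?r)\<bar> / ?r = (1 - ?r) * ((1 + ?r) * (1 / ?r))" using r by (simp add: abs_mult)
  also have "\<dots> \<le> (1 - ?r) * (2 * exp m)" using r e by (intro mult_left_mono mult_mono) auto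
  finally show ?thesis by (simp add: mult_ac)
qed

lemma trace_infsum:
  "(\<lambda>j. 1 / z j - cnj (z j)) summable_on {j. enat j < N}"
  "(\<Sum>\<^sub>\<infinity>j\<in>{j. enat j < N}. 1 / z j - cnj (z j)) = \<mu>1 / of_real pi"
proof -
  let ?J = "{j. enat j < N}" and ?g = "\<lambda>j. 1 / z j - cnj (z j)"
  have "(\<lambda>j. norm (?g j)) summable_on ?J"
  proof (rule summable_on_comparison_test)
    show "(\<lambda>j. 2 * exp m * (1 - cmod (z j))) summable_on ?J" by (intro summable_on_cmult_right zeros_summable)
  qed (use norm_trace_summand_le in auto)
  then show s: "?g summable_on ?J" by (rule abs_summable_summable)
  have "(?g has_sum infsum ?g ?J) ?J" using s by (rule has_sum_infsum)
  then have "((\<lambda>j. if enat j < N then ?g j else 0) has_sum infsum ?g ?J) UNIV"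
    by (subst has_sum_cong_neutral[where g = ?g and T = ?J]) auto
  then have "(\<lambda>j. if enat j < N then ?g j else 0) sums infsum ?g ?J" by (rule has_sum_imp_sums)
  then show "infsum ?g ?J = \<mu>1 / of_real pi" using trace_sums by (rule sums_unique2)
qed

lemma norm_trace_le: "cmod (\<Sum>\<^sub>\<infinity>j\<in>{j. enat j < N}. 1 / z j - cnj (z j)) \<le> 2 * m"
proof -
  have "mu_integral f \<sigma> (\<lambda>t. exp (- \<i> * of_int 1 * of_real t)) = \<mu>1"
    unfolding \<mu>1_def cis_conv_exp by simp
  then have "1 / (2 * pi) * cmod \<mu>1 \<le> m" using fourier_bound[of 1] by simp
  then show ?thesis unfolding trace_infsum(2) by (simp add: norm_divide field_simps)
qed

end

theorem theorem1p4:
  fixes V :: "int ^ 'd::finite \<Rightarrow> complex" and p :: real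
    and N :: enat and z :: "nat \<Rightarrow> complex" and \<sigma> :: "real measure"
  assumes "CARD('d) \<ge> 3"
    and "1 \<le> p"
    and "CARD('d) = 3 \<Longrightarrow> p < 6 / 5"
    and "CARD('d) \<ge> 4 \<Longrightarrow> p < 4 / 3"
    and "in_lp p V"
    and "zero_enumeration (D_fun V) N z"
    and "canonical_singular_measure (D_fun V) N z \<sigma>"
  shows "let d = CARD('d);
             J = {j. enat j < N};
             l = (\<lambda>j. joukowski d (z j));
             k = (\<lambda>j. varkappa d (l j));
             M = (C_star p d)\<^sup>2 * (lp_norm p V)\<^sup>2
         in (\<lambda>j. 1 - cmod (z j)) summable_on J \<and>
            (\<Sum>\<^sub>\<infinity>j\<in>J. 1 - cmod (z j)) \<le> - B_zero N z \<and>
            - B_zero N z \<le> M / 2 - measure \<sigma> (space \<sigma>) / (2 * pi) \<and>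
            (\<lambda>j. complex_of_real (Re (k j)) + \<i> * complex_of_real (Im (l j))) summable_on J \<and>
            cmod (\<Sum>\<^sub>\<infinity>j\<in>J. complex_of_real (Re (k j)) + \<i> * complex_of_real (Im (l j))) \<le> real d * M \<and>
            (\<forall>n::int. 1 / (2 * pi) *
               cmod (mu_integral (D_fun V) \<sigma> (\<lambda>t. exp (- \<i> * of_int n * of_real t))) \<le> M) \<and>
            ((\<forall>n. Im (V n) \<ge> 0) \<longrightarrow> (\<Sum>\<^sub>\<infinity>j\<in>J. Im (l j)) \<le> real d * M) \<and>
            ((\<forall>n. Re (V n) \<ge> 0) \<longrightarrow> (\<Sum>\<^sub>\<infinity>j\<in>J. Re (k j)) \<le> real d * M)"
proof -
  interpret lp_potential V p by unfold_locales (rule assms | assumption)+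
  \<comment> \<open>The parameter m is half of the squared Hilbert-Schmidt bound, as
    \<open>norm_D_le\<close> provides.\<close>
  interpret disk_factorization "D_fun V" N z \<sigma> "MV / 2"
    by unfold_locales (rule D_holomorphic D_at_0 D_deriv_0 norm_D_le norm_boundary_value_le assms(6,7) | assumption)+
  define d where "d = CARD('d)"
  define J where "J = {j. enat j < N}"
  define M where "M = (C_star p d)\<^sup>2 * (lp_norm p V)\<^sup>2"
  have M: "MV = M" by (simp add: MV_def CV_def LV_def M_def d_def)
  have M0: "0 \<le> M" by (simp add: M_def)
  define l where "l = (\<lambda>j. joukowski d (z j))"
  define k where "k = (\<lambda>j. varkappa d (l j))"
  define s where "s = (\<lambda>j. complex_of_real (Re (k j)) + \<i> * complex_of_real (Im (l j)))"
  have s_eq: "s j = of_nat d / 2 * (1 / z j - cnj (z j))" if "j \<in> J" for j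
    unfolding s_def k_def l_def using that zero_props[of j]
    by (intro Re_varkappa_Im_joukowski) (auto simp: J_def d_def)
  have "(\<lambda>j. of_nat d / 2 * (1 / z j - cnj (z j))) summable_on J"
    unfolding J_def by (intro summable_on_cmult_right trace_infsum)
  then have ssum: "s summable_on J" by (subst summable_on_cong[OF s_eq])
  have "infsum s J = (\<Sum>\<^sub>\<infinity>j\<in>J. of_nat d / 2 * (1 / z j - cnj (z j)))" by (rule infsum_cong[OF s_eq])
  also have "\<dots> = of_nat d / 2 * (\<Sum>\<^sub>\<infinity>j\<in>J. 1 / z j - cnj (z j))" by (rule infsum_cmult_right')
  also have "cmod \<dots> = real d / 2 * cmod (\<Sum>\<^sub>\<infinity>j\<in>J. 1 / z j - cnj (z j))"
    by (simp add: norm_mult norm_divide)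
  also have "\<dots> \<le> real d / 2 * (2 * (M / 2))"
    using norm_trace_le unfolding M J_def by (intro mult_left_mono) auto
  also have "\<dots> \<le> real d * M" using M0 by simp
  finally have bd: "cmod (infsum s J) \<le> real d * M" .
  \<comment> \<open>Each summand of s has the real part of kappa_j and the imaginary part of
    lambda_j as its two components, so the separate sums are components of one bounded complex
    number.\<close>
  have "(\<Sum>\<^sub>\<infinity>j\<in>J. Im (l j)) = Im (infsum s J)"
    using infsum_Im[OF ssum] by (simp add: s_def)
  then have im: "(\<Sum>\<^sub>\<infinity>j\<in>J. Im (l j)) \<le> real d * M" using abs_Im_le_cmod[of "infsum s J"] bd by linarith
  have "(\<Sum>\<^sub>\<infinity>j\<in>J. Re (k j)) = Re (infsum s J)"
    using infsum_Re[OF ssum] by (simp add: s_def)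
  then have re: "(\<Sum>\<^sub>\<infinity>j\<in>J. Re (k j)) \<le> real d * M" using abs_Re_le_cmod[of "infsum s J"] bd by linarith
  have fb: "1 / (2 * pi) * cmod (mu_integral (D_fun V) \<sigma> (\<lambda>t. exp (- \<i> * of_int n * of_real t))) \<le> M" for n
    using fourier_bound[of n] M0 unfolding M by linarith
  note defs = M_def s_def k_def l_def J_def d_def
  show ?thesis
    unfolding Let_def
    by (intro conjI allI impI zeros_summable zeros_infsum_le minus_B_zero_le[unfolded M defs] ssum[unfolded defs]
        bd[unfolded defs] fb[unfolded defs] im[unfolded defs] re[unfolded defs])
qed

end
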